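(* Let $K\in\mathbb{R}$ and $N\in(1,\infty)$, and let $(X,\mathsf{d},\mathfrak{m})$ be an essentially non-branching metric measure space verifying $\mathsf{MCP}(K,N)$. Then for any $\mu_0,\mu_1\in\mathcal{P}_2(X)$ with $\mu_0\ll\mathfrak{m}$, there exists a unique optimal transference plan from $\mu_0$ to $\mu_1$ and it is induced by a map $T$ (that is, the plan is $(\mathrm{Id},T)_\sharp\mu_0$); in particular $$W_2(\mu_0,\mu_1)^2=\int_X\mathsf{d}(x,T(x))^2\,\mu_0(dx).$$
   Context: Metric measure space $(X,\mathsf{d},\mathfrak{m})$: $(X,\mathsf{d})$ is a proper, complete and separable metric space, and $\mathfrak{m}$ is a non-negative Borel measure with $\mathfrak{m}(B)<\infty$ for every bounded Borel set $B$. Standing assumptions: $\mathrm{supp}(\mathfrak{m})=X$ and $(X,\mathsf{d})$ is geodesic. $\mathcal{P}(X)$ denotes the Borel probability measures on $X$, $\mathcal{P}_2(X)$ those with finite second moment, $\mathcal{P}_{ac}(X)$ those absolutely continuous with respect to $\mathfrak{m}$. $\Pi(\mu_0,\mu_1)$ is the set of $\pi\in\mathcal{P}(X\times X)$ with marginals $\mu_0,\mu_1$ (transference plans); $W_2(\mu_0,\mu_1)^2=\min_{\pi\in\Pi(\mu_0,\mu_1)}\int\mathsf{d}^2(x,y)\,\pi(dxdy)$, and minimisers are the optimal transference plans. $\mathrm{Geo}(X)=\{\gamma\in C([0,1];X):\mathsf{d}(\gamma_t,\gamma_s)=|t-s|\,\mathsf{d}(\gamma_0,\gamma_1)\ \forall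 s,t\in[0,1]\}$, and $\mathrm{e}_t(\gamma)=\gamma_t$. $\mathrm{OptGeo}(\mu_0,\mu_1)$ is the set of $\nu\in\mathcal{P}(\mathrm{Geo}(X))$ with $(\mathrm{e}_i)_\sharp\nu=\mu_i$ for $i=0,1$ and such that $t\mapsto(\mathrm{e}_t)_\sharp\nu$ is a $W_2$-geodesic, i.e. $W_2(\mu_0,\mu_1)<\infty$ and $W_2((\mathrm{e}_s)_\sharp\nu,(\mathrm{e}_t)_\sharp\nu)=|t-s|W_2(\mu_0,\mu_1)$. A set $\Gamma\subset\mathrm{Geo}(X)$ is non-branching if for all $\gamma^1,\gamma^2\in\Gamma$: if there is $t\in(0,1)$ with $\gamma^1_s=\gamma^2_s$ for all $s\in[0,t]$, then $\gamma^1=\gamma^2$. The space is essentially non-branching if for all $\mu_0,\mu_1\in\mathcal{P}_{ac}(X)$, every $\nu\in\mathrm{OptGeo}(\mu_0,\mu_1)$ satisfies $\nu(\Gamma)=1$ for some non-branching Borel set $\Gamma\subset\mathrm{Geo}(X)$. Distortion coefficients, for $t\in[0,1]$, $\theta\ge0$, $K\in\mathbb{R}$, $N>1$: $\tau_{K,N}^{(t)}(\theta)=\infty$ if $K\theta^2\ge(N-1)\pi^2$; $\tau_{K,N}^{(t)}(\theta)=t^{1/N}\Big(\frac{\sin(t\theta\sqrt{K/(N-1)})}{\sin(\theta\sqrt{K/(N-1)})}\Big)^{(N-1)/N}$ if $0<K\theta^2<(N-1)\pi^2$; $\tau_{K,N}^{(t)}(\theta)=t$ if $K\theta^2=0$;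 $\tau_{K,N}^{(t)}(\theta)=t^{1/N}\Big(\frac{\sinh(t\theta\sqrt{-K/(N-1)})}{\sinh(\theta\sqrt{-K/(N-1)})}\Big)^{(N-1)/N}$ if $K\theta^2<0$. $\mathcal{E}_N(\mu)=\int_X\rho^{1-1/N}\,d\mathfrak{m}$ where $\mu=\rho\,\mathfrak{m}+\mu^s$, $\mu^s\perp\mathfrak{m}$. The space verifies $\mathsf{MCP}(K,N)$ if for every $\mu_0=\rho_0\mathfrak{m}\in\mathcal{P}_{ac}(X)$ with bounded support contained in $\mathrm{supp}(\mathfrak{m})$ and every $o\in\mathrm{supp}(\mathfrak{m})$ there is $\nu\in\mathrm{OptGeo}(\mu_0,\delta_o)$ such that $\mathcal{E}_N((\mathrm{e}_t)_\sharp\nu)\ge\int_X\tau_{K,N}^{(1-t)}(\mathsf{d}(x,o))\,\rho_0(x)^{1-1/N}\,\mathfrak{m}(dx)$ for all $t\in[0,1)$. *)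

theory Defs
  imports "HOL-Probability.Probability"
begin

section \<open>Metric measure spaces\<close>

text \<open>The space \<open>X\<close> is the whole type \<open>'a :: polish_space\<close>, whose class provides completeness and
  separability of the metric.\<close>

definition metric_measure_space :: "'a::polish_space measure \<Rightarrow> bool" where
  "metric_measure_space m \<longleftrightarrow>
     (\<forall>S::'a set. closed S \<and> bounded S \<longrightarrow> compact S) \<and>
     sets m = sets borel \<and>
     (\<forall>B\<in>sets borel. bounded B \<longrightarrow> emeasure m B < \<infinity>)"

definition msupp :: "'a::topological_space measure \<Rightarrow> 'a set" where
  "msupp \<mu> = {x. \<forall>U. open U \<and> x \<in> U \<longrightarrow> emeasure \<mu> U > 0}"

section \<open>Probability measures, transference plans and the Wasserstein distance\<close>

definition Prob :: "'a::topological_space measure set" where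
  "Prob = {\<mu>. prob_space \<mu> \<and> sets \<mu> = sets borel}"

definition Prob2 :: "'a::metric_space measure set" where
  "Prob2 = {\<mu> \<in> Prob. \<exists>x0. (\<integral>\<^sup>+ x. ennreal ((dist x x0)\<^sup>2) \<partial>\<mu>) < \<infinity>}"

definition Prob_ac :: "'a::topological_space measure \<Rightarrow> 'a measure set" where
  "Prob_ac m = {\<mu> \<in> Prob. absolutely_continuous m \<mu>}"

definition plans :: "'a::topological_space measure \<Rightarrow> 'a measure \<Rightarrow> ('a \<times> 'a) measure set" where
  "plans \<mu>0 \<mu>1 = {\<pi> \<in> Prob. distr \<pi> borel fst = \<mu>0 \<and> distr \<pi> borel snd = \<mu>1}"

definition transport_cost :: "('a::metric_space \<times> 'a) measure \<Rightarrow> ennreal" where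
  "transport_cost \<pi> = (\<integral>\<^sup>+ z. ennreal ((dist (fst z) (snd z))\<^sup>2) \<partial>\<pi>)"

definition optimal_plans ::
    "'a::metric_space measure \<Rightarrow> 'a measure \<Rightarrow> ('a \<times> 'a) measure set" where
  "optimal_plans \<mu>0 \<mu>1 =
     {\<pi> \<in> plans \<mu>0 \<mu>1. \<forall>\<pi>'\<in>plans \<mu>0 \<mu>1. transport_cost \<pi> \<le> transport_cost \<pi>'}"

definition W2 :: "'a::metric_space measure \<Rightarrow> 'a measure \<Rightarrow> ennreal" where
  "W2 \<mu>0 \<mu>1 =
     (let c = (INF \<pi>\<in>plans \<mu>0 \<mu>1. transport_cost \<pi>)
      in if c = \<infinity> then \<infinity> else ennreal (sqrt (enn2real c)))"

section \<open>Geodesics and optimal geodesic plans\<close>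

text \<open>A curve in \<open>C([0,1];X)\<close> is encoded by its extension to the real line that is constant on
  \<open>{..0}\<close> and on \<open>{1..}\<close>. This is an isometric embedding for the sup metrics, so the Borel
  sets of \<open>Geo\<close> are those of the uniform metric on \<open>C([0,1];X)\<close>.\<close>

definition Geo :: "(real \<Rightarrow>\<^sub>C 'a::metric_space) set" where
  "Geo = {\<gamma>.
     (\<forall>s\<in>{0..1}. \<forall>t\<in>{0..1}. dist (apply_bcontfun \<gamma> t) (apply_bcontfun \<gamma> s)
        = \<bar>t - s\<bar> * dist (apply_bcontfun \<gamma> 0) (apply_bcontfun \<gamma> 1)) \<and>
     (\<forall>t\<le>0. apply_bcontfun \<gamma> t = apply_bcontfun \<gamma> 0) \<and>
     (\<forall>t\<ge>1. apply_bcontfun \<gamma> t = apply_bcontfun \<gamma> 1)}"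

abbreviation Geo_borel :: "(real \<Rightarrow>\<^sub>C 'a::metric_space) measure" where
  "Geo_borel \<equiv> restrict_space borel Geo"

abbreviation eval_at :: "real \<Rightarrow> (real \<Rightarrow>\<^sub>C 'a::metric_space) \<Rightarrow> 'a" where
  "eval_at t \<equiv> (\<lambda>\<gamma>. apply_bcontfun \<gamma> t)"

definition OptGeo ::
    "'a::metric_space measure \<Rightarrow> 'a measure \<Rightarrow> (real \<Rightarrow>\<^sub>C 'a) measure set" where
  "OptGeo \<mu>0 \<mu>1 = {\<nu>. prob_space \<nu> \<and> sets \<nu> = sets Geo_borel \<and>
     distr \<nu> borel (eval_at 0) = \<mu>0 \<and> distr \<nu> borel (eval_at 1) = \<mu>1 \<and>
     W2 \<mu>0 \<mu>1 < \<infinity> \<and>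
     (\<forall>s\<in>{0..1}. \<forall>t\<in>{0..1}.
        W2 (distr \<nu> borel (eval_at s)) (distr \<nu> borel (eval_at t)) = ennreal \<bar>t - s\<bar> * W2 \<mu>0 \<mu>1)}"

definition non_branching :: "(real \<Rightarrow>\<^sub>C 'a::metric_space) set \<Rightarrow> bool" where
  "non_branching \<Gamma> \<longleftrightarrow>
     (\<forall>\<gamma>1\<in>\<Gamma>. \<forall>\<gamma>2\<in>\<Gamma>.
        (\<exists>t\<in>{0<..<1}. \<forall>s\<in>{0..t}. apply_bcontfun \<gamma>1 s = apply_bcontfun \<gamma>2 s) \<longrightarrow> \<gamma>1 = \<gamma>2)"

definition essentially_non_branching :: "'a::metric_space measure \<Rightarrow> bool" where
  "essentially_non_branching m \<longleftrightarrow>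
     (\<forall>\<mu>0\<in>Prob_ac m. \<forall>\<mu>1\<in>Prob_ac m. \<forall>\<nu>\<in>OptGeo \<mu>0 \<mu>1.
        \<exists>\<Gamma>\<in>sets Geo_borel. non_branching \<Gamma> \<and> emeasure \<nu> \<Gamma> = 1)"

section \<open>The measure contraction property\<close>

definition tau :: "real \<Rightarrow> real \<Rightarrow> real \<Rightarrow> real \<Rightarrow> ennreal" where
  "tau K N t \<theta> =
     (if K * \<theta>\<^sup>2 \<ge> (N - 1) * pi\<^sup>2 then \<infinity>
      else if K * \<theta>\<^sup>2 > 0 then
        ennreal (t powr (1 / N) *
          (sin (t * \<theta> * sqrt (K / (N - 1))) / sin (\<theta> * sqrt (K / (N - 1)))) powr ((N - 1) / N))
      else if K * \<theta>\<^sup>2 = 0 then ennreal t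
      else
        ennreal (t powr (1 / N) *
          (sinh (t * \<theta> * sqrt (- K / (N - 1))) / sinh (\<theta> * sqrt (- K / (N - 1)))) powr ((N - 1) / N)))"

definition mutually_singular :: "'a measure \<Rightarrow> 'a measure \<Rightarrow> bool" where
  "mutually_singular \<mu> \<nu> \<longleftrightarrow> (\<exists>A\<in>sets \<mu>. emeasure \<mu> A = 0 \<and> emeasure \<nu> (space \<mu> - A) = 0)"

definition ac_density_of :: "'a measure \<Rightarrow> 'a measure \<Rightarrow> ('a \<Rightarrow> real) \<Rightarrow> bool" where
  "ac_density_of m \<mu> \<rho> \<longleftrightarrow>
     \<rho> \<in> borel_measurable m \<and> (\<forall>x. 0 \<le> \<rho> x) \<and>
     (\<exists>\<mu>s. sets \<mu>s = sets m \<and> mutually_singular m \<mu>s \<and>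
        (\<forall>A\<in>sets m. emeasure \<mu> A = emeasure (density m (\<lambda>x. ennreal (\<rho> x))) A + emeasure \<mu>s A))"

text \<open>For sigma-finite \<open>m\<close> and finite \<open>\<mu>\<close> with the same measurable sets, the density in the Lebesgue
  decomposition exists and is unique \<open>m\<close>-almost everywhere, so the integral does not depend on the
  choice.\<close>

definition renyi_functional :: "'a measure \<Rightarrow> real \<Rightarrow> 'a measure \<Rightarrow> ennreal" where
  "renyi_functional m N \<mu> =
     (\<integral>\<^sup>+ x. ennreal ((SOME \<rho>. ac_density_of m \<mu> \<rho>) x powr (1 - 1 / N)) \<partial>m)"

definition MCP :: "real \<Rightarrow> real \<Rightarrow> 'a::metric_space measure \<Rightarrow> bool" where
  "MCP K N m \<longleftrightarrow>
     (\<forall>\<rho>0 \<mu>0. \<forall>z\<in>msupp m.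
        \<rho>0 \<in> borel_measurable borel \<and> (\<forall>x. 0 \<le> \<rho>0 x) \<and> \<mu>0 = density m (\<lambda>x. ennreal (\<rho>0 x)) \<and>
        \<mu>0 \<in> Prob_ac m \<and> bounded (msupp \<mu>0) \<and> msupp \<mu>0 \<subseteq> msupp m \<longrightarrow>
        (\<exists>\<nu>\<in>OptGeo \<mu>0 (return borel z). \<forall>t\<in>{0..<1}.
           renyi_functional m N (distr \<nu> borel (eval_at t))
             \<ge> (\<integral>\<^sup>+ x. tau K N (1 - t) (dist x z) * ennreal (\<rho>0 x powr (1 - 1 / N)) \<partial>m)))"

end

theory Submission
  imports Defs
begin

text \<open>It suffices that every optimal plan with absolutely continuous first marginal is induced by a map:
  the sum of two optimal plans with the same marginals is optimal, and a map that induces the sum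
  induces both of them, so they coincide. If an optimal plan \<open>\<pi>\<close> is not induced by a map, its restrictions to the targets in two
  disjoint compact sets \<open>C1\<close>, \<open>C2\<close> have first marginals with a common part \<open>c m|A\<close>, where \<open>A\<close> is compact
  and \<open>m(A) > 0\<close>. Move this part along geodesics towards \<open>C1\<close> and towards \<open>C2\<close>. By MCP both flows
  can be chosen with densities at a small time \<open>t\<close> bounded by about \<open>c\<close>. By cyclical monotonicity, two
  geodesics of the union of the two plans that meet at time \<open>t\<close> can be exchanged after time \<open>t\<close>, so
  essential non-branching makes the two flows at time \<open>t\<close> mutually singular. Hence about \<open>2 m(A)\<close> fits
  into a shrinking neighbourhood of \<open>A\<close>, which is impossible as \<open>t\<close> tends to \<open>0\<close>.

  The MCP bound for a general target is reduced to a finite one. For a Dirac target, the estimate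
  on the volume of intermediate points is a Hall condition, and a fractional marriage
  theorem turns it into a plan whose intermediate marginal has bounded density. For finitely many
  targets the flows do not meet, so the same density bound holds for their sum.\<close>

section \<open>Mixtures, sums and submeasures\<close>

text \<open>Essential non-branching speaks only of optimal geodesic plans between absolutely
  continuous marginals, whereas the targets are Dirac masses or arbitrary measures. The flows are
  therefore cut at a time \<open>s < 1\<close>, where the density bound makes them absolutely
  continuous, and \<open>s\<close> is so close to \<open>1\<close> that disjoint target sets still
  give disjoint positions. Non-branching alone says nothing about masses; the bound on the density
  at time \<open>t\<close>, close to the density at time \<open>0\<close>, turns disjointness into a
  contradiction of volumes.

  MCP bounds a Renyi functional, which does not control the density of the plan it provides. It does
  yield a volume inequality for sets of intermediate points, and a plan with bounded density is
  rebuilt from that inequality.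

  Flows are recorded as measures of arbitrary finite mass on finitely many points of each geodesic.
  These can be restricted, added, glued and passed to weak limits without measurable selection or
  disintegration. Measures on curves enter only through MCP itself and where non-branching is
  invoked.\<close>

definition mix :: "'a measure \<Rightarrow> 'i set \<Rightarrow> ('i \<Rightarrow> 'a measure) \<Rightarrow> 'a measure" where
  "mix S I \<Lambda> = measure_of (space S) (sets S) (\<lambda>A. \<Sum>i\<in>I. emeasure (\<Lambda> i) A)"

lemma space_mix[simp]: "space (mix S I \<Lambda>) = space S"
  and sets_mix[simp, measurable_cong]: "sets (mix S I \<Lambda>) = sets S"
  by (auto simp: mix_def)

lemma emeasure_mix:
  assumes "\<And>i. i \<in> I \<Longrightarrow> sets (\<Lambda> i) = sets S" "A \<in> sets S"
  shows "emeasure (mix S I \<Lambda>) A = (\<Sum>i\<in>I. emeasure (\<Lambda> i) A)"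
proof -
  have "countably_additive (sets S) (\<lambda>A. \<Sum>i\<in>I. emeasure (\<Lambda> i) A)"
  proof (rule countably_additiveI)
    fix A :: "nat \<Rightarrow> _" assume A: "range A \<subseteq> sets S" "disjoint_family A" "\<Union>(range A) \<in> sets S"
    have "(\<Sum>n. \<Sum>i\<in>I. emeasure (\<Lambda> i) (A n)) = (\<Sum>i\<in>I. \<Sum>n. emeasure (\<Lambda> i) (A n))"
      by (rule suminf_sum) auto
    also have "\<dots> = (\<Sum>i\<in>I. emeasure (\<Lambda> i) (\<Union>(range A)))"
      by (intro sum.cong refl suminf_emeasure) (use A assms in auto)
    finally show "(\<Sum>n. \<Sum>i\<in>I. emeasure (\<Lambda> i) (A n)) = (\<Sum>i\<in>I. emeasure (\<Lambda> i) (\<Union>(range A)))" .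
  qed
  moreover have "positive (sets S) (\<lambda>A. \<Sum>i\<in>I. emeasure (\<Lambda> i) A)"
    by (auto simp: positive_def)
  ultimately show ?thesis
    unfolding mix_def using assms(2) by (intro emeasure_measure_of_sigma) (auto intro: sets.sigma_algebra_axioms)
qed

lemma nn_integral_mix:
  assumes S: "\<And>i. i \<in> I \<Longrightarrow> sets (\<Lambda> i) = sets S" and f: "f \<in> borel_measurable S"
  shows "(\<integral>\<^sup>+x. f x \<partial>mix S I \<Lambda>) = (\<Sum>i\<in>I. \<integral>\<^sup>+x. f x \<partial>\<Lambda> i)"
  using f
proof (induction f rule: borel_measurable_induct)
  case (cong f g)
  have "(\<integral>\<^sup>+x. f x \<partial>\<Lambda> i) = (\<integral>\<^sup>+x. g x \<partial>\<Lambda> i)" if "i \<in> I" for i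
    using cong(3) sets_eq_imp_space_eq[OF S[OF that]] by (intro nn_integral_cong) auto
  moreover have "(\<integral>\<^sup>+x. f x \<partial>mix S I \<Lambda>) = (\<integral>\<^sup>+x. g x \<partial>mix S I \<Lambda>)"
    using cong(3) by (intro nn_integral_cong) auto
  ultimately show ?case using cong by simp
next
  case (set A)
  then show ?case using S by (simp add: emeasure_mix)
next
  case (mult u c)
  have "u \<in> borel_measurable (\<Lambda> i)" if "i \<in> I" for i
    using mult S[OF that] by (simp cong: measurable_cong_sets)
  then show ?case using mult by (simp add: nn_integral_cmult sum_distrib_left)
next
  case (add u v)
  have "u \<in> borel_measurable (\<Lambda> i)" "v \<in> borel_measurable (\<Lambda> i)" if "i \<in> I" for i
    using add S[OF that] by (simp_all cong: measurable_cong_sets)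
  then show ?case using add by (simp add: nn_integral_add sum.distrib)
next
  case (seq U)
  have m: "U n \<in> borel_measurable (\<Lambda> i)" if "i \<in> I" for i n
    using seq S[OF that] by (simp cong: measurable_cong_sets)
  have "(\<integral>\<^sup>+x. (SUP i. U i) x \<partial>mix S I \<Lambda>) = (SUP n. \<integral>\<^sup>+x. U n x \<partial>mix S I \<Lambda>)"
    using seq by (simp add: nn_integral_monotone_convergence_SUP image_comp)
  also have "\<dots> = (SUP n. \<Sum>i\<in>I. \<integral>\<^sup>+x. U n x \<partial>\<Lambda> i)" using seq by simp
  also have "\<dots> = (\<Sum>i\<in>I. SUP n. \<integral>\<^sup>+x. U n x \<partial>\<Lambda> i)"
    by (rule ennreal_SUP_sum) (use seq in \<open>auto simp: incseq_def le_fun_def intro!: nn_integral_mono\<close>)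
  also have "\<dots> = (\<Sum>i\<in>I. \<integral>\<^sup>+x. (SUP i. U i) x \<partial>\<Lambda> i)"
    using seq m by (intro sum.cong refl) (simp add: nn_integral_monotone_convergence_SUP image_comp)
  finally show ?case .
qed

lemma distr_mix:
  assumes S: "\<And>i. i \<in> I \<Longrightarrow> sets (\<Lambda> i) = sets S" and p: "p \<in> S \<rightarrow>\<^sub>M T"
  shows "distr (mix S I \<Lambda>) T p = mix T I (\<lambda>i. distr (\<Lambda> i) T p)"
proof (rule measure_eqI)
  fix A assume A: "A \<in> sets (distr (mix S I \<Lambda>) T p)"
  have m: "p \<in> \<Lambda> i \<rightarrow>\<^sub>M T" if "i \<in> I" for i using p S[OF that] by (simp cong: measurable_cong_sets)
  have sp: "space (\<Lambda> i) = space S" if "i \<in> I" for i using S[OF that] by (rule sets_eq_imp_space_eq)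
  have "emeasure (distr (mix S I \<Lambda>) T p) A = (\<Sum>i\<in>I. emeasure (\<Lambda> i) (p -` A \<inter> space S))"
    using A p S by (subst emeasure_distr) (auto simp: emeasure_mix measurable_cong_sets[OF sets_mix refl])
  also have "\<dots> = emeasure (mix T I (\<lambda>i. distr (\<Lambda> i) T p)) A"
    using A m sp by (simp add: emeasure_mix emeasure_distr)
  finally show "emeasure (distr (mix S I \<Lambda>) T p) A = emeasure (mix T I (\<lambda>i. distr (\<Lambda> i) T p)) A" .
qed simp

lemma finite_measure_mix:
  assumes "finite I" "\<And>i. i \<in> I \<Longrightarrow> sets (\<Lambda> i) = sets S" "\<And>i. i \<in> I \<Longrightarrow> finite_measure (\<Lambda> i)"
  shows "finite_measure (mix S I \<Lambda>)"
proof
  have "emeasure (\<Lambda> i) (space S) \<noteq> \<infinity>" if "i \<in> I" for i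
    using assms(3)[OF that] finite_measure.emeasure_finite by auto
  then show "emeasure (mix S I \<Lambda>) (space (mix S I \<Lambda>)) \<noteq> \<infinity>"
    using assms by (simp add: emeasure_mix)
qed

lemma AE_mix:
  assumes "finite I" and S: "\<And>i. i \<in> I \<Longrightarrow> sets (\<Lambda> i) = sets S" and P: "{x\<in>space S. P x} \<in> sets S"
    and AE: "\<And>i. i \<in> I \<Longrightarrow> AE x in \<Lambda> i. P x"
  shows "AE x in mix S I \<Lambda>. P x"
proof -
  have n: "{x\<in>space S. \<not> P x} \<in> sets S" using P by (rule sets.sets_Collect_neg)
  have "emeasure (\<Lambda> i) {x\<in>space S. \<not> P x} = 0" if "i \<in> I" for i
    using AE_iff_measurable[of "{x\<in>space S. \<not> P x}" "\<Lambda> i" P] n AE[OF that] S[OF that]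
      sets_eq_imp_space_eq[OF S[OF that]] by auto
  then have "emeasure (mix S I \<Lambda>) {x\<in>space S. \<not> P x} = 0"
    using n S by (simp add: emeasure_mix)
  then show ?thesis
    using n by (subst AE_iff_measurable[OF _ refl]) auto
qed

definition msum :: "'a measure \<Rightarrow> 'a measure \<Rightarrow> 'a measure" where
  "msum M N = mix M (UNIV :: bool set) (\<lambda>b. if b then M else N)"

lemma space_msum[simp]: "space (msum M N) = space M"
  and sets_msum[simp, measurable_cong]: "sets (msum M N) = sets M"
  by (auto simp: msum_def)

lemma emeasure_msum: "sets N = sets M \<Longrightarrow> A \<in> sets M \<Longrightarrow> emeasure (msum M N) A = emeasure M A + emeasure N A"
  unfolding msum_def by (subst emeasure_mix) (auto simp: UNIV_bool add.commute split: if_splits)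

lemma nn_integral_msum:
  "sets N = sets M \<Longrightarrow> f \<in> borel_measurable M \<Longrightarrow>
    (\<integral>\<^sup>+x. f x \<partial>msum M N) = (\<integral>\<^sup>+x. f x \<partial>M) + (\<integral>\<^sup>+x. f x \<partial>N)"
  unfolding msum_def by (subst nn_integral_mix) (auto simp: UNIV_bool add.commute split: if_splits)

lemma distr_msum:
  assumes "sets N = sets M" "p \<in> M \<rightarrow>\<^sub>M T"
  shows "distr (msum M N) T p = msum (distr M T p) (distr N T p)"
  unfolding msum_def using assms by (subst distr_mix) (auto split: if_splits simp: mix_def if_distrib intro!: arg_cong[where f="measure_of _ _"] sum.cong)

lemma finite_measure_msum:
  "sets N = sets M \<Longrightarrow> finite_measure M \<Longrightarrow> finite_measure N \<Longrightarrow> finite_measure (msum M N)"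
  unfolding msum_def by (rule finite_measure_mix) auto

lemma AE_msum:
  "sets N = sets M \<Longrightarrow> {x\<in>space M. P x} \<in> sets M \<Longrightarrow> AE x in M. P x \<Longrightarrow> AE x in N. P x \<Longrightarrow> AE x in msum M N. P x"
  unfolding msum_def by (rule AE_mix) auto

text \<open>Setwise domination on a common sigma-algebra. The library order on measures compares
  spaces and sigma-algebras first, so \<open>N \<le> M\<close> would not guarantee that both
  measures live on the same sets.\<close>

definition msub :: "'a measure \<Rightarrow> 'a measure \<Rightarrow> bool" where
  "msub N M \<longleftrightarrow> sets N = sets M \<and> (\<forall>A\<in>sets M. emeasure N A \<le> emeasure M A)"

lemma msubI: "sets N = sets M \<Longrightarrow> (\<And>A. A \<in> sets M \<Longrightarrow> emeasure N A \<le> emeasure M A) \<Longrightarrow> msub N M"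
  by (auto simp: msub_def)

lemma msub_sets: "msub N M \<Longrightarrow> sets N = sets M"
  and msub_space: "msub N M \<Longrightarrow> space N = space M"
  and msub_emeasure: "msub N M \<Longrightarrow> emeasure N A \<le> emeasure M A"
  by (auto simp: msub_def dest: sets_eq_imp_space_eq)
     (metis emeasure_notin_sets order.refl)

lemma msub_trans: "msub L N \<Longrightarrow> msub N M \<Longrightarrow> msub L M"
  by (auto simp: msub_def intro: order_trans)

lemma msub_finite: "msub N M \<Longrightarrow> finite_measure M \<Longrightarrow> finite_measure N"
  by (intro finite_measureI)
     (metis finite_measure.emeasure_finite infinity_ennreal_def msub_emeasure neq_top_trans)

lemma msub_AE: assumes "msub N M" "AE x in M. P x" shows "AE x in N. P x"
proof -
  from assms(2) obtain A where A: "A \<in> sets M" "emeasure M A = 0" "{x\<in>space M. \<not> P x} \<subseteq> A"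
    by (auto elim!: AE_E)
  then show ?thesis using assms(1)
    by (intro AE_I[of _ _ A]) (auto simp: msub_sets msub_space, metis le_zero_eq msub_emeasure)
qed

lemma msub_distr:
  assumes "msub N M" "p \<in> M \<rightarrow>\<^sub>M T"
  shows "msub (distr N T p) (distr M T p)"
proof (rule msubI)
  fix A assume A: "A \<in> sets (distr M T p)"
  have p: "p \<in> N \<rightarrow>\<^sub>M T" using assms(2) measurable_cong_sets[OF msub_sets[OF assms(1)] refl] by auto
  show "emeasure (distr N T p) A \<le> emeasure (distr M T p) A"
    using A assms(1) by (simp add: emeasure_distr[OF p] emeasure_distr[OF assms(2)] msub_emeasure msub_space[OF assms(1)])
qed simp

lemma msub_nn_integral:
  assumes "msub N M" "f \<in> borel_measurable M"
  shows "(\<integral>\<^sup>+x. f x \<partial>N) \<le> (\<integral>\<^sup>+x. f x \<partial>M)"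
proof -
  have "N \<le> M" using assms by (subst le_measure) (auto simp: msub_sets le_fun_def msub_emeasure)
  then show ?thesis using assms by (intro nn_integral_mono_measure) (auto simp: msub_sets)
qed

lemma msub_msum1: "sets N = sets M \<Longrightarrow> msub M (msum M N)"
  by (auto simp: msub_def emeasure_msum)
lemma msub_msum2: "sets N = sets M \<Longrightarrow> msub N (msum M N)"
  by (auto simp: msub_def emeasure_msum)

lemma msub_msum_mono:
  assumes "msub M' M" "msub N' N" "sets N = sets M"
  shows "msub (msum M' N') (msum M N)"
  using assms by (auto simp: msub_def emeasure_msum intro: add_mono)

lemma msub_density: "f \<in> borel_measurable M \<Longrightarrow> (\<And>x. f x \<le> 1) \<Longrightarrow> msub (density M f) M"
proof (rule msubI)
  fix A assume f: "f \<in> borel_measurable M" "\<And>x. f x \<le> 1" and A: "A \<in> sets M"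
  have "emeasure (density M f) A = (\<integral>\<^sup>+x. f x * indicator A x \<partial>M)" using f A by (simp add: emeasure_density)
  also have "\<dots> \<le> (\<integral>\<^sup>+x. indicator A x \<partial>M)" using f by (intro nn_integral_mono) (auto split: split_indicator)
  finally show "emeasure (density M f) A \<le> emeasure M A" using A by simp
qed simp

text \<open>Let \<open>f\<close> be a Radon-Nikodym density and \<open>A\<close> the set where it
  exceeds \<open>C\<close>. Domination on \<open>A\<close> leaves no room for the integral of the
  excess \<open>f - C\<close>; the remaining term \<open>C * emeasure m A\<close> is finite, because
  \<mu> is, and cancels. So the minimum of \<open>f\<close> and \<open>C\<close> is a density as
  well.\<close>

lemma bounded_density_exists:
  assumes "sigma_finite_measure m" "finite_measure \<mu>" "msub \<mu> (scale_measure C m)" "C \<noteq> \<infinity>"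
  obtains u where "u \<in> borel_measurable m" "\<And>x. u x \<le> C" "\<mu> = density m u"
proof -
  interpret sigma_finite_measure m by fact
  interpret F: finite_measure \<mu> by fact
  have s: "sets \<mu> = sets m" using assms(3) by (simp add: msub_def)
  have le: "emeasure \<mu> A \<le> C * emeasure m A" for A
    using msub_emeasure[OF assms(3), of A] by simp
  have "absolutely_continuous m \<mu>"
    unfolding absolutely_continuous_def null_sets_def using le s by (auto, metis le_zero_eq mult_zero_right)
  then obtain f where f[measurable]: "f \<in> borel_measurable m" "density m f = \<mu>"
    using Radon_Nikodym s by blast
  define A where "A = {x\<in>space m. C < f x}"
  have A[measurable]: "A \<in> sets m" unfolding A_def by measurable
  have e: "emeasure \<mu> A = (\<integral>\<^sup>+x. (f x - C) * indicator A x \<partial>m) + C * emeasure m A"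
  proof -
    have "emeasure \<mu> A = (\<integral>\<^sup>+x. f x * indicator A x \<partial>m)"
      unfolding f(2)[symmetric] by (simp add: emeasure_density)
    also have "\<dots> = (\<integral>\<^sup>+x. (f x - C) * indicator A x + C * indicator A x \<partial>m)"
      using \<open>C \<noteq> \<infinity>\<close> by (intro nn_integral_cong) (auto simp: A_def diff_add_cancel_ennreal less_imp_le split: split_indicator)
    finally show ?thesis by (simp add: nn_integral_add nn_integral_cmult)
  qed
  have "C * emeasure m A \<noteq> \<infinity>" using e F.emeasure_finite[of A] by (auto simp: ennreal_add_eq_top)
  then have "(\<integral>\<^sup>+x. (f x - C) * indicator A x \<partial>m) = 0"
    using le[of A] ennreal_add_left_cancel_le[of "C * emeasure m A" "\<integral>\<^sup>+x. (f x - C) * indicator A x \<partial>m" 0]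
    by (simp add: e add.commute)
  then have "AE x in m. (f x - C) * indicator A x = 0"
    by (subst (asm) nn_integral_0_iff_AE) auto
  then have "AE x in m. f x = min (f x) C"
    using AE_space by eventually_elim (auto simp: A_def min_def not_le split: split_indicator_asm dest: ennreal_minus_eq_0)
  then have "density m f = density m (\<lambda>x. min (f x) C)"
    by (intro density_cong) auto
  then show ?thesis using f by (intro that[of "\<lambda>x. min (f x) C"]) auto
qed

lemma msub_density_exists:
  assumes "finite_measure M" "msub N M"
  obtains h where "h \<in> borel_measurable M" "\<And>x. h x \<le> 1" "N = density M h"
proof -
  interpret finite_measure M by fact
  show ?thesis
    by (rule bounded_density_exists[of M N 1, OF _ msub_finite[OF assms(2,1)]])
       (use that assms sigma_finite_measure_axioms in auto)
qed

text \<open>The density of \<sigma> with respect to the image measure is pulled back along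
  \<open>p\<close>. In this way a common part of two marginals is traced back to parts of the plans
  that it comes from.\<close>

lemma msub_lift:
  assumes "finite_measure M" "p \<in> M \<rightarrow>\<^sub>M T" "msub \<sigma> (distr M T p)"
  obtains N where "msub N M" "distr N T p = \<sigma>"
proof -
  have "finite_measure (distr M T p)" using assms by (simp add: finite_measure.finite_measure_distr)
  then obtain h where h: "h \<in> borel_measurable (distr M T p)" "\<And>x. h x \<le> 1" "\<sigma> = density (distr M T p) h"
    using msub_density_exists assms by blast
  then have [measurable]: "h \<in> borel_measurable T" by simp
  show ?thesis
    using h assms(2) density_distr[of h T p M] by (intro that[of "density M (\<lambda>x. h (p x))"] msub_density) auto
qed

lemma msub_complement:
  assumes "finite_measure M" "msub N M"
  obtains N' where "msub N' M" "M = msum N N'"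
proof -
  obtain h where h[measurable]: "h \<in> borel_measurable M" and h1: "\<And>x. h x \<le> 1" and N: "N = density M h"
    using msub_density_exists assms by blast
  have "M = msum (density M h) (density M (\<lambda>x. 1 - h x))"
  proof (rule measure_eqI)
    fix A assume [measurable]: "A \<in> sets M"
    have "emeasure (msum (density M h) (density M (\<lambda>x. 1 - h x))) A
      = (\<integral>\<^sup>+x. h x * indicator A x + (1 - h x) * indicator A x \<partial>M)"
      by (simp add: emeasure_msum emeasure_density nn_integral_add)
    also have "\<dots> = (\<integral>\<^sup>+x. indicator A x \<partial>M)"
      using h1 by (intro nn_integral_cong) (auto simp: distrib_right[symmetric] add_diff_inverse_ennreal)
    finally show "emeasure M A = emeasure (msum (density M h) (density M (\<lambda>x. 1 - h x))) A" by simp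
  qed simp
  moreover have "1 - h x \<le> 1" for x by (metis diff_le_self_ennreal)
  ultimately show ?thesis using N by (intro that[of "density M (\<lambda>x. 1 - h x)"] msub_density) auto
qed

section \<open>Weak convergence and tightness\<close>

text \<open>For finite measures this is the usual weak convergence: every bounded continuous
  function is an affine image of one with values in [0,1], and the constant \<open>1\<close> is a
  test function, so total masses converge too. With \<open>nn_integral\<close> no integrability has
  to be shown.\<close>

definition wconv :: "(nat \<Rightarrow> 'a::metric_space measure) \<Rightarrow> 'a measure \<Rightarrow> bool" where
  "wconv M L \<longleftrightarrow> (\<forall>f::'a\<Rightarrow>real. continuous_on UNIV f \<and> (\<forall>x. 0 \<le> f x \<and> f x \<le> 1) \<longrightarrow>
     (\<lambda>j. \<integral>\<^sup>+x. ennreal (f x) \<partial>M j) \<longlonglongrightarrow> (\<integral>\<^sup>+x. ennreal (f x) \<partial>L))"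

lemma measurable_sets_transfer: "f \<in> N \<rightarrow>\<^sub>M K \<Longrightarrow> sets M = sets N \<Longrightarrow> f \<in> M \<rightarrow>\<^sub>M K"
  by (simp cong: measurable_cong_sets)

lemma wconvD:
  "wconv M L \<Longrightarrow> continuous_on UNIV f \<Longrightarrow> (\<And>x. 0 \<le> f x) \<Longrightarrow> (\<And>x. f x \<le> 1) \<Longrightarrow>
   (\<lambda>j. \<integral>\<^sup>+x. ennreal (f x) \<partial>M j) \<longlonglongrightarrow> (\<integral>\<^sup>+x. ennreal (f x) \<partial>L)"
  by (auto simp: wconv_def)

lemma wconv_subseq: "wconv M L \<Longrightarrow> strict_mono r \<Longrightarrow> wconv (M \<circ> r) L"
  unfolding wconv_def using LIMSEQ_subseq_LIMSEQ by (fastforce simp: o_def)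

lemma wconv_distr:
  fixes p :: "'a::metric_space \<Rightarrow> 'b::metric_space"
  assumes "wconv M L" "continuous_on UNIV p" "\<And>j. sets (M j) = sets borel" "sets L = sets borel"
  shows "wconv (\<lambda>j. distr (M j) borel p) (distr L borel p)"
  unfolding wconv_def
proof (intro allI impI)
  fix f :: "'b \<Rightarrow> real" assume f: "continuous_on UNIV f \<and> (\<forall>x. 0 \<le> f x \<and> f x \<le> 1)"
  have p: "p \<in> M j \<rightarrow>\<^sub>M borel" "p \<in> L \<rightarrow>\<^sub>M borel" for j
    using borel_measurable_continuous_onI[OF assms(2)] measurable_cong_sets assms(3,4) by blast+
  have fm: "(\<lambda>x. ennreal (f x)) \<in> borel_measurable borel"
    using f by (intro measurable_compose[OF borel_measurable_continuous_onI measurable_ennreal]) auto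
  have "continuous_on UNIV (\<lambda>x. f (p x))"
    using f assms(2) by (intro continuous_on_compose2[of UNIV f UNIV p]) auto
  then show "(\<lambda>j. \<integral>\<^sup>+ x. ennreal (f x) \<partial>distr (M j) borel p) \<longlonglongrightarrow> \<integral>\<^sup>+ x. ennreal (f x) \<partial>distr L borel p"
    using f p fm wconvD[OF assms(1), of "\<lambda>x. f (p x)"] by (simp add: nn_integral_distr)
qed

section \<open>Cutoff functions, and what weak limits preserve\<close>

definition hat :: "'a::metric_space set \<Rightarrow> nat \<Rightarrow> 'a \<Rightarrow> real" where
  "hat F n x = max 0 (1 - real (Suc n) * infdist x F)"

lemma hat_props: "continuous_on UNIV (hat F n)" "0 \<le> hat F n x" "hat F n x \<le> 1"
  unfolding hat_def by (auto intro!: continuous_intros simp: infdist_nonneg)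

lemma hat_meas[measurable]: "hat F n \<in> borel_measurable borel"
  by (intro borel_measurable_continuous_onI hat_props)

lemma hat_ge_indicator: "F \<noteq> {} \<Longrightarrow> indicator F x \<le> hat F n x"
  by (auto simp: hat_def split: split_indicator)

text \<open>Dominated convergence: the cutoffs vanish outside the neighbourhood of \<open>F\<close>
  of radius one and tend to the indicator. Finiteness is asked on that neighbourhood only, so that
  the lemma also covers a reference measure that is merely finite on bounded sets.\<close>

lemma nn_integral_hat_tendsto:
  assumes M: "sets M = sets borel" and F: "closed F" "F \<noteq> {}"
    and fin: "emeasure M {x. infdist x F \<le> 1} < \<infinity>"
  shows "(\<lambda>n. \<integral>\<^sup>+x. ennreal (hat F n x) \<partial>M) \<longlonglongrightarrow> emeasure M F"
proof -
  have [measurable]: "{x. infdist x F \<le> 1} \<in> sets M"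
    unfolding M by (intro borel_closed closed_Collect_le continuous_intros)
  have [measurable]: "(\<lambda>x. ennreal (hat F n x)) \<in> borel_measurable M" for n
    by (rule measurable_sets_transfer[OF _ M]) simp
  have FM: "F \<in> sets M" using F M by auto
  have "(\<lambda>n. \<integral>\<^sup>+x. ennreal (hat F n x) \<partial>M) \<longlonglongrightarrow> (\<integral>\<^sup>+x. indicator F x \<partial>M)"
  proof (rule nn_integral_dominated_convergence[where w="indicator {x. infdist x F \<le> 1}"])
    show "AE x in M. ennreal (hat F j x) \<le> indicator {x. infdist x F \<le> 1} x" for j
    proof (intro AE_I2)
      fix x
      have "1 - real (Suc j) * infdist x F \<le> 0" if "infdist x F > 1"
        using that mult_mono[of 1 "real (Suc j)" 1 "infdist x F"] by simp
      then show "ennreal (hat F j x) \<le> indicator {x. infdist x F \<le> 1} x"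
        by (auto split: split_indicator simp: hat_def infdist_nonneg max_def)
    qed
    show "AE x in M. (\<lambda>n. ennreal (hat F n x)) \<longlonglongrightarrow> indicator F x"
    proof (intro AE_I2)
      fix x show "(\<lambda>n. ennreal (hat F n x)) \<longlonglongrightarrow> indicator F x"
      proof (cases "x \<in> F")
        case True then show ?thesis by (simp add: hat_def)
      next
        case False
        then have "infdist x F > 0" using F by (metis in_closed_iff_infdist_zero infdist_nonneg less_eq_real_def)
        then obtain N where N: "1 < real N * infdist x F" using ex_less_of_nat_mult by blast
        have "hat F n x = 0" if "n \<ge> N" for n
        proof -
          have "real N * infdist x F \<le> real (Suc n) * infdist x F"
            using that by (intro mult_right_mono) (auto simp: infdist_nonneg)
          then show ?thesis using N by (simp add: hat_def)
        qed
        then show ?thesis using False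
          by (intro tendsto_eventually) (auto simp: eventually_sequentially intro!: exI[of _ N])
      qed
    qed
  qed (use fin FM in auto)
  then show ?thesis using FM by simp
qed

lemma borel_measure_eqI_cont:
  fixes M N :: "'a::metric_space measure"
  assumes "sets M = sets borel" "sets N = sets borel" "finite_measure M" "finite_measure N"
    and eq: "\<And>f::'a\<Rightarrow>real. continuous_on UNIV f \<Longrightarrow> (\<And>x. 0 \<le> f x) \<Longrightarrow> (\<And>x. f x \<le> 1) \<Longrightarrow>
       (\<integral>\<^sup>+x. ennreal (f x) \<partial>M) = (\<integral>\<^sup>+x. ennreal (f x) \<partial>N)"
  shows "M = N"
proof (rule measure_eqI_generator_eq[where E="Collect closed" and \<Omega>=UNIV and A="\<lambda>_. UNIV"])
  show "Int_stable (Collect (closed :: 'a set \<Rightarrow> bool))" by (auto simp: Int_stable_def)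
  show "emeasure M X = emeasure N X" if "X \<in> Collect closed" for X
  proof (cases "X = {}")
    case False
    have "(\<lambda>n. \<integral>\<^sup>+x. ennreal (hat X n x) \<partial>M) \<longlonglongrightarrow> emeasure M X"
      "(\<lambda>n. \<integral>\<^sup>+x. ennreal (hat X n x) \<partial>N) \<longlonglongrightarrow> emeasure N X"
      using that False assms(1-4) by (auto intro!: nn_integral_hat_tendsto finite_measure.emeasure_finite simp: less_top[symmetric])
    moreover have "(\<integral>\<^sup>+x. ennreal (hat X n x) \<partial>M) = (\<integral>\<^sup>+x. ennreal (hat X n x) \<partial>N)" for n
      by (intro eq hat_props)
    ultimately show ?thesis by (simp add: LIMSEQ_unique)
  qed simp
  show "sets M = sigma_sets UNIV (Collect closed)" "sets N = sigma_sets UNIV (Collect closed)"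
    using assms(1,2) by (simp_all add: borel_eq_closed)
  show "emeasure M UNIV \<noteq> \<infinity>" using finite_measure.emeasure_finite[OF assms(3)] by (simp add: infinity_ennreal_def)
qed auto

lemma wconv_unique:
  assumes "wconv M L" "wconv M L'" "sets L = sets borel" "sets L' = sets borel" "finite_measure L" "finite_measure L'"
  shows "L = L'"
  using assms by (intro borel_measure_eqI_cont) (auto intro: LIMSEQ_unique[OF wconvD wconvD])

lemma wconv_const: "wconv (\<lambda>_. M) M"
  by (auto simp: wconv_def)

lemma wconv_marginal:
  fixes p :: "'a::metric_space \<Rightarrow> 'b::metric_space"
  assumes "wconv M L" "continuous_on UNIV p" "\<And>j. sets (M j) = sets borel" "sets L = sets borel"
    "finite_measure L" "\<And>j. distr (M j) borel p = S" "finite_measure S"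
  shows "distr L borel p = S"
proof -
  have p: "p \<in> L \<rightarrow>\<^sub>M borel"
    by (rule measurable_sets_transfer[OF borel_measurable_continuous_onI assms(4)]) fact
  have "sets S = sets borel" using assms(6)[of 0] by (metis sets_distr)
  moreover have "wconv (\<lambda>_. S) (distr L borel p)"
    using wconv_distr[OF assms(1-4)] unfolding assms(6) .
  ultimately show ?thesis
    using wconv_const[of S] p assms(5,7)
    by (intro wconv_unique[of "\<lambda>_. S"]) (simp_all add: finite_measure.finite_measure_distr)
qed

text \<open>Truncated at \<open>1\<close>, the modulus of \<open>f\<close> is an admissible test
  function, and its integrals are at most \<open>e j\<close> times the mass bound. Metric relations
  that hold approximately along a sequence of plans become exact in the limit through this
  lemma.\<close>

lemma wconv_AE_zero:
  fixes f :: "'a::metric_space \<Rightarrow> real"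
  assumes "wconv M L" "continuous_on UNIV f" "sets L = sets borel"
    "\<And>j. AE x in M j. \<bar>f x\<bar> \<le> e j" "e \<longlonglongrightarrow> 0" "\<And>j. emeasure (M j) (space (M j)) \<le> ennreal C"
    "\<And>j. sets (M j) = sets borel"
  shows "AE x in L. f x = 0"
proof -
  let ?g = "\<lambda>x. min 1 \<bar>f x\<bar>"
  have c: "continuous_on UNIV ?g" using assms(2) by (intro continuous_intros)
  have m: "(\<lambda>x. ennreal (?g x)) \<in> borel_measurable borel"
    using c by (intro measurable_compose[OF borel_measurable_continuous_onI measurable_ennreal]) auto
  have lim: "(\<lambda>j. \<integral>\<^sup>+x. ennreal (?g x) \<partial>M j) \<longlonglongrightarrow> (\<integral>\<^sup>+x. ennreal (?g x) \<partial>L)"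
    using c by (intro wconvD[OF assms(1)]) auto
  have "(\<integral>\<^sup>+x. ennreal (?g x) \<partial>M j) \<le> ennreal \<bar>e j\<bar> * ennreal C" for j
  proof -
    have "(\<integral>\<^sup>+x. ennreal (?g x) \<partial>M j) \<le> (\<integral>\<^sup>+x. ennreal \<bar>e j\<bar> \<partial>M j)"
      using assms(4)[of j] by (intro nn_integral_mono_AE) (auto elim!: eventually_mono intro!: ennreal_leI)
    also have "\<dots> = ennreal \<bar>e j\<bar> * emeasure (M j) (space (M j))" by simp
    also have "\<dots> \<le> ennreal \<bar>e j\<bar> * ennreal C" by (intro mult_left_mono assms) auto
    finally show ?thesis .
  qed
  moreover have "(\<lambda>j. ennreal \<bar>e j\<bar> * ennreal C) \<longlonglongrightarrow> 0"
  proof -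
    have "(\<lambda>j. \<bar>e j\<bar> * max 0 C) \<longlonglongrightarrow> 0" using tendsto_mult_left_zero[OF tendsto_rabs_zero[OF assms(5)]] by simp
    then have "(\<lambda>j. ennreal (\<bar>e j\<bar> * max 0 C)) \<longlonglongrightarrow> ennreal 0" by (rule tendsto_ennrealI)
    then show ?thesis by (simp add: ennreal_mult max_def ennreal_neg split: if_splits)
  qed
  ultimately have "(\<integral>\<^sup>+x. ennreal (?g x) \<partial>L) \<le> 0"
    using lim by (intro LIMSEQ_le[OF lim]) auto
  then have "AE x in L. ennreal (?g x) = 0"
    using m assms(3) by (subst (asm) le_zero_eq, subst (asm) nn_integral_0_iff_AE) (auto cong: measurable_cong_sets)
  then show ?thesis by (rule eventually_mono) (auto simp: min_def ennreal_eq_0_iff split: if_splits)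
qed

lemma wconv_AE_closed:
  fixes M :: "nat \<Rightarrow> 'a::metric_space measure"
  assumes "wconv M L" "closed F" "F \<noteq> {}" "sets L = sets borel"
    "\<And>j. AE x in M j. x \<in> F" "\<And>j. emeasure (M j) (space (M j)) \<le> ennreal C" "\<And>j. sets (M j) = sets borel"
  shows "AE x in L. x \<in> F"
proof -
  have "AE x in M j. \<bar>infdist x F\<bar> \<le> 0" for j using assms(5)[of j] by eventually_elim simp
  then have "AE x in L. infdist x F = 0"
    using assms by (intro wconv_AE_zero[where M=M and e="\<lambda>_. 0" and C=C]) (auto intro!: continuous_intros)
  then show ?thesis using assms(2,3) by (elim eventually_mono) (simp add: in_closed_iff_infdist_zero)
qed

text \<open>Cutoffs give the bound on compact sets, and inner regularity of the finite limit carries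
  it to Borel sets. Compact sets have bounded neighbourhoods, so \<open>N\<close> may have infinite
  total mass.\<close>

lemma wconv_msub:
  fixes M :: "nat \<Rightarrow> 'a::{complete_space,second_countable_topology} measure"
  assumes "wconv M L" "sets L = sets borel" "finite_measure L"
    "\<And>j. msub (M j) N" "sets N = sets borel" "\<And>B. B \<in> sets borel \<Longrightarrow> bounded B \<Longrightarrow> emeasure N B < \<infinity>"
  shows "msub L N"
proof (rule msubI)
  fix A assume A: "A \<in> sets N"
  have "emeasure L K \<le> emeasure N K" if K: "compact K" for K
  proof (cases "K = {}")
    case False
    have b: "bounded {x. infdist x K \<le> 1}"
    proof -
      obtain y where y: "y \<in> K" using False by auto
      obtain e where e: "\<And>z. z \<in> K \<Longrightarrow> dist y z \<le> e" using compact_imp_bounded[OF K] bounded_any_center[of K y] by auto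
      have "dist y x \<le> e + 2" if "infdist x K \<le> 1" for x
      proof -
        have "(INF z\<in>K. dist x z) < 2" using that False by (simp add: infdist_notempty)
        then have "\<exists>z\<in>K. dist x z < 2" using False by (subst (asm) cINF_less_iff) auto
        then obtain z where "z \<in> K" "dist x z < 2" by auto
        then show ?thesis using e[of z] dist_triangle[of y x z] by (simp add: dist_commute)
      qed
      then show ?thesis by (auto simp: bounded_def intro!: exI[of _ y] exI[of _ "e + 2"])
    qed
    have c: "{x. infdist x K \<le> 1} \<in> sets borel"
      by (intro borel_closed closed_Collect_le continuous_intros)
    have 1: "(\<lambda>n. \<integral>\<^sup>+x. ennreal (hat K n x) \<partial>L) \<longlonglongrightarrow> emeasure L K"
      using False K assms by (intro nn_integral_hat_tendsto) (auto intro: compact_imp_closed simp: finite_measure.emeasure_finite less_top[symmetric])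
    have 2: "(\<lambda>n. \<integral>\<^sup>+x. ennreal (hat K n x) \<partial>N) \<longlonglongrightarrow> emeasure N K"
      using False K assms b c by (intro nn_integral_hat_tendsto) (auto intro: compact_imp_closed)
    have "(\<integral>\<^sup>+x. ennreal (hat K n x) \<partial>L) \<le> (\<integral>\<^sup>+x. ennreal (hat K n x) \<partial>N)" for n
    proof (rule LIMSEQ_le_const2[OF wconvD[OF assms(1)]])
      have m: "(\<lambda>x. ennreal (hat K n x)) \<in> borel_measurable N"
        by (rule measurable_sets_transfer[OF _ assms(5)]) simp
      show "\<exists>N'. \<forall>j\<ge>N'. (\<integral>\<^sup>+x. ennreal (hat K n x) \<partial>M j) \<le> (\<integral>\<^sup>+x. ennreal (hat K n x) \<partial>N)"
        using msub_nn_integral[OF assms(4) m] by auto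
    qed (auto intro: hat_props)
    then show ?thesis by (intro LIMSEQ_le[OF 1 2]) auto
  qed simp
  moreover have "emeasure L A = (SUP K\<in>{K. K \<subseteq> A \<and> compact K}. emeasure L K)"
    using A assms finite_measure.emeasure_finite[OF assms(3), of "space L"] by (intro inner_regular) auto
  moreover have "emeasure N K \<le> emeasure N A" if "K \<subseteq> A" for K using that A by (intro emeasure_mono)
  ultimately show "emeasure L A \<le> emeasure N A"
    by (auto intro!: SUP_least intro: order_trans)
qed (use assms in auto)

text \<open>An unbounded integrand, such as the squared distance, is truncated and then exhausted by
  monotone convergence. Only an inequality survives, but it is the one that expresses lower
  semicontinuity of the cost.\<close>

lemma wconv_nn_integral_le:
  fixes f :: "'a::metric_space \<Rightarrow> real"
  assumes "wconv M L" "continuous_on UNIV f" "\<And>x. 0 \<le> f x" "sets L = sets borel" "\<And>j. sets (M j) = sets borel"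
    "\<And>j. (\<integral>\<^sup>+x. ennreal (f x) \<partial>M j) \<le> c j" "c \<longlonglongrightarrow> c0"
  shows "(\<integral>\<^sup>+x. ennreal (f x) \<partial>L) \<le> c0"
proof -
  have m: "(\<lambda>x. ennreal (g x)) \<in> borel_measurable L" "(\<lambda>x. ennreal (g x)) \<in> borel_measurable (M j)"
    if "continuous_on UNIV g" for g :: "'a \<Rightarrow> real" and j
    using measurable_compose[OF borel_measurable_continuous_onI[OF that] measurable_ennreal] assms(4,5)
    by (auto cong: measurable_cong_sets)
  have trunc: "(\<integral>\<^sup>+x. ennreal (min (f x) (Suc n)) \<partial>L) \<le> c0" for n :: nat
  proof -
    let ?g = "\<lambda>x. min (f x) (Suc n) / Suc n"
    have c: "continuous_on UNIV ?g" using assms(2) by (intro continuous_intros) auto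
    have eq: "(\<integral>\<^sup>+x. ennreal (min (f x) (Suc n)) \<partial>P) = ennreal (Suc n) * (\<integral>\<^sup>+x. ennreal (?g x) \<partial>P)"
      if "(\<lambda>x. ennreal (?g x)) \<in> borel_measurable P" for P
      using assms(3) by (subst nn_integral_cmult[OF that, symmetric], intro nn_integral_cong, subst ennreal_mult[symmetric]) auto
    have "(\<lambda>j. ennreal (Suc n) * (\<integral>\<^sup>+x. ennreal (?g x) \<partial>M j)) \<longlonglongrightarrow> ennreal (Suc n) * (\<integral>\<^sup>+x. ennreal (?g x) \<partial>L)"
      using assms(3) by (intro ennreal_tendsto_cmult wconvD[OF assms(1) c]) (auto simp: min_def field_simps)
    moreover have "ennreal (Suc n) * (\<integral>\<^sup>+x. ennreal (?g x) \<partial>M j) \<le> c j" for j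
      unfolding eq[OF m(2)[OF c], symmetric]
      by (intro order_trans[OF nn_integral_mono assms(6)]) (auto intro!: ennreal_leI)
    ultimately show ?thesis unfolding eq[OF m(1)[OF c]] by (intro LIMSEQ_le[OF _ assms(7)]) auto
  qed
  have "(\<integral>\<^sup>+x. ennreal (f x) \<partial>L) = (\<integral>\<^sup>+x. (SUP n. ennreal (min (f x) (Suc n))) \<partial>L)"
  proof (intro nn_integral_cong antisym SUP_least)
    fix x
    obtain n :: nat where "f x \<le> real n" using real_arch_simple by blast
    then have "ennreal (f x) \<le> ennreal (min (f x) (Suc n))" by (intro ennreal_leI) auto
    then show "ennreal (f x) \<le> (SUP n. ennreal (min (f x) (Suc n)))" by (rule SUP_upper2[OF UNIV_I])
  qed (auto intro!: ennreal_leI)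
  also have "\<dots> = (SUP n. \<integral>\<^sup>+x. ennreal (min (f x) (Suc n)) \<partial>L)"
    by (intro nn_integral_monotone_convergence_SUP m(1) continuous_intros assms(2))
       (auto simp: incseq_def le_fun_def intro!: ennreal_leI)
  also have "\<dots> \<le> c0" by (intro SUP_least trunc)
  finally show ?thesis .
qed

lemma wconv_distr_tendsto:
  fixes q :: "nat \<Rightarrow> 'b \<Rightarrow> 'a::metric_space"
  assumes "finite_measure M" "\<And>n. q n \<in> M \<rightarrow>\<^sub>M borel" "q0 \<in> M \<rightarrow>\<^sub>M borel" "AE x in M. (\<lambda>n. q n x) \<longlonglongrightarrow> q0 x"
  shows "wconv (\<lambda>n. distr M borel (q n)) (distr M borel q0)"
  unfolding wconv_def
proof (intro allI impI)
  fix f :: "'a \<Rightarrow> real" assume f: "continuous_on UNIV f \<and> (\<forall>x. 0 \<le> f x \<and> f x \<le> 1)"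
  then have [measurable]: "f \<in> borel_measurable borel" by (auto intro: borel_measurable_continuous_onI)
  note [measurable] = assms(2,3)
  have "(\<lambda>n. \<integral>\<^sup>+x. ennreal (f (q n x)) \<partial>M) \<longlonglongrightarrow> (\<integral>\<^sup>+x. ennreal (f (q0 x)) \<partial>M)"
  proof (rule nn_integral_dominated_convergence[where w="\<lambda>_. 1"])
    show "AE x in M. (\<lambda>n. ennreal (f (q n x))) \<longlonglongrightarrow> ennreal (f (q0 x))"
      using assms(4) by (rule eventually_mono)
        (use f in \<open>auto intro!: tendsto_ennrealI continuous_on_tendsto_compose[of UNIV f]\<close>)
  qed (use f assms(1) in \<open>auto simp: finite_measure.emeasure_finite less_top[symmetric]\<close>)
  then show "(\<lambda>n. \<integral>\<^sup>+x. ennreal (f x) \<partial>distr M borel (q n)) \<longlonglongrightarrow> (\<integral>\<^sup>+x. ennreal (f x) \<partial>distr M borel q0)"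
    by (simp add: nn_integral_distr)
qed

section \<open>Prokhorov's theorem, through an encoding in the real line\<close>

text \<open>The weights are those of the Cantor set: the first nonzero digit contributes
  \<open>2 * (1/3)^Suc i\<close>, while all later digits together contribute at most
  \<open>(1/3)^Suc i\<close>.\<close>

lemma ternary_gap:
  fixes a :: "nat \<Rightarrow> real"
  assumes a: "\<And>j. \<bar>a j\<bar> \<le> 1" and "\<bar>a i\<bar> = 1" "\<And>j. j < i \<Longrightarrow> a j = 0"
  shows "\<bar>\<Sum>j. a j * (2/3 * (1/3)^j)\<bar> \<ge> (1/3)^Suc i"
proof -
  define c :: "nat \<Rightarrow> real" where "c j = 2/3 * (1/3)^j" for j
  let ?f = "\<lambda>j. a j * c j"
  have g: "summable c" unfolding c_def by (intro summable_mult summable_geometric) auto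
  have c0: "0 \<le> c j" for j by (simp add: c_def)
  have le: "\<bar>?f j\<bar> \<le> c j" for j
    using mult_right_mono[OF a c0] c0 by (simp add: abs_mult)
  have s: "summable ?f" by (rule summable_comparison_test'[OF g, of 0]) (use le in auto)
  have "suminf ?f = (\<Sum>j. ?f (j + Suc i)) + sum ?f {..<Suc i}" by (rule suminf_split_initial_segment[OF s])
  also have "sum ?f {..<Suc i} = ?f i" using assms(3) by simp
  finally have eq: "suminf ?f = (\<Sum>j. ?f (j + Suc i)) + ?f i" .
  have g': "summable (\<lambda>j. c (j + Suc i))" by (rule summable_ignore_initial_segment[OF g])
  have s': "summable (\<lambda>j. \<bar>?f (j + Suc i)\<bar>)"
    by (rule summable_comparison_test'[OF g', of 0]) (use le in auto)
  have "\<bar>\<Sum>j. ?f (j + Suc i)\<bar> \<le> (\<Sum>j. \<bar>?f (j + Suc i)\<bar>)" by (rule summable_rabs[OF s'])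
  also have "\<dots> \<le> (\<Sum>j. c (j + Suc i))" using le by (intro suminf_le s' g')
  also have "\<dots> = (\<Sum>j. (2/3 * (1/3)^Suc i) * (1/3)^j)" by (simp add: c_def power_add mult_ac)
  also have "\<dots> = (2/3 * (1/3)^Suc i) * (1 / (1 - 1/3))"
    by (subst suminf_mult) (auto intro: summable_geometric simp: suminf_geometric)
  also have "\<dots> = (1/3)^Suc i" by simp
  finally have "\<bar>\<Sum>j. ?f (j + Suc i)\<bar> \<le> (1/3)^Suc i" .
  moreover have "\<bar>?f i\<bar> = 2 * (1/3)^Suc i" using assms(2) by (simp add: abs_mult c_def)
  ultimately show ?thesis unfolding c_def[symmetric] eq by linarith
qed

text \<open>For every \<open>K n\<close> and every scale \<open>1 / Suc k\<close> a finite cover by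
  balls goes into one countable family. A given \<open>K n\<close> and \<open>e\<close> involve only
  one of these finite covers, whence the uniform index \<open>m\<close>.\<close>

lemma compact_family_separating_opens:
  fixes K :: "nat \<Rightarrow> 'a::metric_space set"
  assumes "\<And>n. compact (K n)"
  shows "\<exists>B::nat \<Rightarrow> 'a set. (\<forall>j. open (B j)) \<and>
    (\<forall>n. \<forall>e>0. \<exists>m. \<forall>x\<in>K n. \<exists>j<m. x \<in> B j \<and> (\<forall>y\<in>B j. dist x y < e))"
proof -
  have "\<exists>F. finite F \<and> K n \<subseteq> (\<Union>x\<in>F. ball x (1 / real (Suc k)))" for n k
    using assms[of n] by (subst (asm) compact_eq_totally_bounded) simp
  then obtain F where F: "\<And>n k. finite (F n k)" "\<And>n k. K n \<subseteq> (\<Union>x\<in>F n k. ball x (1 / real (Suc k)))"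
    by metis
  \<comment> \<open>\<open>UNIV\<close> keeps the family nonempty, so that
    \<open>from_nat_into\<close> enumerates it.\<close>
  define BB where "BB = insert UNIV (\<Union>n k. (\<lambda>x. ball x (1 / real (Suc k))) ` F n k)"
  have cB: "countable BB" unfolding BB_def by (intro countable_insert countable_UN) (auto intro: countable_finite F)
  have ne: "BB \<noteq> {}" by (simp add: BB_def)
  show ?thesis
  proof (intro exI[of _ "from_nat_into BB"] conjI allI impI)
    show "open (from_nat_into BB j)" for j
      using from_nat_into[OF ne, of j] by (auto simp: BB_def)
    fix n and e :: real assume "e > 0"
    then obtain k where k: "1 / real (Suc k) < e / 2" using nat_approx_posE[of "e/2"] by auto
    let ?idx = "\<lambda>x. to_nat_on BB (ball x (1 / real (Suc k)))"
    show "\<exists>m. \<forall>x\<in>K n. \<exists>j<m. x \<in> from_nat_into BB j \<and> (\<forall>y\<in>from_nat_into BB j. dist x y < e)"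
    proof (rule exI[of _ "Suc (Max (?idx ` F n k))"], rule ballI)
      fix x assume "x \<in> K n"
      then obtain z where z: "z \<in> F n k" "x \<in> ball z (1 / real (Suc k))" using F(2)[of n k] by auto
      then have "ball z (1 / real (Suc k)) \<in> BB" by (auto simp: BB_def)
      then have b: "from_nat_into BB (?idx z) = ball z (1 / real (Suc k))"
        using cB by (simp add: from_nat_into_to_nat_on)
      show "\<exists>j<Suc (Max (?idx ` F n k)). x \<in> from_nat_into BB j \<and> (\<forall>y\<in>from_nat_into BB j. dist x y < e)"
      proof (intro exI[of _ "?idx z"] conjI ballI)
        show "?idx z < Suc (Max (?idx ` F n k))" using z F(1) by (auto simp: less_Suc_eq_le)
        show "x \<in> from_nat_into BB (?idx z)" using b z by simp
        fix y assume "y \<in> from_nat_into BB (?idx z)"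
        then have "dist z y < e / 2" "dist z x < e / 2" using b k z by auto
        then show "dist x y < e" using dist_triangle2[of x y z] by (simp add: dist_commute)
      qed
    qed
  qed
qed

text \<open>The digits of \<open>s x\<close> record which sets \<open>B j\<close> contain
  \<open>x\<close>. Codes closer than \<open>(1/3)^m\<close> share their first \<open>m\<close>
  digits, so one small \<open>B j\<close> contains both points. The map itself is merely Borel; its
  inverse is uniformly continuous on each \<open>K n\<close>, and this is what the way back from the
  real line requires.\<close>

lemma real_encoding:
  fixes K :: "nat \<Rightarrow> 'a::metric_space set"
  assumes "\<And>n. compact (K n)"
  shows "\<exists>s::'a \<Rightarrow> real. s \<in> borel_measurable borel \<and> (\<forall>x. s x \<in> {0..1}) \<and>
    (\<forall>n. \<forall>e>0. \<exists>d>0. \<forall>x\<in>K n. \<forall>y\<in>K n. \<bar>s x - s y\<bar> < d \<longrightarrow> dist x y < e)"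
proof -
  obtain B :: "nat \<Rightarrow> 'a set" where B: "\<And>j. open (B j)"
    "\<And>n e. e > 0 \<Longrightarrow> \<exists>m. \<forall>x\<in>K n. \<exists>j<m. x \<in> B j \<and> (\<forall>y\<in>B j. dist x y < e)"
    using compact_family_separating_opens[where K=K, OF assms] by auto
  define b :: "nat \<Rightarrow> 'a \<Rightarrow> real" where "b j = indicator (B j)" for j
  define s where "s x = (\<Sum>j. b j x * (2/3 * (1/3)^j))" for x
  have g: "summable (\<lambda>j. 2/3 * (1/3::real)^j)" by (intro summable_mult summable_geometric) auto
  have b01: "0 \<le> b j x" "b j x \<le> 1" for j x by (auto simp: b_def)
  have le: "b j x * (2/3 * (1/3)^j) \<le> 2/3 * (1/3)^j" for j x
    using mult_right_mono[OF b01(2), of "2/3 * (1/3)^j"] by simp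
  have sm: "summable (\<lambda>j. b j x * (2/3 * (1/3)^j))" for x
    by (rule summable_comparison_test'[OF g, of 0]) (use le b01 in \<open>auto simp: abs_mult\<close>)
  show ?thesis
  proof (intro exI[of _ s] conjI allI impI)
    have [measurable]: "b j \<in> borel_measurable borel" for j using B(1) by (auto simp: b_def)
    show "s \<in> borel_measurable borel" unfolding s_def by measurable
    fix x
    have "s x \<le> (\<Sum>j. 2/3 * (1/3::real)^j)" unfolding s_def using le sm g by (intro suminf_le) auto
    also have "\<dots> = 1" by (subst suminf_mult) (auto intro: summable_geometric simp: suminf_geometric)
    finally have "s x \<le> 1" .
    moreover have "0 \<le> s x" unfolding s_def by (rule suminf_nonneg[OF sm]) (use b01 in simp)
    ultimately show "s x \<in> {0..1}" by simp
  next
    fix n and e :: real assume "e > 0"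
    then obtain m where m: "\<forall>x\<in>K n. \<exists>j<m. x \<in> B j \<and> (\<forall>y\<in>B j. dist x y < e)"
      using B(2)[of e n] by auto
    show "\<exists>d>0. \<forall>x\<in>K n. \<forall>y\<in>K n. \<bar>s x - s y\<bar> < d \<longrightarrow> dist x y < e"
    proof (intro exI[of _ "(1/3)^m"] conjI ballI impI)
      fix x y assume xy: "x \<in> K n" "y \<in> K n" "\<bar>s x - s y\<bar> < (1/3)^m"
      have "b j x = b j y" if "j < m" for j
      proof (rule ccontr)
        assume neq: "b j x \<noteq> b j y"
        define i where "i = (LEAST i. b i x \<noteq> b i y)"
        have i: "b i x \<noteq> b i y" unfolding i_def by (rule LeastI[of "\<lambda>i. b i x \<noteq> b i y", OF neq])
        have i': "b j x = b j y" if "j < i" for j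
          using that not_less_Least[of j "\<lambda>i. b i x \<noteq> b i y"] unfolding i_def by blast
        have "i \<le> j" using neq unfolding i_def by (rule Least_le)
        have "s x - s y = (\<Sum>j. (b j x - b j y) * (2/3 * (1/3)^j))"
          unfolding s_def by (subst suminf_diff[OF sm sm]) (simp only: left_diff_distrib)
        moreover have "\<bar>\<Sum>j. (b j x - b j y) * (2/3 * (1/3)^j)\<bar> \<ge> (1/3)^Suc i"
          using i i' by (intro ternary_gap) (auto simp: b_def indicator_def split: if_splits)
        moreover have "(1/3::real)^m \<le> (1/3)^Suc i" using \<open>i \<le> j\<close> \<open>j < m\<close> by (intro power_decreasing) auto
        ultimately show False using xy by linarith
      qed
      moreover obtain j where j: "j < m" "x \<in> B j" "\<forall>y\<in>B j. dist x y < e" using m xy by blast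
      ultimately have "b j x = b j y" by simp
      then have "y \<in> B j" using j(2) by (simp add: b_def indicator_def split: if_splits)
      then show "dist x y < e" using j(3) by blast
    qed simp
  qed
qed

lemma wconvI_prob:
  fixes M :: "nat \<Rightarrow> 'a::metric_space measure"
  assumes "\<And>j. prob_space (M j)" "prob_space L" "\<And>j. sets (M j) = sets borel" "sets L = sets borel"
    "\<And>f::'a\<Rightarrow>real. continuous_on UNIV f \<Longrightarrow> (\<And>x. 0 \<le> f x) \<Longrightarrow> (\<And>x. f x \<le> 1) \<Longrightarrow>
      (\<lambda>j. \<integral>x. f x \<partial>M j) \<longlonglongrightarrow> (\<integral>x. f x \<partial>L)"
  shows "wconv M L"
  unfolding wconv_def
proof (intro allI impI)
  fix f :: "'a \<Rightarrow> real" assume f: "continuous_on UNIV f \<and> (\<forall>x. 0 \<le> f x \<and> f x \<le> 1)"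
  have i: "integrable P f" if "prob_space P" "sets P = sets borel" for P
    using f that by (intro finite_measure.integrable_const_bound[of _ f 1] prob_space.finite_measure)
      (auto intro!: measurable_sets_transfer[OF borel_measurable_continuous_onI])
  have "(\<integral>\<^sup>+x. ennreal (f x) \<partial>P) = ennreal (\<integral>x. f x \<partial>P)" if "prob_space P" "sets P = sets borel" for P
    using f i[OF that] by (intro nn_integral_eq_integral) auto
  then show "(\<lambda>j. \<integral>\<^sup>+x. ennreal (f x) \<partial>M j) \<longlonglongrightarrow> (\<integral>\<^sup>+x. ennreal (f x) \<partial>L)"
    using assms(1-4) assms(5)[of f] f by (simp add: tendsto_ennrealI)
qed

lemma integral_close:
  fixes f g :: "'a \<Rightarrow> real"
  assumes "prob_space P" "f \<in> borel_measurable P" "g \<in> borel_measurable P"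
    "\<And>x. f x \<in> {0..1}" "\<And>x. g x \<in> {0..1}" "A \<in> sets P" "\<And>x. x \<in> A \<Longrightarrow> f x = g x" "measure P A \<ge> 1 - e"
  shows "\<bar>(\<integral>x. f x \<partial>P) - (\<integral>x. g x \<partial>P)\<bar> \<le> e"
proof -
  interpret prob_space P by fact
  have i: "integrable P f" "integrable P g"
    using assms by (auto intro!: integrable_const_bound[of _ 1])
  have "\<bar>(\<integral>x. f x \<partial>P) - (\<integral>x. g x \<partial>P)\<bar> = \<bar>\<integral>x. f x - g x \<partial>P\<bar>" using i by simp
  also have "\<dots> \<le> (\<integral>x. \<bar>f x - g x\<bar> \<partial>P)" by (rule integral_abs_bound)
  also have "\<dots> \<le> (\<integral>x. indicator (space P - A) x \<partial>P)"
  proof (rule integral_mono)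
    show "integrable P (\<lambda>x. indicator (space P - A) x :: real)" using assms(6) by (intro integrable_real_indicator) (auto simp: emeasure_eq_measure)
    fix x assume "x \<in> space P"
    then show "\<bar>f x - g x\<bar> \<le> indicator (space P - A) x"
      using assms(4)[of x] assms(5)[of x] assms(7)[of x] by (auto split: split_indicator simp: abs_le_iff)
  qed (use i in simp)
  also have "\<dots> = 1 - measure P A" using assms(6) by (simp add: prob_compl)
  finally show ?thesis using assms(8) by simp
qed

text \<open>The images under the encoding \<open>s\<close> are laws on [0,1], so the selection
  theorem on the real line provides a limit \<open>N\<close>. It lives on the closures of the images
  of the compact sets. The inverse of \<open>s\<close> extends to these closures by uniform
  continuity and completeness, and the image of \<open>N\<close> under the extension is the desired
  limit.\<close>

theorem prokhorov:
  fixes M :: "nat \<Rightarrow> 'a::complete_space measure" and K :: "nat \<Rightarrow> 'a set"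
  assumes M: "\<And>j. prob_space (M j)" "\<And>j. sets (M j) = sets borel"
    and K0: "\<And>n. compact (K n)" "\<And>n j. measure (M j) (K n) \<ge> 1 - 1 / real (Suc n)"
  obtains r L where "strict_mono r" "prob_space L" "sets L = sets borel" "wconv (M \<circ> r) L"
proof -
  interpret M: prob_space "M j" for j by (rule M)
  have spM: "space (M j) = UNIV" for j using sets_eq_imp_space_eq[OF M(2)[of j]] by simp
  \<comment> \<open>Increasing sets, so that the partial inverses built on them extend one
    another.\<close>
  define K' where "K' n = (\<Union>k\<le>n. K k)" for n
  have K'c: "compact (K' n)" for n using K0(1) by (auto simp: K'_def)
  have K'm: "K' n \<subseteq> K' k" if "n \<le> k" for n k unfolding K'_def using that by (intro UN_mono) auto
  have K'b: "K' n \<in> sets (M j)" for n j using compact_imp_closed[OF K'c] M(2) by simp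
  have K'p: "measure (M j) (K' n) \<ge> 1 - 1 / real (Suc n)" for j n
    using K0(2)[of n j] M.finite_measure_mono[of "K n" "K' n" j] K'b by (force simp: K'_def)
  obtain s :: "'a \<Rightarrow> real" where s[measurable]: "s \<in> borel_measurable borel" and s01: "\<And>x. s x \<in> {0..1}"
    and suc: "\<And>n e. e > 0 \<Longrightarrow> \<exists>d>0. \<forall>x\<in>K' n. \<forall>y\<in>K' n. \<bar>s x - s y\<bar> < d \<longrightarrow> dist x y < e"
    using real_encoding[where K=K', OF K'c] by blast
  have sM[measurable]: "s \<in> borel_measurable (M j)" for j by (rule measurable_sets_transfer[OF s M(2)])
  define \<mu> where "\<mu> j = distr (M j) borel s" for j
  have P\<mu>: "prob_space (\<mu> j)" for j unfolding \<mu>_def by (intro M.prob_space_distr sM)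
  have rd: "real_distribution (\<mu> j)" for j
    unfolding real_distribution_def real_distribution_axioms_def using P\<mu> by (simp add: \<mu>_def)
  have "tight \<mu>"
    unfolding tight_def
  proof (intro conjI allI impI rd)
    fix \<epsilon> :: real assume "\<epsilon> > 0"
    have "measure (\<mu> n) {-1<..1} = 1" for n
    proof -
      have "s -` {-1<..1} = UNIV" using s01 by (force simp: subset_iff)
      then show ?thesis using M.prob_space[of n] by (simp add: \<mu>_def measure_distr spM)
    qed
    then show "\<exists>a b. a < b \<and> (\<forall>n. 1 - \<epsilon> < measure (\<mu> n) {a<..b})"
      using \<open>\<epsilon> > 0\<close> by (intro exI[of _ "-1"] exI[of _ 1]) simp
  qed
  then obtain r N where r: "strict_mono r" and N: "real_distribution N" and w: "weak_conv_m (\<mu> \<circ> id \<circ> r) N"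
    using tight_imp_convergent_subsubsequence[of \<mu> id] by (auto simp: strict_mono_def)
  interpret N: real_distribution N by (rule N)
  have bw: "(\<lambda>j. \<integral>u. f u \<partial>\<mu> (r j)) \<longlonglongrightarrow> (\<integral>u. f u \<partial>N)"
    if "continuous_on UNIV f" "\<And>u. f u \<in> {0..1}" for f :: "real \<Rightarrow> real"
  proof -
    have "(\<lambda>j. \<integral>u. f u \<partial>(\<mu> \<circ> id \<circ> r) j) \<longlonglongrightarrow> (\<integral>u. f u \<partial>N)"
      by (rule weak_conv_imp_integral_bdd_continuous_conv[where B=1, OF _ N w])
        (use rd that in \<open>auto simp: continuous_on_eq_continuous_at\<close>)
    then show ?thesis by simp
  qed
  have wN: "wconv (\<lambda>j. \<mu> (r j)) N"
    by (intro wconvI_prob P\<mu> bw) (auto simp: \<mu>_def N.prob_space_axioms)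
  define T where "T n = closure (s ` K' n)" for n
  have Tm: "T n \<subseteq> T k" if "n \<le> k" for n k unfolding T_def by (intro closure_mono image_mono K'm that)
  \<comment> \<open>The mass of a closed set is upper semicontinuous under weak convergence. The
    functions \<open>hat (T n) k\<close> serve as continuous tests, and \<open>k\<close> is sent to
    infinity afterwards.\<close>
  have NT: "measure N (T n) \<ge> 1 - 1 / real (Suc n)" for n
  proof (cases "K' n = {}")
    case True
    then have "1 - 1 / real (Suc n) \<le> 0" using K'p[of n 0] True by simp
    then show ?thesis by (meson measure_nonneg order_trans)
  next
    case False
    then have Tne: "T n \<noteq> {}" by (auto simp: T_def)
    have lb: "ennreal (1 - 1 / real (Suc n)) \<le> (\<integral>\<^sup>+u. ennreal (hat (T n) k u) \<partial>N)" for k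
    proof (rule LIMSEQ_le_const[OF wconvD[OF wN]])
      show "\<exists>N. \<forall>j\<ge>N. ennreal (1 - 1 / real (Suc n)) \<le> (\<integral>\<^sup>+ u. ennreal (hat (T n) k u) \<partial>\<mu> (r j))"
      proof (intro exI[of _ 0] allI impI)
        fix j
        have "ennreal (1 - 1 / real (Suc n)) \<le> emeasure (M (r j)) (K' n)"
          unfolding M.emeasure_eq_measure by (intro ennreal_leI K'p)
        also have "\<dots> = (\<integral>\<^sup>+x. indicator (K' n) x \<partial>M (r j))" using K'b by simp
        also have "\<dots> \<le> (\<integral>\<^sup>+x. ennreal (hat (T n) k (s x)) \<partial>M (r j))"
        proof (rule nn_integral_mono)
          fix x
          have "x \<in> K' n \<Longrightarrow> s x \<in> T n" unfolding T_def by (intro subsetD[OF closure_subset] imageI)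
          then show "indicator (K' n) x \<le> ennreal (hat (T n) k (s x))"
            using ennreal_leI[OF hat_ge_indicator[OF Tne, of "s x" k]] by (cases "x \<in> K' n") simp_all
        qed
        also have "\<dots> = (\<integral>\<^sup>+u. ennreal (hat (T n) k u) \<partial>\<mu> (r j))"
          unfolding \<mu>_def by (subst nn_integral_distr) auto
        finally show "ennreal (1 - 1 / real (Suc n)) \<le> (\<integral>\<^sup>+u. ennreal (hat (T n) k u) \<partial>\<mu> (r j))" .
      qed
    qed (auto intro: hat_props)
    have "(\<lambda>k. \<integral>\<^sup>+u. ennreal (hat (T n) k u) \<partial>N) \<longlonglongrightarrow> emeasure N (T n)"
      using Tne by (intro nn_integral_hat_tendsto) (auto simp: T_def N.emeasure_eq_measure)
    then have "ennreal (1 - 1 / real (Suc n)) \<le> emeasure N (T n)"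
      by (rule LIMSEQ_le_const) (use lb in auto)
    then show ?thesis by (simp add: N.emeasure_eq_measure)
  qed
  have sinj: "x = y" if "x \<in> K' n" "y \<in> K' n" "s x = s y" for x y n
  proof (rule ccontr)
    assume "x \<noteq> y"
    then obtain d where "d > 0" "\<forall>x'\<in>K' n. \<forall>y'\<in>K' n. \<bar>s x' - s y'\<bar> < d \<longrightarrow> dist x' y' < dist x y"
      using suc[of "dist x y" n] by auto
    then show False using that by force
  qed
  have "\<exists>g. continuous_on (T n) g \<and> (\<forall>x\<in>K' n. g (s x) = x)" for n
  proof -
    define h where "h = inv_into (K' n) s"
    have hs: "h (s x) = x" if "x \<in> K' n" for x
      unfolding h_def using that sinj by (intro inv_into_f_f) (auto simp: inj_on_def)
    have "uniformly_continuous_on (s ` K' n) h"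
      unfolding uniformly_continuous_on_def
    proof (intro allI impI)
      fix e :: real assume "e > 0"
      then obtain d where "d > 0" "\<forall>x\<in>K' n. \<forall>y\<in>K' n. \<bar>s x - s y\<bar> < d \<longrightarrow> dist x y < e" using suc by blast
      then show "\<exists>d>0. \<forall>u\<in>s ` K' n. \<forall>u'\<in>s ` K' n. dist u' u < d \<longrightarrow> dist (h u') (h u) < e"
        by (intro exI[of _ d]) (auto simp: hs dist_real_def)
    qed
    then obtain g where "uniformly_continuous_on (closure (s ` K' n)) g" "\<forall>u\<in>s ` K' n. h u = g u"
      using uniformly_continuous_on_extension_on_closure[of "s ` K' n" h] by metis
    then show ?thesis unfolding T_def using hs by (intro exI[of _ g]) (auto simp: uniformly_continuous_imp_continuous)
  qed
  then obtain g where gc: "\<And>n. continuous_on (T n) (g n)" and gs: "\<And>n x. x \<in> K' n \<Longrightarrow> g n (s x) = x" by metis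
  \<comment> \<open>Both extensions invert \<open>s\<close> on the image of \<open>K' n\<close>,
    which is dense in \<open>T n\<close>.\<close>
  have agree: "g n u = g k u" if "n \<le> k" "u \<in> T n" for n k u
  proof -
    have "continuous_on (T n) (\<lambda>u. dist (g n u) (g k u))"
      using gc[of n] continuous_on_subset[OF gc[of k] Tm[OF that(1)]] by (intro continuous_intros)
    moreover have "dist (g n v) (g k v) = 0" if "v \<in> s ` K' n" for v
      using that gs K'm[OF \<open>n \<le> k\<close>] by auto
    ultimately have "dist (g n u) (g k u) = 0"
      using continuous_constant_on_closure[of "s ` K' n" "\<lambda>u. dist (g n u) (g k u)" 0 u] that(2) unfolding T_def by blast
    then show ?thesis by simp
  qed
  define G where "G u = (if u \<in> (\<Union>n. T n) then g (LEAST n. u \<in> T n) u else undefined)" for u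
  have G: "G u = g n u" if "u \<in> T n" for u n
  proof -
    have "u \<in> T (LEAST n. u \<in> T n)" "(LEAST n. u \<in> T n) \<le> n" using that by (auto intro: LeastI Least_le)
    then show ?thesis using agree that by (auto simp: G_def)
  qed
  have Tb[measurable]: "T n \<in> sets borel" for n by (simp add: T_def)
  have Gm[measurable]: "G \<in> borel \<rightarrow>\<^sub>M borel"
  proof (rule measurable_piecewise_restrict[where C="insert (- (\<Union>n. T n)) (range T)"])
    fix \<Omega> assume "\<Omega> \<in> insert (- (\<Union>n. T n)) (range T)"
    then consider "\<Omega> = - (\<Union>n. T n)" | n where "\<Omega> = T n" by auto
    then show "G \<in> restrict_space borel \<Omega> \<rightarrow>\<^sub>M borel"
    proof cases
      case 1
      then show ?thesis
        by (subst measurable_cong[of _ G "\<lambda>_. undefined"]) (auto simp: G_def space_restrict_space)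
    next
      case 2
      have "g n \<in> restrict_space borel (T n) \<rightarrow>\<^sub>M borel" by (rule borel_measurable_continuous_on_restrict[OF gc])
      then show ?thesis unfolding 2
        by (subst measurable_cong[of _ G "g n"]) (auto simp: G space_restrict_space)
    qed
  qed auto
  define L where "L = distr N borel G"
  have GN[measurable]: "G \<in> N \<rightarrow>\<^sub>M borel" by (rule measurable_sets_transfer[OF Gm]) simp
  have PL: "prob_space L" unfolding L_def by (intro N.prob_space_distr GN)
  have "wconv (M \<circ> r) L"
  proof (rule wconvI_prob)
    fix f :: "'a \<Rightarrow> real" assume f: "continuous_on UNIV f" "\<And>x. 0 \<le> f x" "\<And>x. f x \<le> 1"
    have fm[measurable]: "f \<in> borel_measurable borel" using f(1) by (rule borel_measurable_continuous_onI)
    have fM[measurable]: "f \<in> borel_measurable (M j)" for j by (rule measurable_sets_transfer[OF fm M(2)])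
    have LN: "(\<integral>x. f x \<partial>L) = (\<integral>u. f (G u) \<partial>N)" unfolding L_def by (rule integral_distr) auto
    show "(\<lambda>j. \<integral>x. f x \<partial>(M \<circ> r) j) \<longlonglongrightarrow> (\<integral>x. f x \<partial>L)"
    proof (rule LIMSEQ_I)
      fix e :: real assume "e > 0"
      then obtain n where n: "1 / real (Suc n) < e / 3" using nat_approx_posE[of "e/3"] by auto
      have "continuous_on (T n) (\<lambda>u. f (g n u))" using f(1) gc[of n]
        by (intro continuous_on_compose2[OF f(1) gc]) auto
      \<comment> \<open>After the inverse encoding, \<open>f\<close> is continuous on
        \<open>T n\<close> only. Its Tietze extension \<open>h\<close> is a test function on the
        whole line and differs from the true integrand on a set of mass at most
        \<open>1 / Suc n\<close>, for \<open>N\<close> as well as for every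
        \<open>M j\<close>.\<close>
      then obtain h where h: "continuous_on UNIV h" "\<And>u. u \<in> T n \<Longrightarrow> h u = f (g n u)" "\<And>u. h u \<in> cbox 0 1"
        by (rule Tietze_closed_interval_1[where U=UNIV and a=0 and b=1]) (use f in \<open>auto simp: T_def\<close>)
      have hm[measurable]: "h \<in> borel_measurable borel" using h(1) by (rule borel_measurable_continuous_onI)
      have 1: "\<bar>(\<integral>u. f (G u) \<partial>N) - (\<integral>u. h u \<partial>N)\<bar> \<le> 1 / real (Suc n)"
      proof (rule integral_close[where A="T n", OF N.prob_space_axioms])
        show "h \<in> borel_measurable N" by (rule measurable_sets_transfer[OF hm]) simp
        show "f (G u) \<in> {0..1}" "h u \<in> {0..1}" for u using f h(3)[of u] by auto
        show "f (G u) = h u" if "u \<in> T n" for u using h(2)[OF that] G[OF that] by simp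
        show "1 - 1 / real (Suc n) \<le> N.prob (T n)" by (rule NT)
      qed simp_all
      have 2: "\<bar>(\<integral>x. f x \<partial>M j) - (\<integral>u. h u \<partial>\<mu> j)\<bar> \<le> 1 / real (Suc n)" for j
      proof -
        have e: "(\<integral>u. h u \<partial>\<mu> j) = (\<integral>x. h (s x) \<partial>M j)" unfolding \<mu>_def by (rule integral_distr) auto
        have "f x = h (s x)" if "x \<in> K' n" for x
        proof -
          have "s x \<in> T n" unfolding T_def by (intro subsetD[OF closure_subset] imageI that)
          then show ?thesis using h(2) gs[OF that] by simp
        qed
        then show ?thesis unfolding e
          by (intro integral_close[where A="K' n", OF M(1)]) (use f h K'p K'b in auto)
      qed
      obtain J where J: "\<And>j. j \<ge> J \<Longrightarrow> \<bar>(\<integral>u. h u \<partial>\<mu> (r j)) - (\<integral>u. h u \<partial>N)\<bar> < e / 3"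
        using LIMSEQ_D[OF bw[OF h(1)], of "e/3"] h(3) \<open>e > 0\<close> by auto
      show "\<exists>no. \<forall>j\<ge>no. norm ((\<integral>x. f x \<partial>(M \<circ> r) j) - (\<integral>x. f x \<partial>L)) < e"
      proof (intro exI[of _ J] allI impI)
        fix j assume "j \<ge> J"
        then show "norm ((\<integral>x. f x \<partial>(M \<circ> r) j) - (\<integral>x. f x \<partial>L)) < e"
          using J[of j] 1 2[of "r j"] n unfolding LN o_def real_norm_def by linarith
      qed
    qed
  qed (use M PL in \<open>auto simp: L_def\<close>)
  then show ?thesis using that[OF r PL] by (simp add: L_def)
qed

section \<open>Tightness for finite measures of arbitrary mass\<close>

definition tight_seq :: "(nat \<Rightarrow> 'a::metric_space measure) \<Rightarrow> bool" where
  "tight_seq M \<longleftrightarrow> (\<forall>e>0. \<exists>K. compact K \<and> (\<forall>j. emeasure (M j) (- K) \<le> ennreal e))"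

lemma tight_seq_const:
  fixes M :: "'a::{complete_space,second_countable_topology} measure"
  assumes "finite_measure M" "sets M = sets borel"
  shows "tight_seq (\<lambda>_. M)"
  unfolding tight_seq_def
proof (intro allI impI)
  interpret finite_measure M by fact
  fix e :: real assume "e > 0"
  have sp: "space M = UNIV" using sets_eq_imp_space_eq[OF assms(2)] by simp
  have "emeasure M UNIV = (SUP K\<in>{K. K \<subseteq> UNIV \<and> compact K}. emeasure M K)"
    using assms emeasure_finite[of "space M"] by (intro inner_regular) auto
  moreover have "emeasure M UNIV \<le> ennreal e \<or> emeasure M UNIV - ennreal e < emeasure M UNIV"
  proof (cases "emeasure M UNIV \<le> ennreal e")
    case False
    then have "0 < emeasure M UNIV" by (simp add: not_le le_less_trans[OF zero_le])
    then have "emeasure M UNIV - ennreal e < emeasure M UNIV"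
      using \<open>e > 0\<close> emeasure_finite[of UNIV] by (intro ennreal_between) (simp_all add: less_top[symmetric])
    then show ?thesis ..
  qed simp
  ultimately consider "emeasure M UNIV \<le> ennreal e" | K where "compact K" "emeasure M UNIV - ennreal e < emeasure M K"
    by (auto simp: less_SUP_iff)
  then show "\<exists>K. compact K \<and> (\<forall>j::nat. emeasure M (- K) \<le> ennreal e)"
  proof cases
    case 1 then show ?thesis by (intro exI[of _ "{}"]) auto
  next
    case 2
    have "K \<in> sets M" using compact_imp_closed[OF 2(1)] assms by simp
    then have "emeasure M (- K) = emeasure M UNIV - emeasure M K"
      using emeasure_compl[of K M] emeasure_finite sp by (simp add: Compl_eq_Diff_UNIV)
    also have "\<dots> \<le> ennreal e"
      using 2(2) emeasure_finite[of UNIV] emeasure_finite[of K]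
      by (metis ennreal_minus_le_iff add.commute less_imp_le)
    finally show ?thesis using 2 by blast
  qed
qed

lemma tight_seq_compact:
  assumes "compact K" "\<And>j. AE x in M j. x \<in> K" "\<And>j. sets (M j) = sets borel"
  shows "tight_seq M"
  unfolding tight_seq_def
proof (intro allI impI exI[of _ K] conjI assms(1))
  fix e j
  have "- K \<in> sets (M j)" using compact_imp_closed[OF assms(1)] assms(3) by auto
  then have "emeasure (M j) (- K) = 0"
    using assms(2)[of j] sets_eq_imp_space_eq[OF assms(3), of j] by (subst AE_iff_measurable[symmetric, where P="\<lambda>x. x \<in> K"]) auto
  then show "emeasure (M j) (- K) \<le> ennreal e" by simp
qed

lemma tight_seq_prod:
  fixes M :: "nat \<Rightarrow> ('a::metric_space \<times> 'b::metric_space) measure"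
  assumes "tight_seq (\<lambda>j. distr (M j) borel fst)" "tight_seq (\<lambda>j. distr (M j) borel snd)" "\<And>j. sets (M j) = sets borel"
  shows "tight_seq M"
  unfolding tight_seq_def
proof (intro allI impI)
  fix e :: real assume "e > 0"
  then obtain K1 K2 where K: "compact K1" "\<And>j. emeasure (distr (M j) borel fst) (- K1) \<le> ennreal (e/2)"
    "compact K2" "\<And>j. emeasure (distr (M j) borel snd) (- K2) \<le> ennreal (e/2)"
    using assms(1)[unfolded tight_seq_def, rule_format, of "e/2"] assms(2)[unfolded tight_seq_def, rule_format, of "e/2"] by auto
  have sp: "space (M j) = UNIV" for j using sets_eq_imp_space_eq[OF assms(3)] by simp
  have fs: "fst \<in> M j \<rightarrow>\<^sub>M borel" "snd \<in> M j \<rightarrow>\<^sub>M borel" for j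
    by (intro measurable_sets_transfer[OF borel_measurable_continuous_onI assms(3)] continuous_intros)+
  have o: "- K1 \<in> sets borel" "- K2 \<in> sets borel"
    using compact_imp_closed[OF K(1)] compact_imp_closed[OF K(3)] by simp_all
  show "\<exists>K. compact K \<and> (\<forall>j. emeasure (M j) (- K) \<le> ennreal e)"
  proof (intro exI[of _ "K1 \<times> K2"] conjI allI compact_Times K)
    fix j
    have "emeasure (M j) (- (K1 \<times> K2)) \<le> emeasure (M j) (fst -` (- K1) \<inter> space (M j) \<union> snd -` (- K2) \<inter> space (M j))"
      using o fs by (intro emeasure_mono sets.Un measurable_sets[OF fs(1)] measurable_sets[OF fs(2)]) (auto simp: sp)
    also have "\<dots> \<le> emeasure (M j) (fst -` (- K1) \<inter> space (M j)) + emeasure (M j) (snd -` (- K2) \<inter> space (M j))"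
      using o by (intro emeasure_subadditive measurable_sets[OF fs(1)] measurable_sets[OF fs(2)])
    also have "\<dots> \<le> ennreal (e/2) + ennreal (e/2)"
      using K o fs by (intro add_mono) (auto simp: emeasure_distr)
    also have "\<dots> = ennreal e" using \<open>e > 0\<close> by (simp add: ennreal_plus[symmetric] del: ennreal_plus)
    finally show "emeasure (M j) (- (K1 \<times> K2)) \<le> ennreal e" .
  qed
qed

lemma wconv_scale:
  assumes "wconv M L" "\<And>j. sets (M j) = sets borel" "sets L = sets borel" "c \<noteq> \<infinity>"
  shows "wconv (\<lambda>j. scale_measure c (M j)) (scale_measure c L)"
  unfolding wconv_def
proof (intro allI impI)
  fix f :: "'a \<Rightarrow> real" assume f: "continuous_on UNIV f \<and> (\<forall>x. 0 \<le> f x \<and> f x \<le> 1)"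
  then have m: "(\<lambda>x. ennreal (f x)) \<in> borel_measurable borel"
    by (intro measurable_compose[OF borel_measurable_continuous_onI measurable_ennreal]) auto
  have "(\<lambda>x. ennreal (f x)) \<in> borel_measurable (M j)" "(\<lambda>x. ennreal (f x)) \<in> borel_measurable L" for j
    using measurable_sets_transfer[OF m] assms by auto
  moreover have "c < \<top>" using assms(4) less_top[of c] by simp
  then have "(\<lambda>j. c * (\<integral>\<^sup>+x. ennreal (f x) \<partial>M j)) \<longlonglongrightarrow> c * (\<integral>\<^sup>+x. ennreal (f x) \<partial>L)"
    using f by (intro ennreal_tendsto_cmult wconvD[OF assms(1)]) simp_all
  ultimately show "(\<lambda>j. \<integral>\<^sup>+x. ennreal (f x) \<partial>scale_measure c (M j)) \<longlonglongrightarrow> (\<integral>\<^sup>+x. ennreal (f x) \<partial>scale_measure c L)"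
    by (simp add: nn_integral_scale_measure)
qed

theorem prokhorov_finite:
  fixes M :: "nat \<Rightarrow> 'a::complete_space measure"
  assumes M: "\<And>j. emeasure (M j) UNIV = ennreal c" "\<And>j. sets (M j) = sets borel" and "tight_seq M"
  obtains r L where "strict_mono r" "finite_measure L" "sets L = sets borel" "wconv (M \<circ> r) L"
proof (cases "c \<le> 0")
  case True
  have sp: "space (M j) = UNIV" for j using sets_eq_imp_space_eq[OF M(2)[of j]] by simp
  have "AE x in M j. False" for j
    using M(1)[of j] M(2)[of j] True by (intro AE_I[where N=UNIV]) (auto simp: ennreal_neg)
  then have "(\<integral>\<^sup>+x. f x \<partial>M j) = 0" for f j
    using nn_integral_cong_AE[OF eventually_mono, of "\<lambda>x. False" "M j" f "\<lambda>_. 0"] by simp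
  then have "wconv (M \<circ> id) (null_measure borel)"
    by (simp add: wconv_def)
  moreover have "strict_mono (id :: nat \<Rightarrow> nat)" by (simp add: strict_mono_def)
  moreover have "finite_measure (null_measure (borel :: 'a measure))" by (intro finite_measureI) simp
  ultimately show ?thesis by (intro that[of id "null_measure borel"]) simp_all
next
  case False
  then have c: "c > 0" by simp
  have sp: "space (M j) = UNIV" for j using sets_eq_imp_space_eq[OF M(2)[of j]] by simp
  define N where "N j = scale_measure (ennreal (1/c)) (M j)" for j
  have N: "sets (N j) = sets borel" "prob_space (N j)" for j
    using M c sp by (auto simp: N_def space_scale_measure ennreal_mult[symmetric] intro!: prob_spaceI)
  have "\<exists>K. compact K \<and> (\<forall>j. emeasure (M j) (- K) \<le> ennreal (c / real (Suc n)))" for n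
    using assms(3) c by (auto simp: tight_seq_def)
  then obtain K where K: "\<And>n. compact (K n)" "\<And>n j. emeasure (M j) (- K n) \<le> ennreal (c / real (Suc n))" by metis
  have pb: "measure (N j) (K n) \<ge> 1 - 1 / real (Suc n)" for n j
  proof -
    interpret prob_space "N j" by (rule N)
    have "K n \<in> sets (N j)" using compact_imp_closed[OF K(1)] N by simp
    moreover have "emeasure (N j) (- K n) \<le> ennreal (1 / real (Suc n))"
    proof -
      have "emeasure (N j) (- K n) \<le> ennreal (1/c) * ennreal (c / real (Suc n))"
        unfolding N_def by (simp only: emeasure_scale_measure) (intro mult_left_mono K(2), simp)
      then show ?thesis using c by (simp add: ennreal_mult[symmetric])
    qed
    moreover have "space (N j) = UNIV" using sets_eq_imp_space_eq[OF N(1)] by simp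
    moreover have "0 \<le> 1 / real (Suc n)" by simp
    ultimately show ?thesis using prob_compl[of "K n"]
      by (simp add: emeasure_eq_measure Compl_eq_Diff_UNIV del: of_nat_Suc)
  qed
  obtain r L where r: "strict_mono r" "prob_space L" "sets L = sets borel" "wconv (N \<circ> r) L"
    by (rule prokhorov[of N K, OF N(2,1) K(1) pb])
  interpret L: prob_space L by fact
  have "scale_measure (ennreal c) (N j) = M j" for j
    using c by (simp add: N_def scale_scale_measure ennreal_mult[symmetric])
  then have "wconv (M \<circ> r) (scale_measure (ennreal c) L)"
    using wconv_scale[OF r(4), of "ennreal c"] N(1) r(3) by (simp add: o_def)
  moreover have "finite_measure (scale_measure (ennreal c) L)"
    using L.emeasure_finite by (intro finite_measureI) (simp add: ennreal_mult_eq_top_iff space_scale_measure)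
  ultimately show ?thesis using r by (intro that) auto
qed

text \<open>A point receives the index of the first point of a dense sequence that is within
  \<open>e / 2\<close> of it. These countable Borel partitions take the place of measurable
  selection and disintegration in all later constructions.\<close>

lemma cell_index:
  fixes e :: real
  assumes "e > 0"
  shows "\<exists>ix::'v::{metric_space,second_countable_topology} \<Rightarrow> nat. ix \<in> borel \<rightarrow>\<^sub>M count_space UNIV \<and>
    (\<forall>x y. ix x = ix y \<longrightarrow> dist x y < e) \<and> (\<forall>K. compact K \<longrightarrow> finite (ix ` K))"
proof -
  obtain D :: "'v set" where D: "countable D" "\<And>X. open X \<Longrightarrow> X \<noteq> {} \<Longrightarrow> \<exists>d\<in>D. d \<in> X"
    using countable_dense_exists by metis
  define d where "d = from_nat_into D"
  have ex: "\<exists>n. dist (d n) x < e / 2" for x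
  proof -
    obtain z where "z \<in> D" "z \<in> ball x (e/2)" using D(2)[of "ball x (e/2)"] assms by auto
    then show ?thesis using from_nat_into_to_nat_on[OF D(1)] by (auto simp: d_def dist_commute intro!: exI[of _ "to_nat_on D z"])
  qed
  define ix where "ix x = (LEAST n. dist (d n) x < e / 2)" for x
  have ix: "dist (d (ix x)) x < e / 2" for x unfolding ix_def using ex by (rule LeastI_ex)
  show ?thesis
  proof (intro exI[of _ ix] conjI allI impI)
    show "ix \<in> borel \<rightarrow>\<^sub>M count_space UNIV" unfolding ix_def by measurable
    show "dist x y < e" if "ix x = ix y" for x y
      using ix[of x] ix[of y] that dist_triangle2[of x y "d (ix x)"] by (simp add: dist_commute)
    show "finite (ix ` K)" if K: "compact K" for K
    proof -
      have "K \<subseteq> (\<Union>n. ball (d n) (e/2))" using ex by auto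
      then obtain F where F: "finite F" "K \<subseteq> (\<Union>n\<in>F. ball (d n) (e/2))"
        using compactE_image[OF K, of UNIV "\<lambda>n. ball (d n) (e/2)"] by auto
      have "ix x \<le> Max F" if "x \<in> K" for x
      proof -
        have "x \<in> (\<Union>n\<in>F. ball (d n) (e/2))" using F(2) that by (rule subsetD)
        then obtain n where "n \<in> F" "dist (d n) x < e/2" by auto
        then have "ix x \<le> n" unfolding ix_def by (intro Least_le)
        then show ?thesis using Max_ge[OF F(1) \<open>n \<in> F\<close>] by linarith
      qed
      then have "ix ` K \<subseteq> {..Max F}" by blast
      then show ?thesis by (rule finite_subset) (rule finite_atMost)
    qed
  qed
qed

lemma space_UNIV_borel: "sets M = sets borel \<Longrightarrow> space M = UNIV"
  by (metis sets_eq_imp_space_eq space_borel)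

lemma cont_measurable:
  "continuous_on UNIV p \<Longrightarrow> sets M = sets borel \<Longrightarrow> p \<in> M \<rightarrow>\<^sub>M borel"
  by (rule measurable_sets_transfer[OF borel_measurable_continuous_onI])

lemma AE_distr_vimage:
  assumes "p \<in> M \<rightarrow>\<^sub>M N" "AE y in distr M N p. P y"
  shows "AE x in M. P (p x)"
proof -
  obtain A where "{y\<in>space N. \<not> P y} \<subseteq> A" "A \<in> sets N" "emeasure (distr M N p) A = 0"
    using assms(2) by (auto elim!: AE_E)
  then show ?thesis using assms(1)
    by (intro AE_I[where N="p -` A \<inter> space M"]) (auto simp: emeasure_distr dest: measurable_space)
qed

section \<open>Gluing and lifting\<close>

text \<open>The couplings that are products on the cells of a fine partition have the right marginals, and a
  weak limit along partitions of vanishing mesh identifies the common coordinate.\<close>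

lemma approximate_gluing:
  fixes M1 :: "'u::{metric_space,second_countable_topology} measure"
    and M2 :: "'w::{metric_space,second_countable_topology} measure"
    and p :: "'u \<Rightarrow> 'v::{metric_space,second_countable_topology}"
  assumes fin: "finite_measure M1" "finite_measure M2" and S: "sets M1 = sets borel" "sets M2 = sets borel"
    and p: "p \<in> borel \<rightarrow>\<^sub>M borel" and q: "q \<in> borel \<rightarrow>\<^sub>M borel"
    and eq: "distr M1 borel p = distr M2 borel q" and "e > 0"
  shows "\<exists>R. sets R = sets borel \<and> distr R borel fst = M1 \<and> distr R borel snd = M2 \<and>
    (AE z in R. dist (p (fst z)) (q (snd z)) < e)"
proof -
  interpret M1: finite_measure M1 by fact
  interpret M2: finite_measure M2 by fact
  obtain ix :: "'v \<Rightarrow> nat" where ix[measurable]: "ix \<in> borel \<rightarrow>\<^sub>M count_space UNIV"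
    and ixd: "\<And>x y. ix x = ix y \<Longrightarrow> dist x y < e" and "\<And>K. compact K \<Longrightarrow> finite (ix ` K)"
    using cell_index[OF \<open>e > 0\<close>] by blast
  note [measurable_cong] = S
  note [measurable] = p q
  note sp = space_UNIV_borel[OF S(1)] space_UNIV_borel[OF S(2)]
  define \<sigma> where "\<sigma> k = emeasure (distr M1 borel p) (ix -` {k})" for k
  have cell: "ix -` {k} \<in> sets borel" for k using measurable_sets[OF ix, of "{k}"] by simp
  have s1: "\<sigma> k = emeasure M1 {u. ix (p u) = k}" for k
    unfolding \<sigma>_def using cell by (subst emeasure_distr) (auto simp: sp intro!: arg_cong[where f="emeasure M1"])
  have s2: "\<sigma> k = emeasure M2 {u. ix (q u) = k}" for k
    unfolding \<sigma>_def eq using cell by (subst emeasure_distr) (auto simp: sp intro!: arg_cong[where f="emeasure M2"])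
  have sfin: "\<sigma> k \<noteq> \<top>" for k unfolding s1 by simp
  have m1: "{u. ix (p u) = k} \<in> sets M1" for k using measurable_sets[of "\<lambda>u. ix (p u)" borel "count_space UNIV" "{k}"] S by (simp add: vimage_def)
  have m2: "{u. ix (q u) = k} \<in> sets M2" for k using measurable_sets[of "\<lambda>u. ix (q u)" borel "count_space UNIV" "{k}"] S by (simp add: vimage_def)
  \<comment> \<open>Cells of mass zero must be discarded, because the factor
    \<open>1 / \<sigma> k\<close> in the density \<open>h\<close> below is infinite there.\<close>
  have ae1: "AE u in M1. \<sigma> (ix (p u)) \<noteq> 0"
  proof -
    have "AE u in M1. \<forall>k. \<sigma> k = 0 \<longrightarrow> ix (p u) \<noteq> k"
      unfolding AE_all_countable
    proof
      fix k show "AE u in M1. \<sigma> k = 0 \<longrightarrow> ix (p u) \<noteq> k"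
        using s1[of k] m1[of k] by (cases "\<sigma> k = 0") (auto intro!: AE_I[where N="{u. ix (p u) = k}"])
    qed
    then show ?thesis by eventually_elim auto
  qed
  have ae2: "AE u in M2. \<sigma> (ix (q u)) \<noteq> 0"
  proof -
    have "AE u in M2. \<forall>k. \<sigma> k = 0 \<longrightarrow> ix (q u) \<noteq> k"
      unfolding AE_all_countable
    proof
      fix k show "AE u in M2. \<sigma> k = 0 \<longrightarrow> ix (q u) \<noteq> k"
        using s2[of k] m2[of k] by (cases "\<sigma> k = 0") (auto intro!: AE_I[where N="{u. ix (q u) = k}"])
    qed
    then show ?thesis by eventually_elim auto
  qed
  \<comment> \<open>On cell \<open>k\<close> both measures have mass \<open>\<sigma> k\<close>, so
    their product divided by \<open>\<sigma> k\<close> is a coupling of the two restrictions to the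
    cell.\<close>
  define h :: "'u \<times> 'w \<Rightarrow> ennreal" where
    "h = (\<lambda>z. if ix (p (fst z)) = ix (q (snd z)) then 1 / \<sigma> (ix (p (fst z))) else 0)"
  have sm[measurable]: "\<sigma> \<in> count_space UNIV \<rightarrow>\<^sub>M borel" by simp
  have hm[measurable]: "h \<in> borel_measurable (M1 \<Otimes>\<^sub>M M2)"
  proof -
    have 1: "(\<lambda>z. ix (p (fst z))) \<in> M1 \<Otimes>\<^sub>M M2 \<rightarrow>\<^sub>M count_space UNIV" by measurable
    have 2: "(\<lambda>z. ix (q (snd z))) \<in> M1 \<Otimes>\<^sub>M M2 \<rightarrow>\<^sub>M count_space UNIV" by measurable
    have "(\<lambda>z. 1 / \<sigma> (ix (p (fst z)))) \<in> borel_measurable (M1 \<Otimes>\<^sub>M M2)"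
      by (rule measurable_compose[OF 1]) simp
    moreover have "{z\<in>space (M1 \<Otimes>\<^sub>M M2). ix (p (fst z)) = ix (q (snd z))} \<in> sets (M1 \<Otimes>\<^sub>M M2)"
    proof -
      have "{z\<in>space (M1 \<Otimes>\<^sub>M M2). ix (p (fst z)) = ix (q (snd z))} =
        (\<Union>k. ((\<lambda>z. ix (p (fst z))) -` {k} \<inter> space (M1 \<Otimes>\<^sub>M M2)) \<inter> ((\<lambda>z. ix (q (snd z))) -` {k} \<inter> space (M1 \<Otimes>\<^sub>M M2)))"
        by auto
      then show ?thesis using measurable_sets[OF 1] measurable_sets[OF 2] by auto
    qed
    ultimately show ?thesis unfolding h_def by (intro measurable_If measurable_const) simp_all
  qed
  have in2: "(\<integral>\<^sup>+w. h (u, w) \<partial>M2) = 1" if "\<sigma> (ix (p u)) \<noteq> 0" for u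
  proof -
    have "(\<integral>\<^sup>+w. h (u, w) \<partial>M2) = (\<integral>\<^sup>+w. 1 / \<sigma> (ix (p u)) * indicator {w. ix (q w) = ix (p u)} w \<partial>M2)"
      by (intro nn_integral_cong) (auto simp: h_def split: split_indicator)
    also have "\<dots> = 1 / \<sigma> (ix (p u)) * \<sigma> (ix (p u))"
      using m2 by (subst nn_integral_cmult_indicator) (auto simp: s2[symmetric])
    finally show ?thesis using that sfin by (simp add: ennreal_divide_times ennreal_divide_self less_top[symmetric])
  qed
  have in1: "(\<integral>\<^sup>+u. h (u, w) \<partial>M1) = 1" if "\<sigma> (ix (q w)) \<noteq> 0" for w
  proof -
    have "(\<integral>\<^sup>+u. h (u, w) \<partial>M1) = (\<integral>\<^sup>+u. 1 / \<sigma> (ix (q w)) * indicator {u. ix (p u) = ix (q w)} u \<partial>M1)"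
      by (intro nn_integral_cong) (auto simp: h_def split: split_indicator)
    also have "\<dots> = 1 / \<sigma> (ix (q w)) * \<sigma> (ix (q w))"
      using m1 by (subst nn_integral_cmult_indicator) (auto simp: s1[symmetric])
    finally show ?thesis using that sfin by (simp add: ennreal_divide_times ennreal_divide_self less_top[symmetric])
  qed
  interpret P: pair_sigma_finite M1 M2 by unfold_locales
  define R where "R = density (M1 \<Otimes>\<^sub>M M2) h"
  have SR: "sets R = sets borel"
    unfolding R_def sets_density using sets_pair_measure_cong[OF S] by (simp only: borel_prod)
  have "distr R borel fst = M1"
  proof (rule measure_eqI)
    fix A assume A0: "A \<in> sets (distr R borel fst)"
    then have [measurable]: "A \<in> sets M1" using S by simp
    have [measurable]: "fst -` A \<in> sets (M1 \<Otimes>\<^sub>M M2)"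
    proof -
      have "fst -` A = A \<times> space M2" by (auto simp: sp)
      then show ?thesis by simp
    qed
    have "emeasure (distr R borel fst) A = (\<integral>\<^sup>+z. h z * indicator (fst -` A) z \<partial>(M1 \<Otimes>\<^sub>M M2))"
      using A0 cont_measurable[OF continuous_on_fst[OF continuous_on_id] SR]
      by (subst emeasure_distr) (auto simp: R_def emeasure_density space_pair_measure sp)
    also have "\<dots> = (\<integral>\<^sup>+u. \<integral>\<^sup>+w. h (u, w) * indicator A u \<partial>M2 \<partial>M1)"
      by (subst M2.nn_integral_fst[symmetric]) (auto intro!: nn_integral_cong split: split_indicator)
    also have "\<dots> = (\<integral>\<^sup>+u. indicator A u \<partial>M1)"
    proof (intro nn_integral_cong_AE eventually_mono[OF ae1])
      fix u assume u: "\<sigma> (ix (p u)) \<noteq> 0"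
      show "(\<integral>\<^sup>+w. h (u, w) * indicator A u \<partial>M2) = indicator A u"
        using in2[OF u] by (cases "u \<in> A") simp_all
    qed
    finally show "emeasure (distr R borel fst) A = emeasure M1 A" by simp
  qed (simp add: S)
  moreover have "distr R borel snd = M2"
  proof (rule measure_eqI)
    fix A assume A0: "A \<in> sets (distr R borel snd)"
    then have [measurable]: "A \<in> sets M2" using S by simp
    have [measurable]: "snd -` A \<in> sets (M1 \<Otimes>\<^sub>M M2)"
    proof -
      have "snd -` A = space M1 \<times> A" by (auto simp: sp)
      then show ?thesis by simp
    qed
    have "emeasure (distr R borel snd) A = (\<integral>\<^sup>+z. h z * indicator (snd -` A) z \<partial>(M1 \<Otimes>\<^sub>M M2))"
      using A0 cont_measurable[OF continuous_on_snd[OF continuous_on_id] SR]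
      by (subst emeasure_distr) (auto simp: R_def emeasure_density space_pair_measure sp)
    also have "\<dots> = (\<integral>\<^sup>+w. \<integral>\<^sup>+u. h (u, w) * indicator A w \<partial>M1 \<partial>M2)"
      by (subst P.nn_integral_snd[symmetric]) (auto intro!: nn_integral_cong split: split_indicator)
    also have "\<dots> = (\<integral>\<^sup>+u. indicator A u \<partial>M2)"
    proof (intro nn_integral_cong_AE eventually_mono[OF ae2])
      fix w assume w: "\<sigma> (ix (q w)) \<noteq> 0"
      show "(\<integral>\<^sup>+u. h (u, w) * indicator A w \<partial>M1) = indicator A w"
        using in1[OF w] by (cases "w \<in> A") simp_all
    qed
    finally show "emeasure (distr R borel snd) A = emeasure M2 A" by simp
  qed (simp add: S)
  moreover have "AE z in R. dist (p (fst z)) (q (snd z)) < e"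
    unfolding R_def by (subst AE_density[OF hm]) (auto simp: h_def intro!: ixd)
  ultimately show ?thesis using SR by blast
qed

text \<open>The approximate couplings are tight because their marginals are fixed, and continuity of
  \<open>p\<close> and \<open>q\<close> lets the approximate equality of the common coordinate
  become exact in the limit.\<close>

theorem gluing:
  fixes M1 :: "'u::{complete_space,second_countable_topology} measure"
    and M2 :: "'w::{complete_space,second_countable_topology} measure"
    and p :: "'u \<Rightarrow> 'v::{metric_space,second_countable_topology}"
  assumes fin: "finite_measure M1" "finite_measure M2" and S: "sets M1 = sets borel" "sets M2 = sets borel"
    and p: "continuous_on UNIV p" and q: "continuous_on UNIV q" and eq: "distr M1 borel p = distr M2 borel q"
  obtains R where "finite_measure R" "sets R = sets borel" "distr R borel fst = M1" "distr R borel snd = M2"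
    "AE z in R. p (fst z) = q (snd z)"
proof -
  interpret M1: finite_measure M1 by fact
  have "\<exists>R. sets R = sets borel \<and> distr R borel fst = M1 \<and> distr R borel snd = M2 \<and>
    (AE z in R. dist (p (fst z)) (q (snd z)) < 1 / real (Suc j))" for j
    using assms by (intro approximate_gluing borel_measurable_continuous_onI) auto
  then have "\<exists>R. \<forall>j. sets (R j) = sets borel \<and> distr (R j) borel fst = M1 \<and> distr (R j) borel snd = M2 \<and>
    (AE z in R j. dist (p (fst z)) (q (snd z)) < 1 / real (Suc j))" by (intro choice allI)
  then obtain R where SR: "\<And>j. sets (R j) = sets borel" and R1: "\<And>j. distr (R j) borel fst = M1"
    and R2: "\<And>j. distr (R j) borel snd = M2"
    and AE: "\<And>j. AE z in R j. dist (p (fst z)) (q (snd z)) < 1 / real (Suc j)"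
    by auto
  note c = continuous_on_fst[OF continuous_on_id] continuous_on_snd[OF continuous_on_id]
  have tot: "emeasure (R j) UNIV = emeasure M1 UNIV" for j
    using emeasure_distr[OF cont_measurable[OF c(1) SR], of UNIV j] R1[of j] by (simp add: space_UNIV_borel[OF SR])
  have "tight_seq R"
    using tight_seq_const[OF fin(1) S(1)] tight_seq_const[OF fin(2) S(2)] SR by (intro tight_seq_prod) (simp_all add: R1 R2)
  note ti = this
  have tot': "emeasure (R j) UNIV = ennreal (measure M1 UNIV)" for j using tot M1.emeasure_eq_measure by simp
  obtain r L where r: "strict_mono r" and L: "finite_measure L" "sets L = sets borel" and w: "wconv (R \<circ> r) L"
    by (rule prokhorov_finite[of R "measure M1 UNIV", OF tot' SR ti])
  show ?thesis
  proof (rule that[OF L])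
    show "distr L borel fst = M1" "distr L borel snd = M2"
      using SR R1 R2 L fin by (auto intro!: wconv_marginal[OF w] c)
    have "AE z in L. dist (p (fst z)) (q (snd z)) = 0"
    proof (rule wconv_AE_zero[OF w _ L(2), where e="\<lambda>j. 1 / real (Suc (r j))" and C="measure M1 UNIV"])
      show "continuous_on UNIV (\<lambda>z. dist (p (fst z)) (q (snd z)))"
        by (intro continuous_intros continuous_on_compose2[OF p] continuous_on_compose2[OF q]) auto
      show "AE z in (R \<circ> r) j. \<bar>dist (p (fst z)) (q (snd z))\<bar> \<le> 1 / real (Suc (r j))" for j
        using AE[of "r j"] unfolding o_def by (rule eventually_mono) (simp del: of_nat_Suc)
      show "(\<lambda>j. 1 / real (Suc (r j))) \<longlonglongrightarrow> 0"
        using LIMSEQ_subseq_LIMSEQ[OF LIMSEQ_inverse_real_of_nat r] by (simp add: o_def inverse_eq_divide)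
      show "emeasure ((R \<circ> r) j) (space ((R \<circ> r) j)) \<le> ennreal (measure M1 UNIV)" for j
        using tot[of "r j"] by (simp add: space_UNIV_borel[OF SR] M1.emeasure_eq_measure)
    qed (simp add: SR)
    then show "AE z in L. p (fst z) = q (snd z)" by simp
  qed
qed

text \<open>A point of \<open>K\<close> is chosen once per cell, so the approximate right inverses
  \<open>c n\<close> have countably many values and are Borel without a selection theorem.
  Compactness of \<open>K\<close> makes their image measures tight, and continuity of
  \<open>g\<close> identifies the image of the limit. Laws of points are lifted to laws of geodesics
  in this way.\<close>

theorem lifting:
  fixes g :: "'u::complete_space \<Rightarrow> 'v::{metric_space,second_countable_topology}"
  assumes K: "compact K" and g: "continuous_on UNIV g"
    and P: "finite_measure P" "sets P = sets borel" "AE y in P. y \<in> g ` K"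
  obtains Q where "finite_measure Q" "sets Q = sets borel" "AE x in Q. x \<in> K" "distr Q borel g = P"
proof (cases "K = {}")
  case True
  have "emeasure P (space P) = 0" using P(3) AE_iff_measurable[of "space P" P "\<lambda>_. False"] True by simp
  then have "P = distr (null_measure borel) borel g"
    using P(2) emeasure_space[of P] cont_measurable[OF g, of "null_measure borel"]
    by (intro measure_eqI) (simp_all add: emeasure_distr)
  moreover have "finite_measure (null_measure (borel :: 'u measure))" by (intro finite_measureI) simp
  ultimately show ?thesis
    by (intro that[of "null_measure borel"]) (auto intro!: AE_I[where N=UNIV])
next
  case False
  then obtain u0 where u0: "u0 \<in> K" by auto
  interpret P: finite_measure P by fact
  have "\<exists>c. c \<in> P \<rightarrow>\<^sub>M borel \<and> (\<forall>y. c y \<in> K) \<and> (\<forall>y\<in>g ` K. dist (g (c y)) y < 1 / real (Suc n))" for n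
  proof -
    obtain ix :: "'v \<Rightarrow> nat" where ix[measurable]: "ix \<in> borel \<rightarrow>\<^sub>M count_space UNIV"
      and ixd: "\<And>x y. ix x = ix y \<Longrightarrow> dist x y < 1 / real (Suc n)" and "\<And>K. compact K \<Longrightarrow> finite (ix ` K)"
      using cell_index[of "1 / real (Suc n)"] by (auto simp del: of_nat_Suc)
    define c where "c k = (if \<exists>u\<in>K. ix (g u) = k then SOME u. u \<in> K \<and> ix (g u) = k else u0)" for k
    have c: "c k \<in> K" "(\<exists>u\<in>K. ix (g u) = k) \<Longrightarrow> ix (g (c k)) = k" for k
      using someI_ex[of "\<lambda>u. u \<in> K \<and> ix (g u) = k"] u0 by (auto simp: c_def Bex_def)
    have "(\<lambda>y. c (ix y)) \<in> P \<rightarrow>\<^sub>M borel"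
      by (rule measurable_sets_transfer[OF _ P(2)]) (rule measurable_compose[OF ix], simp)
    moreover have "dist (g (c (ix y))) y < 1 / real (Suc n)" if "y \<in> g ` K" for y
      using that by (intro ixd c(2)) auto
    ultimately show ?thesis using c(1) by (intro exI[of _ "\<lambda>y. c (ix y)"]) blast
  qed
  then have "\<exists>c. \<forall>n. c n \<in> P \<rightarrow>\<^sub>M borel \<and> (\<forall>y. c n y \<in> K) \<and> (\<forall>y\<in>g ` K. dist (g (c n y)) y < 1 / real (Suc n))"
    by (intro choice allI)
  then obtain c where cm: "\<And>n. c n \<in> P \<rightarrow>\<^sub>M borel" and cK: "\<And>n y. c n y \<in> K"
    and cd: "\<And>n y. y \<in> g ` K \<Longrightarrow> dist (g (c n y)) y < 1 / real (Suc n)" by auto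
  define Q where "Q n = distr P borel (c n)" for n
  have SQ: "sets (Q n) = sets borel" for n by (simp add: Q_def)
  have QK: "AE x in Q n. x \<in> K" for n
    unfolding Q_def using cm cK compact_imp_closed[OF K] by (subst AE_distr_iff) auto
  have tot: "emeasure (Q n) UNIV = ennreal (measure P UNIV)" for n
    unfolding Q_def using cm by (subst emeasure_distr) (auto simp: space_UNIV_borel[OF P(2)] P.emeasure_eq_measure)
  obtain r L where r: "strict_mono r" and L: "finite_measure L" "sets L = sets borel" and w: "wconv (Q \<circ> r) L"
    by (rule prokhorov_finite[of Q "measure P UNIV", OF tot SQ tight_seq_compact[OF K QK SQ]])
  show ?thesis
  proof (rule that[OF L])
    show "AE x in L. x \<in> K"
    proof (rule wconv_AE_closed[OF w compact_imp_closed[OF K] False L(2), where C="measure P UNIV"])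
      show "AE x in (Q \<circ> r) j. x \<in> K" for j using QK[of "r j"] unfolding o_def .
    qed (use SQ tot in \<open>auto simp: space_UNIV_borel[OF SQ]\<close>)
    have 1: "wconv (\<lambda>j. distr ((Q \<circ> r) j) borel g) (distr L borel g)"
      by (rule wconv_distr[OF w g]) (use SQ L in auto)
    have gm: "g \<in> borel \<rightarrow>\<^sub>M borel" by (rule borel_measurable_continuous_onI[OF g])
    have e: "distr (Q n) borel g = distr P borel (\<lambda>y. g (c n y))" for n
      unfolding Q_def by (subst distr_distr[OF gm cm]) (simp add: o_def)
    have 2: "wconv (\<lambda>n. distr P borel (\<lambda>y. g (c n y))) (distr P borel (\<lambda>y. y))"
    proof (rule wconv_distr_tendsto[OF P(1)])
      show "AE y in P. (\<lambda>n. g (c n y)) \<longlonglongrightarrow> y"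
        using P(3)
      proof (rule eventually_mono)
        fix y assume "y \<in> g ` K"
        then have "\<And>n. dist (g (c n y)) y \<le> 1 / real (Suc n)" using cd less_imp_le by blast
        then have "\<And>n. dist (g (c n y)) y \<le> inverse (real (Suc n))" unfolding inverse_eq_divide .
        then have "(\<lambda>n. dist (g (c n y)) y) \<longlonglongrightarrow> 0"
          by (intro tendsto_sandwich[OF _ _ tendsto_const LIMSEQ_inverse_real_of_nat]) (rule always_eventually; simp)+
        then show "(\<lambda>n. g (c n y)) \<longlonglongrightarrow> y" by (subst tendsto_dist_iff)
      qed
      show "(\<lambda>y. g (c n y)) \<in> P \<rightarrow>\<^sub>M borel" for n by (rule measurable_compose[OF cm gm])
      show "(\<lambda>y. y) \<in> P \<rightarrow>\<^sub>M borel" by (rule measurable_sets_transfer[OF _ P(2)]) simp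
    qed
    have "distr P borel (\<lambda>y. y) = P" by (rule distr_id2) (simp add: P(2))
    then have "wconv ((\<lambda>n. distr (Q n) borel g) \<circ> r) P"
      using wconv_subseq[OF 2 r] unfolding e by simp
    then have 3: "wconv (\<lambda>j. distr ((Q \<circ> r) j) borel g) P" by (simp only: o_def)
    show "distr L borel g = P"
      by (rule wconv_unique[OF 1 3 sets_distr P(2) finite_measure.finite_measure_distr[OF L(1) cont_measurable[OF g L(2)]] P(1)])
  qed
qed

section \<open>Optimal plans of finite measures\<close>

text \<open>Optimality for plans of arbitrary finite mass, so that parts, sums and multiples of
  optimal plans can be treated alike. Finite cost is built in because the comparisons below cancel
  costs.\<close>

definition opt :: "('a::metric_space \<times> 'a) measure \<Rightarrow> bool" where
  "opt \<pi> \<longleftrightarrow> finite_measure \<pi> \<and> sets \<pi> = sets borel \<and> transport_cost \<pi> < \<infinity> \<and>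
    (\<forall>\<pi>'. sets \<pi>' = sets borel \<longrightarrow> distr \<pi>' borel fst = distr \<pi> borel fst \<longrightarrow>
       distr \<pi>' borel snd = distr \<pi> borel snd \<longrightarrow> transport_cost \<pi> \<le> transport_cost \<pi>')"

lemma optD:
  assumes "opt \<pi>"
  shows "finite_measure \<pi>" "sets \<pi> = sets borel" "transport_cost \<pi> < \<infinity>"
    "sets \<pi>' = sets borel \<Longrightarrow> distr \<pi>' borel fst = distr \<pi> borel fst \<Longrightarrow>
       distr \<pi>' borel snd = distr \<pi> borel snd \<Longrightarrow> transport_cost \<pi> \<le> transport_cost \<pi>'"
  using assms by (auto simp: opt_def)

lemma dist_sq_cont: "continuous_on UNIV (\<lambda>z::'a::metric_space \<times> 'a. (dist (fst z) (snd z))\<^sup>2)"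
  by (intro continuous_intros)

lemma dist_sq_meas: "(\<lambda>z::'a::metric_space \<times> 'a. ennreal ((dist (fst z) (snd z))\<^sup>2)) \<in> borel_measurable borel"
  by (rule measurable_compose[OF borel_measurable_continuous_onI[OF dist_sq_cont] measurable_ennreal])

lemma fst_snd_meas:
  assumes "sets (\<pi> :: ('a::topological_space \<times> 'b::topological_space) measure) = sets borel"
  shows "fst \<in> \<pi> \<rightarrow>\<^sub>M borel" "snd \<in> \<pi> \<rightarrow>\<^sub>M borel"
  by (intro measurable_sets_transfer[OF borel_measurable_continuous_onI assms] continuous_intros)+

lemma transport_cost_msum:
  assumes "sets M = sets borel" "sets N = sets borel"
  shows "transport_cost (msum M N) = transport_cost M + transport_cost N"
  unfolding transport_cost_def using assms
  by (intro nn_integral_msum measurable_sets_transfer[OF dist_sq_meas]) auto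

lemma transport_cost_scale:
  assumes "sets M = sets borel"
  shows "transport_cost (scale_measure c M) = c * transport_cost M"
  unfolding transport_cost_def using assms
  by (intro nn_integral_scale_measure measurable_sets_transfer[OF dist_sq_meas]) auto

lemma transport_cost_mono:
  assumes "msub N M" "sets M = sets borel"
  shows "transport_cost N \<le> transport_cost M"
  unfolding transport_cost_def using assms
  by (intro msub_nn_integral measurable_sets_transfer[OF dist_sq_meas]) auto

lemma transport_cost_distr:
  assumes "(\<lambda>u. (p u, q u)) \<in> Q \<rightarrow>\<^sub>M borel"
  shows "transport_cost (distr Q borel (\<lambda>u. (p u, q u))) = (\<integral>\<^sup>+u. ennreal ((dist (p u) (q u))\<^sup>2) \<partial>Q)"
  unfolding transport_cost_def using dist_sq_meas assms by (subst nn_integral_distr) simp_all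

lemma distr_scale_measure:
  assumes "p \<in> M \<rightarrow>\<^sub>M N"
  shows "distr (scale_measure c M) N p = scale_measure c (distr M N p)"
proof (rule measure_eqI)
  fix A assume "A \<in> sets (distr (scale_measure c M) N p)"
  moreover have "p \<in> scale_measure c M \<rightarrow>\<^sub>M N" using assms by (rule measurable_sets_transfer) simp
  ultimately show "emeasure (distr (scale_measure c M) N p) A = emeasure (scale_measure c (distr M N p)) A"
    using assms by (simp add: emeasure_distr space_scale_measure)
qed simp

lemma finite_measure_scale: "finite_measure M \<Longrightarrow> c \<noteq> \<infinity> \<Longrightarrow> finite_measure (scale_measure c M)"
  using finite_measure.emeasure_finite[of M "space M"]
  by (intro finite_measureI) (simp add: ennreal_mult_eq_top_iff space_scale_measure)

text \<open>A cheaper plan for the part, completed by the rest of \<pi>, would be cheaper than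
  \<pi>. The cost of the rest is finite and cancels.\<close>

lemma opt_msub:
  assumes o: "opt \<pi>" and s: "msub \<pi>' \<pi>"
  shows "opt \<pi>'"
proof -
  note O = optD[OF o]
  obtain \<pi>'' where c: "msub \<pi>'' \<pi>" "\<pi> = msum \<pi>' \<pi>''" by (rule msub_complement[OF O(1) s])
  have S: "sets \<pi>' = sets borel" "sets \<pi>'' = sets borel" using msub_sets[OF s] msub_sets[OF c(1)] O(2) by auto
  have fin: "transport_cost \<pi>'' < \<infinity>" using transport_cost_mono[OF c(1) O(2)] O(3) by (rule le_less_trans)
  have "transport_cost \<pi>' \<le> transport_cost \<theta>"
    if t: "sets \<theta> = sets borel" "distr \<theta> borel fst = distr \<pi>' borel fst" "distr \<theta> borel snd = distr \<pi>' borel snd" for \<theta>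
  proof -
    have "transport_cost \<pi> \<le> transport_cost (msum \<theta> \<pi>'')"
      by (rule O(4)) (use t S in \<open>simp_all add: c(2) distr_msum fst_snd_meas\<close>)
    then have "transport_cost \<pi>' + transport_cost \<pi>'' \<le> transport_cost \<theta> + transport_cost \<pi>''"
      using t S by (simp add: c(2) transport_cost_msum)
    then show ?thesis using fin ennreal_add_left_cancel_le[of "transport_cost \<pi>''"] by (auto simp: add.commute)
  qed
  moreover have "transport_cost \<pi>' < \<infinity>" using transport_cost_mono[OF s O(2)] O(3) by (rule le_less_trans)
  ultimately show ?thesis using msub_finite[OF s O(1)] S by (auto simp: opt_def)
qed

lemma opt_le_cost:
  assumes "opt \<pi>1" "finite_measure \<pi>2" "sets \<pi>2 = sets borel" "distr \<pi>2 borel fst = distr \<pi>1 borel fst"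
    "distr \<pi>2 borel snd = distr \<pi>1 borel snd" "transport_cost \<pi>2 \<le> transport_cost \<pi>1"
  shows "opt \<pi>2"
  unfolding opt_def
proof (intro conjI allI impI assms(2,3))
  show "transport_cost \<pi>2 < \<infinity>" using assms(6) optD(3)[OF assms(1)] by (rule le_less_trans)
  fix \<pi>' :: "('a \<times> 'a) measure" assume "sets \<pi>' = sets borel" "distr \<pi>' borel fst = distr \<pi>2 borel fst" "distr \<pi>' borel snd = distr \<pi>2 borel snd"
  then have "transport_cost \<pi>1 \<le> transport_cost \<pi>'" using assms(4,5) by (intro optD(4)[OF assms(1)]) auto
  with assms(6) show "transport_cost \<pi>2 \<le> transport_cost \<pi>'" by (rule order_trans)
qed

text \<open>Equal marginals are the point: half of any competitor for the sum is then a competitor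
  for \<open>\<pi>1\<close>, and both plans have the same cost.\<close>

lemma opt_msum_same:
  assumes o: "opt \<pi>1" "opt \<pi>2" and m: "distr \<pi>2 borel fst = distr \<pi>1 borel fst" "distr \<pi>2 borel snd = distr \<pi>1 borel snd"
  shows "opt (msum \<pi>1 \<pi>2)"
  unfolding opt_def
proof (intro conjI allI impI)
  note O = optD[OF o(1)] and O2 = optD[OF o(2)]
  have ce: "transport_cost \<pi>2 = transport_cost \<pi>1"
    using O(4)[OF O2(2) m] O2(4)[OF O(2) m[symmetric]] by (rule antisym[rotated])
  show "finite_measure (msum \<pi>1 \<pi>2)" using O O2 by (intro finite_measure_msum) auto
  show "sets (msum \<pi>1 \<pi>2) = sets borel" using O by simp
  show "transport_cost (msum \<pi>1 \<pi>2) < \<infinity>" using O O2 by (simp add: transport_cost_msum)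
  fix \<theta> :: "('a \<times> 'a) measure"
  assume t: "sets \<theta> = sets borel" "distr \<theta> borel fst = distr (msum \<pi>1 \<pi>2) borel fst" "distr \<theta> borel snd = distr (msum \<pi>1 \<pi>2) borel snd"
  have half: "scale_measure (1/2) (msum N N) = N" for N :: "'a measure"
  proof (rule measure_eqI)
    fix A assume "A \<in> sets (scale_measure (1/2) (msum N N))"
    then show "emeasure (scale_measure (1/2) (msum N N)) A = emeasure N A"
      by (simp add: emeasure_msum mult_2[symmetric] mult.assoc[symmetric] ennreal_divide_times ennreal_divide_self)
  qed simp
  have "transport_cost \<pi>1 \<le> transport_cost (scale_measure (1/2) \<theta>)"
    using t O O2 m by (intro O(4)) (simp_all add: distr_scale_measure distr_msum fst_snd_meas half)
  then have "2 * transport_cost \<pi>1 \<le> 2 * (1/2 * transport_cost \<theta>)"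
    using t by (intro mult_left_mono) (simp_all add: transport_cost_scale)
  also have "2 * (1/2 * transport_cost \<theta>) = transport_cost \<theta>"
    by (simp add: mult.assoc[symmetric] ennreal_times_divide ennreal_divide_self)
  finally show "transport_cost (msum \<pi>1 \<pi>2) \<le> transport_cost \<theta>"
    using O O2 ce by (simp add: transport_cost_msum mult_2)
qed

lemma opt_scale:
  assumes o: "opt \<pi>" and c: "c \<noteq> 0" "c \<noteq> \<infinity>"
  shows "opt (scale_measure c \<pi>)"
  unfolding opt_def
proof (intro conjI allI impI)
  note O = optD[OF o]
  show "finite_measure (scale_measure c \<pi>)" using O c by (intro finite_measure_scale) auto
  show "transport_cost (scale_measure c \<pi>) < \<infinity>"
    using O c by (simp add: transport_cost_scale ennreal_mult_less_top less_top)
  fix \<theta> :: "('a \<times> 'a) measure"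
  assume t: "sets \<theta> = sets borel" "distr \<theta> borel fst = distr (scale_measure c \<pi>) borel fst"
    "distr \<theta> borel snd = distr (scale_measure c \<pi>) borel snd"
  have i: "(1/c) * c = 1" "c * (1/c) = 1" using c by (simp_all add: ennreal_divide_times ennreal_times_divide ennreal_divide_self less_top)
  have "transport_cost \<pi> \<le> transport_cost (scale_measure (1/c) \<theta>)"
    using t O i by (intro O(4)) (simp_all add: distr_scale_measure fst_snd_meas scale_scale_measure)
  then have "c * transport_cost \<pi> \<le> c * ((1/c) * transport_cost \<theta>)"
    using t by (intro mult_left_mono) (simp_all add: transport_cost_scale)
  then show "transport_cost (scale_measure c \<pi>) \<le> transport_cost \<theta>"
    using O i by (simp add: transport_cost_scale mult.assoc[symmetric])
qed (use optD[OF o] in simp)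

text \<open>Direct method: a minimising sequence is tight because its marginals are fixed, and the
  cost is lower semicontinuous.\<close>

lemma opt_exists:
  fixes \<pi>0 :: "('a::{complete_space,second_countable_topology} \<times> 'a) measure"
  assumes "finite_measure \<pi>0" "sets \<pi>0 = sets borel" "transport_cost \<pi>0 < \<infinity>"
  obtains \<pi> where "opt \<pi>" "distr \<pi> borel fst = distr \<pi>0 borel fst" "distr \<pi> borel snd = distr \<pi>0 borel snd"
proof -
  interpret finite_measure \<pi>0 by fact
  define Pl where "Pl = {\<pi>. sets \<pi> = sets borel \<and> distr \<pi> borel fst = distr \<pi>0 borel fst \<and> distr \<pi> borel snd = distr \<pi>0 borel snd}"
  have "\<pi>0 \<in> Pl" using assms by (simp add: Pl_def)
  then have "transport_cost ` Pl \<noteq> {}" by auto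
  then obtain f :: "nat \<Rightarrow> ennreal" where f: "decseq f" "range f \<subseteq> transport_cost ` Pl" "Inf (transport_cost ` Pl) = (INF i. f i)"
    using ennreal_Inf_countable_INF by metis
  have "\<forall>j. \<exists>\<pi>. \<pi> \<in> Pl \<and> f j = transport_cost \<pi>" using f(2) by auto
  then obtain M where M: "\<And>j. M j \<in> Pl" "\<And>j. f j = transport_cost (M j)" by metis
  have MS: "sets (M j) = sets borel" and M1: "distr (M j) borel fst = distr \<pi>0 borel fst"
    and M2: "distr (M j) borel snd = distr \<pi>0 borel snd" for j using M(1)[of j] by (auto simp: Pl_def)
  have fin: "finite_measure (distr \<pi>0 borel fst)" "finite_measure (distr \<pi>0 borel snd)"
    using fst_snd_meas[OF assms(2)] by (auto intro: finite_measure_distr)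
  have "tight_seq M"
    by (rule tight_seq_prod) (simp_all add: M1 M2 MS tight_seq_const[OF fin(1)] tight_seq_const[OF fin(2)])
  note ti = this
  have tot: "emeasure (M j) UNIV = ennreal (measure \<pi>0 UNIV)" for j
    using emeasure_distr[OF fst_snd_meas(1)[OF MS], of UNIV j] emeasure_distr[OF fst_snd_meas(1)[OF assms(2)], of UNIV]
    by (simp add: M1 space_UNIV_borel[OF MS] space_UNIV_borel[OF assms(2)] emeasure_eq_measure)
  obtain r L where r: "strict_mono r" and L: "finite_measure L" "sets L = sets borel" and w: "wconv (M \<circ> r) L"
    by (rule prokhorov_finite[of M "measure \<pi>0 UNIV", OF tot MS ti])
  have Lm: "distr L borel fst = distr \<pi>0 borel fst" "distr L borel snd = distr \<pi>0 borel snd"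
    using MS M1 M2 L fin by (auto intro!: wconv_marginal[OF w] continuous_intros)
  have "transport_cost L \<le> (INF i. f i)"
    unfolding transport_cost_def
  proof (rule wconv_nn_integral_le[OF w dist_sq_cont _ L(2)])
    show "(f \<circ> r) \<longlonglongrightarrow> (INF i. f i)" using LIMSEQ_INF[OF f(1)] r by (rule LIMSEQ_subseq_LIMSEQ)
  qed (use M(2) MS in \<open>auto simp: transport_cost_def\<close>)
  then have le: "transport_cost L \<le> transport_cost \<pi>" if "\<pi> \<in> Pl" for \<pi>
    unfolding f(3)[symmetric] using that by (auto intro: order_trans INF_lower)
  have "opt L"
    unfolding opt_def using L Lm le le_less_trans[OF le[OF \<open>\<pi>0 \<in> Pl\<close>] assms(3)] by (auto simp: Pl_def)
  then show ?thesis using Lm by (rule that)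
qed

lemma opt_W2:
  assumes "opt \<pi>" "prob_space \<pi>"
  shows "W2 (distr \<pi> borel fst) (distr \<pi> borel snd) = ennreal (sqrt (enn2real (transport_cost \<pi>)))"
proof -
  note O = optD[OF assms(1)]
  have "\<pi> \<in> plans (distr \<pi> borel fst) (distr \<pi> borel snd)"
    using O assms(2) by (simp add: plans_def Prob_def)
  then have "(INF \<pi>'\<in>plans (distr \<pi> borel fst) (distr \<pi> borel snd). transport_cost \<pi>') = transport_cost \<pi>"
    by (intro antisym INF_lower INF_greatest) (auto simp: plans_def Prob_def intro!: O(4))
  then show ?thesis using O(3) by (simp add: W2_def Let_def)
qed

section \<open>Optimality of intermediate pieces\<close>

text \<open>Cauchy-Schwarz with weights: add up
  \<open>u\<^sup>2 / a \<ge> 2 * u * r - r\<^sup>2 * a\<close> for the three terms, with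
  \<open>r\<close> the sum \<open>x + y + z\<close>. Division by zero gives zero, so a vanishing
  weight is harmless when its numerator vanishes as well.\<close>

lemma weighted_three_squares:
  fixes x y z \<alpha> \<beta> \<delta> :: real
  assumes w: "0 \<le> \<alpha>" "0 < \<beta>" "0 \<le> \<delta>" "\<alpha> + \<beta> + \<delta> = 1" and 0: "\<alpha> = 0 \<Longrightarrow> x = 0" "\<delta> = 0 \<Longrightarrow> z = 0"
  shows "(x + y + z)\<^sup>2 \<le> x\<^sup>2 / \<alpha> + y\<^sup>2 / \<beta> + z\<^sup>2 / \<delta>"
proof -
  have sq: "2 * u * s - s\<^sup>2 * a \<le> u\<^sup>2 / a" if "0 \<le> a" "a = 0 \<Longrightarrow> u = 0" for u a s :: real
  proof (cases "a = 0")
    case False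
    then have "0 \<le> (u - s * a)\<^sup>2 / a" using that by simp
    also have "(u - s * a)\<^sup>2 / a = u\<^sup>2 / a - (2 * u * s - s\<^sup>2 * a)"
      using False by (simp add: field_simps power2_eq_square)
    finally show ?thesis by simp
  qed (use that in simp)
  let ?s = "x + y + z"
  have "2 * x * ?s - ?s\<^sup>2 * \<alpha> + (2 * y * ?s - ?s\<^sup>2 * \<beta>) + (2 * z * ?s - ?s\<^sup>2 * \<delta>) \<le> x\<^sup>2 / \<alpha> + y\<^sup>2 / \<beta> + z\<^sup>2 / \<delta>"
    using assms by (intro add_mono sq) auto
  moreover have "2 * x * ?s - ?s\<^sup>2 * \<alpha> + (2 * y * ?s - ?s\<^sup>2 * \<beta>) + (2 * z * ?s - ?s\<^sup>2 * \<delta>)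
    = 2 * ?s * ?s - ?s\<^sup>2 * (\<alpha> + \<beta> + \<delta>)" by (simp add: algebra_simps)
  moreover have "2 * ?s * ?s - ?s\<^sup>2 * (\<alpha> + \<beta> + \<delta>) = ?s\<^sup>2" unfolding w(4) by (simp add: power2_eq_square)
  ultimately show ?thesis by linarith
qed

lemma distr_compose:
  assumes "f \<in> M \<rightarrow>\<^sub>M N" "g \<in> N \<rightarrow>\<^sub>M L"
  shows "distr (distr M N f) L g = distr M L (\<lambda>x. g (f x))"
  using distr_distr[OF assms(2,1)] by (simp add: o_def)

lemma pair_borel_measurable:
  fixes p :: "'u \<Rightarrow> 'a::second_countable_topology" and q :: "'u \<Rightarrow> 'b::second_countable_topology"
  assumes "p \<in> Q \<rightarrow>\<^sub>M borel" "q \<in> Q \<rightarrow>\<^sub>M borel"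
  shows "(\<lambda>u. (p u, q u)) \<in> Q \<rightarrow>\<^sub>M borel"
  using measurable_Pair[OF assms] unfolding borel_prod .

lemma distr_pair_marginals:
  fixes p :: "'u \<Rightarrow> 'a::second_countable_topology" and q :: "'u \<Rightarrow> 'b::second_countable_topology"
  assumes "p \<in> Q \<rightarrow>\<^sub>M borel" "q \<in> Q \<rightarrow>\<^sub>M borel"
  shows "distr (distr Q borel (\<lambda>u. (p u, q u))) borel fst = distr Q borel p"
    "distr (distr Q borel (\<lambda>u. (p u, q u))) borel snd = distr Q borel q"
  using distr_compose[OF pair_borel_measurable[OF assms] fst_snd_meas(1)[OF refl]]
    distr_compose[OF pair_borel_measurable[OF assms] fst_snd_meas(2)[OF refl]] by simp_all

text \<open>Any competitor for the middle piece can be glued to the two outer pieces.\<close>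

lemma opt_middle:
  fixes p q r w :: "'u \<Rightarrow> 'a::{complete_space,second_countable_topology}"
  assumes Q: "finite_measure Q" and m: "p \<in> Q \<rightarrow>\<^sub>M borel" "q \<in> Q \<rightarrow>\<^sub>M borel" "r \<in> Q \<rightarrow>\<^sub>M borel" "w \<in> Q \<rightarrow>\<^sub>M borel"
    and wt: "0 \<le> \<alpha>" "0 < \<beta>" "0 \<le> \<delta>" "\<alpha> + \<beta> + \<delta> = 1"
    and ch: "AE u in Q. dist (p u) (q u) = \<alpha> * dist (p u) (w u)" "AE u in Q. dist (q u) (r u) = \<beta> * dist (p u) (w u)"
      "AE u in Q. dist (r u) (w u) = \<delta> * dist (p u) (w u)"
    and o: "opt (distr Q borel (\<lambda>u. (p u, w u)))"
  shows "opt (distr Q borel (\<lambda>u. (q u, r u)))"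
    "transport_cost (distr Q borel (\<lambda>u. (q u, r u))) = ennreal (\<beta>\<^sup>2) * transport_cost (distr Q borel (\<lambda>u. (p u, w u)))"
proof -
  interpret finite_measure Q by fact
  note pb = pair_borel_measurable
  define C where "C = transport_cost (distr Q borel (\<lambda>u. (p u, w u)))"
  have Cfin: "C < \<infinity>" unfolding C_def by (rule optD(3)[OF o])
  have Ci: "C = (\<integral>\<^sup>+u. ennreal ((dist (p u) (w u))\<^sup>2) \<partial>Q)"
    unfolding C_def by (rule transport_cost_distr[OF pb[OF m(1,4)]])
  have dm: "(\<lambda>u. ennreal ((dist (a u) (b u))\<^sup>2)) \<in> borel_measurable Q"
    if "a \<in> Q \<rightarrow>\<^sub>M borel" "b \<in> Q \<rightarrow>\<^sub>M borel" for a b :: "'u \<Rightarrow> 'a"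
    using measurable_compose[OF pb[OF that] dist_sq_meas] by simp
  have part: "(\<integral>\<^sup>+u. ennreal ((dist (a u) (b u))\<^sup>2) \<partial>Q) = ennreal (\<beta>'\<^sup>2) * C"
    if "AE u in Q. dist (a u) (b u) = \<beta>' * dist (p u) (w u)" for a b :: "'u \<Rightarrow> 'a" and \<beta>'
  proof -
    have "(\<integral>\<^sup>+u. ennreal ((dist (a u) (b u))\<^sup>2) \<partial>Q) = (\<integral>\<^sup>+u. ennreal (\<beta>'\<^sup>2) * ennreal ((dist (p u) (w u))\<^sup>2) \<partial>Q)"
      using that by (intro nn_integral_cong_AE, elim eventually_mono) (simp add: power_mult_distrib ennreal_mult)
    then show ?thesis using dm[OF m(1,4)] by (simp add: nn_integral_cmult Ci)
  qed
  show cost: "transport_cost (distr Q borel (\<lambda>u. (q u, r u))) = ennreal (\<beta>\<^sup>2) * C"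
    using transport_cost_distr[OF pb[OF m(2,3)]] part[OF ch(2)] by simp
  show "opt (distr Q borel (\<lambda>u. (q u, r u)))"
    unfolding opt_def
  proof (intro conjI allI impI)
    show "finite_measure (distr Q borel (\<lambda>u. (q u, r u)))" using pb[OF m(2,3)] by (rule finite_measure_distr)
    show "transport_cost (distr Q borel (\<lambda>u. (q u, r u))) < \<infinity>"
      unfolding cost using Cfin by (simp add: ennreal_mult_less_top)
    fix \<theta> :: "('a \<times> 'a) measure"
    assume t: "sets \<theta> = sets borel" "distr \<theta> borel fst = distr (distr Q borel (\<lambda>u. (q u, r u))) borel fst"
      "distr \<theta> borel snd = distr (distr Q borel (\<lambda>u. (q u, r u))) borel snd"
    have t1: "distr \<theta> borel fst = distr Q borel q" "distr \<theta> borel snd = distr Q borel r"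
      using t distr_pair_marginals[OF m(2,3)] by auto
    have f\<theta>: "finite_measure \<theta>"
    proof (rule finite_measureI)
      have "emeasure \<theta> (space \<theta>) = emeasure (distr \<theta> borel fst) UNIV"
        using fst_snd_meas(1)[OF t(1)] by (simp add: emeasure_distr)
      then show "emeasure \<theta> (space \<theta>) \<noteq> \<infinity>" using m(2) by (simp add: t1 emeasure_distr)
    qed
    define Q1 where "Q1 = distr Q borel (\<lambda>u. (p u, q u))"
    define Q2 where "Q2 = distr Q borel (\<lambda>u. (r u, w u))"
    have Q1: "finite_measure Q1" "sets Q1 = sets borel" and Q2: "finite_measure Q2" "sets Q2 = sets borel"
      unfolding Q1_def Q2_def using pb[OF m(1,2)] pb[OF m(3,4)] by (auto intro: finite_measure_distr)
    have Q1m: "distr Q1 borel fst = distr Q borel p" "distr Q1 borel snd = distr Q borel q"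
      and Q2m: "distr Q2 borel fst = distr Q borel r" "distr Q2 borel snd = distr Q borel w"
      unfolding Q1_def Q2_def using distr_pair_marginals[OF m(1,2)] distr_pair_marginals[OF m(3,4)] by auto
    \<comment> \<open>\<open>R\<close> puts the first leg in front of the competitor \<theta>, and
      \<open>G\<close> below appends the last leg. The result is a plan between the outer marginals,
      hence at least as expensive as the given optimal one.\<close>
    obtain R where R: "finite_measure R" "sets R = sets borel" "distr R borel fst = Q1" "distr R borel snd = \<theta>"
      "AE z in R. snd (fst z) = fst (snd z)"
      by (rule gluing[OF Q1(1) f\<theta> Q1(2) t(1), of snd fst]) (auto intro: continuous_intros simp: Q1m t1)
    have "distr R borel (\<lambda>z. snd (snd z)) = distr (distr R borel snd) borel snd"
      using fst_snd_meas[OF R(2)] by (subst distr_compose) (auto intro: fst_snd_meas)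
    then have Rr: "distr R borel (\<lambda>z. snd (snd z)) = distr Q borel r" by (simp add: R(4) t1)
    obtain G where G: "finite_measure G" "sets G = sets borel" "distr G borel fst = R" "distr G borel snd = Q2"
      "AE z in G. snd (snd (fst z)) = fst (snd z)"
      by (rule gluing[OF R(1) Q2(1) R(2) Q2(2), of "\<lambda>z. snd (snd z)" fst]) (auto intro!: continuous_intros simp: Rr Q2m)
    have gm: "f \<in> G \<rightarrow>\<^sub>M borel" if "continuous_on UNIV f" for f :: "_ \<Rightarrow> 'a"
      using that G(2) by (rule cont_measurable)
    have gm2: "f \<in> G \<rightarrow>\<^sub>M borel" if "continuous_on UNIV f" for f :: "_ \<Rightarrow> 'a \<times> 'a"
      using that G(2) by (rule cont_measurable)
    have G1: "distr G borel (\<lambda>z. fst (fst z)) = Q1"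
      using fst_snd_meas[OF G(2)] distr_compose[of fst G borel fst borel] R(3) G(3) by (simp add: fst_snd_meas)
    have G2: "distr G borel (\<lambda>z. snd (fst z)) = \<theta>"
      using fst_snd_meas[OF G(2)] distr_compose[of fst G borel snd borel] R(4) G(3) by (simp add: fst_snd_meas)
    have pm: "distr G borel (\<lambda>z. fst (fst (fst z))) = distr Q borel p"
      using distr_compose[OF gm2[of "\<lambda>z. fst (fst z)"], of fst borel] by (simp add: G1 Q1m fst_snd_meas continuous_intros)
    have wm: "distr G borel (\<lambda>z. snd (snd z)) = distr Q borel w"
      using distr_compose[OF gm2[of snd], of snd borel] by (simp add: G(4) Q2m fst_snd_meas continuous_intros)
    have c: "C \<le> transport_cost (distr G borel (\<lambda>z. (fst (fst (fst z)), snd (snd z))))"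
      unfolding C_def
    proof (rule optD(4)[OF o])
      have a: "(\<lambda>z. fst (fst (fst z))) \<in> G \<rightarrow>\<^sub>M borel" "(\<lambda>z. snd (snd z)) \<in> G \<rightarrow>\<^sub>M borel"
        by (intro gm continuous_intros)+
      show "distr (distr G borel (\<lambda>z. (fst (fst (fst z)), snd (snd z)))) borel fst = distr (distr Q borel (\<lambda>u. (p u, w u))) borel fst"
        "distr (distr G borel (\<lambda>z. (fst (fst (fst z)), snd (snd z)))) borel snd = distr (distr Q borel (\<lambda>u. (p u, w u))) borel snd"
        using distr_pair_marginals[OF a] distr_pair_marginals[OF m(1,4)] pm wm by auto
    qed simp
    \<comment> \<open>A vanishing weight has to come with a leg of length zero before
      \<open>weighted_three_squares\<close> applies.\<close>
    have z1: "AE z in G. \<alpha> = 0 \<longrightarrow> fst (fst (fst z)) = snd (fst (fst z))"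
    proof (cases "\<alpha> = 0")
      case True
      have "AE y in Q1. fst y = snd y"
        unfolding Q1_def using ch(1) True pb[OF m(1,2)]
        by (subst AE_distr_iff) (auto intro!: borel_closed closed_Collect_eq continuous_intros)
      then have "AE z in G. fst (fst (fst z)) = snd (fst (fst z))"
        unfolding G1[symmetric] by (rule AE_distr_vimage[rotated]) (intro gm2 continuous_intros)
      then show ?thesis by simp
    qed simp
    have z2: "AE z in G. \<delta> = 0 \<longrightarrow> fst (snd z) = snd (snd z)"
    proof (cases "\<delta> = 0")
      case True
      have "AE y in Q2. fst y = snd y"
        unfolding Q2_def using ch(3) True pb[OF m(3,4)]
        by (subst AE_distr_iff) (auto intro!: borel_closed closed_Collect_eq continuous_intros)
      then have "AE z in G. fst (snd z) = snd (snd z)"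
        unfolding G(4)[symmetric] by (rule AE_distr_vimage[rotated]) (intro gm2 continuous_intros)
      then show ?thesis by simp
    qed simp
    have z3: "AE z in G. snd (fst (fst z)) = fst (snd (fst z))"
      using R(5) unfolding G(3)[symmetric] by (rule AE_distr_vimage[rotated]) (rule fst_snd_meas[OF G(2)])
    let ?d = "\<lambda>a b. (dist a b)\<^sup>2 :: real"
    have sq: "(\<lambda>z. ennreal (?d (f z) (g z))) \<in> borel_measurable G" if "continuous_on UNIV f" "continuous_on UNIV g" for f g :: "_ \<Rightarrow> 'a"
      using measurable_compose[OF pb[OF gm[OF that(1)] gm[OF that(2)]] dist_sq_meas] by simp
    have "transport_cost (distr G borel (\<lambda>z. (fst (fst (fst z)), snd (snd z))))
      = (\<integral>\<^sup>+z. ennreal (?d (fst (fst (fst z))) (snd (snd z))) \<partial>G)"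
      by (intro transport_cost_distr gm2 continuous_intros)
    also have "\<dots> \<le> (\<integral>\<^sup>+z. ennreal (1/\<alpha>) * ennreal (?d (fst (fst (fst z))) (snd (fst (fst z))))
       + ennreal (1/\<beta>) * ennreal (?d (fst (snd (fst z))) (snd (snd (fst z))))
       + ennreal (1/\<delta>) * ennreal (?d (fst (snd z)) (snd (snd z))) \<partial>G)"
      using z1 z2 z3 G(5)
    proof (intro nn_integral_mono_AE, elim eventually_rev_mp, intro always_eventually allI impI)
      fix z :: "(('a \<times> 'a) \<times> ('a \<times> 'a)) \<times> ('a \<times> 'a)"
      obtain x1 x2 y1 y2 v1 v2 where z: "z = (((x1, x2), (y1, y2)), (v1, v2))" by (metis prod.exhaust)
      assume "\<alpha> = 0 \<longrightarrow> fst (fst (fst z)) = snd (fst (fst z))" "\<delta> = 0 \<longrightarrow> fst (snd z) = snd (snd z)"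
        "snd (fst (fst z)) = fst (snd (fst z))" "snd (snd (fst z)) = fst (snd z)"
      then have e: "\<alpha> = 0 \<Longrightarrow> x1 = x2" "\<delta> = 0 \<Longrightarrow> v1 = v2" "x2 = y1" "y2 = v1" by (auto simp: z)
      have "dist x1 v2 \<le> dist x1 x2 + dist y1 y2 + dist v1 v2"
        using dist_triangle[of x1 v2 x2] dist_triangle[of x2 v2 v1] e(3,4) by simp
      then have "?d x1 v2 \<le> (dist x1 x2 + dist y1 y2 + dist v1 v2)\<^sup>2" by (rule power_mono) simp
      also have "\<dots> \<le> ?d x1 x2 / \<alpha> + ?d y1 y2 / \<beta> + ?d v1 v2 / \<delta>"
        using wt e by (intro weighted_three_squares) auto
      finally have "ennreal (?d x1 v2) \<le> ennreal (1/\<alpha> * ?d x1 x2 + 1/\<beta> * ?d y1 y2 + 1/\<delta> * ?d v1 v2)"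
        by (intro ennreal_leI) simp
      also have "\<dots> = ennreal (1/\<alpha>) * ennreal (?d x1 x2) + ennreal (1/\<beta>) * ennreal (?d y1 y2) + ennreal (1/\<delta>) * ennreal (?d v1 v2)"
        using wt by (simp add: ennreal_mult'[symmetric] ennreal_plus[symmetric] del: ennreal_plus)
      finally show "ennreal (?d (fst (fst (fst z))) (snd (snd z))) \<le> ennreal (1/\<alpha>) * ennreal (?d (fst (fst (fst z))) (snd (fst (fst z))))
       + ennreal (1/\<beta>) * ennreal (?d (fst (snd (fst z))) (snd (snd (fst z)))) + ennreal (1/\<delta>) * ennreal (?d (fst (snd z)) (snd (snd z)))"
        by (simp add: z)
    qed
    also have "\<dots> = ennreal (1/\<alpha>) * (\<integral>\<^sup>+z. ennreal (?d (fst (fst (fst z))) (snd (fst (fst z)))) \<partial>G)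
       + ennreal (1/\<beta>) * (\<integral>\<^sup>+z. ennreal (?d (fst (snd (fst z))) (snd (snd (fst z)))) \<partial>G)
       + ennreal (1/\<delta>) * (\<integral>\<^sup>+z. ennreal (?d (fst (snd z)) (snd (snd z))) \<partial>G)"
    proof -
      have "(\<lambda>z. ennreal (?d (fst (fst (fst z))) (snd (fst (fst z))))) \<in> borel_measurable G"
        "(\<lambda>z. ennreal (?d (fst (snd (fst z))) (snd (snd (fst z))))) \<in> borel_measurable G"
        "(\<lambda>z. ennreal (?d (fst (snd z)) (snd (snd z)))) \<in> borel_measurable G"
        by (intro sq continuous_intros)+
      then show ?thesis by (simp add: nn_integral_add nn_integral_cmult)
    qed
    also have "(\<integral>\<^sup>+z. ennreal (?d (fst (fst (fst z))) (snd (fst (fst z)))) \<partial>G) = transport_cost Q1"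
      unfolding transport_cost_def G1[symmetric] by (subst nn_integral_distr[OF gm2 measurable_sets_transfer[OF dist_sq_meas]]) (auto intro!: continuous_intros)
    also have "transport_cost Q1 = ennreal (\<alpha>\<^sup>2) * C"
      unfolding Q1_def using transport_cost_distr[OF pb[OF m(1,2)]] part[OF ch(1)] by simp
    also have "(\<integral>\<^sup>+z. ennreal (?d (fst (snd z)) (snd (snd z))) \<partial>G) = transport_cost Q2"
      unfolding transport_cost_def G(4)[symmetric] by (subst nn_integral_distr[OF gm2 measurable_sets_transfer[OF dist_sq_meas]]) (auto intro!: continuous_intros)
    also have "transport_cost Q2 = ennreal (\<delta>\<^sup>2) * C"
      unfolding Q2_def using transport_cost_distr[OF pb[OF m(3,4)]] part[OF ch(3)] by simp
    also have "(\<integral>\<^sup>+z. ennreal (?d (fst (snd (fst z))) (snd (snd (fst z)))) \<partial>G) = transport_cost \<theta>"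
      unfolding transport_cost_def G2[symmetric] by (subst nn_integral_distr[OF gm2 measurable_sets_transfer[OF dist_sq_meas]]) (auto intro!: continuous_intros)
    \<comment> \<open>The right-hand side is \<open>\<alpha> * C\<close> plus the cost of \<theta>
      divided by \<beta> plus \<open>\<delta> * C\<close>. As the weights add up to one, the cost of
      \<theta> is at least \<open>\<beta>\<^sup>2 * C\<close>, the cost of the middle piece.\<close>
    finally have main: "C \<le> ennreal (1/\<alpha>) * (ennreal (\<alpha>\<^sup>2) * C) + ennreal (1/\<beta>) * transport_cost \<theta> + ennreal (1/\<delta>) * (ennreal (\<delta>\<^sup>2) * C)"
      using c by (rule order_trans[rotated])
    have ab: "ennreal (1/a) * (ennreal (a\<^sup>2) * C) = ennreal a * C" if "0 \<le> a" for a
      using that by (cases "a = 0") (auto simp: mult.assoc[symmetric] ennreal_mult[symmetric] power2_eq_square)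
    show "transport_cost (distr Q borel (\<lambda>u. (q u, r u))) \<le> transport_cost \<theta>"
    proof (cases "transport_cost \<theta>" rule: ennreal_cases)
      case (real \<tau>)
      obtain c where c: "C = ennreal c" "0 \<le> c" using Cfin by (cases C rule: ennreal_cases) auto
      have "ennreal c \<le> ennreal \<alpha> * ennreal c + ennreal (1/\<beta>) * ennreal \<tau> + ennreal \<delta> * ennreal c"
        using main unfolding ab[OF wt(1)] ab[OF wt(3)] unfolding c(1) real(2) .
      also have "\<dots> = ennreal (\<alpha> * c + 1/\<beta> * \<tau> + \<delta> * c)"
        using wt real c(2) by (simp add: ennreal_mult'[symmetric] ennreal_plus[symmetric] del: ennreal_plus)
      finally have "ennreal c \<le> ennreal (\<alpha> * c + 1/\<beta> * \<tau> + \<delta> * c)" .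
      then have "c \<le> \<alpha> * c + 1/\<beta> * \<tau> + \<delta> * c" using wt c real by (subst (asm) ennreal_le_iff) auto
      moreover have "\<alpha> * c + \<beta> * c + \<delta> * c = c" using wt(4) by (metis distrib_right mult_1)
      ultimately have "\<beta> * c \<le> 1/\<beta> * \<tau>" by linarith
      then have "\<beta> * (\<beta> * c) \<le> \<beta> * (1/\<beta> * \<tau>)" using wt(2) by (intro mult_left_mono) auto
      then have "\<beta>\<^sup>2 * c \<le> \<tau>" using wt(2) by (simp add: power2_eq_square mult.assoc)
      then show ?thesis using real c(2) unfolding cost c(1) by (simp add: ennreal_mult[symmetric])
    qed simp
  qed simp
qed

section \<open>Geodesics\<close>

lemma eval_cont: "continuous_on UNIV (\<lambda>\<gamma>::real \<Rightarrow>\<^sub>C 'a::metric_space. apply_bcontfun \<gamma> t)"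
  unfolding continuous_on_iff
proof (intro ballI allI impI)
  fix \<gamma> :: "real \<Rightarrow>\<^sub>C 'a" and e :: real assume "e > 0"
  then show "\<exists>d>0. \<forall>\<gamma>'\<in>UNIV. dist \<gamma>' \<gamma> < d \<longrightarrow> dist (apply_bcontfun \<gamma>' t) (apply_bcontfun \<gamma> t) < e"
    using dist_bounded le_less_trans by (intro exI[of _ e]) blast
qed

lemma eval_cont':
  assumes "continuous_on UNIV f"
  shows "continuous_on UNIV (\<lambda>x. apply_bcontfun (f x :: real \<Rightarrow>\<^sub>C 'a::metric_space) t)"
  using continuous_on_compose2[OF eval_cont assms] by simp

lemma closed_Geo: "closed (Geo :: (real \<Rightarrow>\<^sub>C 'a::metric_space) set)"
proof -
  have eq: "(Geo :: (real \<Rightarrow>\<^sub>C 'a) set) =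
    (\<Inter>s\<in>{0..1}. \<Inter>t\<in>{0..1}. {\<gamma>. dist (apply_bcontfun \<gamma> t) (apply_bcontfun \<gamma> s)
        = \<bar>t - s\<bar> * dist (apply_bcontfun \<gamma> 0) (apply_bcontfun \<gamma> 1)}) \<inter>
    (\<Inter>t\<in>{..0}. {\<gamma>. apply_bcontfun \<gamma> t = apply_bcontfun \<gamma> 0}) \<inter> (\<Inter>t\<in>{1..}. {\<gamma>. apply_bcontfun \<gamma> t = apply_bcontfun \<gamma> 1})"
    by (auto simp: Geo_def)
  show ?thesis
    unfolding eq by (intro closed_Int closed_INT ballI closed_Collect_eq continuous_intros eval_cont)
qed

lemma GeoD:
  assumes "\<gamma> \<in> Geo"
  shows "s \<in> {0..1} \<Longrightarrow> t \<in> {0..1} \<Longrightarrow> dist (apply_bcontfun \<gamma> t) (apply_bcontfun \<gamma> s)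
        = \<bar>t - s\<bar> * dist (apply_bcontfun \<gamma> 0) (apply_bcontfun \<gamma> 1)"
    "t \<le> 0 \<Longrightarrow> apply_bcontfun \<gamma> t = apply_bcontfun \<gamma> 0" "t \<ge> 1 \<Longrightarrow> apply_bcontfun \<gamma> t = apply_bcontfun \<gamma> 1"
  using assms unfolding Geo_def by blast+

definition clamp01 :: "real \<Rightarrow> real" where "clamp01 t = max 0 (min 1 t)"

lemma clamp01: "clamp01 t \<in> {0..1}" "t \<in> {0..1} \<Longrightarrow> clamp01 t = t" "\<bar>clamp01 t - clamp01 s\<bar> \<le> \<bar>t - s\<bar>"
  by (auto simp: clamp01_def max_def min_def)

lemma Geo_clamp: "\<gamma> \<in> Geo \<Longrightarrow> apply_bcontfun \<gamma> t = apply_bcontfun \<gamma> (clamp01 t)"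
  using GeoD(2)[of \<gamma> t] GeoD(3)[of \<gamma> t] by (auto simp: clamp01_def max_def min_def)

text \<open>A geodesic never leaves the ball around its starting point whose radius is its length,
  here at most \<open>2 * \<rho>\<close>.\<close>

lemma Geo_range:
  assumes "\<gamma> \<in> Geo" "apply_bcontfun \<gamma> 0 \<in> cball a \<rho>" "apply_bcontfun \<gamma> 1 \<in> cball a \<rho>"
  shows "apply_bcontfun \<gamma> t \<in> cball a (3 * \<rho>)"
proof -
  let ?g = "apply_bcontfun \<gamma>"
  have "dist (?g (clamp01 t)) (?g 0) = \<bar>clamp01 t - 0\<bar> * dist (?g 0) (?g 1)"
    using assms(1) clamp01(1) by (intro GeoD(1)) auto
  also have "\<dots> \<le> 1 * dist (?g 0) (?g 1)"
    using clamp01(1)[of t] by (intro mult_right_mono) auto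
  finally have "dist (?g t) (?g 0) \<le> dist (?g 0) (?g 1)" using Geo_clamp[OF assms(1), of t] by simp
  moreover have "dist (?g 0) (?g 1) \<le> 2 * \<rho>" using assms(2,3) dist_triangle3[of "?g 0" "?g 1" a] by simp
  ultimately show ?thesis using assms(2) dist_triangle[of a "?g t" "?g 0"] by (simp add: dist_commute)
qed

text \<open>Arzela-Ascoli for curves of bounded speed. Between neighbouring grid times a geodesic in
  \<open>W\<close> moves less than \<open>e / 8\<close>, so it is determined up to
  \<open>e / 2\<close> by the points of a finite net of mesh \<open>e / 8\<close> that are near its
  positions at the grid times.\<close>

lemma compact_Geo:
  fixes W :: "'a::complete_space set"
  assumes W: "compact W"
  shows "compact {\<gamma>\<in>Geo. \<forall>t. apply_bcontfun \<gamma> t \<in> W}" (is "compact ?G")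
proof -
  have eq: "?G = Geo \<inter> (\<Inter>t. (\<lambda>\<gamma>. apply_bcontfun \<gamma> t) -` W)" by auto
  have "closed ?G"
    unfolding eq using compact_imp_closed[OF W] by (intro closed_Int closed_Geo closed_INT ballI closed_vimage eval_cont)
  then have "Topological_Spaces.complete ?G" by (simp add: complete_eq_closed)
  moreover have "\<exists>k. finite k \<and> ?G \<subseteq> (\<Union>\<gamma>\<in>k. ball \<gamma> e)" if "e > 0" for e
  proof -
    obtain D where D: "\<And>x y. x \<in> W \<Longrightarrow> y \<in> W \<Longrightarrow> dist x y \<le> D"
      using compact_imp_bounded[OF W] unfolding bounded_two_points by blast
    define D' where "D' = max D 1"
    have D': "D' > 0" "\<And>x y. x \<in> W \<Longrightarrow> y \<in> W \<Longrightarrow> dist x y \<le> D'" using D by (auto simp: D'_def intro: le_max_iff_disj[THEN iffD2])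
    obtain N where N: "1 / real (Suc N) < e / (8 * D')" using nat_approx_posE[of "e / (8 * D')"] D' \<open>e > 0\<close> by auto
    define M where "M = real (Suc N)"
    have M: "M > 0" "D' / M < e / 8" using N D' by (auto simp: M_def field_simps)
    have "\<exists>F. finite F \<and> W \<subseteq> (\<Union>z\<in>F. ball z (e/8))"
      using W \<open>e > 0\<close> by (subst (asm) compact_eq_totally_bounded) simp
    then obtain F where F: "finite F" "W \<subseteq> (\<Union>z\<in>F. ball z (e/8))" by auto
    define near where "near x = (SOME z. z \<in> F \<and> dist z x < e/8)" for x
    have near: "near x \<in> F" "dist (near x) x < e/8" if "x \<in> W" for x
    proof -
      have "x \<in> (\<Union>z\<in>F. ball z (e/8))" using F(2) that by (rule subsetD)
      then have "\<exists>z. z \<in> F \<and> dist z x < e/8" by auto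
      then show "near x \<in> F" "dist (near x) x < e/8" unfolding near_def by (metis (mono_tags, lifting) someI_ex)+
    qed
    define sg where "sg \<gamma> = (\<lambda>k\<in>{..Suc N}. near (apply_bcontfun \<gamma> (real k / M)))" for \<gamma> :: "real \<Rightarrow>\<^sub>C 'a"
    have "sg ` ?G \<subseteq> PiE {..Suc N} (\<lambda>_. F)"
    proof (intro image_subsetI PiE_I)
      fix \<gamma> k assume "\<gamma> \<in> ?G"
      then show "k \<in> {..Suc N} \<Longrightarrow> sg \<gamma> k \<in> F" using near(1) by (simp add: sg_def)
    qed (simp add: sg_def)
    then have fin: "finite (sg ` ?G)" by (rule finite_subset) (intro finite_PiE finite_atMost F)
    have close: "dist \<gamma> \<gamma>' < e" if g: "\<gamma> \<in> ?G" "\<gamma>' \<in> ?G" "sg \<gamma> = sg \<gamma>'" for \<gamma> \<gamma>'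
    proof -
      have lip: "dist (apply_bcontfun \<gamma> t) (apply_bcontfun \<gamma> s) \<le> D' / M"
        if "\<gamma> \<in> ?G" "t \<in> {0..1}" "s \<in> {0..1}" "\<bar>t - s\<bar> \<le> 1 / M" for \<gamma> t s
      proof -
        have "dist (apply_bcontfun \<gamma> t) (apply_bcontfun \<gamma> s) = \<bar>t - s\<bar> * dist (apply_bcontfun \<gamma> 0) (apply_bcontfun \<gamma> 1)"
          using that by (intro GeoD) auto
        also have "\<dots> \<le> (1 / M) * D'" using that D'(2) M by (intro mult_mono) auto
        finally show ?thesis by simp
      qed
      have "dist (apply_bcontfun \<gamma> t) (apply_bcontfun \<gamma>' t) \<le> e/2" for t
      proof -
        define u where "u = clamp01 t"
        have u: "u \<in> {0..1}" unfolding u_def by (rule clamp01)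
        define k where "k = nat \<lfloor>u * M\<rfloor>"
        have k: "real k \<le> u * M" "u * M \<le> real k + 1" using u M(1) by (auto simp: k_def of_nat_nat)
        have kN: "k \<le> Suc N"
        proof -
          have "u * M \<le> 1 * M" using u M by (intro mult_right_mono) auto
          then have "real k \<le> 1 * M" using k(1) by (rule order_trans[rotated])
          then have "real k \<le> real (Suc N)" by (simp only: M_def mult_1)
          then show ?thesis by simp
        qed
        have v: "real k / M \<in> {0..1}" using kN M(1) by (simp add: M_def)
        have uk: "\<bar>u - real k / M\<bar> \<le> 1 / M"
        proof -
          have "u - real k / M = (u * M - real k) / M" using M(1) by (simp add: field_simps)
          moreover have "\<bar>u * M - real k\<bar> \<le> 1" using k by simp
          ultimately show ?thesis using M(1) by (simp add: divide_right_mono)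
        qed
        have "near (apply_bcontfun \<gamma> (real k / M)) = near (apply_bcontfun \<gamma>' (real k / M))"
          using fun_cong[OF g(3), of k] kN by (simp add: sg_def)
        moreover have "dist (near (apply_bcontfun \<gamma> (real k / M))) (apply_bcontfun \<gamma> (real k / M)) < e/8"
          "dist (near (apply_bcontfun \<gamma>' (real k / M))) (apply_bcontfun \<gamma>' (real k / M)) < e/8"
          using g by (blast intro: near(2))+
        ultimately have "dist (apply_bcontfun \<gamma> (real k / M)) (apply_bcontfun \<gamma>' (real k / M)) < e/4"
          using dist_triangle3[of "apply_bcontfun \<gamma> (real k / M)" "apply_bcontfun \<gamma>' (real k / M)"
            "near (apply_bcontfun \<gamma> (real k / M))"] by simp
        moreover have "dist (apply_bcontfun \<gamma> u) (apply_bcontfun \<gamma> (real k / M)) < e / 8"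
          using lip[OF g(1) u v uk] M(2) by linarith
        moreover have "dist (apply_bcontfun \<gamma>' u) (apply_bcontfun \<gamma>' (real k / M)) < e / 8"
          using lip[OF g(2) u v uk] M(2) by linarith
        ultimately have "dist (apply_bcontfun \<gamma> u) (apply_bcontfun \<gamma>' u) \<le> e/2"
          using dist_triangle[of "apply_bcontfun \<gamma> u" "apply_bcontfun \<gamma>' u" "apply_bcontfun \<gamma> (real k / M)"]
            dist_triangle[of "apply_bcontfun \<gamma> (real k / M)" "apply_bcontfun \<gamma>' u" "apply_bcontfun \<gamma>' (real k / M)"]
            dist_commute[of "apply_bcontfun \<gamma>' u" "apply_bcontfun \<gamma>' (real k / M)"] by linarith
        then show ?thesis using g Geo_clamp[of \<gamma> t] Geo_clamp[of \<gamma>' t] by (simp add: u_def)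
      qed
      then have "dist \<gamma> \<gamma>' \<le> e/2" by (intro dist_bound)
      then show ?thesis using \<open>e > 0\<close> by simp
    qed
    define rep where "rep s = (SOME \<gamma>. \<gamma> \<in> ?G \<and> sg \<gamma> = s)" for s
    have rep: "rep (sg \<gamma>) \<in> ?G \<and> sg (rep (sg \<gamma>)) = sg \<gamma>" if "\<gamma> \<in> ?G" for \<gamma>
      unfolding rep_def by (rule someI[of "\<lambda>\<gamma>'. \<gamma>' \<in> ?G \<and> sg \<gamma>' = sg \<gamma>" \<gamma>]) (use that in simp)
    have "?G \<subseteq> (\<Union>\<gamma>\<in>rep ` sg ` ?G. ball \<gamma> e)"
    proof
      fix \<gamma> assume g: "\<gamma> \<in> ?G"
      then have "dist (rep (sg \<gamma>)) \<gamma> < e" using rep[OF g] by (intro close) simp_all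
      then show "\<gamma> \<in> (\<Union>\<gamma>\<in>rep ` sg ` ?G. ball \<gamma> e)" using g by (simp only: UN_iff mem_ball) blast
    qed
    then show ?thesis using fin by blast
  qed
  ultimately show ?thesis by (simp add: compact_eq_totally_bounded)
qed

text \<open>Only distances across the joint need an argument: they are at most the sum of the two
  legs, and anything shorter would contradict the length \<open>dist x z\<close> of the whole. The
  explicit form up to \<tau> makes two concatenations with the same first piece agree there.\<close>

lemma Geo_concat:
  fixes \<alpha> \<beta> :: "real \<Rightarrow>\<^sub>C 'a::metric_space"
  assumes "\<alpha> \<in> Geo" "\<beta> \<in> Geo" and \<tau>: "0 < \<tau>" "\<tau> < 1"
    and a: "apply_bcontfun \<alpha> 0 = x" "apply_bcontfun \<alpha> 1 = y" and b: "apply_bcontfun \<beta> 0 = y" "apply_bcontfun \<beta> 1 = z"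
    and d: "dist x y = \<tau> * dist x z" "dist y z = (1 - \<tau>) * dist x z"
  shows "\<exists>\<gamma>\<in>Geo. apply_bcontfun \<gamma> 1 = z \<and> (\<forall>r\<le>\<tau>. apply_bcontfun \<gamma> r = apply_bcontfun \<alpha> (r / \<tau>))"
proof -
  define c where "c r = (if r \<le> \<tau> then apply_bcontfun \<alpha> (r / \<tau>) else apply_bcontfun \<beta> ((r - \<tau>) / (1 - \<tau>)))" for r
  define L where "L = dist x z"
  have L0: "0 \<le> L" by (simp add: L_def)
  have cl: "dist (c r) (c r') = \<bar>r - r'\<bar> * L" if "r \<in> {0..\<tau>}" "r' \<in> {0..\<tau>}" for r r'
  proof -
    have "dist (c r) (c r') = \<bar>r / \<tau> - r' / \<tau>\<bar> * dist x y"
      using that \<tau> GeoD(1)[OF assms(1), of "r' / \<tau>" "r / \<tau>"] a by (simp add: c_def)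
    also have "\<bar>r / \<tau> - r' / \<tau>\<bar> = \<bar>r - r'\<bar> / \<tau>" using \<tau> by (simp add: diff_divide_distrib[symmetric])
    finally show ?thesis using \<tau> by (simp add: d L_def)
  qed
  have c\<tau>: "c \<tau> = apply_bcontfun \<beta> ((\<tau> - \<tau>) / (1 - \<tau>))" using a b \<tau> by (simp add: c_def)
  have cr: "dist (c r) (c r') = \<bar>r - r'\<bar> * L" if "r \<in> {\<tau>..1}" "r' \<in> {\<tau>..1}" for r r'
  proof -
    have e: "c u = apply_bcontfun \<beta> ((u - \<tau>) / (1 - \<tau>))" if "u \<in> {\<tau>..1}" for u
      using that c\<tau> by (cases "u = \<tau>") (auto simp: c_def)
    have "dist (c r) (c r') = \<bar>(r - \<tau>) / (1 - \<tau>) - (r' - \<tau>) / (1 - \<tau>)\<bar> * dist y z"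
      using that \<tau> GeoD(1)[OF assms(2), of "(r' - \<tau>) / (1 - \<tau>)" "(r - \<tau>) / (1 - \<tau>)"] b by (simp add: e)
    also have "\<bar>(r - \<tau>) / (1 - \<tau>) - (r' - \<tau>) / (1 - \<tau>)\<bar> = \<bar>r - r'\<bar> / (1 - \<tau>)"
      using \<tau> by (simp add: diff_divide_distrib[symmetric])
    finally show ?thesis using \<tau> by (simp add: d L_def)
  qed
  have c0: "c 0 = x" "c 1 = z" using \<tau> a b by (simp_all add: c_def)
  have mix: "dist (c r) (c r') = (r' - r) * L" if "r \<in> {0..\<tau>}" "r' \<in> {\<tau>..1}" for r r'
  proof (rule antisym)
    show "dist (c r) (c r') \<le> (r' - r) * L"
      using dist_triangle[of "c r" "c r'" "c \<tau>"] cl[of r \<tau>] cr[of \<tau> r'] that \<tau> by (auto simp: algebra_simps)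
    have "L \<le> dist (c 0) (c r) + dist (c r) (c r') + dist (c r') (c 1)"
      using dist_triangle[of "c 0" "c 1" "c r"] dist_triangle[of "c r" "c 1" "c r'"] by (simp add: c0 L_def)
    then show "(r' - r) * L \<le> dist (c r) (c r')"
      using cl[of 0 r] cr[of r' 1] that \<tau> by (auto simp: algebra_simps)
  qed
  have geo: "dist (c r) (c r') = \<bar>r - r'\<bar> * L" if "r \<in> {0..1}" "r' \<in> {0..1}" for r r'
  proof -
    consider "r \<le> \<tau>" "r' \<le> \<tau>" | "r \<le> \<tau>" "\<tau> \<le> r'" | "\<tau> \<le> r" "r' \<le> \<tau>" | "\<tau> \<le> r" "\<tau> \<le> r'" by linarith
    then show ?thesis
    proof cases
      case 3 then show ?thesis using mix[of r' r] that by (simp add: dist_commute)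
    qed (use that cl[of r r'] mix[of r r'] cr[of r r'] in auto)
  qed
  have cc: "c r = c (clamp01 r)" for r
  proof -
    consider "r < 0" | "r \<in> {0..1}" | "r > 1" by fastforce
    then show ?thesis
    proof cases
      case 1
      then have "r / \<tau> \<le> 0" using \<tau> by (simp add: divide_nonpos_pos)
      then show ?thesis using 1 \<tau> GeoD(2)[OF assms(1), of "r / \<tau>"] by (simp add: c_def clamp01_def)
    next
      case 3
      then have "(r - \<tau>) / (1 - \<tau>) \<ge> 1" using \<tau> by simp
      then show ?thesis using 3 \<tau> GeoD(3)[OF assms(2), of "(r - \<tau>) / (1 - \<tau>)"] by (simp add: c_def clamp01_def)
    qed (simp add: clamp01)
  qed
  have lip: "dist (c r) (c r') \<le> \<bar>r - r'\<bar> * L" for r r'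
    using geo[of "clamp01 r" "clamp01 r'"] cc[of r] cc[of r'] clamp01(1) mult_right_mono[OF clamp01(3)[of r r'] L0] by simp
  have "continuous_on UNIV c"
    unfolding continuous_on_iff
  proof (intro ballI allI impI)
    fix r and e :: real assume "e > 0"
    show "\<exists>d>0. \<forall>r'\<in>UNIV. dist r' r < d \<longrightarrow> dist (c r') (c r) < e"
    proof (intro exI[of _ "e / (L + 1)"] conjI ballI impI)
      fix r' assume "dist r' r < e / (L + 1)"
      then have "\<bar>r' - r\<bar> * (L + 1) < e" using L0 by (simp add: dist_real_def pos_less_divide_eq)
      moreover have "\<bar>r' - r\<bar> * L \<le> \<bar>r' - r\<bar> * (L + 1)" by (intro mult_left_mono) auto
      ultimately show "dist (c r') (c r) < e" using lip[of r' r] by linarith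
    qed (use \<open>e > 0\<close> L0 in auto)
  qed
  moreover have "bounded (range c)"
  proof -
    have "dist x (c r) \<le> L" for r
    proof -
      have "dist (c 0) (c (clamp01 r)) = \<bar>0 - clamp01 r\<bar> * L" using clamp01(1) by (intro geo) auto
      also have "\<dots> \<le> 1 * L" using clamp01(1)[of r] L0 by (intro mult_right_mono) auto
      finally show ?thesis using cc[of r] by (simp add: c0)
    qed
    then show ?thesis by (auto simp: bounded_def)
  qed
  ultimately have "c \<in> bcontfun" by (simp add: bcontfun_def)
  then have ap: "apply_bcontfun (Bcontfun c) = c" by (rule Bcontfun_inverse)
  have "Bcontfun c \<in> Geo"
    unfolding Geo_def mem_Collect_eq ap c0
  proof (intro conjI ballI allI impI)
    show "dist (c t) (c s) = \<bar>t - s\<bar> * dist x z" if "s \<in> {0..1}" "t \<in> {0..1}" for s t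
      using geo[OF that(2,1)] by (simp add: L_def)
    show "c t = x" if "t \<le> 0" for t using cc[of t] that by (simp add: clamp01_def c0)
    show "c t = z" if "1 \<le> t" for t using cc[of t] that by (simp add: clamp01_def c0)
  qed
  then show ?thesis by (intro bexI[of _ "Bcontfun c"]) (auto simp: ap c0, simp add: c_def)
qed

lemma eval_meas_Geo: "sets \<nu> = sets Geo_borel \<Longrightarrow> eval_at t \<in> \<nu> \<rightarrow>\<^sub>M borel"
  by (rule measurable_sets_transfer[OF measurable_restrict_space1[OF borel_measurable_continuous_onI[OF eval_cont]]])

lemma transport_cost_swap:
  assumes "sets \<pi> = sets borel"
  shows "transport_cost (distr \<pi> borel (\<lambda>z. (snd z, fst z))) = transport_cost (\<pi> :: ('a::metric_space \<times> 'a) measure)"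
    "distr (distr \<pi> borel (\<lambda>z. (snd z, fst z))) borel fst = distr \<pi> borel snd"
    "distr (distr \<pi> borel (\<lambda>z. (snd z, fst z))) borel snd = distr \<pi> borel fst"
    "(\<lambda>z. (snd z, fst z)) \<in> \<pi> \<rightarrow>\<^sub>M borel"
proof -
  show m: "(\<lambda>z. (snd z, fst z)) \<in> \<pi> \<rightarrow>\<^sub>M borel"
    by (rule cont_measurable[OF _ assms]) (intro continuous_intros)
  show "transport_cost (distr \<pi> borel (\<lambda>z. (snd z, fst z))) = transport_cost \<pi>"
    unfolding transport_cost_distr[OF m] by (simp add: transport_cost_def dist_commute)
  show "distr (distr \<pi> borel (\<lambda>z. (snd z, fst z))) borel fst = distr \<pi> borel snd"
    "distr (distr \<pi> borel (\<lambda>z. (snd z, fst z))) borel snd = distr \<pi> borel fst"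
    using distr_compose[OF m fst_snd_meas(1)[OF refl]] distr_compose[OF m fst_snd_meas(2)[OF refl]] by simp_all
qed

lemma W2_commute: "W2 \<mu> \<nu> = W2 \<nu> \<mu>"
proof -
  have "(INF \<pi>\<in>plans \<mu> \<nu>. transport_cost \<pi>) \<le> (INF \<pi>\<in>plans \<nu> \<mu>. transport_cost \<pi>)" for \<mu> \<nu> :: "'a measure"
  proof (rule INF_greatest)
    fix \<pi> :: "('a \<times> 'a) measure" assume "\<pi> \<in> plans \<nu> \<mu>"
    then have p: "prob_space \<pi>" "sets \<pi> = sets borel" "distr \<pi> borel fst = \<nu>" "distr \<pi> borel snd = \<mu>"
      by (auto simp: plans_def Prob_def)
    note s = transport_cost_swap[OF p(2)]
    have "distr \<pi> borel (\<lambda>z. (snd z, fst z)) \<in> plans \<mu> \<nu>"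
      using p s by (auto simp: plans_def Prob_def intro: prob_space.prob_space_distr)
    then show "(INF \<pi>\<in>plans \<mu> \<nu>. transport_cost \<pi>) \<le> transport_cost \<pi>"
      using INF_lower[of "distr \<pi> borel (\<lambda>z. (snd z, fst z))" "plans \<mu> \<nu>" transport_cost] s(1) by simp
  qed
  then have "(INF \<pi>\<in>plans \<mu> \<nu>. transport_cost \<pi>) = (INF \<pi>\<in>plans \<nu> \<mu>. transport_cost \<pi>)" by (intro antisym)
  then show ?thesis by (simp add: W2_def)
qed

text \<open>By \<open>opt_middle\<close> the plan between the times \<open>s\<close> and
  \<open>t\<close> is optimal and costs \<open>(t - s)\<^sup>2\<close> times the total, so
  optimality of the plan of the end points is all that has to be checked.\<close>

lemma OptGeoI:
  fixes \<nu> :: "(real \<Rightarrow>\<^sub>C 'a::{complete_space,second_countable_topology}) measure"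
  assumes p: "prob_space \<nu>" and S: "sets \<nu> = sets Geo_borel" and o: "opt (distr \<nu> borel (\<lambda>\<gamma>. (eval_at 0 \<gamma>, eval_at 1 \<gamma>)))"
  shows "\<nu> \<in> OptGeo (distr \<nu> borel (eval_at 0)) (distr \<nu> borel (eval_at 1))"
proof -
  interpret prob_space \<nu> by fact
  note ev = eval_meas_Geo[OF S]
  have sp: "space \<nu> = Geo" using sets_eq_imp_space_eq[OF S] by (simp add: space_restrict_space)
  let ?P = "\<lambda>s t. distr \<nu> borel (\<lambda>\<gamma>. (eval_at s \<gamma>, eval_at t \<gamma>))"
  define C where "C = transport_cost (?P 0 1)"
  have pr: "prob_space (?P s t)" for s t by (intro prob_space_distr pair_borel_measurable ev)
  have W01: "W2 (distr \<nu> borel (eval_at 0)) (distr \<nu> borel (eval_at 1)) = ennreal (sqrt (enn2real C))"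
    using opt_W2[OF o pr] distr_pair_marginals[OF ev ev] by (simp add: C_def)
  have lt: "W2 (distr \<nu> borel (eval_at s)) (distr \<nu> borel (eval_at t)) = ennreal (t - s) * ennreal (sqrt (enn2real C))"
    if st: "0 \<le> s" "s < t" "t \<le> 1" for s t
  proof -
    have ch: "AE \<gamma> in \<nu>. dist (eval_at 0 \<gamma>) (eval_at s \<gamma>) = s * dist (eval_at 0 \<gamma>) (eval_at 1 \<gamma>)"
      "AE \<gamma> in \<nu>. dist (eval_at s \<gamma>) (eval_at t \<gamma>) = (t - s) * dist (eval_at 0 \<gamma>) (eval_at 1 \<gamma>)"
      "AE \<gamma> in \<nu>. dist (eval_at t \<gamma>) (eval_at 1 \<gamma>) = (1 - t) * dist (eval_at 0 \<gamma>) (eval_at 1 \<gamma>)"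
      using st GeoD(1)[of _ s 0] GeoD(1)[of _ t s] GeoD(1)[of _ 1 t] by (auto simp: sp intro!: AE_I2)
    have mid: "opt (?P s t)" "transport_cost (?P s t) = ennreal ((t - s)\<^sup>2) * C"
      unfolding C_def using st by (auto intro!: opt_middle[OF finite_measure_axioms ev ev ev ev _ _ _ _ ch o])
    have "W2 (distr \<nu> borel (eval_at s)) (distr \<nu> borel (eval_at t)) = ennreal (sqrt (enn2real (ennreal ((t - s)\<^sup>2) * C)))"
      using opt_W2[OF mid(1) pr] distr_pair_marginals[OF ev ev] by (simp add: mid(2))
    also have "\<dots> = ennreal (t - s) * ennreal (sqrt (enn2real C))"
      using st by (simp add: enn2real_mult real_sqrt_mult ennreal_mult)
    finally show ?thesis .
  qed
  have eq: "W2 (distr \<nu> borel (eval_at s)) (distr \<nu> borel (eval_at s)) = 0" for s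
  proof -
    have "transport_cost (?P s s) = 0" by (simp add: transport_cost_distr[OF pair_borel_measurable[OF ev ev]])
    moreover have "finite_measure (?P s s)" using pr[of s s] by (rule prob_space.finite_measure)
    ultimately have "opt (?P s s)" by (auto simp: opt_def)
    then show ?thesis
      using opt_W2[OF _ pr, of s s] distr_pair_marginals[OF ev ev] \<open>transport_cost (?P s s) = 0\<close> by simp
  qed
  have "W2 (distr \<nu> borel (eval_at s)) (distr \<nu> borel (eval_at t)) = ennreal \<bar>t - s\<bar> * ennreal (sqrt (enn2real C))"
    if "s \<in> {0..1}" "t \<in> {0..1}" for s t
  proof -
    consider "s < t" | "s = t" | "t < s" by linarith
    then show ?thesis
    proof cases
      case 3 then show ?thesis using lt[of t s] that by (simp add: W2_commute)
    qed (use that lt[of s t] eq in auto)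
  qed
  then show ?thesis unfolding OptGeo_def mem_Collect_eq W01 using p S by simp
qed

section \<open>Crossing geodesics\<close>

text \<open>The points of a geodesic at the times \<open>0 < t < s < 1\<close>.\<close>

type_synonym 'a quad = "'a \<times> 'a \<times> 'a \<times> 'a"

abbreviation (input) q0 :: "'a quad \<Rightarrow> 'a" where "q0 z \<equiv> fst z"
abbreviation (input) q1 :: "'a quad \<Rightarrow> 'a" where "q1 z \<equiv> fst (snd z)"
abbreviation (input) q2 :: "'a quad \<Rightarrow> 'a" where "q2 z \<equiv> fst (snd (snd z))"
abbreviation (input) q3 :: "'a quad \<Rightarrow> 'a" where "q3 z \<equiv> snd (snd (snd z))"

text \<open>Consecutive distances are prescribed; the triangle inequality then forces the others,
  such as \<open>dist (q0 z) (q2 z) = s * dist (q0 z) (q3 z)\<close>.\<close>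

definition chain :: "real \<Rightarrow> real \<Rightarrow> 'a::metric_space quad \<Rightarrow> bool" where
  "chain t s z \<longleftrightarrow> dist (q0 z) (q1 z) = t * dist (q0 z) (q3 z) \<and> dist (q1 z) (q2 z) = (s - t) * dist (q0 z) (q3 z) \<and>
     dist (q2 z) (q3 z) = (1 - s) * dist (q0 z) (q3 z)"

text \<open>The exchanged curves run through the common point, so their lengths are at most the two
  weighted means of \<open>d1\<close> and \<open>d2\<close>. The squares of these means fall short
  of \<open>d1\<^sup>2 + d2\<^sup>2\<close> by \<open>2 * (t * (1 - t)) * (d1 - d2)\<^sup>2\<close>,
  which settles the equality case.\<close>

lemma chain_swap:
  assumes u: "chain t s u" and v: "chain t s v" and ts: "0 < t" "t < s" "s < 1" and e: "q1 u = q1 v"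
  defines "d1 \<equiv> dist (q0 u) (q3 u)" and "d2 \<equiv> dist (q0 v) (q3 v)"
  shows "(dist (q0 u) (q3 v))\<^sup>2 + (dist (q0 v) (q3 u))\<^sup>2 \<le> d1\<^sup>2 + d2\<^sup>2"
    "(dist (q0 u) (q3 v))\<^sup>2 + (dist (q0 v) (q3 u))\<^sup>2 = d1\<^sup>2 + d2\<^sup>2 \<Longrightarrow> dist (q0 u) (q3 v) = d1 \<and> d1 = d2"
proof -
  have 1: "dist (q0 u) (q3 v) \<le> t * d1 + (1 - t) * d2"
    using u v e dist_triangle[of "q0 u" "q3 v" "q1 u"] dist_triangle[of "q1 v" "q3 v" "q2 v"]
    by (simp add: chain_def d1_def d2_def algebra_simps)
  have 2: "dist (q0 v) (q3 u) \<le> t * d2 + (1 - t) * d1"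
    using u v e dist_triangle[of "q0 v" "q3 u" "q1 v"] dist_triangle[of "q1 u" "q3 u" "q2 u"]
    by (simp add: chain_def d1_def d2_def algebra_simps)
  have s1: "(dist (q0 u) (q3 v))\<^sup>2 \<le> (t * d1 + (1 - t) * d2)\<^sup>2" using 1 by (rule power_mono) simp
  have s2: "(dist (q0 v) (q3 u))\<^sup>2 \<le> (t * d2 + (1 - t) * d1)\<^sup>2" using 2 by (rule power_mono) simp
  have id: "(t * d1 + (1 - t) * d2)\<^sup>2 + (t * d2 + (1 - t) * d1)\<^sup>2 = d1\<^sup>2 + d2\<^sup>2 - 2 * (t * (1 - t)) * (d1 - d2)\<^sup>2"
    by (simp add: power2_eq_square algebra_simps)
  have p: "0 < t * (1 - t)" using ts by simp
  then have n: "0 \<le> 2 * (t * (1 - t)) * (d1 - d2)\<^sup>2" by simp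
  show "(dist (q0 u) (q3 v))\<^sup>2 + (dist (q0 v) (q3 u))\<^sup>2 \<le> d1\<^sup>2 + d2\<^sup>2" using s1 s2 id n by linarith
  assume eq: "(dist (q0 u) (q3 v))\<^sup>2 + (dist (q0 v) (q3 u))\<^sup>2 = d1\<^sup>2 + d2\<^sup>2"
  then have "2 * (t * (1 - t)) * (d1 - d2)\<^sup>2 \<le> 0" using s1 s2 id by linarith
  then have "(d1 - d2)\<^sup>2 = 0" using n p by (smt (verit) mult_pos_pos zero_le_power2)
  then have d: "d1 = d2" by simp
  have "(dist (q0 u) (q3 v))\<^sup>2 = (t * d1 + (1 - t) * d2)\<^sup>2" using eq s1 s2 id n by (smt (verit) \<open>(d1 - d2)\<^sup>2 = 0\<close> mult_zero_right)
  also have "t * d1 + (1 - t) * d2 = d1" unfolding d by (simp add: algebra_simps)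
  finally have "dist (q0 u) (q3 v) = d1" by (simp add: d1_def)
  then show "dist (q0 u) (q3 v) = d1 \<and> d1 = d2" using d by simp
qed

lemma AE_eq_of_nn_integral_eq:
  assumes "f \<in> borel_measurable M" "g \<in> borel_measurable M" "AE x in M. f x \<le> g x"
    "(\<integral>\<^sup>+x. g x \<partial>M) \<le> (\<integral>\<^sup>+x. f x \<partial>M)" "(\<integral>\<^sup>+x. f x \<partial>M) < \<infinity>"
  shows "AE x in M. f x = (g x :: ennreal)"
proof -
  have "(\<integral>\<^sup>+x. g x - f x \<partial>M) = (\<integral>\<^sup>+x. g x \<partial>M) - (\<integral>\<^sup>+x. f x \<partial>M)"
    using assms by (intro nn_integral_diff) auto
  also have "\<dots> = 0" using assms(4) le_less_trans[OF assms(4,5)] by (simp add: diff_eq_0_iff_ennreal)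
  finally have "AE x in M. g x - f x = 0" using assms(1,2) by (subst (asm) nn_integral_0_iff_AE) auto
  then show ?thesis using assms(3)
    by eventually_elim (auto dest: ennreal_minus_eq_0 intro: antisym)
qed

lemma AE_proj:
  assumes "distr R borel p = L" "continuous_on UNIV p" "sets R = sets borel" "AE x in L. P x"
  shows "AE z in R. P (p z)"
  by (rule AE_distr_vimage[OF cont_measurable[OF assms(2,3)] assms(4)[folded assms(1)]])

text \<open>A quadruple holds here a starting point, a branching point at time \<tau> and two end
  points. Both geodesics are built with the same first piece, and the pairs that agree up to time
  \<tau> within a large ball form a compact set, so \<open>lifting\<close> applies.\<close>

lemma lift_to_geodesic_pairs:
  fixes P :: "'a::polish_space quad measure"
  assumes proper: "\<forall>S::'a set. closed S \<and> bounded S \<longrightarrow> compact S"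
    and geod: "\<forall>x y::'a. \<exists>\<gamma>\<in>Geo. apply_bcontfun \<gamma> 0 = x \<and> apply_bcontfun \<gamma> 1 = y"
    and P: "finite_measure P" "sets P = sets borel" and \<tau>: "0 < \<tau>" "\<tau> < 1"
    and bd: "AE z in P. q0 z \<in> cball ctr \<rho> \<and> q2 z \<in> cball ctr \<rho> \<and> q3 z \<in> cball ctr \<rho>"
    and ch: "AE z in P. dist (q0 z) (q1 z) = \<tau> * dist (q0 z) (q2 z) \<and> dist (q1 z) (q2 z) = (1 - \<tau>) * dist (q0 z) (q2 z)"
      "AE z in P. dist (q0 z) (q1 z) = \<tau> * dist (q0 z) (q3 z) \<and> dist (q1 z) (q3 z) = (1 - \<tau>) * dist (q0 z) (q3 z)"
  obtains Q :: "((real \<Rightarrow>\<^sub>C 'a) \<times> (real \<Rightarrow>\<^sub>C 'a)) measure" where "finite_measure Q" "sets Q = sets borel"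
    "AE q in Q. fst q \<in> Geo \<and> snd q \<in> Geo \<and> (\<forall>r\<in>{0..\<tau>}. apply_bcontfun (fst q) r = apply_bcontfun (snd q) r)"
    "distr Q borel (\<lambda>q. (eval_at 0 (fst q), eval_at \<tau> (fst q), eval_at 1 (fst q), eval_at 1 (snd q))) = P"
proof -
  define W where "W = cball ctr (3 * \<rho>)"
  have W: "compact W" using proper by (auto simp: W_def)
  define G where "G = {\<gamma>\<in>Geo. \<forall>t. apply_bcontfun \<gamma> t \<in> W}"
  have G: "compact G" unfolding G_def by (rule compact_Geo[OF W])
  define K where "K = (G \<times> G) \<inter> (\<Inter>r\<in>{0..\<tau>}. {q. apply_bcontfun (fst q) r = apply_bcontfun (snd q) r})"
  have K: "compact K" unfolding K_def
    by (intro compact_Int_closed compact_Times G closed_INT ballI closed_Collect_eq eval_cont' continuous_intros)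
  define g where "g q = (eval_at 0 (fst q), eval_at \<tau> (fst q), eval_at 1 (fst q), eval_at 1 (snd q))"
    for q :: "(real \<Rightarrow>\<^sub>C 'a) \<times> (real \<Rightarrow>\<^sub>C 'a)"
  have g: "continuous_on UNIV g" unfolding g_def by (intro continuous_intros eval_cont')
  have "AE z in P. z \<in> g ` K"
    using bd ch
  proof eventually_elim
    case (elim z)
    obtain a b c d where z: "z = (a, b, c, d)" by (metis prod.exhaust)
    obtain \<alpha> where \<alpha>: "\<alpha> \<in> Geo" "apply_bcontfun \<alpha> 0 = a" "apply_bcontfun \<alpha> 1 = b" using geod by blast
    obtain \<beta> where \<beta>: "\<beta> \<in> Geo" "apply_bcontfun \<beta> 0 = b" "apply_bcontfun \<beta> 1 = c" using geod by blast
    obtain \<delta> where \<delta>: "\<delta> \<in> Geo" "apply_bcontfun \<delta> 0 = b" "apply_bcontfun \<delta> 1 = d" using geod by blast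
    obtain \<gamma> where \<gamma>: "\<gamma> \<in> Geo" "apply_bcontfun \<gamma> 1 = c" "\<And>r. r \<le> \<tau> \<Longrightarrow> apply_bcontfun \<gamma> r = apply_bcontfun \<alpha> (r / \<tau>)"
      using Geo_concat[OF \<alpha>(1) \<beta>(1) \<tau> \<alpha>(2,3) \<beta>(2,3)] elim by (auto simp: z)
    obtain \<gamma>' where \<gamma>': "\<gamma>' \<in> Geo" "apply_bcontfun \<gamma>' 1 = d" "\<And>r. r \<le> \<tau> \<Longrightarrow> apply_bcontfun \<gamma>' r = apply_bcontfun \<alpha> (r / \<tau>)"
      using Geo_concat[OF \<alpha>(1) \<delta>(1) \<tau> \<alpha>(2,3) \<delta>(2,3)] elim by (auto simp: z)
    have 0: "apply_bcontfun \<gamma> 0 = a" "apply_bcontfun \<gamma>' 0 = a" "apply_bcontfun \<gamma> \<tau> = b"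
      using \<gamma>(3)[of 0] \<gamma>'(3)[of 0] \<gamma>(3)[of \<tau>] \<tau> \<alpha> by simp_all
    have "\<gamma> \<in> G" "\<gamma>' \<in> G"
      using Geo_range[OF \<gamma>(1), of ctr \<rho>] Geo_range[OF \<gamma>'(1), of ctr \<rho>] \<gamma> \<gamma>' 0 elim by (auto simp: G_def W_def z)
    then have "(\<gamma>, \<gamma>') \<in> K" using \<gamma>(3) \<gamma>'(3) by (auto simp: K_def)
    moreover have "g (\<gamma>, \<gamma>') = z" using \<gamma>(2) \<gamma>'(2) 0 by (simp add: g_def z)
    ultimately show ?case by (metis image_eqI)
  qed
  then obtain Q where Q: "finite_measure Q" "sets Q = sets borel" "AE q in Q. q \<in> K" "distr Q borel g = P"
    by (rule lifting[OF K g P])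
  have "AE q in Q. fst q \<in> Geo \<and> snd q \<in> Geo \<and> (\<forall>r\<in>{0..\<tau>}. apply_bcontfun (fst q) r = apply_bcontfun (snd q) r)"
    using Q(3) by eventually_elim (auto simp: K_def G_def)
  then show ?thesis using Q(4) unfolding g_def by (rule that[OF Q(1,2)])
qed

lemma msum_commute: "sets N = sets M \<Longrightarrow> msum M N = msum N M"
  by (rule measure_eqI) (simp_all add: emeasure_msum add.commute)

lemma distr_AE_eqI:
  assumes "f \<in> M \<rightarrow>\<^sub>M N" "g \<in> M \<rightarrow>\<^sub>M N" "AE x in M. f x = g x"
  shows "distr M N f = distr M N g"
  using assms by (intro distr_cong_AE) auto

text \<open>Glue the two plans along the common point at time \<open>t\<close> and exchange their ends. On \<open>[0,s]\<close> the
  exchanged curve and the original one are geodesics of one optimal plan that share their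
  initial part, but the points at time \<open>s\<close> differ.\<close>

lemma crossing:
  fixes m :: "'a::polish_space measure" and \<Lambda>1 \<Lambda>2 :: "'a quad measure"
  assumes proper: "\<forall>S::'a set. closed S \<and> bounded S \<longrightarrow> compact S"
    and geod: "\<forall>x y::'a. \<exists>\<gamma>\<in>Geo. apply_bcontfun \<gamma> 0 = x \<and> apply_bcontfun \<gamma> 1 = y"
    and enb: "essentially_non_branching m"
    and fin: "finite_measure \<Lambda>1" "finite_measure \<Lambda>2" and S: "sets \<Lambda>1 = sets borel" "sets \<Lambda>2 = sets borel"
    and ts: "0 < t" "t < s" "s < 1"
    and ch: "AE z in \<Lambda>1. chain t s z" "AE z in \<Lambda>2. chain t s z"
    and bd: "AE z in \<Lambda>1. q0 z \<in> cball ctr D \<and> q3 z \<in> cball ctr D" "AE z in \<Lambda>2. q0 z \<in> cball ctr D \<and> q3 z \<in> cball ctr D"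
    and ac0: "absolutely_continuous m (distr \<Lambda>1 borel q0)"
    and ac2: "absolutely_continuous m (distr \<Lambda>1 borel q2)" "absolutely_continuous m (distr \<Lambda>2 borel q2)"
    and op: "opt (distr (msum \<Lambda>1 \<Lambda>2) borel (\<lambda>z. (q0 z, q3 z)))"
    and sep: "AE z in \<Lambda>1. q2 z \<in> S1" "AE z in \<Lambda>2. q2 z \<in> S2" "S1 \<inter> S2 = {}"
    and \<sigma>: "msub \<sigma> (distr \<Lambda>1 borel q1)" "msub \<sigma> (distr \<Lambda>2 borel q1)"
  shows "emeasure \<sigma> (space \<sigma>) = 0"
proof (rule ccontr)
  assume cz: "emeasure \<sigma> (space \<sigma>) \<noteq> 0"
  define c where "c = emeasure \<sigma> (space \<sigma>)"
  have cq: "continuous_on UNIV (\<lambda>z::'a quad. q0 z)" "continuous_on UNIV (\<lambda>z::'a quad. q1 z)"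
    "continuous_on UNIV (\<lambda>z::'a quad. q2 z)" "continuous_on UNIV (\<lambda>z::'a quad. q3 z)"
    by (intro continuous_intros)+
  \<comment> \<open>\<open>L1\<close> and \<open>L2\<close> are the parts of the two plans that sit
    on \<sigma> at time \<open>t\<close>; both have mass \<open>c\<close>.\<close>
  obtain L1 where L1: "msub L1 \<Lambda>1" "distr L1 borel q1 = \<sigma>"
    by (rule msub_lift[OF fin(1) cont_measurable[OF cq(2) S(1)] \<sigma>(1)])
  obtain L2 where L2: "msub L2 \<Lambda>2" "distr L2 borel q1 = \<sigma>"
    by (rule msub_lift[OF fin(2) cont_measurable[OF cq(2) S(2)] \<sigma>(2)])
  have SL: "sets L1 = sets borel" "sets L2 = sets borel" using msub_sets[OF L1(1)] msub_sets[OF L2(1)] S by auto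
  have fL: "finite_measure L1" "finite_measure L2" using msub_finite[OF L1(1) fin(1)] msub_finite[OF L2(1) fin(2)] .
  have L1tot: "emeasure L1 UNIV = c"
  proof -
    have "emeasure (distr L1 borel q1) UNIV = emeasure L1 UNIV"
      using cont_measurable[OF cq(2) SL(1)] by (subst emeasure_distr) (auto simp: space_UNIV_borel[OF SL(1)])
    moreover have "space \<sigma> = UNIV" using L1(2) by (metis space_distr space_borel)
    ultimately show ?thesis by (simp add: c_def L1(2))
  qed
  have c: "c \<noteq> 0" "c \<noteq> \<infinity>"
    using cz L1tot finite_measure.emeasure_finite[OF fL(1), of UNIV] by (auto simp: c_def)
  obtain R where R: "finite_measure R" "sets R = sets borel" "distr R borel fst = L1" "distr R borel snd = L2"
    and Req: "AE z in R. q1 (fst z) = q1 (snd z)"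
    by (rule gluing[OF fL SL cq(2) cq(2)]) (simp_all add: L1 L2)
  have fc: "continuous_on UNIV (fst :: 'a quad \<times> 'a quad \<Rightarrow> _)" "continuous_on UNIV (snd :: 'a quad \<times> 'a quad \<Rightarrow> _)"
    by (intro continuous_intros)+
  have Rch: "AE z in R. chain t s (fst z)" "AE z in R. chain t s (snd z)"
    and Rbd: "AE z in R. q0 (fst z) \<in> cball ctr D \<and> q3 (fst z) \<in> cball ctr D" "AE z in R. q0 (snd z) \<in> cball ctr D \<and> q3 (snd z) \<in> cball ctr D"
    and Rsep: "AE z in R. q2 (fst z) \<in> S1" "AE z in R. q2 (snd z) \<in> S2"
    using AE_proj[OF R(3) fc(1) R(2) msub_AE[OF L1(1) ch(1)]] AE_proj[OF R(4) fc(2) R(2) msub_AE[OF L2(1) ch(2)]]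
      AE_proj[OF R(3) fc(1) R(2) msub_AE[OF L1(1) bd(1)]] AE_proj[OF R(4) fc(2) R(2) msub_AE[OF L2(1) bd(2)]]
      AE_proj[OF R(3) fc(1) R(2) msub_AE[OF L1(1) sep(1)]] AE_proj[OF R(4) fc(2) R(2) msub_AE[OF L2(1) sep(2)]] .
  have Rtot: "emeasure R UNIV = c"
    using L1tot emeasure_distr[OF cont_measurable[OF fc(1) R(2)], of UNIV] by (simp add: R(3) space_UNIV_borel[OF R(2)])
  define u0 u1 u2 u3 v0 v2 v3 :: "'a quad \<times> 'a quad \<Rightarrow> 'a" where
    "u0 = (\<lambda>z. q0 (fst z))" and "u1 = (\<lambda>z. q1 (fst z))" and "u2 = (\<lambda>z. q2 (fst z))" and "u3 = (\<lambda>z. q3 (fst z))"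
    and "v0 = (\<lambda>z. q0 (snd z))" and "v2 = (\<lambda>z. q2 (snd z))" and "v3 = (\<lambda>z. q3 (snd z))"
  note uv = u0_def u1_def u2_def u3_def v0_def v2_def v3_def
  have uvc: "continuous_on UNIV u0" "continuous_on UNIV u1" "continuous_on UNIV u2" "continuous_on UNIV u3"
    "continuous_on UNIV v0" "continuous_on UNIV v2" "continuous_on UNIV v3"
    unfolding uv by (intro continuous_intros)+
  note uvm = uvc[THEN cont_measurable, OF R(2)]
  note pm = pair_borel_measurable
  define Dp where "Dp f g = distr R borel (\<lambda>z. (f z, g z))" for f g :: "'a quad \<times> 'a quad \<Rightarrow> 'a"
  have SD: "sets (Dp f g) = sets borel" for f g by (simp add: Dp_def)
  have fD: "finite_measure (Dp f g)" if "f \<in> R \<rightarrow>\<^sub>M borel" "g \<in> R \<rightarrow>\<^sub>M borel" for f g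
    unfolding Dp_def by (intro finite_measure.finite_measure_distr R(1) pm that)
  have Dm: "distr (Dp f g) borel fst = distr R borel f" "distr (Dp f g) borel snd = distr R borel g"
    if "f \<in> R \<rightarrow>\<^sub>M borel" "g \<in> R \<rightarrow>\<^sub>M borel" for f g
    unfolding Dp_def using distr_pair_marginals[OF that] .
  have Dc: "transport_cost (Dp f g) = (\<integral>\<^sup>+z. ennreal ((dist (f z) (g z))\<^sup>2) \<partial>R)"
    if "f \<in> R \<rightarrow>\<^sub>M borel" "g \<in> R \<rightarrow>\<^sub>M borel" for f g
    unfolding Dp_def by (rule transport_cost_distr[OF pm[OF that]])
  have dm: "(\<lambda>z. ennreal ((dist (f z) (g z))\<^sup>2)) \<in> borel_measurable R"
    if "f \<in> R \<rightarrow>\<^sub>M borel" "g \<in> R \<rightarrow>\<^sub>M borel" for f g :: "'a quad \<times> 'a quad \<Rightarrow> 'a"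
    using measurable_compose[OF pm[OF that] dist_sq_meas] by simp
  \<comment> \<open>\<open>\<Pi>a\<close> pairs the original ends, \<open>\<Pi>b\<close> the
    exchanged ones; the marginals are the same.\<close>
  define \<Pi>a where "\<Pi>a = msum (Dp u0 u3) (Dp v0 v3)"
  define \<Pi>b where "\<Pi>b = msum (Dp u0 v3) (Dp v0 u3)"
  have q03: "continuous_on UNIV (\<lambda>z::'a quad. (q0 z, q3 z))" by (intro continuous_intros)
  note q03m = cont_measurable[OF q03]
  have DA: "Dp u0 u3 = distr L1 borel (\<lambda>z. (q0 z, q3 z))" "Dp v0 v3 = distr L2 borel (\<lambda>z. (q0 z, q3 z))"
    unfolding Dp_def uv R(3)[symmetric] R(4)[symmetric]
    using distr_compose[OF cont_measurable[OF fc(1) R(2)] q03m[OF refl]] distr_compose[OF cont_measurable[OF fc(2) R(2)] q03m[OF refl]]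
    by simp_all
  have opa: "opt \<Pi>a"
  proof (rule opt_msub[OF op])
    have "\<Pi>a = distr (msum L1 L2) borel (\<lambda>z. (q0 z, q3 z))"
      unfolding \<Pi>a_def DA using SL by (intro distr_msum[symmetric] q03m) simp_all
    also have "msub \<dots> (distr (msum \<Lambda>1 \<Lambda>2) borel (\<lambda>z. (q0 z, q3 z)))"
      using L1 L2 S by (intro msub_distr msub_msum_mono q03m) simp_all
    finally show "msub \<Pi>a (distr (msum \<Lambda>1 \<Lambda>2) borel (\<lambda>z. (q0 z, q3 z)))" .
  qed
  let ?F = "\<lambda>z. (dist (u0 z) (v3 z))\<^sup>2 + (dist (v0 z) (u3 z))\<^sup>2"
  let ?G = "\<lambda>z. (dist (u0 z) (u3 z))\<^sup>2 + (dist (v0 z) (v3 z))\<^sup>2"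
  have cb: "transport_cost \<Pi>b = (\<integral>\<^sup>+z. ennreal (?F z) \<partial>R)" and ca: "transport_cost \<Pi>a = (\<integral>\<^sup>+z. ennreal (?G z) \<partial>R)"
    unfolding \<Pi>a_def \<Pi>b_def using SD dm uvm by (simp_all add: transport_cost_msum Dc nn_integral_add)
  have FG: "AE z in R. ennreal (?F z) \<le> ennreal (?G z)"
    using Rch Req
  proof eventually_elim
    case (elim z)
    then show ?case using chain_swap(1)[OF elim(1,2) ts elim(3)] unfolding uv by (intro ennreal_leI)
  qed
  have marg: "distr \<Pi>b borel fst = distr \<Pi>a borel fst" "distr \<Pi>b borel snd = distr \<Pi>a borel snd"
    unfolding \<Pi>a_def \<Pi>b_def using SD uvm
    by (simp_all add: distr_msum fst_snd_meas Dm msum_commute[of "distr R borel u3" "distr R borel v3"])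
  have opb: "opt \<Pi>b"
  proof (rule opt_le_cost[OF opa _ _ marg])
    show "finite_measure \<Pi>b" unfolding \<Pi>b_def using SD fD uvm by (intro finite_measure_msum) simp_all
    show "sets \<Pi>b = sets borel" by (simp add: \<Pi>b_def SD)
    show "transport_cost \<Pi>b \<le> transport_cost \<Pi>a" unfolding ca cb using FG by (rule nn_integral_mono_AE)
  qed
  \<comment> \<open>Pointwise the exchange does not raise the cost, and optimality of
    \<open>\<Pi>a\<close> forbids lowering it in total. So the equality case of
    \<open>chain_swap\<close> holds almost everywhere, and crossing geodesics have equal
    length.\<close>
  have "AE z in R. ennreal (?F z) = ennreal (?G z)"
  proof (rule AE_eq_of_nn_integral_eq[OF _ _ FG])
    show "(\<lambda>z. ennreal (?F z)) \<in> borel_measurable R" "(\<lambda>z. ennreal (?G z)) \<in> borel_measurable R"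
      using dm uvm by simp_all
    show "(\<integral>\<^sup>+z. ennreal (?G z) \<partial>R) \<le> (\<integral>\<^sup>+z. ennreal (?F z) \<partial>R)"
      using optD(4)[OF opa _ marg] optD(2)[OF opb] unfolding ca cb .
    show "(\<integral>\<^sup>+z. ennreal (?F z) \<partial>R) < \<infinity>" using optD(3)[OF opb] unfolding cb .
  qed
  then have eqd: "AE z in R. dist (u0 z) (v3 z) = dist (u0 z) (u3 z) \<and> dist (u0 z) (u3 z) = dist (v0 z) (v3 z)"
    using Rch Req
  proof eventually_elim
    case (elim z)
    then have "?F z = ?G z" by (subst (asm) ennreal_inj) auto
    then show ?case using chain_swap(2)[OF elim(2,3) ts elim(4)] unfolding uv by simp
  qed
  have len: "AE z in R. dist (u0 z) (u2 z) = s * dist (u0 z) (u3 z) \<and> dist (u2 z) (u3 z) = (1 - s) * dist (u0 z) (u3 z) \<and>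
     dist (u0 z) (v2 z) = s * dist (u0 z) (v3 z) \<and> dist (v2 z) (v3 z) = (1 - s) * dist (u0 z) (v3 z) \<and>
     dist (u0 z) (u1 z) = t * dist (u0 z) (u3 z) \<and> dist (u1 z) (u2 z) = (s - t) * dist (u0 z) (u3 z) \<and>
     dist (u1 z) (v2 z) = (s - t) * dist (u0 z) (u3 z) \<and> dist (u0 z) (u3 z) = dist (u0 z) (v3 z)"
    using Rch Req eqd
  proof eventually_elim
    case (elim z)
    define d where "d = dist (u0 z) (u3 z)"
    have e: "dist (u0 z) (u1 z) = t * d" "dist (u1 z) (u2 z) = (s - t) * d" "dist (u2 z) (u3 z) = (1 - s) * d"
      "dist (u1 z) (v2 z) = (s - t) * d" "dist (v2 z) (v3 z) = (1 - s) * d" "dist (u0 z) (v3 z) = d"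
      using elim by (auto simp: chain_def uv d_def)
    have "dist (u0 z) (u2 z) = s * d"
      using dist_triangle[of "u0 z" "u2 z" "u1 z"] dist_triangle[of "u0 z" "u3 z" "u2 z"] e
      by (intro antisym) (auto simp: d_def[symmetric] algebra_simps)
    moreover have "dist (u0 z) (v2 z) = s * d"
      using dist_triangle[of "u0 z" "v2 z" "u1 z"] dist_triangle[of "u0 z" "v3 z" "v2 z"] e
      by (intro antisym) (auto simp: algebra_simps)
    ultimately show ?case using e by (simp add: d_def[symmetric])
  qed
  \<comment> \<open>Both families start at \<open>u0\<close>, since non-branching compares curves
    with a common initial part: \<open>F1\<close> follows the original curve and \<open>F2\<close>
    the exchanged one.\<close>
  define F1 where "F1 z = (u0 z, u2 z, u3 z)" for z
  define F2 where "F2 z = (u0 z, v2 z, v3 z)" for z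
  have Fm: "F1 \<in> R \<rightarrow>\<^sub>M borel" "F2 \<in> R \<rightarrow>\<^sub>M borel"
    unfolding F1_def F2_def by (intro pm uvm)+
  define M where "M = msum (distr R borel F1) (distr R borel F2)"
  have SM: "sets M = sets borel" by (simp add: M_def)
  have fM: "finite_measure M" unfolding M_def using R(1) Fm by (intro finite_measure_msum finite_measure.finite_measure_distr) simp_all
  have c3: "continuous_on UNIV (\<lambda>y::'a\<times>'a\<times>'a. fst y)" "continuous_on UNIV (\<lambda>y::'a\<times>'a\<times>'a. fst (snd y))" "continuous_on UNIV (\<lambda>y::'a\<times>'a\<times>'a. snd (snd y))"
    by (intro continuous_intros)+
  note m3 = c3[THEN cont_measurable]
  have AEM: "AE y in M. P y" if "closed {y. P y}" "AE z in R. P (F1 z)" "AE z in R. P (F2 z)" for P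
    unfolding M_def using that Fm by (intro AE_msum) (auto simp: AE_distr_iff borel_closed)
  have DM: "distr M borel (\<lambda>y. (f y, g y)) = msum (Dp (\<lambda>z. f (F1 z)) (\<lambda>z. g (F1 z))) (Dp (\<lambda>z. f (F2 z)) (\<lambda>z. g (F2 z)))"
    if "continuous_on UNIV f" "continuous_on UNIV g" for f g :: "'a\<times>'a\<times>'a \<Rightarrow> 'a"
    unfolding M_def Dp_def
    using pm[OF cont_measurable[OF that(1) refl] cont_measurable[OF that(2) refl]] Fm
    by (subst distr_msum) (auto simp: distr_compose)
  \<comment> \<open>The plan of the end points is a part of \<open>\<Pi>a\<close> plus
    \<open>\<Pi>b\<close>, a sum of optimal plans with equal marginals. Cutting it at time
    \<open>s\<close> keeps it optimal and leads to an absolutely continuous end marginal.\<close>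
  have "opt (distr M borel (\<lambda>y. (fst y, fst (snd y))))"
  proof (rule opt_middle(1)[OF fM m3(1)[OF SM] m3(1)[OF SM] m3(2)[OF SM] m3(3)[OF SM], of 0 s "1 - s"])
    show "AE y in M. dist (fst y) (fst y) = 0 * dist (fst y) (snd (snd y))" by simp
    show "AE y in M. dist (fst y) (fst (snd y)) = s * dist (fst y) (snd (snd y))"
    proof (rule AEM, goal_cases)
      case 1 show ?case by (intro closed_Collect_eq continuous_intros)
      case 2 show ?case using len by eventually_elim (simp add: F1_def)
      case 3 show ?case using len by eventually_elim (simp add: F2_def)
    qed
    show "AE y in M. dist (fst (snd y)) (snd (snd y)) = (1 - s) * dist (fst y) (snd (snd y))"
    proof (rule AEM, goal_cases)
      case 1 show ?case by (intro closed_Collect_eq continuous_intros)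
      case 2 show ?case using len by eventually_elim (simp add: F1_def)
      case 3 show ?case using len by eventually_elim (simp add: F2_def)
    qed
    show "opt (distr M borel (\<lambda>y. (fst y, snd (snd y))))"
    proof (rule opt_msub[OF opt_msum_same[OF opa opb marg]])
      have "distr M borel (\<lambda>y. (fst y, snd (snd y))) = msum (Dp u0 u3) (Dp u0 v3)"
        using DM[OF c3(1,3)] by (simp add: F1_def F2_def)
      moreover have "msub (msum (Dp u0 u3) (Dp u0 v3)) (msum \<Pi>a \<Pi>b)"
        unfolding \<Pi>a_def \<Pi>b_def using SD by (intro msub_msum_mono msub_msum1) simp_all
      ultimately show "msub (distr M borel (\<lambda>y. (fst y, snd (snd y)))) (msum \<Pi>a \<Pi>b)" by simp
    qed
  qed (use ts in auto)
  then have opM: "opt (msum (Dp u0 u2) (Dp u0 v2))"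
    using DM[OF c3(1,2)] by (simp add: F1_def F2_def)
  define P where "P = distr R borel (\<lambda>z. (u0 z, u1 z, u2 z, v2 z))"
  have Pm: "(\<lambda>z. (u0 z, u1 z, u2 z, v2 z)) \<in> R \<rightarrow>\<^sub>M borel" by (intro pm uvm)
  have SP: "sets P = sets borel" by (simp add: P_def)
  have fP: "finite_measure P" unfolding P_def by (rule finite_measure.finite_measure_distr[OF R(1) Pm])
  \<comment> \<open>The meeting time \<open>t\<close>, after the interval from \<open>0\<close> to
    \<open>s\<close> has been rescaled to unit length.\<close>
  define \<tau> where "\<tau> = t / s"
  have \<tau>: "0 < \<tau>" "\<tau> < 1" "\<tau> * s = t" "(1 - \<tau>) * s = s - t" using ts by (auto simp: \<tau>_def field_simps)
  have AEP: "AE y in P. Q y" if "closed {y. Q y}" "AE z in R. Q (u0 z, u1 z, u2 z, v2 z)" for Q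
    unfolding P_def using that Pm by (subst AE_distr_iff) (auto simp: borel_closed)
  \<comment> \<open>The start lies within \<open>D\<close> of the centre, and the points at time
    \<open>s\<close> lie within \<open>2 * D\<close> of the start.\<close>
  have bdP: "AE z in P. q0 z \<in> cball ctr (3 * D) \<and> q2 z \<in> cball ctr (3 * D) \<and> q3 z \<in> cball ctr (3 * D)"
  proof (rule AEP)
    have "{y::'a quad. q0 y \<in> cball ctr (3 * D) \<and> q2 y \<in> cball ctr (3 * D) \<and> q3 y \<in> cball ctr (3 * D)} =
      {y. dist ctr (q0 y) \<le> 3 * D} \<inter> {y. dist ctr (q2 y) \<le> 3 * D} \<inter> {y. dist ctr (q3 y) \<le> 3 * D}" by auto
    then show "closed {y::'a quad. q0 y \<in> cball ctr (3 * D) \<and> q2 y \<in> cball ctr (3 * D) \<and> q3 y \<in> cball ctr (3 * D)}"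
      by (simp only:) (intro closed_Int closed_Collect_le continuous_intros)
    show "AE z in R. q0 (u0 z, u1 z, u2 z, v2 z) \<in> cball ctr (3 * D) \<and> q2 (u0 z, u1 z, u2 z, v2 z) \<in> cball ctr (3 * D)
       \<and> q3 (u0 z, u1 z, u2 z, v2 z) \<in> cball ctr (3 * D)"
      using Rbd len
    proof eventually_elim
      case (elim z)
      have a: "dist ctr (u0 z) \<le> D" "dist ctr (u3 z) \<le> D" using elim by (auto simp: uv)
      then have d: "dist (u0 z) (u3 z) \<le> 2 * D" using dist_triangle3[of "u0 z" "u3 z" ctr] by simp
      have "s * dist (u0 z) (u3 z) \<le> 1 * dist (u0 z) (u3 z)" using ts by (intro mult_right_mono) auto
      then have "dist (u0 z) (u2 z) \<le> 2 * D" "dist (u0 z) (v2 z) \<le> 2 * D" using d elim by auto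
      then show ?case
        using a dist_triangle[of ctr "u2 z" "u0 z"] dist_triangle[of ctr "v2 z" "u0 z"] zero_le_dist[of ctr "u0 z"]
        by (auto simp del: zero_le_dist)
    qed
  qed
  have chP1: "AE z in P. dist (q0 z) (q1 z) = \<tau> * dist (q0 z) (q2 z) \<and> dist (q1 z) (q2 z) = (1 - \<tau>) * dist (q0 z) (q2 z)"
  proof (rule AEP, goal_cases)
    case 1 show ?case by (intro closed_Collect_conj closed_Collect_eq continuous_intros)
    case 2 show ?case using len by eventually_elim (simp add: mult.assoc[symmetric] \<tau>(3,4))
  qed
  have chP2: "AE z in P. dist (q0 z) (q1 z) = \<tau> * dist (q0 z) (q3 z) \<and> dist (q1 z) (q3 z) = (1 - \<tau>) * dist (q0 z) (q3 z)"
  proof (rule AEP, goal_cases)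
    case 1 show ?case by (intro closed_Collect_conj closed_Collect_eq continuous_intros)
    case 2 show ?case using len by eventually_elim (simp add: mult.assoc[symmetric] \<tau>(3,4))
  qed
  obtain Q :: "((real \<Rightarrow>\<^sub>C 'a) \<times> (real \<Rightarrow>\<^sub>C 'a)) measure" where Q: "finite_measure Q" "sets Q = sets borel"
    "AE q in Q. fst q \<in> Geo \<and> snd q \<in> Geo \<and> (\<forall>r\<in>{0..\<tau>}. apply_bcontfun (fst q) r = apply_bcontfun (snd q) r)"
    "distr Q borel (\<lambda>q. (eval_at 0 (fst q), eval_at \<tau> (fst q), eval_at 1 (fst q), eval_at 1 (snd q))) = P"
    by (rule lift_to_geodesic_pairs[OF proper geod fP SP \<tau>(1,2) bdP chP1 chP2])
  let ?g = "\<lambda>q::(real \<Rightarrow>\<^sub>C 'a) \<times> (real \<Rightarrow>\<^sub>C 'a). (eval_at 0 (fst q), eval_at \<tau> (fst q), eval_at 1 (fst q), eval_at 1 (snd q))"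
  have gm: "?g \<in> Q \<rightarrow>\<^sub>M borel" by (rule cont_measurable[OF _ Q(2)]) (intro continuous_intros eval_cont')
  have Qtot: "emeasure Q UNIV = c"
  proof -
    have "emeasure P UNIV = emeasure Q UNIV" unfolding Q(4)[symmetric] using gm by (subst emeasure_distr) (auto simp: space_UNIV_borel[OF Q(2)])
    moreover have "emeasure P UNIV = emeasure R UNIV" unfolding P_def using Pm by (subst emeasure_distr) (auto simp: space_UNIV_borel[OF R(2)])
    ultimately show ?thesis using Rtot by simp
  qed
  obtain \<gamma>0 :: "real \<Rightarrow>\<^sub>C 'a" where \<gamma>0: "\<gamma>0 \<in> Geo" using geod by blast
  \<comment> \<open>The default \<open>\<gamma>0\<close> makes \<open>f1\<close> and
    \<open>f2\<close> total maps into \<open>Geo\<close>, as measurability into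
    \<open>Geo_borel\<close> requires.\<close>
  define f1 where "f1 q = (if fst q \<in> Geo then fst q else \<gamma>0)" for q :: "(real \<Rightarrow>\<^sub>C 'a) \<times> (real \<Rightarrow>\<^sub>C 'a)"
  define f2 where "f2 q = (if snd q \<in> Geo then snd q else \<gamma>0)" for q :: "(real \<Rightarrow>\<^sub>C 'a) \<times> (real \<Rightarrow>\<^sub>C 'a)"
  have fQ: "f1 \<in> Q \<rightarrow>\<^sub>M Geo_borel" "f2 \<in> Q \<rightarrow>\<^sub>M Geo_borel"
  proof -
    have "{q\<in>space Q. fst q \<in> Geo} \<in> sets Q" "{q\<in>space Q. snd q \<in> Geo} \<in> sets Q"
      using closed_vimage[OF closed_Geo, of fst] closed_vimage[OF closed_Geo, of snd]
      by (auto simp: Q(2) space_UNIV_borel[OF Q(2)] vimage_def continuous_intros intro!: borel_closed)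
    then have "f1 \<in> Q \<rightarrow>\<^sub>M borel" "f2 \<in> Q \<rightarrow>\<^sub>M borel"
      unfolding f1_def f2_def by (intro measurable_If fst_snd_meas[OF Q(2)] measurable_const; simp)+
    then show "f1 \<in> Q \<rightarrow>\<^sub>M Geo_borel" "f2 \<in> Q \<rightarrow>\<^sub>M Geo_borel"
      by (intro measurable_restrict_space2; auto simp: f1_def f2_def \<gamma>0)+
  qed
  define \<nu>0 where "\<nu>0 = msum (distr Q Geo_borel f1) (distr Q Geo_borel f2)"
  \<comment> \<open>Each family has mass \<open>c\<close>; the factor produces the probability
    measure that \<open>OptGeo\<close> asks for.\<close>
  define \<nu> where "\<nu> = scale_measure (1 / (2 * c)) \<nu>0"
  have S0: "sets \<nu>0 = sets Geo_borel" "sets \<nu> = sets Geo_borel" by (simp_all add: \<nu>0_def \<nu>_def)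
  have c2: "2 * c \<noteq> 0" "2 * c \<noteq> \<infinity>" "1 / (2 * c) \<noteq> 0" "1 / (2 * c) \<noteq> \<infinity>"
    using c by (auto simp: ennreal_mult_eq_top_iff ennreal_divide_eq_top_iff ennreal_divide_eq_0_iff)
  have sG: "space (Geo_borel :: (real \<Rightarrow>\<^sub>C 'a) measure) = Geo" by (simp add: space_restrict_space)
  have prob: "prob_space \<nu>"
  proof
    have "emeasure \<nu>0 (space \<nu>0) = c + c"
    proof -
      have "f1 -` Geo \<inter> space Q = UNIV" "f2 -` Geo \<inter> space Q = UNIV" by (auto simp: f1_def f2_def \<gamma>0 space_UNIV_borel[OF Q(2)])
      then have "emeasure (distr Q Geo_borel f1) (space Geo_borel) = c" "emeasure (distr Q Geo_borel f2) (space Geo_borel) = c"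
        using sets.top[of "Geo_borel :: (real \<Rightarrow>\<^sub>C 'a) measure"]
        by (simp_all only: emeasure_distr[OF fQ(1)] emeasure_distr[OF fQ(2)] sG Qtot)
      then show ?thesis unfolding \<nu>0_def by (subst emeasure_msum) (simp_all del: sets_restrict_space)
    qed
    then show "emeasure \<nu> (space \<nu>) = 1"
      using c2 by (simp add: \<nu>_def space_scale_measure mult_2[symmetric] ennreal_divide_times ennreal_divide_self less_top)
  qed
  have em: "eval_at r \<in> (Geo_borel :: (real \<Rightarrow>\<^sub>C 'a) measure) \<rightarrow>\<^sub>M borel" for r by (rule eval_meas_Geo) simp
  have efm: "(\<lambda>q. eval_at r (f1 q)) \<in> Q \<rightarrow>\<^sub>M borel" "(\<lambda>q. eval_at r (f2 q)) \<in> Q \<rightarrow>\<^sub>M borel" for r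
    using measurable_compose[OF fQ(1) em] measurable_compose[OF fQ(2) em] .
  have dP: "distr P borel (\<lambda>z. (q0 z, q2 z)) = Dp u0 u2" "distr P borel (\<lambda>z. (q0 z, q3 z)) = Dp u0 v2"
    unfolding P_def Dp_def
    using distr_compose[OF Pm pm[OF cont_measurable[OF cq(1) refl] cont_measurable[OF cq(3) refl]]]
      distr_compose[OF Pm pm[OF cont_measurable[OF cq(1) refl] cont_measurable[OF cq(4) refl]]] by simp_all
  have e1: "distr Q borel (\<lambda>q. (eval_at 0 (f1 q), eval_at 1 (f1 q))) = Dp u0 u2"
  proof -
    have "distr Q borel (\<lambda>q. (eval_at 0 (f1 q), eval_at 1 (f1 q))) = distr Q borel (\<lambda>q. (q0 (?g q), q2 (?g q)))"
    proof (rule distr_AE_eqI)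
      show "AE q in Q. (eval_at 0 (f1 q), eval_at 1 (f1 q)) = (q0 (?g q), q2 (?g q))"
        using Q(3) by eventually_elim (simp add: f1_def)
    qed (intro pm efm measurable_compose[OF gm] cont_measurable[OF _ refl] continuous_intros)+
    also have "\<dots> = distr P borel (\<lambda>z. (q0 z, q2 z))"
      unfolding Q(4)[symmetric] by (rule distr_compose[symmetric, OF gm]) (intro cont_measurable[OF _ refl] continuous_intros)
    finally show ?thesis by (simp add: dP)
  qed
  have e2: "distr Q borel (\<lambda>q. (eval_at 0 (f2 q), eval_at 1 (f2 q))) = Dp u0 v2"
  proof -
    have "distr Q borel (\<lambda>q. (eval_at 0 (f2 q), eval_at 1 (f2 q))) = distr Q borel (\<lambda>q. (q0 (?g q), q3 (?g q)))"
    proof (rule distr_AE_eqI)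
      show "AE q in Q. (eval_at 0 (f2 q), eval_at 1 (f2 q)) = (q0 (?g q), q3 (?g q))"
        using Q(3) by eventually_elim (use \<tau> in \<open>auto simp: f2_def\<close>)
    qed (intro pm efm measurable_compose[OF gm] cont_measurable[OF _ refl] continuous_intros)+
    also have "\<dots> = distr P borel (\<lambda>z. (q0 z, q3 z))"
      unfolding Q(4)[symmetric] by (rule distr_compose[symmetric, OF gm]) (intro cont_measurable[OF _ refl] continuous_intros)
    finally show ?thesis by (simp add: dP)
  qed
  have e\<nu>: "distr \<nu> borel (\<lambda>\<gamma>. (eval_at 0 \<gamma>, eval_at 1 \<gamma>)) = scale_measure (1 / (2 * c)) (msum (Dp u0 u2) (Dp u0 v2))"
  proof -
    have pe: "(\<lambda>\<gamma>. (eval_at 0 \<gamma>, eval_at 1 \<gamma>)) \<in> Geo_borel \<rightarrow>\<^sub>M (borel :: ('a \<times> 'a) measure)" by (intro pm em)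
    have "distr \<nu>0 borel (\<lambda>\<gamma>. (eval_at 0 \<gamma>, eval_at 1 \<gamma>)) = msum (Dp u0 u2) (Dp u0 v2)"
      unfolding \<nu>0_def e1[symmetric] e2[symmetric] distr_compose[OF fQ(1) pe, symmetric] distr_compose[OF fQ(2) pe, symmetric]
      by (rule distr_msum) (auto intro: measurable_sets_transfer[OF pe])
    then show ?thesis unfolding \<nu>_def
      by (subst distr_scale_measure[OF measurable_sets_transfer[OF pe S0(1)]]) simp
  qed
  have OG: "\<nu> \<in> OptGeo (distr \<nu> borel (eval_at 0)) (distr \<nu> borel (eval_at 1))"
  proof (rule OptGeoI[OF prob S0(2)])
    show "opt (distr \<nu> borel (\<lambda>\<gamma>. (eval_at 0 \<gamma>, eval_at 1 \<gamma>)))"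
      unfolding e\<nu> by (rule opt_scale[OF opM c2(3,4)])
  qed
  have ev: "eval_at r \<in> \<nu> \<rightarrow>\<^sub>M borel" for r by (rule eval_meas_Geo[OF S0(2)])
  have mar: "distr \<nu> borel (eval_at 0) = scale_measure (1 / (2 * c)) (msum (distr R borel u0) (distr R borel u0))"
    "distr \<nu> borel (eval_at 1) = scale_measure (1 / (2 * c)) (msum (distr R borel u2) (distr R borel v2))"
    unfolding distr_pair_marginals[OF ev ev, of 0 1, symmetric] e\<nu>
    using SD uvm by (simp_all add: distr_scale_measure distr_msum fst_snd_meas Dm)
  have ru: "distr R borel u0 = distr L1 borel q0" "distr R borel u2 = distr L1 borel q2" "distr R borel v2 = distr L2 borel q2"
    unfolding uv R(3)[symmetric] R(4)[symmetric]
    using distr_compose[OF cont_measurable[OF fc(1) R(2)] cont_measurable[OF cq(1) refl]]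
      distr_compose[OF cont_measurable[OF fc(1) R(2)] cont_measurable[OF cq(3) refl]]
      distr_compose[OF cont_measurable[OF fc(2) R(2)] cont_measurable[OF cq(3) refl]] by simp_all
  have nul: "emeasure (distr L1 borel q0) N = 0" "emeasure (distr L1 borel q2) N = 0" "emeasure (distr L2 borel q2) N = 0"
    if "N \<in> null_sets m" for N
  proof -
    have "emeasure (distr \<Lambda>1 borel q0) N = 0" "emeasure (distr \<Lambda>1 borel q2) N = 0" "emeasure (distr \<Lambda>2 borel q2) N = 0"
      using that ac0 ac2 by (auto simp: absolutely_continuous_def)
    then show "emeasure (distr L1 borel q0) N = 0" "emeasure (distr L1 borel q2) N = 0" "emeasure (distr L2 borel q2) N = 0"
      using msub_emeasure[OF msub_distr[OF L1(1) cont_measurable[OF cq(1) S(1)]], of N]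
        msub_emeasure[OF msub_distr[OF L1(1) cont_measurable[OF cq(3) S(1)]], of N]
        msub_emeasure[OF msub_distr[OF L2(1) cont_measurable[OF cq(3) S(2)]], of N] by simp_all
  qed
  have bN: "N \<in> sets borel" if "N \<in> null_sets m" for N
    using that ac0 by (auto simp: absolutely_continuous_def dest!: subsetD)
  have "emeasure (distr \<nu> borel (eval_at 0)) N = 0" "emeasure (distr \<nu> borel (eval_at 1)) N = 0" if "N \<in> null_sets m" for N
    unfolding mar ru using nul[OF that] bN[OF that] by (simp_all add: emeasure_msum)
  then have "absolutely_continuous m (distr \<nu> borel (eval_at 0))" "absolutely_continuous m (distr \<nu> borel (eval_at 1))"
    unfolding absolutely_continuous_def using bN by (auto intro!: null_setsI)
  then have P0: "distr \<nu> borel (eval_at 0) \<in> Prob_ac m" and P1: "distr \<nu> borel (eval_at 1) \<in> Prob_ac m"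
    using prob_space.prob_space_distr[OF prob ev] by (simp_all add: Prob_ac_def Prob_def)
  obtain \<Gamma> where \<Gamma>: "\<Gamma> \<in> sets Geo_borel" "non_branching \<Gamma>" "emeasure \<nu> \<Gamma> = 1"
    using enb P0 P1 OG unfolding essentially_non_branching_def by blast
  interpret N: prob_space \<nu> by (rule prob)
  have G': "Geo - \<Gamma> \<in> sets Geo_borel" using sets.compl_sets[OF \<Gamma>(1)] unfolding sG .
  have "emeasure \<nu> (space \<nu> - \<Gamma>) = 0"
    using \<Gamma> S0 N.prob_compl[of \<Gamma>] by (simp add: N.emeasure_eq_measure)
  moreover have "space \<nu> = Geo" using sets_eq_imp_space_eq[OF S0(2)] sG by simp
  ultimately have "emeasure \<nu>0 (Geo - \<Gamma>) = 0" using c2 by (simp add: \<nu>_def)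
  then have "emeasure (distr Q Geo_borel f1) (Geo - \<Gamma>) = 0 \<and> emeasure (distr Q Geo_borel f2) (Geo - \<Gamma>) = 0"
    unfolding \<nu>0_def using G' by (subst (asm) emeasure_msum) (simp_all del: sets_restrict_space)
  then have "AE q in Q. f1 q \<in> \<Gamma>" "AE q in Q. f2 q \<in> \<Gamma>"
  proof -
    assume z: "emeasure (distr Q Geo_borel f1) (Geo - \<Gamma>) = 0 \<and> emeasure (distr Q Geo_borel f2) (Geo - \<Gamma>) = 0"
    have "AE \<gamma> in distr Q Geo_borel f1. \<gamma> \<in> \<Gamma>" "AE \<gamma> in distr Q Geo_borel f2. \<gamma> \<in> \<Gamma>"
      using z G' by (auto intro!: AE_I[where N="Geo - \<Gamma>"] simp: sG simp del: sets_restrict_space)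
    then show "AE q in Q. f1 q \<in> \<Gamma>" "AE q in Q. f2 q \<in> \<Gamma>"
      using AE_distr_vimage[OF fQ(1)] AE_distr_vimage[OF fQ(2)] by blast+
  qed
  \<comment> \<open>Both curves lie in one non-branching set and agree up to time \<tau>, so their
    ends coincide. These ends are the points of the two flows at time \<open>s\<close>, which lie in
    the disjoint sets \<open>S1\<close> and \<open>S2\<close>.\<close>
  then have "AE q in Q. q2 (?g q) = q3 (?g q)"
    using Q(3)
  proof eventually_elim
    case (elim q)
    then have "fst q \<in> \<Gamma>" "snd q \<in> \<Gamma>" by (simp_all add: f1_def f2_def)
    then have "fst q = snd q" using \<Gamma>(2) elim(3) \<tau> unfolding non_branching_def by (metis greaterThanLessThan_iff)
    then show ?case by simp
  qed
  then have "AE z in P. q2 z = q3 z"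
    unfolding Q(4)[symmetric] using gm by (subst AE_distr_iff) (auto intro!: borel_closed closed_Collect_eq continuous_intros)
  then have "AE z in R. u2 z = v2 z"
    unfolding P_def using AE_distr_vimage[OF Pm, of "\<lambda>z. q2 z = q3 z"] by simp
  then have "AE z in R. False"
    using Rsep
  proof eventually_elim
    case (elim z) then show ?case using sep(3) by (auto simp: uv)
  qed
  then have "emeasure R UNIV = 0"
    using AE_iff_measurable[of "space R" R "\<lambda>_. False"] by (simp add: space_UNIV_borel[OF R(2)] R(2))
  then show False using Rtot c by simp
qed

section \<open>Volume estimates from the measure contraction property\<close>

lemma sin_concave_ineq:
  assumes "0 < a" "a < pi" "0 \<le> r" "r \<le> 1"
  shows "r * sin a \<le> sin (r * a)"
proof -
  have "convex_on {0..pi} (\<lambda>x. - sin x)"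
    by (rule convex_on_realI[where f'="\<lambda>x. - cos x"])
       (auto intro!: derivative_eq_intros cos_monotone_0_pi_le)
  then have "- sin ((1 - r) *\<^sub>R 0 + r *\<^sub>R a) \<le> (1 - r) * (- sin 0) + r * (- sin a)"
    using assms by (intro convex_onD) auto
  then show ?thesis by simp
qed

text \<open>Convexity of \<open>exp\<close> between \<open>0\<close> and \<open>- 2 * a\<close>,
  multiplied by \<open>exp (r * a)\<close>.\<close>

lemma sinh_ratio_ineq:
  assumes "0 \<le> a" "0 \<le> r" "r \<le> 1"
  shows "r * exp (- ((1 - r) * a)) * sinh a \<le> sinh (r * (a::real))"
proof -
  have "exp ((1 - r) *\<^sub>R 0 + r *\<^sub>R (- 2 * a)) \<le> (1 - r) * exp 0 + r * exp (- 2 * a)"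
    using assms by (intro convex_onD[OF exp_convex]) auto
  then have "r * (1 - exp (- 2 * a)) \<le> 1 - exp (- 2 * (r * a))" by (simp add: algebra_simps)
  then have "exp (r * a) * (r * (1 - exp (- 2 * a))) \<le> exp (r * a) * (1 - exp (- 2 * (r * a)))"
    by (intro mult_left_mono) auto
  also have "exp (r * a) * (1 - exp (- 2 * (r * a))) = 2 * sinh (r * a)"
    by (simp add: sinh_field_def right_diff_distrib exp_add[symmetric])
  also have "exp (r * a) * (r * (1 - exp (- 2 * a))) = r * (exp (r * a) - exp (r * a - 2 * a))"
    by (simp add: right_diff_distrib exp_add[symmetric] exp_diff exp_minus field_simps)
  finally have f: "r * (exp (r * a) - exp (r * a - 2 * a)) \<le> 2 * sinh (r * a)" .
  define E where "E = exp (- ((1 - r) * a))"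
  have "exp (r * a) = E * exp a" "exp (r * a - 2 * a) = E * exp (- a)"
    by (simp_all add: E_def exp_add[symmetric] algebra_simps)
  then have "r * (exp (r * a) - exp (r * a - 2 * a)) = 2 * (r * E * sinh a)"
    by (simp add: sinh_field_def field_simps)
  then show ?thesis using f unfolding E_def[symmetric] by linarith
qed

text \<open>A lower bound for \<open>tau K N (1 - t)\<close> that is uniform over distances up to
  \<open>D\<close> and tends to \<open>1\<close> as \<open>t\<close> decreases to \<open>0\<close>.
  For \<open>K \<ge> 0\<close> it is just \<open>1 - t\<close>; the exponential pays for negative
  curvature.\<close>

definition contraction :: "real \<Rightarrow> real \<Rightarrow> real \<Rightarrow> real \<Rightarrow> real" where
  "contraction K N D t = (1 - t) * exp (- (t * (D * sqrt (max 0 (- K) / (N - 1)))))"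

lemma contraction_pos: "t < 1 \<Longrightarrow> 0 < contraction K N D t"
  by (simp add: contraction_def)

lemma contraction_tendsto: "((\<lambda>t. contraction K N D t) \<longlongrightarrow> 1) (at_right 0)"
proof -
  have "((\<lambda>t. contraction K N D t) \<longlongrightarrow> (1 - 0) * exp (- (0 * (D * sqrt (max 0 (- K) / (N - 1)))))) (at_right 0)"
    unfolding contraction_def by (intro tendsto_intros)
  then show ?thesis by simp
qed

text \<open>With \<open>r = 1 - t\<close>, concavity of the sine bounds the quotient inside
  \<open>tau\<close> below by \<open>r\<close>, and \<open>sinh_ratio_ineq\<close> bounds it by
  \<open>r\<close> times an exponential. The exponents \<open>1 / N\<close> and \<open>p\<close> add
  up to one, and raising a number below one to the power \<open>p < 1\<close> only increases
  it.\<close>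

lemma tau_ge_contraction:
  assumes N: "1 < N" and t: "0 \<le> t" "t < 1" and \<theta>: "0 \<le> \<theta>" "\<theta> \<le> D"
  shows "ennreal (contraction K N D t) \<le> tau K N (1 - t) \<theta>"
proof -
  define r where "r = 1 - t"
  have r: "0 < r" "r \<le> 1" using t by (auto simp: r_def)
  have D: "0 \<le> D" using \<theta> by simp
  define a' where "a' = D * sqrt (max 0 (- K) / (N - 1))"
  have a': "0 \<le> a'" using D N by (simp add: a'_def)
  have ce: "contraction K N D t = r * exp (- (t * a'))" by (simp add: contraction_def r_def a'_def)
  have cr: "contraction K N D t \<le> r"
  proof -
    have "r * exp (- (t * a')) \<le> r * 1" using r a' t by (intro mult_left_mono) auto
    then show ?thesis by (simp add: ce)
  qed
  define p where "p = (N - 1) / N"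
  have p: "0 < p" "p < 1" "1 / N + p = 1" using N by (auto simp: p_def field_simps)
  have rp: "r powr (1 / N) * r powr p = r" using r p(3) by (simp add: powr_add[symmetric])
  consider (inf) "K * \<theta>\<^sup>2 \<ge> (N - 1) * pi\<^sup>2" | (pos) "K * \<theta>\<^sup>2 < (N - 1) * pi\<^sup>2" "K * \<theta>\<^sup>2 > 0"
    | (zero) "K * \<theta>\<^sup>2 < (N - 1) * pi\<^sup>2" "K * \<theta>\<^sup>2 = 0" | (neg) "K * \<theta>\<^sup>2 < (N - 1) * pi\<^sup>2" "K * \<theta>\<^sup>2 < 0" by linarith
  then show ?thesis
  proof cases
    case inf then show ?thesis by (simp add: tau_def)
  next
    case pos
    then have K: "0 < K" and th: "0 < \<theta>" using \<theta> by (auto simp: zero_less_mult_iff)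
    define a where "a = \<theta> * sqrt (K / (N - 1))"
    have a0: "0 < a" using K th N by (simp add: a_def)
    have "a\<^sup>2 = \<theta>\<^sup>2 * (K / (N - 1))" using K N by (simp add: a_def power_mult_distrib)
    also have "\<dots> < pi\<^sup>2" using pos N by (simp add: field_simps)
    finally have "a < pi" by (rule power_less_imp_less_base) simp
    have "sin a > 0" using a0 \<open>a < pi\<close> by (rule sin_gt_zero)
    then have "r \<le> sin (r * a) / sin a"
      using sin_concave_ineq[OF a0 \<open>a < pi\<close>, of r] r by (simp add: pos_le_divide_eq)
    then have "r powr p \<le> (sin (r * a) / sin a) powr p" using r p by (intro powr_mono2) auto
    then have "r powr (1 / N) * r powr p \<le> r powr (1 / N) * (sin (r * a) / sin a) powr p" by (intro mult_left_mono) auto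
    then have "contraction K N D t \<le> r powr (1 / N) * (sin (r * a) / sin a) powr p" using cr unfolding rp by linarith
    then show ?thesis using pos by (simp add: tau_def r_def[symmetric] a_def p_def mult.assoc ennreal_leI)
  next
    case zero
    have "tau K N (1 - t) \<theta> = ennreal r"
      unfolding tau_def r_def[symmetric] using zero
      by (subst if_not_P, linarith, subst if_not_P, linarith, subst if_P) auto
    then show ?thesis using cr by (simp add: ennreal_leI)
  next
    case neg
    then have K: "K < 0" and th: "0 < \<theta>" using \<theta> by (auto simp: mult_less_0_iff)
    define a where "a = \<theta> * sqrt (- K / (N - 1))"
    have kn: "0 < - K / (N - 1)" using K N by (intro divide_pos_pos) auto
    have a0: "0 < a" unfolding a_def using kn th by (intro mult_pos_pos real_sqrt_gt_zero)
    have aa: "a \<le> a'"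
      unfolding a_def a'_def using K \<theta> D N real_sqrt_gt_zero[OF kn] by (intro mult_mono) (auto simp: less_imp_le)
    have sp: "0 < sinh a" using a0 by simp
    have "r * exp (- (t * a)) * sinh a \<le> sinh (r * a)"
      using sinh_ratio_ineq[of a r] a0 r by (simp add: r_def)
    then have "r * exp (- (t * a)) \<le> sinh (r * a) / sinh a" using sp by (simp add: pos_le_divide_eq)
    moreover have "r * exp (- (t * a')) \<le> r * exp (- (t * a))"
      using aa t r by (intro mult_left_mono) (auto intro: mult_left_mono)
    ultimately have le: "r * exp (- (t * a')) \<le> sinh (r * a) / sinh a" by linarith
    have "r * exp (- (t * a')) = r powr (1 / N) * (r powr p * exp (- (t * a')))" using rp by (simp add: mult.assoc[symmetric])
    also have "\<dots> \<le> r powr (1 / N) * (r powr p * exp (- (t * a')) powr p)"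
    proof -
      have "exp (- (t * a')) powr 1 \<le> exp (- (t * a')) powr p"
        using p a' t by (intro powr_mono') auto
      then show ?thesis by (intro mult_left_mono) auto
    qed
    also have "r powr p * exp (- (t * a')) powr p = (r * exp (- (t * a'))) powr p"
      using r by (simp add: powr_mult)
    also have "r powr (1 / N) * (r * exp (- (t * a'))) powr p \<le> r powr (1 / N) * (sinh (r * a) / sinh a) powr p"
      using le r p by (intro mult_left_mono powr_mono2) auto
    finally have "contraction K N D t \<le> r powr (1 / N) * (sinh (r * a) / sinh a) powr p" unfolding ce .
    moreover have "tau K N (1 - t) \<theta> = ennreal (r powr (1 / N) * (sinh (r * a) / sinh a) powr p)"
      unfolding tau_def r_def[symmetric] using neg
      by (subst if_not_P, linarith, subst if_not_P, linarith, subst if_not_P, linarith) (simp only: a_def p_def mult.assoc)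
    ultimately show ?thesis by (simp only: ennreal_leI)
  qed
qed

section \<open>From the Renyi functional to volumes\<close>

lemma sigma_finite_msum:
  assumes "sigma_finite_measure m" "finite_measure \<mu>" "sets \<mu> = sets m"
  shows "sigma_finite_measure (msum m \<mu>)"
proof
  interpret sigma_finite_measure m by fact
  obtain A where A: "countable A" "A \<subseteq> sets m" "\<Union>A = space m" "\<forall>a\<in>A. emeasure m a \<noteq> \<infinity>"
    using sigma_finite_countable by blast
  have "emeasure (msum m \<mu>) a \<noteq> \<infinity>" if "a \<in> A" for a
    using A that assms finite_measure.emeasure_finite[OF assms(2), of a] by (subst emeasure_msum) (auto simp: subset_eq)
  then show "\<exists>A. countable A \<and> A \<subseteq> sets (msum m \<mu>) \<and> \<Union> A = space (msum m \<mu>) \<and> (\<forall>a\<in>A. emeasure (msum m \<mu>) a \<noteq> \<infinity>)"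
    using A by auto
qed

text \<open>Von Neumann's argument: \<mu> has a density \<open>u \<le> 1\<close> with respect to
  \<open>msum m \<mu>\<close>, and the singular part sits where \<open>u = 1\<close>. Existence
  matters because \<open>renyi_functional\<close> picks its density by \<open>SOME\<close>.\<close>

lemma ac_density_exists:
  assumes m: "sigma_finite_measure m" and \<mu>: "finite_measure \<mu>" "sets \<mu> = sets m"
  shows "\<exists>\<rho>. ac_density_of m \<mu> \<rho>"
proof -
  interpret m: sigma_finite_measure m by fact
  interpret \<mu>: finite_measure \<mu> by fact
  note [measurable_cong] = \<mu>(2)
  have sp: "space \<mu> = space m" using \<mu>(2) by (rule sets_eq_imp_space_eq)
  have "msub \<mu> (scale_measure 1 (msum m \<mu>))" using msub_msum2[OF \<mu>(2)] by simp
  then obtain u where u: "u \<in> borel_measurable (msum m \<mu>)" "\<And>x. u x \<le> 1" "\<mu> = density (msum m \<mu>) u"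
    by (rule bounded_density_exists[OF sigma_finite_msum[OF m \<mu>] \<mu>(1)]) auto
  have um[measurable]: "u \<in> borel_measurable m" using u(1) by (rule measurable_sets_transfer) simp
  have mu: "emeasure \<mu> A = (\<integral>\<^sup>+x. u x * indicator A x \<partial>m) + (\<integral>\<^sup>+x. u x * indicator A x \<partial>\<mu>)" if [measurable]: "A \<in> sets m" for A
  proof -
    have "emeasure \<mu> A = (\<integral>\<^sup>+x. u x * indicator A x \<partial>msum m \<mu>)"
      by (subst u(3), subst emeasure_density[OF u(1)]) auto
    then show ?thesis using \<mu>(2) by (subst (asm) nn_integral_msum) auto
  qed
  define S where "S = {x\<in>space m. u x = 1}"
  have S[measurable]: "S \<in> sets m" unfolding S_def by measurable
  have "emeasure \<mu> S = emeasure m S + emeasure \<mu> S"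
  proof -
    have "(\<integral>\<^sup>+x. u x * indicator S x \<partial>P) = emeasure P S" if "sets P = sets m" for P
    proof -
      have "(\<integral>\<^sup>+x. u x * indicator S x \<partial>P) = (\<integral>\<^sup>+x. indicator S x \<partial>P)"
        by (intro nn_integral_cong) (auto simp: S_def split: split_indicator)
      then show ?thesis using S that by simp
    qed
    then show ?thesis using mu[OF S] \<mu>(2) by simp
  qed
  then have mS: "emeasure m S = 0"
    using \<mu>.emeasure_finite[of S] by (metis add.commute add_0 ennreal_add_left_cancel infinity_ennreal_def)
  define \<mu>a where "\<mu>a = density \<mu> (indicator (space m - S))"
  define \<mu>s where "\<mu>s = density \<mu> (indicator S)"
  have ea: "emeasure \<mu>a A = emeasure \<mu> (A - S)" and es: "emeasure \<mu>s A = emeasure \<mu> (A \<inter> S)" if A: "A \<in> sets m" for A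
  proof -
    have "A - S = (space m - S) \<inter> A" using sets.sets_into_space[OF A] by auto
    then show "emeasure \<mu>a A = emeasure \<mu> (A - S)" "emeasure \<mu>s A = emeasure \<mu> (A \<inter> S)"
      using A \<mu>(2) S by (auto simp: \<mu>a_def \<mu>s_def emeasure_density indicator_inter_arith[symmetric] Int_commute)
  qed
  have "absolutely_continuous m \<mu>a"
    unfolding absolutely_continuous_def
  proof
    fix A assume A: "A \<in> null_sets m"
    then have A1[measurable]: "A \<in> sets m" by auto
    define E where "E = A - S"
    have E[measurable]: "E \<in> sets m" using S by (simp add: E_def)
    have "emeasure m E = 0" using A emeasure_mono[of E A m] by (auto simp: E_def)
    then have "AE x in m. u x * indicator E x = 0"
      using E by (intro AE_I[of _ _ E]) (auto split: split_indicator_asm)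
    then have "(\<integral>\<^sup>+x. u x * indicator E x \<partial>m) = 0" by (subst nn_integral_0_iff_AE) auto
    \<comment> \<open>Off \<open>S\<close> the density \<open>u\<close> is below one, so the mass of
      \<open>E\<close> can equal the integral of \<open>u\<close> over \<open>E\<close> only if it
      vanishes.\<close>
    then have e: "emeasure \<mu> E = (\<integral>\<^sup>+x. u x * indicator E x \<partial>\<mu>)" using mu[OF E] by simp
    have "AE x in \<mu>. u x * indicator E x = indicator E x"
    proof (rule AE_eq_of_nn_integral_eq)
      show "AE x in \<mu>. u x * indicator E x \<le> indicator E x"
        using u(2) by (intro AE_I2) (auto split: split_indicator)
      show "(\<integral>\<^sup>+x. indicator E x \<partial>\<mu>) \<le> (\<integral>\<^sup>+x. u x * indicator E x \<partial>\<mu>)" using e E \<mu>(2) by simp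
      show "(\<integral>\<^sup>+x. u x * indicator E x \<partial>\<mu>) < \<infinity>" using e \<mu>.emeasure_finite[of E] by (simp add: less_top[symmetric])
    qed measurable
    then have "AE x in \<mu>. x \<notin> E" using AE_space by eventually_elim (auto simp: E_def S_def sp split: split_indicator_asm)
    then have "emeasure \<mu> E = 0" using E \<mu>(2) sp sets.sets_into_space[OF E] by (subst AE_iff_measurable[of E \<mu> "\<lambda>x. x \<notin> E", symmetric]) auto
    then show "A \<in> null_sets \<mu>a" using A1 ea[OF A1] by (auto simp: null_sets_def E_def \<mu>a_def \<mu>(2))
  qed
  moreover have Sa: "sets \<mu>a = sets m" by (simp add: \<mu>a_def \<mu>(2))
  ultimately obtain f where f[measurable]: "f \<in> borel_measurable m" and fd: "density m f = \<mu>a"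
    using m.Radon_Nikodym[of \<mu>a] by auto
  have "(\<integral>\<^sup>+x. f x \<partial>m) = emeasure \<mu>a (space m)" unfolding fd[symmetric] by (simp add: emeasure_density cong: nn_integral_cong)
  also have "\<dots> = emeasure \<mu> (space m - S)" by (rule ea) simp
  finally have "(\<integral>\<^sup>+x. f x \<partial>m) \<noteq> \<infinity>" by simp
  then have "AE x in m. f x \<noteq> \<infinity>" by (rule nn_integral_PInf_AE[OF f])
  then have fe: "density m (\<lambda>x. ennreal (enn2real (f x))) = \<mu>a"
    unfolding fd[symmetric] by (intro density_cong) (auto elim!: eventually_mono simp: less_top)
  have "ac_density_of m \<mu> (\<lambda>x. enn2real (f x))"
    unfolding ac_density_of_def fe
  proof (intro conjI exI[of _ \<mu>s] allI ballI)
    show "sets \<mu>s = sets m" by (simp add: \<mu>s_def \<mu>(2))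
    have "emeasure \<mu>s (space m - S) = 0" by (subst es) (auto simp: Diff_Int_distrib2)
    then show "mutually_singular m \<mu>s" unfolding mutually_singular_def using mS by (intro bexI[of _ S]) auto
    fix A assume A: "A \<in> sets m"
    have "emeasure \<mu> A = emeasure \<mu> (A - S) + emeasure \<mu> (A \<inter> S)"
      using A S \<mu>(2) by (subst plus_emeasure) (auto intro!: arg_cong[where f="emeasure \<mu>"])
    then show "emeasure \<mu> A = emeasure \<mu>a A + emeasure \<mu>s A" using ea[OF A] es[OF A] by simp
  qed auto
  then show ?thesis by blast
qed

text \<open>The tangent at \<open>l\<close> lies above the concave power; after division by
  \<open>l\<close> this is convexity of \<open>exp\<close> at the logarithm.\<close>

lemma powr_tangent:
  assumes "0 \<le> x" "0 < l" "0 < p" "p < (1::real)"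
  shows "x powr p \<le> p * l powr (p - 1) * x + (1 - p) * l powr p"
proof (cases "x = 0")
  case True then show ?thesis using assms by simp
next
  case False
  define y where "y = x / l"
  have y: "0 < y" "x = y * l" using False assms by (auto simp: y_def)
  have "exp ((1 - p) *\<^sub>R 0 + p *\<^sub>R ln y) \<le> (1 - p) * exp 0 + p * exp (ln y)"
    using assms by (intro convex_onD[OF exp_convex]) auto
  then have yp: "y powr p \<le> (1 - p) + p * y" using y by (simp add: powr_def)
  have lp: "l powr (p - 1) * l = l powr p"
    using assms powr_add[of l "p - 1" 1] by simp
  have "x powr p = y powr p * l powr p" using y assms by (simp add: powr_mult)
  also have "\<dots> \<le> ((1 - p) + p * y) * l powr p" using yp by (intro mult_right_mono) auto
  also have "\<dots> = p * (l powr (p - 1) * l) * y + (1 - p) * l powr p" unfolding lp by (simp add: algebra_simps)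
  also have "\<dots> = p * l powr (p - 1) * x + (1 - p) * l powr p" unfolding y(2) by simp
  finally show ?thesis .
qed

text \<open>Jensen's inequality for a density concentrated on \<open>B\<close>, by the tangent at
  the mean density \<open>1 / measure m B\<close>. A singular part of \<mu> only lowers the integral
  of \<rho> below one.\<close>

lemma renyi_le_volume:
  assumes m: "sigma_finite_measure m" and \<mu>: "prob_space \<mu>" "sets \<mu> = sets m" and N: "1 < N"
    and B: "B \<in> sets m" "emeasure m B < \<infinity>" "emeasure \<mu> (space m - B) = 0"
  shows "renyi_functional m N \<mu> \<le> ennreal (measure m B powr (1 / N))"
proof -
  interpret \<mu>: prob_space \<mu> by fact
  define \<rho> where "\<rho> = (SOME \<rho>. ac_density_of m \<mu> \<rho>)"
  have "ac_density_of m \<mu> \<rho>"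
    unfolding \<rho>_def using ac_density_exists[OF m \<mu>.finite_measure_axioms \<mu>(2)] by (rule someI_ex)
  then obtain \<mu>s where \<rho>[measurable]: "\<rho> \<in> borel_measurable m" and \<rho>0: "\<And>x. 0 \<le> \<rho> x"
    and e: "\<And>A. A \<in> sets m \<Longrightarrow> emeasure \<mu> A = emeasure (density m (\<lambda>x. ennreal (\<rho> x))) A + emeasure \<mu>s A"
    unfolding ac_density_of_def by blast
  have le: "(\<integral>\<^sup>+x. ennreal (\<rho> x) * indicator A x \<partial>m) \<le> emeasure \<mu> A" if "A \<in> sets m" for A
    using e[OF that] that by (simp add: emeasure_density)
  have "(\<integral>\<^sup>+x. ennreal (\<rho> x) * indicator (space m - B) x \<partial>m) = 0"
    using le[of "space m - B"] B by auto
  then have "AE x in m. ennreal (\<rho> x) * indicator (space m - B) x = 0"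
    using B by (subst (asm) nn_integral_0_iff_AE) auto
  then have out: "AE x in m. x \<notin> B \<longrightarrow> \<rho> x = 0"
    using AE_space by eventually_elim (use \<rho>0 in \<open>auto simp: antisym split: split_indicator_asm\<close>)
  define p where "p = 1 - 1 / N"
  have p: "0 < p" "p < 1" using N by (auto simp: p_def)
  have R: "renyi_functional m N \<mu> = (\<integral>\<^sup>+x. ennreal (\<rho> x powr p) \<partial>m)" by (simp add: renyi_functional_def \<rho>_def p_def)
  define b where "b = measure m B"
  have eb: "emeasure m B = ennreal b" using B(2) by (simp add: b_def emeasure_eq_ennreal_measure)
  show ?thesis
  proof (cases "b = 0")
    case True
    then have "AE x in m. x \<notin> B" using eb B(1) by (intro AE_I[of _ _ B]) auto
    then have "AE x in m. ennreal (\<rho> x powr p) = 0" using out by eventually_elim auto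
    then show ?thesis unfolding R by (subst nn_integral_cong_AE[where v="\<lambda>_. 0"]) auto
  next
    case False
    then have b: "0 < b" by (simp add: b_def zero_less_measure_iff)
    define l where "l = 1 / b"
    have l: "0 < l" using b by (simp add: l_def)
    have "(\<integral>\<^sup>+x. ennreal (\<rho> x powr p) \<partial>m) \<le> (\<integral>\<^sup>+x. ennreal (p * l powr (p - 1)) * ennreal (\<rho> x) + ennreal ((1 - p) * l powr p) * indicator B x \<partial>m)"
    proof (rule nn_integral_mono_AE, use out in eventually_elim)
      fix x assume o: "x \<notin> B \<longrightarrow> \<rho> x = 0"
      have "ennreal (\<rho> x powr p) \<le> ennreal (p * l powr (p - 1) * \<rho> x + (1 - p) * l powr p)"
        using powr_tangent[OF \<rho>0 l p] by (rule ennreal_leI)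
      also have "\<dots> = ennreal (p * l powr (p - 1)) * ennreal (\<rho> x) + ennreal ((1 - p) * l powr p)"
        using p \<rho>0 by (simp add: ennreal_mult'[symmetric] ennreal_plus[symmetric] del: ennreal_plus)
      finally show "ennreal (\<rho> x powr p) \<le> ennreal (p * l powr (p - 1)) * ennreal (\<rho> x) + ennreal ((1 - p) * l powr p) * indicator B x"
        using o by (cases "x \<in> B") auto
    qed
    also have "\<dots> = ennreal (p * l powr (p - 1)) * (\<integral>\<^sup>+x. ennreal (\<rho> x) \<partial>m) + ennreal ((1 - p) * l powr p) * ennreal b"
      using B by (simp add: nn_integral_add nn_integral_cmult eb)
    also have "(\<integral>\<^sup>+x. ennreal (\<rho> x) \<partial>m) \<le> 1"
      using le[of "space m"] \<mu>.emeasure_space_1 sets_eq_imp_space_eq[OF \<mu>(2)] by (simp cong: nn_integral_cong)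
    also have "ennreal (p * l powr (p - 1)) * 1 + ennreal ((1 - p) * l powr p) * ennreal b = ennreal (l powr (p - 1))"
    proof -
      have "l powr p * b = l powr (p - 1)" using b powr_add[of l "p - 1" 1] l by (simp add: l_def)
      then have "(1 - p) * l powr p * b = (1 - p) * l powr (p - 1)" by simp
      then have "p * l powr (p - 1) + (1 - p) * l powr p * b = l powr (p - 1)" by (simp only:) (simp add: algebra_simps)
      then show ?thesis using p b by (simp add: ennreal_mult'[symmetric] ennreal_plus[symmetric] del: ennreal_plus)
    qed
    also have "l powr (p - 1) = b powr (1 / N)"
      using b by (simp add: l_def p_def powr_divide powr_minus_divide)
    finally show ?thesis unfolding R b_def by (simp add: add_right_mono mult_left_mono)
  qed
qed

lemma mms_sets: "metric_measure_space m \<Longrightarrow> sets m = sets borel"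
  and mms_bounded: "metric_measure_space m \<Longrightarrow> B \<in> sets borel \<Longrightarrow> bounded B \<Longrightarrow> emeasure m B < \<infinity>"
  by (simp_all add: metric_measure_space_def)

lemma mms_space: "metric_measure_space m \<Longrightarrow> space m = UNIV"
  by (rule space_UNIV_borel[OF mms_sets])

lemma mms_sigma_finite:
  assumes "metric_measure_space (m :: 'a::polish_space measure)"
  shows "sigma_finite_measure m"
proof
  fix x0 :: 'a
  have "emeasure m (cball x0 (real n)) \<noteq> \<infinity>" for n :: nat
    using mms_bounded[OF assms, of "cball x0 (real n)"] by (simp add: less_top)
  moreover have "(\<Union>n. cball x0 (real n)) = UNIV"
    using real_arch_simple by (auto simp: set_eq_iff)
  ultimately show "\<exists>A. countable A \<and> A \<subseteq> sets m \<and> \<Union> A = space m \<and> (\<forall>a\<in>A. emeasure m a \<noteq> \<infinity>)"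
    by (intro exI[of _ "range (\<lambda>n::nat. cball x0 (real n))"]) (auto simp: mms_sets[OF assms] mms_space[OF assms])
qed

text \<open>An inequality of Brunn-Minkowski type. MCP is applied to the normalised restriction of
  \<open>m\<close> to \<open>A\<close>, and the Renyi functional at time \<open>t\<close> is at most
  a power of the volume of any set that catches the intermediate points. Allowing every such Borel
  set \<open>B\<close> avoids the question whether the set of intermediate points is
  measurable.\<close>

lemma MCP_volume:
  fixes m :: "'a::polish_space measure"
  assumes mms: "metric_measure_space m" and supp: "msupp m = UNIV" and N: "1 < N" and mcp: "MCP K N m"
    and A: "A \<in> sets borel" "A \<subseteq> cball z D" "0 < measure m A" and t: "0 \<le> t" "t < 1"
    and B: "B \<in> sets borel" "emeasure m B < \<infinity>"
    and geo: "\<And>\<gamma>. \<gamma> \<in> Geo \<Longrightarrow> apply_bcontfun \<gamma> 0 \<in> A \<Longrightarrow> apply_bcontfun \<gamma> 1 = z \<Longrightarrow> apply_bcontfun \<gamma> t \<in> B"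
  shows "contraction K N D t powr N * measure m A \<le> measure m B"
proof -
  define \<kappa> where "\<kappa> = contraction K N D t"
  have \<kappa>: "0 < \<kappa>" unfolding \<kappa>_def by (rule contraction_pos[OF t(2)])
  note Sm = mms_sets[OF mms]
  have bA: "bounded A" using A(2) bounded_cball bounded_subset by blast
  have eA: "emeasure m A = ennreal (measure m A)"
    using mms_bounded[OF mms A(1) bA] by (simp add: emeasure_eq_ennreal_measure less_top)
  define a where "a = measure m A"
  have a: "0 < a" using A(3) by (simp add: a_def)
  define \<rho> where "\<rho> = (\<lambda>x. indicator A x / a)"
  have \<rho>: "\<rho> \<in> borel_measurable borel" "\<And>x. 0 \<le> \<rho> x" unfolding \<rho>_def using A(1) a by auto
  define \<mu> where "\<mu> = density m (\<lambda>x. ennreal (\<rho> x))"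
  have \<rho>m: "(\<lambda>x. ennreal (\<rho> x)) \<in> borel_measurable m"
    by (rule measurable_sets_transfer[OF _ Sm]) (use \<rho>(1) in measurable)
  have e\<mu>: "emeasure \<mu> E = ennreal (1 / a) * emeasure m (A \<inter> E)" if E: "E \<in> sets borel" for E
  proof -
    have "emeasure \<mu> E = (\<integral>\<^sup>+x. ennreal (1 / a) * indicator (A \<inter> E) x \<partial>m)"
      unfolding \<mu>_def using E Sm \<rho>m by (subst emeasure_density) (auto simp: \<rho>_def intro!: nn_integral_cong split: split_indicator)
    then show ?thesis using E A Sm by (simp add: nn_integral_cmult_indicator)
  qed
  have sp\<mu>: "space \<mu> = UNIV" "sets \<mu> = sets borel" by (simp_all add: \<mu>_def mms_space[OF mms] Sm)
  have P\<mu>: "prob_space \<mu>"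
    using e\<mu>[of UNIV] a eA by (intro prob_spaceI) (simp add: sp\<mu> a_def[symmetric] ennreal_mult'[symmetric])
  have ac: "absolutely_continuous m \<mu>"
    unfolding absolutely_continuous_def using e\<mu> sp\<mu> Sm emeasure_mono[of "A \<inter> _" _ m]
    by (auto simp: null_sets_def) (metis Int_lower2 emeasure_mono le_zero_eq)
  have "msupp \<mu> \<subseteq> closure A"
  proof
    fix x assume x: "x \<in> msupp \<mu>"
    show "x \<in> closure A"
    proof (rule ccontr)
      assume "x \<notin> closure A"
      then have "emeasure \<mu> (- closure A) > 0"
        using x[unfolded msupp_def, simplified, rule_format, of "- closure A"] by (simp add: open_Compl)
      moreover have "A \<inter> - closure A = {}" using closure_subset[of A] by auto
      ultimately show False using e\<mu>[of "- closure A"] by simp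
    qed
  qed
  then have "bounded (msupp \<mu>)" using bounded_closure[OF bA] bounded_subset by blast
  moreover have "\<mu> \<in> Prob_ac m" using P\<mu> ac sp\<mu> by (simp add: Prob_ac_def Prob_def)
  ultimately obtain \<nu> where \<nu>: "\<nu> \<in> OptGeo \<mu> (return borel z)"
    and ren: "(\<integral>\<^sup>+x. tau K N (1 - t) (dist x z) * ennreal (\<rho> x powr (1 - 1 / N)) \<partial>m) \<le> renyi_functional m N (distr \<nu> borel (eval_at t))"
    using mcp[unfolded MCP_def, rule_format, of z \<rho> \<mu>] \<rho> supp t unfolding \<mu>_def by auto
  have n: "prob_space \<nu>" "sets \<nu> = sets Geo_borel" "distr \<nu> borel (eval_at 0) = \<mu>" "distr \<nu> borel (eval_at 1) = return borel z"
    using \<nu> unfolding OptGeo_def by auto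
  note ev = eval_meas_Geo[OF n(2)]
  have "AE x in \<mu>. x \<in> A"
    using e\<mu>[of "- A"] A(1) by (intro AE_I[of _ _ "- A"]) (auto simp: sp\<mu>)
  then have 1: "AE \<gamma> in \<nu>. eval_at 0 \<gamma> \<in> A" unfolding n(3)[symmetric] by (rule AE_distr_vimage[OF ev])
  have "AE x in return borel z. x = z" by (subst AE_return) auto
  then have 2: "AE \<gamma> in \<nu>. eval_at 1 \<gamma> = z" unfolding n(4)[symmetric] by (rule AE_distr_vimage[OF ev])
  have "AE \<gamma> in \<nu>. \<gamma> \<in> Geo" using sets_eq_imp_space_eq[OF n(2)] by (intro AE_I2) (simp add: space_restrict_space)
  with 1 2 have "AE \<gamma> in \<nu>. eval_at t \<gamma> \<in> B" by eventually_elim (rule geo)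
  then have "AE x in distr \<nu> borel (eval_at t). x \<in> B" using ev B(1) by (subst AE_distr_iff) auto
  then have z: "emeasure (distr \<nu> borel (eval_at t)) (space m - B) = 0"
    using B(1) by (subst AE_iff_measurable[symmetric, where P="\<lambda>x. x \<in> B"]) (auto simp: mms_space[OF mms])
  have up: "renyi_functional m N (distr \<nu> borel (eval_at t)) \<le> ennreal (measure m B powr (1 / N))"
    using z B N n(1) ev by (intro renyi_le_volume mms_sigma_finite[OF mms]) (auto simp: Sm intro: prob_space.prob_space_distr)
  have "ennreal (\<kappa> * a powr (1 / N)) \<le> (\<integral>\<^sup>+x. tau K N (1 - t) (dist x z) * ennreal (\<rho> x powr (1 - 1 / N)) \<partial>m)"
  proof -
    have "ennreal (\<kappa> * a powr (1 / N)) = ennreal (\<kappa> * (1 / a) powr (1 - 1 / N)) * ennreal a"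
    proof -
      have "(1 / a) powr (1 - 1 / N) * a = a powr (1 / N)"
        using a powr_add[of a "1 / N - 1" 1] by (simp add: powr_divide powr_minus_divide[symmetric])
      then show ?thesis using a \<kappa> by (simp add: ennreal_mult'[symmetric] mult.assoc)
    qed
    also have "\<dots> = (\<integral>\<^sup>+x. ennreal (\<kappa> * (1 / a) powr (1 - 1 / N)) * indicator A x \<partial>m)"
      using A(1) Sm eA by (simp add: nn_integral_cmult_indicator a_def)
    also have "\<dots> \<le> (\<integral>\<^sup>+x. tau K N (1 - t) (dist x z) * ennreal (\<rho> x powr (1 - 1 / N)) \<partial>m)"
    proof (rule nn_integral_mono)
      fix x
      have "ennreal \<kappa> * ennreal ((1 / a) powr (1 - 1 / N)) \<le> tau K N (1 - t) (dist x z) * ennreal ((1 / a) powr (1 - 1 / N))" if "x \<in> A"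
        unfolding \<kappa>_def using that A(2) by (intro mult_right_mono tau_ge_contraction[OF N t]) (auto simp: dist_commute)
      then show "ennreal (\<kappa> * (1 / a) powr (1 - 1 / N)) * indicator A x \<le> tau K N (1 - t) (dist x z) * ennreal (\<rho> x powr (1 - 1 / N))"
        using \<kappa> by (cases "x \<in> A") (simp_all add: \<rho>_def ennreal_mult)
    qed
    finally show ?thesis .
  qed
  also note ren
  also note up
  finally have "\<kappa> * a powr (1 / N) \<le> measure m B powr (1 / N)" by simp
  then have "(\<kappa> * a powr (1 / N)) powr N \<le> (measure m B powr (1 / N)) powr N"
    using \<kappa> N by (intro powr_mono2) auto
  then show ?thesis using \<kappa> a N by (simp add: powr_mult powr_powr \<kappa>_def a_def)
qed

section \<open>Intermediate plans with bounded density\<close>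

lemma compact_bounded_functions: "compact {f :: 'i \<Rightarrow> real. \<forall>i. f i \<in> {0..A}}"
proof -
  have "compactin (product_topology (\<lambda>_::'i. euclidean) UNIV) (PiE UNIV (\<lambda>_. {0..A}))"
    by (subst compactin_PiE) (auto simp: compactin_euclidean_iff)
  moreover have "PiE UNIV (\<lambda>_. {0..A}) = {f :: 'i \<Rightarrow> real. \<forall>i. f i \<in> {0..A}}" by (auto simp: PiE_def)
  ultimately show ?thesis by (simp only: euclidean_product_topology compactin_euclidean_iff)
qed

text \<open>A feasible flow that minimises the weighted sum of squared loads sends mass only to neighbours of
  least relative load. The columns of maximal relative load are then the only neighbours of the rows
  they serve, so Hall's condition bounds that load by one.\<close>

lemma fractional_hall:
  fixes a :: "'i \<Rightarrow> real" and b :: "'j \<Rightarrow> real"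
  assumes fin: "finite I" "finite J" and a: "\<And>i. i \<in> I \<Longrightarrow> 0 \<le> a i" and b: "\<And>j. j \<in> J \<Longrightarrow> 0 < b j"
    and hall: "\<And>S. S \<subseteq> I \<Longrightarrow> sum a S \<le> sum b {j\<in>J. \<exists>i\<in>S. E i j}"
  shows "\<exists>f. (\<forall>i j. 0 \<le> f i j) \<and> (\<forall>i j. 0 < f i j \<longrightarrow> i \<in> I \<and> j \<in> J \<and> E i j) \<and>
    (\<forall>i\<in>I. (\<Sum>j\<in>J. f i j) = a i) \<and> (\<forall>j\<in>J. (\<Sum>i\<in>I. f i j) \<le> b j)"
proof -
  \<comment> \<open>A bound for every entry of a feasible flow, which makes the set of feasible
    flows compact.\<close>
  define A where "A = sum a I"
  define G where "G = {f :: 'i \<times> 'j \<Rightarrow> real. \<forall>p. f p \<in> {0..A}} \<inter>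
    (\<Inter>p\<in>{p. \<not> (fst p \<in> I \<and> snd p \<in> J \<and> E (fst p) (snd p))}. {f. f p = 0}) \<inter> (\<Inter>i\<in>I. {f. (\<Sum>j\<in>J. f (i, j)) = a i})"
  have ev: "continuous_on UNIV (\<lambda>f :: 'i \<times> 'j \<Rightarrow> real. f p)" for p by (rule continuous_on_product_coordinates)
  have G: "compact G" unfolding G_def
    by (intro compact_Int_closed compact_bounded_functions closed_INT ballI closed_Collect_eq continuous_intros ev)
  have GI: "f \<in> G" if "\<And>p. 0 \<le> f p" "\<And>i j. \<not> (i \<in> I \<and> j \<in> J \<and> E i j) \<Longrightarrow> f (i, j) = 0" "\<And>i. i \<in> I \<Longrightarrow> (\<Sum>j\<in>J. f (i, j)) = a i" for f
  proof -
    have "f (i, j) \<le> A" for i j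
    proof (cases "i \<in> I \<and> j \<in> J")
      case True
      then have "f (i, j) \<le> (\<Sum>j\<in>J. f (i, j))" using that(1) fin by (intro member_le_sum) auto
      also have "\<dots> \<le> A" using True that(3) a fin by (auto simp: A_def intro: member_le_sum)
      finally show ?thesis .
    next
      case False
      then have "f (i, j) = 0" using that(2) by blast
      then show ?thesis using a by (simp add: A_def sum_nonneg)
    qed
    then show ?thesis using that by (auto simp: G_def)
  qed
  have GD: "0 \<le> f p" "0 < f (i, j) \<Longrightarrow> i \<in> I \<and> j \<in> J \<and> E i j" "i \<in> I \<Longrightarrow> (\<Sum>j\<in>J. f (i, j)) = a i" if "f \<in> G" for f p i j
  proof -
    show "0 \<le> f p" using that by (cases p) (auto simp: G_def)
    show "i \<in> I \<Longrightarrow> (\<Sum>j\<in>J. f (i, j)) = a i" using that by (auto simp: G_def)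
    have "f (i, j) = 0" if "\<not> (i \<in> I \<and> j \<in> J \<and> E i j)"
      using \<open>f \<in> G\<close> that by (auto simp: G_def)
    then show "0 < f (i, j) \<Longrightarrow> i \<in> I \<and> j \<in> J \<and> E i j" by (metis less_irrefl)
  qed
  have "\<exists>j\<in>J. E i j" if "i \<in> I" "0 < a i" for i
  proof (rule ccontr)
    assume "\<not> ?thesis"
    then have eq: "{j\<in>J. \<exists>i'\<in>{i}. E i' j} = {}" by auto
    show False using hall[of "{i}"] that unfolding eq by simp
  qed
  then obtain n where n: "\<And>i. i \<in> I \<Longrightarrow> 0 < a i \<Longrightarrow> n i \<in> J \<and> E i (n i)" by metis
  have "(\<lambda>(i, j). if i \<in> I \<and> 0 < a i \<and> j = n i then a i else 0) \<in> G"
  proof (rule GI)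
    fix i assume i: "i \<in> I"
    show "(\<Sum>j\<in>J. (case (i, j) of (i, j) \<Rightarrow> if i \<in> I \<and> 0 < a i \<and> j = n i then a i else 0)) = a i"
      using i n[OF i] a[OF i] fin by (cases "0 < a i") (auto simp: sum.delta)
  qed (use n in \<open>auto split: if_splits\<close>)
  then have Gne: "G \<noteq> {}" by auto
  define col where "col f j = (\<Sum>i\<in>I. f (i, j))" for f :: "'i \<times> 'j \<Rightarrow> real" and j
  define \<Phi> where "\<Phi> f = (\<Sum>j\<in>J. (col f j)\<^sup>2 / b j)" for f
  have "continuous_on G \<Phi>"
    unfolding \<Phi>_def col_def by (rule continuous_on_subset[of UNIV]) (auto intro!: continuous_intros ev simp: b less_imp_neq[OF b, symmetric])
  then obtain f where f: "f \<in> G" and fmin: "\<And>g. g \<in> G \<Longrightarrow> \<Phi> f \<le> \<Phi> g"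
    using continuous_attains_inf[OF G Gne] by metis
  have load: "col f j / b j \<le> col f j' / b j'" if ij: "0 < f (i, j)" and j': "j' \<in> J" "E i j'" for i j j'
  proof (rule ccontr)
    assume "\<not> ?thesis"
    then have d: "0 < col f j / b j - col f j' / b j'" (is "0 < ?d") by simp
    have i: "i \<in> I" "j \<in> J" "E i j" using GD(2)[OF f ij] by auto
    have ne: "j \<noteq> j'" using d by auto
    define w where "w = 1 / b j + 1 / b j'"
    have w: "0 < w" using b i j' by (simp add: w_def add_pos_pos)
    \<comment> \<open>Moving \<open>e\<close> from column \<open>j\<close> to column
      \<open>j'\<close> changes \<Phi> by \<open>- 2 * (e * ?d) + e * (e * w)\<close>. The bound
      \<open>e * w \<le> ?d\<close> makes this negative, and \<open>e \<le> f (i, j)\<close> keeps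
      the flow nonnegative.\<close>
    define e where "e = min (f (i, j)) (?d / w)"
    have e: "0 < e" "e \<le> f (i, j)" "e * w \<le> ?d"
    proof -
      show "0 < e" using ij d w by (simp add: e_def)
      show "e \<le> f (i, j)" by (simp add: e_def)
      have "e * w \<le> (?d / w) * w" using w by (intro mult_right_mono) (auto simp: e_def)
      then show "e * w \<le> ?d" using w by simp
    qed
    define g where "g = f((i, j) := f (i, j) - e, (i, j') := f (i, j') + e)"
    define x where "x k = (if k = j' then e else 0) - (if k = j then e else 0)" for k
    have gx: "g (i', k) = f (i', k) + (if i' = i then x k else 0)" for i' k
      using ne by (auto simp: g_def x_def)
    have gG: "g \<in> G"
    proof (rule GI)
      show "0 \<le> g p" for p using GD(1)[OF f, of p] GD(1)[OF f, of "(i, j')"] e by (auto simp: g_def)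
      show "g (i', k) = 0" if "\<not> (i' \<in> I \<and> k \<in> J \<and> E i' k)" for i' k
      proof -
        have "f (i', k) = 0" using GD(1)[OF f, of "(i', k)"] GD(2)[OF f, of i' k] that by (auto simp: less_le)
        then show ?thesis using that i j' by (auto simp: gx x_def)
      qed
      show "(\<Sum>k\<in>J. g (i', k)) = a i'" if "i' \<in> I" for i'
      proof -
        have "sum x J = 0" using i j' fin by (simp add: x_def sum_subtractf)
        then show ?thesis using GD(3)[OF f that] by (cases "i' = i") (simp_all add: gx sum.distrib)
      qed
    qed
    have colg: "col g k = col f k + x k" for k
      unfolding col_def gx using i fin by (simp add: sum.distrib)
    have "\<Phi> g = (\<Sum>k\<in>J. (col f k)\<^sup>2 / b k + 2 * (col f k / b k) * x k + (x k)\<^sup>2 / b k)"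
      unfolding \<Phi>_def colg by (intro sum.cong refl) (simp add: power2_eq_square algebra_simps add_divide_distrib)
    also have "\<dots> = \<Phi> f + 2 * (\<Sum>k\<in>J. col f k / b k * x k) + (\<Sum>k\<in>J. (x k)\<^sup>2 / b k)"
      by (simp add: sum.distrib \<Phi>_def sum_distrib_left mult.assoc)
    also have "(\<Sum>k\<in>J. col f k / b k * x k) = e * (col f j' / b j') - e * (col f j / b j)"
    proof -
      have "(\<Sum>k\<in>J. col f k / b k * x k) = (\<Sum>k\<in>J. (if k = j' then e * (col f k / b k) else 0) - (if k = j then e * (col f k / b k) else 0))"
        by (intro sum.cong) (auto simp: x_def)
      then show ?thesis using i j' fin by (simp add: sum_subtractf)
    qed
    also have "(\<Sum>k\<in>J. (x k)\<^sup>2 / b k) = e\<^sup>2 * w"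
    proof -
      have "(\<Sum>k\<in>J. (x k)\<^sup>2 / b k) = (\<Sum>k\<in>J. (if k = j' then e\<^sup>2 / b k else 0) + (if k = j then e\<^sup>2 / b k else 0))"
        using ne by (intro sum.cong) (auto simp: x_def)
      then show ?thesis using i j' fin by (simp add: sum.distrib w_def algebra_simps)
    qed
    finally have "\<Phi> g = \<Phi> f - 2 * (e * ?d) + e * (e * w)" by (simp add: algebra_simps power2_eq_square)
    moreover have "e * (e * w) \<le> e * ?d" using e by (intro mult_left_mono) auto
    moreover have "0 < e * ?d" using e d by simp
    ultimately have "\<Phi> g < \<Phi> f" by linarith
    then show False using fmin[OF gG] by simp
  qed
  have colb: "col f j \<le> b j" if "j \<in> J" for j
  proof (rule ccontr)
    assume "\<not> col f j \<le> b j"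
    then have gt: "1 < col f j / b j" using b[OF that] by simp
    define L where "L = Max ((\<lambda>j. col f j / b j) ` J)"
    have L: "col f j / b j \<le> L" if "j \<in> J" for j using that fin by (auto simp: L_def)
    have L1: "1 < L" using L[OF that] gt by simp
    define Jm where "Jm = {j\<in>J. col f j / b j = L}"
    have "L \<in> (\<lambda>j. col f j / b j) ` J" unfolding L_def using that fin by (intro Max_in) auto
    then have Jne: "Jm \<noteq> {}" by (auto simp: Jm_def)
    have Jm: "finite Jm" "Jm \<subseteq> J" using fin by (auto simp: Jm_def)
    define Im where "Im = {i\<in>I. \<exists>j\<in>Jm. 0 < f (i, j)}"
    have sub: "{j\<in>J. \<exists>i\<in>Im. E i j} \<subseteq> Jm"
    proof
      fix j' assume "j' \<in> {j\<in>J. \<exists>i\<in>Im. E i j}"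
      then obtain i j where "j' \<in> J" "E i j'" "j \<in> Jm" "0 < f (i, j)" by (auto simp: Im_def)
      then show "j' \<in> Jm" using load[of i j j'] L[of j'] by (auto simp: Jm_def)
    qed
    have "L * sum b Jm = (\<Sum>j\<in>Jm. col f j)"
      unfolding sum_distrib_left using b Jm by (intro sum.cong) (auto simp: Jm_def less_imp_neq[OF b, symmetric])
    also have "\<dots> = (\<Sum>j\<in>Jm. \<Sum>i\<in>Im. f (i, j))"
      unfolding col_def
    proof (rule sum.cong[OF refl], rule sum.mono_neutral_right[OF fin(1)])
      fix j assume "j \<in> Jm"
      then show "\<forall>i\<in>I - Im. f (i, j) = 0" using GD(1)[OF f] by (auto simp: Im_def less_le)
    qed (auto simp: Im_def)
    also have "\<dots> = (\<Sum>i\<in>Im. \<Sum>j\<in>Jm. f (i, j))" by (rule sum.swap)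
    also have "\<dots> \<le> (\<Sum>i\<in>Im. \<Sum>j\<in>J. f (i, j))"
      using Jm fin GD(1)[OF f] by (intro sum_mono sum_mono2) auto
    also have "\<dots> = sum a Im" using GD(3)[OF f] by (intro sum.cong) (auto simp: Im_def)
    also have "\<dots> \<le> sum b {j\<in>J. \<exists>i\<in>Im. E i j}" by (rule hall) (auto simp: Im_def)
    also have "\<dots> \<le> sum b Jm" using sub Jm b by (intro sum_mono2) (auto simp: less_imp_le subset_eq)
    finally have "L * sum b Jm \<le> sum b Jm" .
    moreover have "0 < sum b Jm" using Jne Jm b by (intro sum_pos) auto
    ultimately show False using L1 by simp
  qed
  show ?thesis
    using GD[OF f] colb by (intro exI[of _ "\<lambda>i j. f (i, j)"]) (auto simp: col_def)
qed

lemma msub_limit_marginal: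
  fixes M :: "nat \<Rightarrow> 'b::{complete_space,second_countable_topology} measure"
    and m :: "'a::polish_space measure"
  assumes mms: "metric_measure_space m" and w: "wconv M L" and S: "\<And>j. sets (M j) = sets borel" "sets L = sets borel"
    and L: "finite_measure L" and p: "continuous_on UNIV p" and s: "\<And>j. msub (distr (M j) borel p) (scale_measure (ennreal C) m)"
  shows "msub (distr L borel p) (scale_measure (ennreal C) m)"
proof (rule wconv_msub[OF wconv_distr[OF w p S] _ _ s])
  show "finite_measure (distr L borel p)" using L cont_measurable[OF p S(2)] by (rule finite_measure.finite_measure_distr)
  show "emeasure (scale_measure (ennreal C) m) B < \<infinity>" if "B \<in> sets borel" "bounded B" for B
    using mms_bounded[OF mms that] by (simp add: ennreal_mult_less_top)
qed (simp_all add: mms_sets[OF mms])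

lemma nn_integral_cells:
  fixes g :: "nat \<Rightarrow> ennreal"
  assumes "finite (ix ` W)" "\<And>k. {x\<in>W. ix x = k} \<in> sets M"
  shows "(\<integral>\<^sup>+y. (if y \<in> W then g (ix y) else 0) \<partial>M) = (\<Sum>k\<in>ix ` W. g k * emeasure M {x\<in>W. ix x = k})"
proof -
  have "(\<integral>\<^sup>+y. (if y \<in> W then g (ix y) else 0) \<partial>M) = (\<integral>\<^sup>+y. (\<Sum>k\<in>ix ` W. g k * indicator {x\<in>W. ix x = k} y) \<partial>M)"
  proof (rule nn_integral_cong)
    fix y
    have "(\<Sum>k\<in>ix ` W. g k * indicator {x\<in>W. ix x = k} y) = (\<Sum>k\<in>ix ` W. if k = ix y then (if y \<in> W then g k else 0) else 0)"
      by (intro sum.cong) (auto split: split_indicator)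
    then show "(if y \<in> W then g (ix y) else 0) = (\<Sum>k\<in>ix ` W. g k * indicator {x\<in>W. ix x = k} y)"
      using assms(1) by (auto simp: sum.delta)
  qed
  also have "\<dots> = (\<Sum>k\<in>ix ` W. g k * emeasure M {x\<in>W. ix x = k})"
    using assms by (subst nn_integral_sum) (auto simp: nn_integral_cmult_indicator)
  finally show ?thesis .
qed

text \<open>The ball is cut into finitely many small cells. A row is a cell with its mass under
  \<mu>, a column is a cell with capacity \<open>C / \<kappa>\<close> times its volume, and an edge
  joins two cells that contain a point and its intermediate point at time \<open>t\<close>. Hall's
  condition is \<open>MCP_volume\<close> for unions of cells, and the flow is spread over products
  of cells.\<close>

lemma approximate_intermediate_plan:
  fixes m :: "'a::polish_space measure"
  assumes mms: "metric_measure_space m" and supp: "msupp m = UNIV" and N: "1 < N" and mcp: "MCP K N m"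
    and \<mu>: "finite_measure \<mu>" "sets \<mu> = sets borel" "msub \<mu> (scale_measure (ennreal C) m)" "0 < C"
    and bd: "AE x in \<mu>. x \<in> cball z D" and t: "0 \<le> t" "t < 1" and e: "0 < e"
  shows "\<exists>P. sets P = sets borel \<and> distr P borel fst = \<mu> \<and>
    msub (distr P borel snd) (scale_measure (ennreal (C / contraction K N D t powr N)) m) \<and>
    (AE y in P. fst y \<in> cball z D \<and> snd y \<in> cball z D \<and> \<bar>dist (fst y) (snd y) - t * dist (fst y) z\<bar> \<le> 3 * e \<and>
      \<bar>dist (snd y) z - (1 - t) * dist (fst y) z\<bar> \<le> 3 * e)"
proof -
  interpret \<mu>: finite_measure \<mu> by fact
  interpret m: sigma_finite_measure m by (rule mms_sigma_finite[OF mms])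
  interpret pr: pair_sigma_finite \<mu> m by unfold_locales
  note Sm = mms_sets[OF mms] and spm = mms_space[OF mms] and sp\<mu> = space_UNIV_borel[OF \<mu>(2)]
  define \<kappa> where "\<kappa> = contraction K N D t powr N"
  have \<kappa>: "0 < \<kappa>" unfolding \<kappa>_def using contraction_pos[OF t(2), of K N D] by simp
  \<comment> \<open>Points between \<open>x\<close> and \<open>z\<close> stay in the ball around
    \<open>z\<close>, so cells inside \<open>W\<close> suffice.\<close>
  define W where "W = cball z D"
  have W: "compact W" using mms by (auto simp: W_def metric_measure_space_def)
  have Wb: "W \<in> sets borel" by (simp add: W_def)
  obtain ix :: "'a \<Rightarrow> nat" where ix: "ix \<in> borel \<rightarrow>\<^sub>M count_space UNIV" and ixd: "\<And>x y. ix x = ix y \<Longrightarrow> dist x y < e"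
    and ixf: "\<And>K. compact K \<Longrightarrow> finite (ix ` K)"
    using cell_index[OF e] by blast
  define I where "I = ix ` W"
  have I: "finite I" unfolding I_def by (rule ixf[OF W])
  define c where "c k = {x\<in>W. ix x = k}" for k
  have cb: "c k \<in> sets borel" for k
  proof -
    have "c k = W \<inter> ix -` {k}" by (auto simp: c_def)
    then show ?thesis using measurable_sets[OF ix, of "{k}"] Wb by auto
  qed
  have cm: "c k \<in> sets m" "c k \<in> sets \<mu>" for k using cb Sm \<mu>(2) by auto
  define a where "a k = measure \<mu> (c k)" for k
  define mc where "mc k = measure m (c k)" for k
  have em: "emeasure m B = ennreal (measure m B)" if "B \<in> sets borel" "B \<subseteq> W" for B
    using mms_bounded[OF mms that(1) bounded_subset[OF compact_imp_bounded[OF W] that(2)]] by (simp add: emeasure_eq_ennreal_measure less_top)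
  have ec: "emeasure m (c k) = ennreal (mc k)" "emeasure \<mu> (c k) = ennreal (a k)" for k
    using em[OF cb] by (auto simp: mc_def a_def c_def \<mu>.emeasure_eq_measure)
  have a0: "0 \<le> a k" and mc0: "0 \<le> mc k" for k by (simp_all add: a_def mc_def)
  \<comment> \<open>\<open>fractional_hall\<close> wants positive capacities; cells of volume zero
    add nothing to the volume of a union.\<close>
  define J where "J = {k\<in>I. 0 < mc k}"
  have J: "finite J" "J \<subseteq> I" using I by (auto simp: J_def)
  define E where "E i j \<longleftrightarrow> (\<exists>x\<in>c i. \<exists>y\<in>c j. dist x y = t * dist x z \<and> dist y z = (1 - t) * dist x z)" for i j
  define b where "b k = C / \<kappa> * mc k" for k
  have um: "emeasure m (\<Union>k\<in>S. c k) = ennreal (sum mc S)" "emeasure \<mu> (\<Union>k\<in>S. c k) = ennreal (sum a S)" if "S \<subseteq> I" for S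
  proof -
    have f: "finite S" "disjoint_family_on c S" using that I finite_subset by (auto simp: disjoint_family_on_def c_def)
    show "emeasure m (\<Union>k\<in>S. c k) = ennreal (sum mc S)" "emeasure \<mu> (\<Union>k\<in>S. c k) = ennreal (sum a S)"
      using f cm mc0 a0 by (subst sum_emeasure[symmetric]; auto simp: ec sum_ennreal)+
  qed
  have hall: "sum a S \<le> sum b {j\<in>J. \<exists>i\<in>S. E i j}" if S: "S \<subseteq> I" for S
  proof -
    define A where "A = (\<Union>k\<in>S. c k)"
    define B where "B = (\<Union>k\<in>{j\<in>I. \<exists>i\<in>S. E i j}. c k)"
    have AB: "A \<in> sets borel" "B \<in> sets borel" "A \<subseteq> W" "B \<subseteq> W"
      using cb I S by (auto simp: A_def B_def c_def intro!: sets.finite_UN finite_subset[OF _ I])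
    have "ennreal (sum a S) \<le> ennreal C * ennreal (sum mc S)"
      using msub_emeasure[OF \<mu>(3), of A] um[OF S] by (simp add: A_def)
    then have le: "sum a S \<le> C * sum mc S" using \<mu>(4) sum_nonneg[of S mc] mc0 by (simp add: ennreal_mult'[symmetric])
    have mA: "measure m A = sum mc S"
      using um(1)[OF S] sum_nonneg[of S mc] mc0 by (simp add: measure_def A_def)
    have mB: "measure m B = sum mc {j\<in>I. \<exists>i\<in>S. E i j}"
      using um(1)[of "{j\<in>I. \<exists>i\<in>S. E i j}"] sum_nonneg[of "{j\<in>I. \<exists>i\<in>S. E i j}" mc] mc0 by (simp add: measure_def B_def)
    have sb: "sum b {j\<in>J. \<exists>i\<in>S. E i j} = C / \<kappa> * measure m B"
    proof -
      have "sum mc {j\<in>I. \<exists>i\<in>S. E i j} = sum mc {j\<in>J. \<exists>i\<in>S. E i j}"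
        using I mc0 by (intro sum.mono_neutral_right) (auto simp: J_def less_le)
      then show ?thesis unfolding mB b_def by (simp add: sum_distrib_left)
    qed
    have "\<kappa> * measure m A \<le> measure m B"
    proof (cases "0 < measure m A")
      case True
      show ?thesis unfolding \<kappa>_def
      proof (rule MCP_volume[OF mms supp N mcp AB(1) _ True t AB(2)])
        show "A \<subseteq> cball z D" using AB by (simp add: W_def)
        show "emeasure m B < \<infinity>" using em[OF AB(2,4)] by simp
        fix \<gamma> :: "real \<Rightarrow>\<^sub>C 'a" assume g: "\<gamma> \<in> Geo" "apply_bcontfun \<gamma> 0 \<in> A" "apply_bcontfun \<gamma> 1 = z"
        let ?x = "apply_bcontfun \<gamma> 0" and ?y = "apply_bcontfun \<gamma> t"
        have d: "dist ?x ?y = t * dist ?x z" "dist ?y z = (1 - t) * dist ?x z"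
          using GeoD(1)[OF g(1), of t 0] GeoD(1)[OF g(1), of 1 t] t g(3) by auto
        have "dist ?x z \<le> D" using g(2) AB(3) by (auto simp: W_def dist_commute)
        moreover have "(1 - t) * dist ?x z \<le> 1 * dist ?x z" using t by (intro mult_right_mono) auto
        ultimately have "dist ?y z \<le> D" using d by simp
        then have yW: "?y \<in> W" by (simp add: W_def dist_commute)
        obtain i where i: "i \<in> S" "?x \<in> c i" using g(2) by (auto simp: A_def)
        have "E i (ix ?y)" unfolding E_def using i d yW by (intro bexI[of _ ?x] bexI[of _ ?y]) (auto simp: c_def)
        then show "?y \<in> B" using yW i by (auto simp: B_def I_def c_def)
      qed
    next
      case False
      then have "measure m A = 0" using measure_nonneg[of m A] by linarith
      then show ?thesis by simp
    qed
    then have "C * measure m A \<le> C / \<kappa> * measure m B" using \<kappa> \<mu>(4) by (simp add: field_simps)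
    then show ?thesis using le mA sb by simp
  qed
  obtain f where f0: "\<And>i j. 0 \<le> f i j" and fE: "\<And>i j. 0 < f i j \<Longrightarrow> i \<in> I \<and> j \<in> J \<and> E i j"
    and fr: "\<And>i. i \<in> I \<Longrightarrow> (\<Sum>j\<in>J. f i j) = a i" and fc: "\<And>j. j \<in> J \<Longrightarrow> (\<Sum>i\<in>I. f i j) \<le> b j"
  proof -
    have "0 < b j" if "j \<in> J" for j using that \<kappa> \<mu>(4) by (simp add: b_def J_def)
    from fractional_hall[OF I J(1) a0 this hall] show ?thesis using that by blast
  qed
  \<comment> \<open>The flow from cell \<open>i\<close> to cell \<open>j\<close>, written as a
    density with respect to the product of \<mu> and \<open>m\<close> that is constant on the
    product of the two cells.\<close>
  define w where "w i j = ennreal (f i j / (a i * mc j))" for i j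
  define h where "h y = (if fst y \<in> W then (if snd y \<in> W then w (ix (fst y)) (ix (snd y)) else 0) else 0)" for y :: "'a \<times> 'a"
  have ixm: "ix \<in> \<mu> \<rightarrow>\<^sub>M count_space UNIV" "ix \<in> m \<rightarrow>\<^sub>M count_space UNIV"
    using measurable_sets_transfer[OF ix] \<mu>(2) Sm by auto
  have hm: "h \<in> borel_measurable (\<mu> \<Otimes>\<^sub>M m)"
  proof -
    have 1: "(\<lambda>y. (ix (fst y), ix (snd y))) \<in> \<mu> \<Otimes>\<^sub>M m \<rightarrow>\<^sub>M count_space UNIV \<Otimes>\<^sub>M count_space UNIV"
      using ixm by measurable
    have "(\<lambda>y. w (ix (fst y)) (ix (snd y))) \<in> borel_measurable (\<mu> \<Otimes>\<^sub>M m)"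
      using measurable_compose[OF 1, of "\<lambda>p. w (fst p) (snd p)" borel] by (simp add: pair_measure_countable)
    moreover have "{y\<in>space (\<mu> \<Otimes>\<^sub>M m). fst y \<in> W} \<in> sets (\<mu> \<Otimes>\<^sub>M m)" "{y\<in>space (\<mu> \<Otimes>\<^sub>M m). snd y \<in> W} \<in> sets (\<mu> \<Otimes>\<^sub>M m)"
      using Wb Sm \<mu>(2) by measurable
    ultimately show ?thesis unfolding h_def by (intro measurable_If measurable_const) auto
  qed
  define P where "P = density (\<mu> \<Otimes>\<^sub>M m) h"
  have SP: "sets P = sets borel"
    unfolding P_def sets_density using sets_pair_measure_cong[OF \<mu>(2) Sm] by (simp only: borel_prod)
  \<comment> \<open>Row sums of the flow give the first marginal, column sums (in
    \<open>colm\<close>) the density bound for the second. Division by \<open>a\<close> asks for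
    cells of positive mass, and these carry all of \<mu>.\<close>
  have row: "(\<integral>\<^sup>+y. h (x, y) \<partial>m) = 1" if x: "x \<in> W" "a (ix x) \<noteq> 0" for x
  proof -
    have i: "ix x \<in> I" using x by (simp add: I_def)
    have "(\<integral>\<^sup>+y. h (x, y) \<partial>m) = (\<Sum>k\<in>I. w (ix x) k * ennreal (mc k))"
      using x nn_integral_cells[OF I[unfolded I_def], of m "w (ix x)"] cm(1)
      by (simp add: h_def I_def[symmetric] c_def[symmetric] ec cong: if_cong)
    also have "\<dots> = (\<Sum>k\<in>J. w (ix x) k * ennreal (mc k))"
      using I mc0 by (intro sum.mono_neutral_right) (auto simp: J_def less_le)
    also have "\<dots> = (\<Sum>k\<in>J. ennreal (f (ix x) k / a (ix x)))"
      unfolding w_def using a0 mc0 f0 by (intro sum.cong refl) (auto simp: J_def ennreal_mult'[symmetric])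
    also have "\<dots> = ennreal (a (ix x) / a (ix x))"
      using f0 a0 fr[OF i] by (subst sum_ennreal) (auto simp: sum_divide_distrib[symmetric])
    finally show ?thesis using x by simp
  qed
  have colm: "(\<integral>\<^sup>+x. h (x, y) \<partial>\<mu>) \<le> ennreal (C / \<kappa>)" for y
  proof (cases "y \<in> W \<and> ix y \<in> J")
    case True
    then have j: "0 < mc (ix y)" by (simp add: J_def)
    have "(\<integral>\<^sup>+x. h (x, y) \<partial>\<mu>) = (\<Sum>k\<in>I. w k (ix y) * ennreal (a k))"
      using True nn_integral_cells[OF I[unfolded I_def], of \<mu> "\<lambda>k. w k (ix y)"] cm(2)
      by (simp add: h_def I_def[symmetric] c_def[symmetric] ec cong: if_cong)
    also have "\<dots> \<le> (\<Sum>k\<in>I. ennreal (f k (ix y) / mc (ix y)))"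
      unfolding w_def using a0 mc0 f0 by (intro sum_mono) (auto simp: ennreal_mult'[symmetric] intro!: ennreal_leI)
    also have "\<dots> = ennreal ((\<Sum>k\<in>I. f k (ix y)) / mc (ix y))"
      using f0 mc0 by (subst sum_ennreal) (auto simp: sum_divide_distrib)
    also have "\<dots> \<le> ennreal (b (ix y) / mc (ix y))"
      using True fc[of "ix y"] j by (intro ennreal_leI divide_right_mono) auto
    also have "b (ix y) / mc (ix y) = C / \<kappa>" using j by (simp add: b_def)
    finally show ?thesis .
  next
    case False
    have "h (x, y) = 0" for x
    proof (cases "y \<in> W")
      case True
      then have "mc (ix y) = 0" using False mc0[of "ix y"] by (auto simp: J_def I_def less_le)
      then show ?thesis by (simp add: h_def w_def)
    qed (simp add: h_def)
    then show ?thesis by simp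
  qed
  have "AE x in \<mu>. \<forall>k. a k = 0 \<longrightarrow> x \<notin> c k"
    unfolding AE_all_countable
  proof
    fix k show "AE x in \<mu>. a k = 0 \<longrightarrow> x \<notin> c k"
      using ec(2)[of k] cm by (cases "a k = 0") (auto intro!: AE_I[where N="c k"])
  qed
  with bd have good: "AE x in \<mu>. x \<in> W \<and> a (ix x) \<noteq> 0" by eventually_elim (auto simp: W_def c_def)
  note fsm = fst_snd_meas[OF SP]
  have "distr P borel fst = \<mu>"
  proof (rule measure_eqI)
    fix A assume "A \<in> sets (distr P borel fst)"
    then have A: "A \<in> sets borel" "A \<in> sets \<mu>" using \<mu>(2) by auto
    have [measurable]: "fst -` A \<in> sets (\<mu> \<Otimes>\<^sub>M m)"
    proof -
      have "fst -` A = A \<times> space m" by (auto simp: spm)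
      then show ?thesis using A by simp
    qed
    have "emeasure (distr P borel fst) A = (\<integral>\<^sup>+y. h y * indicator (fst -` A) y \<partial>(\<mu> \<Otimes>\<^sub>M m))"
      using A fsm hm by (subst emeasure_distr) (auto simp: P_def emeasure_density space_pair_measure spm sp\<mu>)
    also have "\<dots> = (\<integral>\<^sup>+x. \<integral>\<^sup>+y. h (x, y) * indicator A x \<partial>m \<partial>\<mu>)"
      using hm by (subst m.nn_integral_fst[symmetric]) (auto intro!: nn_integral_cong split: split_indicator)
    also have "\<dots> = (\<integral>\<^sup>+x. indicator A x \<partial>\<mu>)"
    proof (intro nn_integral_cong_AE eventually_mono[OF good])
      fix x assume "x \<in> W \<and> a (ix x) \<noteq> 0"
      then show "(\<integral>\<^sup>+y. h (x, y) * indicator A x \<partial>m) = indicator A x" using row[of x] by (cases "x \<in> A") simp_all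
    qed
    finally show "emeasure (distr P borel fst) A = emeasure \<mu> A" using A by simp
  qed (simp add: \<mu>(2))
  moreover have "msub (distr P borel snd) (scale_measure (ennreal (C / \<kappa>)) m)"
  proof (rule msubI)
    fix A assume "A \<in> sets (scale_measure (ennreal (C / \<kappa>)) m)"
    then have A: "A \<in> sets borel" "A \<in> sets m" using Sm by auto
    have [measurable]: "snd -` A \<in> sets (\<mu> \<Otimes>\<^sub>M m)"
    proof -
      have "snd -` A = space \<mu> \<times> A" by (auto simp: sp\<mu>)
      then show ?thesis using A by simp
    qed
    have "emeasure (distr P borel snd) A = (\<integral>\<^sup>+y. h y * indicator (snd -` A) y \<partial>(\<mu> \<Otimes>\<^sub>M m))"
      using A fsm hm by (subst emeasure_distr) (auto simp: P_def emeasure_density space_pair_measure spm sp\<mu>)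
    also have "\<dots> = (\<integral>\<^sup>+y. \<integral>\<^sup>+x. h (x, y) * indicator A y \<partial>\<mu> \<partial>m)"
      using hm by (subst pr.nn_integral_snd[symmetric]) (auto intro!: nn_integral_cong split: split_indicator)
    also have "\<dots> \<le> (\<integral>\<^sup>+y. ennreal (C / \<kappa>) * indicator A y \<partial>m)"
    proof (rule nn_integral_mono)
      fix y show "(\<integral>\<^sup>+x. h (x, y) * indicator A y \<partial>\<mu>) \<le> ennreal (C / \<kappa>) * indicator A y"
        using colm[of y] by (cases "y \<in> A") simp_all
    qed
    finally show "emeasure (distr P borel snd) A \<le> emeasure (scale_measure (ennreal (C / \<kappa>)) m) A"
      using A by (simp add: nn_integral_cmult_indicator)
  qed (simp add: Sm)
  moreover have "AE y in P. fst y \<in> cball z D \<and> snd y \<in> cball z D \<and> \<bar>dist (fst y) (snd y) - t * dist (fst y) z\<bar> \<le> 3 * e \<and>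
      \<bar>dist (snd y) z - (1 - t) * dist (fst y) z\<bar> \<le> 3 * e"
    unfolding P_def
  proof (subst AE_density[OF hm], intro AE_I2 impI)
    fix y :: "'a \<times> 'a"
    obtain u v where y: "y = (u, v)" by (cases y)
    assume "0 < h y"
    then have uv: "u \<in> W" "v \<in> W" "0 < w (ix u) (ix v)" by (auto simp: h_def y split: if_splits)
    then have "f (ix u) (ix v) \<noteq> 0" by (auto simp: w_def)
    then have "0 < f (ix u) (ix v)" using f0[of "ix u" "ix v"] by simp
    then have "E (ix u) (ix v)" using fE by blast
    then obtain u' v' where "u' \<in> c (ix u)" "v' \<in> c (ix v)" and r: "dist u' v' = t * dist u' z" "dist v' z = (1 - t) * dist u' z"
      by (auto simp: E_def)
    then have d: "dist u u' < e" "dist v v' < e" by (auto simp: c_def intro!: ixd)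
    \<comment> \<open>Passing to other points of the same cells costs at most \<open>2 * e\<close>
      in the mutual distance and \<open>e\<close> in a distance to \<open>z\<close>; together this
      is the \<open>3 * e\<close> of the claim.\<close>
    have duz: "\<bar>dist u z - dist u' z\<bar> \<le> e" and dvz: "\<bar>dist v z - dist v' z\<bar> \<le> e" and duv: "\<bar>dist u v - dist u' v'\<bar> \<le> 2 * e"
      using d dist_triangle[of u z u'] dist_triangle[of u' z u] dist_triangle[of v z v'] dist_triangle[of v' z v]
        dist_triangle[of u v u'] dist_triangle[of u' v v'] dist_triangle[of u' v' u] dist_triangle[of u v' v]
      by (auto simp: dist_commute abs_le_iff)
    have s: "\<bar>s * (dist u z - dist u' z)\<bar> \<le> e" if "0 \<le> s" "s \<le> 1" for s
      using mult_mono[OF that(2) duz] that by (simp add: abs_mult)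
    have "\<bar>dist u v - t * dist u z\<bar> \<le> 3 * e" "\<bar>dist v z - (1 - t) * dist u z\<bar> \<le> 3 * e"
      using s[of t] s[of "1 - t"] t duv dvz r e by (auto simp: algebra_simps abs_le_iff)
    then show "fst y \<in> cball z D \<and> snd y \<in> cball z D \<and> \<bar>dist (fst y) (snd y) - t * dist (fst y) z\<bar> \<le> 3 * e \<and>
      \<bar>dist (snd y) z - (1 - t) * dist (fst y) z\<bar> \<le> 3 * e" using uv by (simp add: y W_def)
  qed
  ultimately show ?thesis using SP unfolding \<kappa>_def by blast
qed

section \<open>Flows with bounded density towards one, finitely many and arbitrary targets\<close>

locale mcp_space =
  fixes m :: "'a::polish_space measure" and K N :: real
  assumes mms: "metric_measure_space m" and supp: "msupp m = UNIV"
    and geod: "\<forall>x y::'a. \<exists>\<gamma>\<in>Geo. apply_bcontfun \<gamma> 0 = x \<and> apply_bcontfun \<gamma> 1 = y"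
    and N: "1 < N" and enb: "essentially_non_branching m" and mcp: "MCP K N m"
begin

lemma proper: "\<forall>S::'a set. closed S \<and> bounded S \<longrightarrow> compact S"
  using mms by (simp add: metric_measure_space_def)

lemma compact_cball': "compact (cball (x::'a) r)"
  using proper by simp

text \<open>Weak limit of the approximate plans as \<open>e\<close> tends to zero: the density bound
  survives because it does not depend on \<open>e\<close>, and the metric relations become
  exact.\<close>

lemma intermediate_plan:
  assumes \<mu>: "finite_measure \<mu>" "sets \<mu> = sets borel" "msub \<mu> (scale_measure (ennreal C) m)" "0 < C"
    and bd: "AE x in \<mu>. x \<in> cball z D" and t: "0 \<le> t" "t < 1"
  obtains P where "finite_measure P" "sets P = sets borel" "distr P borel fst = \<mu>"
    "msub (distr P borel snd) (scale_measure (ennreal (C / contraction K N D t powr N)) m)"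
    "AE y in P. snd y \<in> cball z D \<and> dist (fst y) (snd y) = t * dist (fst y) z \<and> dist (snd y) z = (1 - t) * dist (fst y) z"
proof -
  interpret \<mu>: finite_measure \<mu> by fact
  define e where "e j = 1 / real (Suc j)" for j
  have e0: "0 < e j" for j by (simp add: e_def)
  have "\<exists>P. \<forall>j. sets (P j) = sets borel \<and> distr (P j) borel fst = \<mu> \<and>
    msub (distr (P j) borel snd) (scale_measure (ennreal (C / contraction K N D t powr N)) m) \<and>
    (AE y in P j. fst y \<in> cball z D \<and> snd y \<in> cball z D \<and> \<bar>dist (fst y) (snd y) - t * dist (fst y) z\<bar> \<le> 3 * e j \<and>
      \<bar>dist (snd y) z - (1 - t) * dist (fst y) z\<bar> \<le> 3 * e j)"
    by (intro choice allI approximate_intermediate_plan[OF mms supp N mcp \<mu> bd t e0])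
  then obtain P where S: "\<And>j. sets (P j) = sets borel" and P1: "\<And>j. distr (P j) borel fst = \<mu>"
    and P2: "\<And>j. msub (distr (P j) borel snd) (scale_measure (ennreal (C / contraction K N D t powr N)) m)"
    and P3: "\<And>j. AE y in P j. fst y \<in> cball z D \<and> snd y \<in> cball z D \<and> \<bar>dist (fst y) (snd y) - t * dist (fst y) z\<bar> \<le> 3 * e j \<and>
      \<bar>dist (snd y) z - (1 - t) * dist (fst y) z\<bar> \<le> 3 * e j"
    by blast
  have tot: "emeasure (P j) UNIV = ennreal (measure \<mu> UNIV)" for j
    using emeasure_distr[OF fst_snd_meas(1)[OF S], of UNIV j] by (simp add: P1 space_UNIV_borel[OF S] \<mu>.emeasure_eq_measure)
  have "tight_seq P"
  proof (rule tight_seq_compact[OF compact_Times[OF compact_cball'[of z D] compact_cball'[of z D]] _ S])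
    show "AE y in P j. y \<in> cball z D \<times> cball z D" for j
      using P3[of j] by eventually_elim (auto simp: mem_Times_iff)
  qed
  then obtain r L where r: "strict_mono r" and L: "finite_measure L" "sets L = sets borel" and w: "wconv (P \<circ> r) L"
    by (rule prokhorov_finite[OF tot S])
  have er: "(\<lambda>j. 3 * e (r j)) \<longlonglongrightarrow> 0"
    using tendsto_mult_right_zero[OF LIMSEQ_subseq_LIMSEQ[OF LIMSEQ_inverse_real_of_nat r], of 3]
    by (simp add: e_def inverse_eq_divide o_def)
  have tb: "emeasure ((P \<circ> r) j) (space ((P \<circ> r) j)) \<le> ennreal (measure \<mu> UNIV)" for j
    using tot by (simp add: space_UNIV_borel[OF S])
  have Sr: "sets ((P \<circ> r) j) = sets borel" for j using S by simp
  show ?thesis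
  proof (rule that[OF L])
    show "distr L borel fst = \<mu>"
      by (rule wconv_marginal[OF w _ Sr L(2) L(1) _ \<mu>(1)]) (auto intro: continuous_intros simp: P1)
    show "msub (distr L borel snd) (scale_measure (ennreal (C / contraction K N D t powr N)) m)"
      by (rule msub_limit_marginal[OF mms w Sr L(2,1)]) (auto intro: continuous_intros simp: P2)
    have "AE y in L. dist (fst y) (snd y) - t * dist (fst y) z = 0"
    proof (rule wconv_AE_zero[OF w _ L(2) _ er tb Sr])
      show "AE y in (P \<circ> r) j. \<bar>dist (fst y) (snd y) - t * dist (fst y) z\<bar> \<le> 3 * e (r j)" for j
        using P3[of "r j"] unfolding o_def by eventually_elim simp
    qed (intro continuous_intros)
    moreover have "AE y in L. dist (snd y) z - (1 - t) * dist (fst y) z = 0"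
    proof (rule wconv_AE_zero[OF w _ L(2) _ er tb Sr])
      show "AE y in (P \<circ> r) j. \<bar>dist (snd y) z - (1 - t) * dist (fst y) z\<bar> \<le> 3 * e (r j)" for j
        using P3[of "r j"] unfolding o_def by eventually_elim simp
    qed (intro continuous_intros)
    moreover have "AE y in L. max 0 (dist z (snd y) - D) = 0"
    proof (rule wconv_AE_zero[OF w _ L(2) _ er tb Sr])
      show "AE y in (P \<circ> r) j. \<bar>max 0 (dist z (snd y) - D)\<bar> \<le> 3 * e (r j)" for j
        using P3[of "r j"] unfolding o_def by eventually_elim (use e0[of "r j"] in simp)
    qed (intro continuous_intros)
    ultimately show "AE y in L. snd y \<in> cball z D \<and> dist (fst y) (snd y) = t * dist (fst y) z \<and> dist (snd y) z = (1 - t) * dist (fst y) z"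
      by eventually_elim auto
  qed
qed

definition dens1 :: "real \<Rightarrow> real \<Rightarrow> real \<Rightarrow> real" where
  "dens1 C D t = C / contraction K N D t powr N"

text \<open>The density bound after a second step from time \<open>t\<close> to time
  \<open>s\<close>; that step covers the fraction \<open>(s - t) / (1 - t)\<close> of the distance
  that is left.\<close>

definition dens2 :: "real \<Rightarrow> real \<Rightarrow> real \<Rightarrow> real \<Rightarrow> real" where
  "dens2 C D t s = dens1 (dens1 C D t) D ((s - t) / (1 - t))"

lemma dens1_pos: "0 < C \<Longrightarrow> t < 1 \<Longrightarrow> 0 < dens1 C D t"
  using contraction_pos[of t K N D] by (simp add: dens1_def)

text \<open>Three intermediate plans towards the same \<open>z\<close> are glued one after the
  other; since each stays on the way to \<open>z\<close>, the legs add up to a geodesic. The fourth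
  coordinate is the point at an extra time \<open>r\<close>, not the end: it provides the absolutely
  continuous end that \<open>crossing\<close> needs when flows are compared at the times
  \<open>t\<close> and \<open>s\<close>.\<close>

lemma dirac_chain:
  assumes \<mu>: "finite_measure \<mu>" "sets \<mu> = sets borel" "msub \<mu> (scale_measure (ennreal C) m)" "0 < C"
    and bd: "AE x in \<mu>. x \<in> cball z D" and t: "0 < t" "t < s" "s < r" "r < 1"
  obtains \<Lambda> C3 where "finite_measure \<Lambda>" "sets \<Lambda> = sets borel" "distr \<Lambda> borel q0 = \<mu>"
    "msub (distr \<Lambda> borel q1) (scale_measure (ennreal (dens1 C D t)) m)"
    "msub (distr \<Lambda> borel q2) (scale_measure (ennreal (dens2 C D t s)) m)"
    "msub (distr \<Lambda> borel q3) (scale_measure (ennreal C3) m)"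
    "AE u in \<Lambda>. chain t s (q0 u, q1 u, q2 u, z) \<and> chain t r (q0 u, q1 u, q3 u, z) \<and> chain s r (q0 u, q2 u, q3 u, z)"
proof -
  \<comment> \<open>\<open>t2\<close> and \<open>t3\<close> are the relative times of the second and
    third step: fractions of the distance left at the times \<open>t\<close> and
    \<open>s\<close>.\<close>
  define t2 where "t2 = (s - t) / (1 - t)"
  define t3 where "t3 = (r - s) / (1 - s)"
  have t2: "0 \<le> t2" "t2 < 1" and t3: "0 \<le> t3" "t3 < 1" using t by (auto simp: t2_def t3_def)
  have t2e: "t2 * (1 - t) = s - t" "(1 - t2) * (1 - t) = 1 - s" and t3e: "t3 * (1 - s) = r - s" "(1 - t3) * (1 - s) = 1 - r"
  proof -
    show a: "t2 * (1 - t) = s - t" and b: "t3 * (1 - s) = r - s" using t by (auto simp: t2_def t3_def)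
    show "(1 - t2) * (1 - t) = 1 - s" "(1 - t3) * (1 - s) = 1 - r" by (simp_all only: left_diff_distrib a b) simp_all
  qed
  have d: "0 < dens1 C D t" "0 < dens2 C D t s" unfolding dens2_def t2_def[symmetric]
    using \<mu>(4) t t2 by (auto intro!: dens1_pos)
  obtain P1 where P1: "finite_measure P1" "sets P1 = sets borel" "distr P1 borel fst = \<mu>"
    "msub (distr P1 borel snd) (scale_measure (ennreal (dens1 C D t)) m)"
    "AE y in P1. snd y \<in> cball z D \<and> dist (fst y) (snd y) = t * dist (fst y) z \<and> dist (snd y) z = (1 - t) * dist (fst y) z"
    unfolding dens1_def using t by (auto intro: intermediate_plan[OF \<mu> bd, of t])
  have b1: "AE x in distr P1 borel snd. x \<in> cball z D"
    using P1(5) fst_snd_meas[OF P1(2)] by (subst AE_distr_iff) (auto elim: eventually_mono)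
  obtain P2 where P2: "finite_measure P2" "sets P2 = sets borel" "distr P2 borel fst = distr P1 borel snd"
    "msub (distr P2 borel snd) (scale_measure (ennreal (dens2 C D t s)) m)"
    "AE y in P2. snd y \<in> cball z D \<and> dist (fst y) (snd y) = t2 * dist (fst y) z \<and> dist (snd y) z = (1 - t2) * dist (fst y) z"
    unfolding dens2_def t2_def[symmetric] dens1_def[of "dens1 C D t"]
    by (rule intermediate_plan[OF finite_measure.finite_measure_distr[OF P1(1) fst_snd_meas(2)[OF P1(2)]] _ P1(4) d(1) b1 t2]) auto
  have b2: "AE x in distr P2 borel snd. x \<in> cball z D"
    using P2(5) fst_snd_meas[OF P2(2)] by (subst AE_distr_iff) (auto elim: eventually_mono)
  obtain P3 where P3: "finite_measure P3" "sets P3 = sets borel" "distr P3 borel fst = distr P2 borel snd"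
    "msub (distr P3 borel snd) (scale_measure (ennreal (dens1 (dens2 C D t s) D t3)) m)"
    "AE y in P3. snd y \<in> cball z D \<and> dist (fst y) (snd y) = t3 * dist (fst y) z \<and> dist (snd y) z = (1 - t3) * dist (fst y) z"
    unfolding dens1_def[of "dens2 C D t s"]
    by (rule intermediate_plan[OF finite_measure.finite_measure_distr[OF P2(1) fst_snd_meas(2)[OF P2(2)]] _ P2(4) d(2) b2 t3]) auto
  obtain R where R: "finite_measure R" "sets R = sets borel" "distr R borel fst = P1" "distr R borel snd = P2"
    "AE y in R. snd (fst y) = fst (snd y)"
    by (rule gluing[OF P1(1) P2(1) P1(2) P2(2), of snd fst]) (auto intro: continuous_intros simp: P2(3))
  have Rs: "distr R borel (\<lambda>y. snd (snd y)) = distr P2 borel snd"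
    using distr_compose[OF fst_snd_meas(2)[OF R(2)] fst_snd_meas(2)[OF refl]] by (simp add: R(4))
  obtain G where G: "finite_measure G" "sets G = sets borel" "distr G borel fst = R" "distr G borel snd = P3"
    "AE y in G. snd (snd (fst y)) = fst (snd y)"
    by (rule gluing[OF R(1) P3(1) R(2) P3(2), of "\<lambda>y. snd (snd y)" fst]) (auto intro!: continuous_intros simp: P3(3) Rs)
  define F where "F y = (fst (fst (fst y)), snd (fst (fst y)), snd (snd (fst y)), snd (snd y))" for y :: "(('a \<times> 'a) \<times> ('a \<times> 'a)) \<times> ('a \<times> 'a)"
  have Fc: "continuous_on UNIV F" unfolding F_def by (intro continuous_intros)
  note Fm = cont_measurable[OF Fc G(2)]
  have gm: "f \<in> G \<rightarrow>\<^sub>M borel" if "continuous_on UNIV f" for f :: "_ \<Rightarrow> 'a \<times> 'a" using that G(2) by (rule cont_measurable)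
  have G1: "distr G borel (\<lambda>y. fst (fst y)) = P1" "distr G borel (\<lambda>y. snd (fst y)) = P2"
    using distr_compose[OF fst_snd_meas(1)[OF G(2)] fst_snd_meas(1)[OF refl]] distr_compose[OF fst_snd_meas(1)[OF G(2)] fst_snd_meas(2)[OF refl]]
    by (simp_all add: R(3,4) G(3))
  have mq: "distr (distr G borel F) borel q = distr G borel (\<lambda>y. q (F y))" if "continuous_on UNIV q" for q :: "_ \<Rightarrow> 'a"
    using that by (intro distr_compose[OF Fm] cont_measurable) auto
  have gm1: "(\<lambda>y. fst (fst y)) \<in> G \<rightarrow>\<^sub>M borel" "(\<lambda>y. snd (fst y)) \<in> G \<rightarrow>\<^sub>M borel" by (intro gm continuous_intros)+
  have fsb: "(fst :: 'a \<times> 'a \<Rightarrow> 'a) \<in> borel \<rightarrow>\<^sub>M borel" "(snd :: 'a \<times> 'a \<Rightarrow> 'a) \<in> borel \<rightarrow>\<^sub>M borel" by (auto intro: fst_snd_meas)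
  have marg: "distr (distr G borel F) borel q0 = distr P1 borel fst" "distr (distr G borel F) borel q1 = distr P1 borel snd"
    "distr (distr G borel F) borel q2 = distr P2 borel snd" "distr (distr G borel F) borel q3 = distr P3 borel snd"
  proof -
    show "distr (distr G borel F) borel q0 = distr P1 borel fst"
      using distr_compose[OF gm1(1) fsb(1)] by (subst mq) (auto intro: continuous_intros simp: F_def G1)
    show "distr (distr G borel F) borel q1 = distr P1 borel snd"
      using distr_compose[OF gm1(1) fsb(2)] by (subst mq) (auto intro!: continuous_intros simp: F_def G1)
    show "distr (distr G borel F) borel q2 = distr P2 borel snd"
      using distr_compose[OF gm1(2) fsb(2)] by (subst mq) (auto intro!: continuous_intros simp: F_def G1)
    show "distr (distr G borel F) borel q3 = distr P3 borel snd"
      using distr_compose[OF fst_snd_meas(2)[OF G(2)] fsb(2)] by (subst mq) (auto intro!: continuous_intros simp: F_def G(4))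
  qed
  show ?thesis
  proof (rule that[of "distr G borel F"])
    show "finite_measure (distr G borel F)" using G(1) Fm by (rule finite_measure.finite_measure_distr)
    let ?P = "\<lambda>u. chain t s (q0 u, q1 u, q2 u, z) \<and> chain t r (q0 u, q1 u, q3 u, z) \<and> chain s r (q0 u, q2 u, q3 u, z)"
    have "closed {u. ?P u}"
      unfolding chain_def by (intro closed_Collect_conj closed_Collect_eq continuous_intros)
    moreover have "AE y in G. ?P (F y)"
      using G(5) AE_distr_vimage[OF gm1(1), unfolded G1, OF P1(5)] AE_distr_vimage[OF gm1(2), unfolded G1, OF P2(5)]
        AE_distr_vimage[OF fst_snd_meas(2)[OF G(2)], unfolded G(4), OF P3(5)]
        AE_distr_vimage[OF fst_snd_meas(1)[OF G(2)], unfolded G(3), OF R(5)]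
    proof eventually_elim
      case (elim y)
      obtain a b b' c c' e where y: "y = (((a, b), (b', c)), (c', e))" by (metis prod.exhaust)
      define d where "d = dist a z"
      have eq: "b' = b" "c' = c" and d1: "dist a b = t * d" "dist b z = (1 - t) * d"
        using elim by (auto simp: y d_def)
      have d2: "dist b c = (s - t) * d" "dist c z = (1 - s) * d"
        using elim d1 t2e eq by (simp_all add: y mult.assoc[symmetric])
      have "dist c e = t3 * dist c z" "dist e z = (1 - t3) * dist c z" using elim eq by (auto simp: y)
      then have d3: "dist c e = (r - s) * d" "dist e z = (1 - r) * d"
        by (simp_all only: d2 mult.assoc[symmetric] t3e)
      have "dist b e = (r - t) * d"
        using dist_triangle[of b e c] dist_triangle[of b z e] d1 d2 d3 by (intro antisym) (auto simp: algebra_simps)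
      moreover have "dist a c = s * d"
        using dist_triangle[of a c b] dist_triangle[of a z c] d1 d2 d3 d_def by (intro antisym) (auto simp: algebra_simps)
      ultimately show ?case using d1 d2 d3 by (simp add: chain_def F_def y d_def[symmetric])
    qed
    ultimately show "AE u in distr G borel F. ?P u" using Fm by (subst AE_distr_iff) (auto simp: borel_closed)
  qed (use P1 P2 P3 marg in auto)
qed

text \<open>The disjointness hypothesis, applied to the density \<open>min (u y x) (u y' x)\<close>,
  says that almost everywhere at most one density is nonzero. So the sum obeys the bound of a single
  term, whatever the number of terms.\<close>

lemma disjoint_sum_bound:
  fixes \<nu> :: "'i \<Rightarrow> 'a measure"
  assumes Y: "finite Y" and \<nu>: "\<And>y. y \<in> Y \<Longrightarrow> finite_measure (\<nu> y)" "\<And>y. y \<in> Y \<Longrightarrow> msub (\<nu> y) (scale_measure (ennreal C) m)"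
    and disj: "\<And>y y' \<sigma>. y \<in> Y \<Longrightarrow> y' \<in> Y \<Longrightarrow> y \<noteq> y' \<Longrightarrow> msub \<sigma> (\<nu> y) \<Longrightarrow> msub \<sigma> (\<nu> y') \<Longrightarrow> emeasure \<sigma> (space \<sigma>) = 0"
  shows "msub (mix borel Y \<nu>) (scale_measure (ennreal C) m)"
proof -
  note Sm = mms_sets[OF mms]
  have "\<exists>u. u \<in> borel_measurable m \<and> (\<forall>x. u x \<le> ennreal C) \<and> \<nu> y = density m u" if "y \<in> Y" for y
    using bounded_density_exists[OF mms_sigma_finite[OF mms] \<nu>[OF that]] by (metis ennreal_neq_top infinity_ennreal_def)
  then obtain u where u: "\<And>y. y \<in> Y \<Longrightarrow> u y \<in> borel_measurable m" "\<And>y x. y \<in> Y \<Longrightarrow> u y x \<le> ennreal C" "\<And>y. y \<in> Y \<Longrightarrow> \<nu> y = density m (u y)"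
    by metis
  have pw: "AE x in m. y \<noteq> y' \<longrightarrow> u y x = 0 \<or> u y' x = 0" if y: "y \<in> Y" "y' \<in> Y" for y y'
  proof (cases "y = y'")
    case False
    have mm: "(\<lambda>x. min (u y x) (u y' x)) \<in> borel_measurable m" using u(1)[OF y(1)] u(1)[OF y(2)] by measurable
    let ?\<sigma> = "density m (\<lambda>x. min (u y x) (u y' x))"
    have "msub ?\<sigma> (\<nu> y)" "msub ?\<sigma> (\<nu> y')"
      unfolding u(3)[OF y(1)] u(3)[OF y(2)] using mm u(1)[OF y(1)] u(1)[OF y(2)]
      by (auto intro!: msubI nn_integral_mono mult_right_mono simp: emeasure_density)
    then have "emeasure ?\<sigma> (space ?\<sigma>) = 0" using disj y False by blast
    then have "(\<integral>\<^sup>+x. min (u y x) (u y' x) \<partial>m) = 0" using mm by (simp add: emeasure_density cong: nn_integral_cong)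
    then have "AE x in m. min (u y x) (u y' x) = 0" using mm by (subst (asm) nn_integral_0_iff_AE) auto
    then show ?thesis by eventually_elim (auto simp: min_def split: if_splits)
  qed simp
  have "AE x in m. \<forall>y\<in>Y. \<forall>y'\<in>Y. y \<noteq> y' \<longrightarrow> u y x = 0 \<or> u y' x = 0"
    using Y pw by (intro AE_finite_allI)
  then have le: "AE x in m. (\<Sum>y\<in>Y. u y x) \<le> ennreal C"
  proof eventually_elim
    case (elim x)
    show ?case
    proof (cases "\<exists>y\<in>Y. u y x \<noteq> 0")
      case True
      then obtain y where y: "y \<in> Y" "u y x \<noteq> 0" by auto
      have "(\<Sum>y'\<in>Y. u y' x) = (\<Sum>y'\<in>{y}. u y' x)" using Y y elim by (intro sum.mono_neutral_right) auto
      then show ?thesis using u(2)[OF y(1)] by simp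
    qed simp
  qed
  show ?thesis
  proof (rule msubI)
    fix A assume "A \<in> sets (scale_measure (ennreal C) m)"
    then have A: "A \<in> sets borel" "A \<in> sets m" using Sm by auto
    have Sn: "sets (\<nu> y) = sets borel" if "y \<in> Y" for y using msub_sets[OF \<nu>(2)[OF that]] Sm by simp
    have "emeasure (mix borel Y \<nu>) A = (\<Sum>y\<in>Y. \<integral>\<^sup>+x. u y x * indicator A x \<partial>m)"
      using A Sn u by (simp add: emeasure_mix emeasure_density)
    also have "\<dots> = (\<integral>\<^sup>+x. (\<Sum>y\<in>Y. u y x) * indicator A x \<partial>m)"
      using u A by (subst nn_integral_sum[symmetric]) (auto simp: sum_distrib_right)
    also have "\<dots> \<le> (\<integral>\<^sup>+x. ennreal C * indicator A x \<partial>m)"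
      using le by (intro nn_integral_mono_AE) (auto elim!: eventually_mono intro: mult_right_mono)
    finally show "emeasure (mix borel Y \<nu>) A \<le> emeasure (scale_measure (ennreal C) m) A"
      using A by (simp add: nn_integral_cmult_indicator)
  qed (simp add: Sm)
qed

lemma msub_scale_ac:
  assumes "msub \<mu> (scale_measure C m)"
  shows "absolutely_continuous m \<mu>"
proof -
  have "emeasure \<mu> A = 0" if "A \<in> null_sets m" for A
    using msub_emeasure[OF assms, of A] null_setsD1[OF that] by simp
  then show ?thesis using msub_sets[OF assms] by (auto simp: absolutely_continuous_def)
qed

text \<open>The plan is split by target. At a time \<open>r\<close> close to \<open>1\<close> the
  pieces lie in disjoint balls around their targets, so \<open>crossing\<close>, with end time
  \<open>r\<close>, excludes a common part of two flows at the times \<open>t\<close> and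
  \<open>s\<close>.\<close>

lemma finite_target_chain:
  fixes \<pi> :: "('a \<times> 'a) measure"
  assumes op: "opt \<pi>" and Y: "finite Y" "Y \<subseteq> cball ctr \<rho>" "AE z in \<pi>. snd z \<in> Y" and X: "AE z in \<pi>. fst z \<in> cball ctr \<rho>"
    and le: "msub (distr \<pi> borel fst) (scale_measure (ennreal C) m)" and C: "0 < C" and ts: "0 < t" "t < s" "s < 1"
  shows "\<exists>\<Lambda>. finite_measure \<Lambda> \<and> sets \<Lambda> = sets borel \<and> distr \<Lambda> borel (\<lambda>z. (q0 z, q3 z)) = \<pi> \<and>
    (AE z in \<Lambda>. chain t s z) \<and>
    msub (distr \<Lambda> borel q1) (scale_measure (ennreal (dens1 C (2 * \<rho>) t)) m) \<and>
    msub (distr \<Lambda> borel q2) (scale_measure (ennreal (dens2 C (2 * \<rho>) t s)) m)"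
proof -
  note O = optD[OF op]
  interpret \<pi>: finite_measure \<pi> by (rule O)
  define D where "D = 2 * \<rho>"
  obtain \<delta> where \<delta>: "0 < \<delta>" "\<And>y y'. y \<in> Y \<Longrightarrow> y' \<in> Y \<Longrightarrow> y \<noteq> y' \<Longrightarrow> \<delta> \<le> dist y y'"
  proof -
    define Ds where "Ds = insert 1 ((\<lambda>(y, y'). dist y y') ` {p\<in>Y \<times> Y. fst p \<noteq> snd p})"
    have f: "finite Ds" using Y(1) by (auto simp: Ds_def)
    have "0 < Min Ds" using f by (subst Min_gr_iff) (auto simp: Ds_def)
    moreover have "Min Ds \<le> dist y y'" if "y \<in> Y" "y' \<in> Y" "y \<noteq> y'" for y y'
      using f that by (intro Min_le) (auto simp: Ds_def image_iff intro!: bexI[of _ "(y, y')"])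
    ultimately show ?thesis using that by blast
  qed
  \<comment> \<open>At time \<open>r\<close> each flow is within
    \<open>w * \<bar>D\<bar> \<le> \<delta> / 4\<close> of its target, so flows to different targets
    are apart; the first term of the minimum keeps \<open>s < r\<close>. The added \<open>1\<close>
    avoids a division by zero.\<close>
  define w where "w = min ((1 - s) / 2) (\<delta> / (4 * (\<bar>D\<bar> + 1)))"
  define r where "r = 1 - w"
  have w0: "0 < w" using ts \<delta>(1) by (simp add: w_def)
  have "w \<le> (1 - s) / 2" unfolding w_def by (rule min.cobounded1)
  then have r: "s < r" "r < 1" using w0 ts by (auto simp: r_def)
  have rD: "2 * ((1 - r) * \<bar>D\<bar>) < \<delta>"
  proof -
    have "w * \<bar>D\<bar> \<le> (\<delta> / (4 * (\<bar>D\<bar> + 1))) * \<bar>D\<bar>" by (intro mult_right_mono) (auto simp: w_def)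
    also have "\<dots> \<le> \<delta> / 4" using \<delta>(1) by (simp add: field_simps)
    finally show ?thesis using \<delta>(1) by (simp add: r_def)
  qed
  have sfm: "snd -` {y} \<in> sets \<pi>" for y :: 'a
    using closed_vimage[OF closed_singleton[of y], of "snd :: 'a \<times> 'a \<Rightarrow> 'a"] O(2) by (simp add: borel_closed continuous_on_snd continuous_on_id)
  define \<pi>y where "\<pi>y y = density \<pi> (indicator (snd -` {y}))" for y
  have pe: "emeasure (\<pi>y y) A = emeasure \<pi> (snd -` {y} \<inter> A)" if "A \<in> sets \<pi>" for y A
    using that sfm[of y] by (simp add: \<pi>y_def emeasure_density indicator_inter_arith[symmetric])
  have pS: "sets (\<pi>y y) = sets borel" for y by (simp add: \<pi>y_def O(2))
  have psub: "msub (\<pi>y y) \<pi>" for y unfolding \<pi>y_def using sfm by (intro msub_density) (auto split: split_indicator)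
  have psnd: "AE z in \<pi>y y. snd z = y" for y unfolding \<pi>y_def using sfm by (subst AE_density) (auto split: split_indicator_asm)
  define \<mu>y where "\<mu>y y = distr (\<pi>y y) borel fst" for y
  have \<mu>f: "finite_measure (\<mu>y y)" for y
    unfolding \<mu>y_def using msub_finite[OF psub \<pi>.finite_measure_axioms] fst_snd_meas(1)[OF pS] by (rule finite_measure.finite_measure_distr)
  have \<mu>s: "msub (\<mu>y y) (scale_measure (ennreal C) m)" for y
    unfolding \<mu>y_def using msub_distr[OF psub fst_snd_meas(1)[OF O(2)]] le by (rule msub_trans)
  have \<mu>b: "AE x in \<mu>y y. x \<in> cball y D" if "y \<in> Y" for y
  proof -
    have "AE z in \<pi>y y. fst z \<in> cball y D"
      using msub_AE[OF psub X]
    proof eventually_elim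
      case (elim z)
      moreover have "dist ctr y \<le> \<rho>" using Y(2) that by auto
      ultimately show ?case using dist_triangle3[of y "fst z" ctr] by (simp add: D_def)
    qed
    then show ?thesis unfolding \<mu>y_def using fst_snd_meas[OF pS] by (subst AE_distr_iff) auto
  qed
  have "\<exists>\<Lambda>. finite_measure \<Lambda> \<and> sets \<Lambda> = sets borel \<and> distr \<Lambda> borel q0 = \<mu>y y \<and>
    msub (distr \<Lambda> borel q1) (scale_measure (ennreal (dens1 C D t)) m) \<and>
    msub (distr \<Lambda> borel q2) (scale_measure (ennreal (dens2 C D t s)) m) \<and>
    absolutely_continuous m (distr \<Lambda> borel q3) \<and>
    (AE u in \<Lambda>. chain t s (q0 u, q1 u, q2 u, y) \<and> chain t r (q0 u, q1 u, q3 u, y) \<and> chain s r (q0 u, q2 u, q3 u, y))"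
    if "y \<in> Y" for y
  proof -
    have S: "sets (\<mu>y y) = sets borel" by (simp add: \<mu>y_def)
    obtain \<Lambda> C3 where L: "finite_measure \<Lambda>" "sets \<Lambda> = sets borel" "distr \<Lambda> borel q0 = \<mu>y y"
      "msub (distr \<Lambda> borel q1) (scale_measure (ennreal (dens1 C D t)) m)"
      "msub (distr \<Lambda> borel q2) (scale_measure (ennreal (dens2 C D t s)) m)"
      "msub (distr \<Lambda> borel q3) (scale_measure (ennreal C3) m)"
      "AE u in \<Lambda>. chain t s (q0 u, q1 u, q2 u, y) \<and> chain t r (q0 u, q1 u, q3 u, y) \<and> chain s r (q0 u, q2 u, q3 u, y)"
      by (rule dirac_chain[OF \<mu>f S \<mu>s C \<mu>b[OF \<open>y \<in> Y\<close>] ts(1,2) r])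
    then show ?thesis using msub_scale_ac[OF L(6)] by blast
  qed
  then have "\<exists>L. \<forall>y\<in>Y. finite_measure (L y) \<and> sets (L y) = sets borel \<and> distr (L y) borel q0 = \<mu>y y \<and>
    msub (distr (L y) borel q1) (scale_measure (ennreal (dens1 C D t)) m) \<and>
    msub (distr (L y) borel q2) (scale_measure (ennreal (dens2 C D t s)) m) \<and>
    absolutely_continuous m (distr (L y) borel q3) \<and>
    (AE u in L y. chain t s (q0 u, q1 u, q2 u, y) \<and> chain t r (q0 u, q1 u, q3 u, y) \<and> chain s r (q0 u, q2 u, q3 u, y))"
    by (intro bchoice ballI)
  then obtain L where L: "\<And>y. y \<in> Y \<Longrightarrow> finite_measure (L y)" "\<And>y. y \<in> Y \<Longrightarrow> sets (L y) = sets borel"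
    "\<And>y. y \<in> Y \<Longrightarrow> distr (L y) borel q0 = \<mu>y y"
    "\<And>y. y \<in> Y \<Longrightarrow> msub (distr (L y) borel q1) (scale_measure (ennreal (dens1 C D t)) m)"
    "\<And>y. y \<in> Y \<Longrightarrow> msub (distr (L y) borel q2) (scale_measure (ennreal (dens2 C D t s)) m)"
    "\<And>y. y \<in> Y \<Longrightarrow> absolutely_continuous m (distr (L y) borel q3)"
    "\<And>y. y \<in> Y \<Longrightarrow> AE u in L y. chain t s (q0 u, q1 u, q2 u, y) \<and> chain t r (q0 u, q1 u, q3 u, y) \<and> chain s r (q0 u, q2 u, q3 u, y)"
    by blast
  have qc: "continuous_on UNIV (\<lambda>u::'a quad. q0 u)" "continuous_on UNIV (\<lambda>u::'a quad. q1 u)"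
    "continuous_on UNIV (\<lambda>u::'a quad. q2 u)" "continuous_on UNIV (\<lambda>u::'a quad. q3 u)"
    by (intro continuous_intros)+
  have plan: "distr (L y) borel (\<lambda>u. (q0 u, y)) = \<pi>y y" if y: "y \<in> Y" for y
  proof -
    have c: "(\<lambda>x. (x, y)) \<in> borel \<rightarrow>\<^sub>M borel" by (intro borel_measurable_continuous_onI continuous_intros)
    have "distr (L y) borel (\<lambda>u. (q0 u, y)) = distr (\<mu>y y) borel (\<lambda>x. (x, y))"
      using distr_compose[OF cont_measurable[OF qc(1) L(2)[OF y]] c] by (simp add: L(3)[OF y])
    also have "\<dots> = distr (\<pi>y y) borel (\<lambda>z. (fst z, y))"
      unfolding \<mu>y_def by (rule distr_compose[OF fst_snd_meas(1)[OF pS] c])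
    also have "\<dots> = distr (\<pi>y y) borel (\<lambda>z. z)"
    proof (rule distr_AE_eqI)
      show "AE z in \<pi>y y. (fst z, y) = z" using psnd[of y] by eventually_elim auto
      show "(\<lambda>z. (fst z, y)) \<in> \<pi>y y \<rightarrow>\<^sub>M borel" by (rule measurable_compose[OF fst_snd_meas(1)[OF pS] c])
    qed (simp add: measurable_def pS[of y] space_UNIV_borel[OF pS])
    also have "\<dots> = \<pi>y y" by (rule distr_id2) (simp add: pS)
    finally show ?thesis .
  qed
  have psum: "msub (msum (\<pi>y y) (\<pi>y y')) \<pi>" if "y \<noteq> y'" for y y'
  proof (rule msubI)
    fix A assume A: "A \<in> sets \<pi>"
    have "emeasure (msum (\<pi>y y) (\<pi>y y')) A = emeasure \<pi> (snd -` {y} \<inter> A) + emeasure \<pi> (snd -` {y'} \<inter> A)"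
      using A pS O(2) by (simp add: emeasure_msum pe)
    also have "\<dots> = emeasure \<pi> ((snd -` {y} \<inter> A) \<union> (snd -` {y'} \<inter> A))"
      using A sfm[of y] sfm[of y'] that by (intro plus_emeasure) auto
    also have "\<dots> \<le> emeasure \<pi> A" using A by (intro emeasure_mono) auto
    finally show "emeasure (msum (\<pi>y y) (\<pi>y y')) A \<le> emeasure \<pi> A" .
  qed (simp add: pS O(2))
  have cross: "emeasure \<sigma> (space \<sigma>) = 0"
    if y: "y \<in> Y" "y' \<in> Y" "y \<noteq> y'" and \<tau>: "0 < \<tau>" "\<tau> < r" and p: "continuous_on UNIV p"
      and ch: "\<And>y. y \<in> Y \<Longrightarrow> AE u in L y. chain \<tau> r (q0 u, p u, q3 u, y)"
      and \<sigma>: "msub \<sigma> (distr (L y) borel p)" "msub \<sigma> (distr (L y') borel p)" for y y' \<tau> p \<sigma>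
  proof -
    \<comment> \<open>The quadruple for the times \<open>0\<close>, \<tau>, \<open>r\<close> and
      \<open>1\<close>: the point at time \<open>r\<close> moves to the third place and the target
      becomes the end.\<close>
    define F where "F y u = (q0 u, p u, q3 u, y)" for y :: 'a and u :: "'a quad"
    have Fc: "continuous_on UNIV (F y)" for y unfolding F_def using p by (intro continuous_intros)
    have Fm: "F y \<in> L y \<rightarrow>\<^sub>M borel" if "y \<in> Y" for y using Fc L(2)[OF that] by (rule cont_measurable)
    have AEF: "AE z in distr (L y) borel (F y). P z" if "y \<in> Y" "closed {z. P z}" "AE u in L y. P (F y u)" for P y
      using that Fm[OF that(1)] by (subst AE_distr_iff) (auto simp: borel_closed)
    have dF: "distr (distr (L y) borel (F y)) borel q = distr (L y) borel (\<lambda>u. q (F y u))" if "y \<in> Y" "continuous_on UNIV q" for y and q :: "'a quad \<Rightarrow> 'a"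
      using that by (intro distr_compose[OF Fm[OF that(1)] cont_measurable]) auto
    have bx: "AE u in L y. q0 u \<in> cball ctr \<rho>" if "y \<in> Y" for y
    proof -
      have "AE x in \<mu>y y. x \<in> cball ctr \<rho>"
        unfolding \<mu>y_def using msub_AE[OF psub X] fst_snd_meas[OF pS] by (subst AE_distr_iff) auto
      then show ?thesis unfolding L(3)[OF that, symmetric] by (rule AE_distr_vimage[OF cont_measurable[OF qc(1) L(2)[OF that]]])
    qed
    have dq: "AE u in L y. dist (q0 u) y \<le> D" if "y \<in> Y" for y
      using bx[OF that]
    proof eventually_elim
      case (elim u)
      moreover have "dist ctr y \<le> \<rho>" using Y(2) that by auto
      ultimately show ?case using dist_triangle3[of "q0 u" y ctr] by (simp add: D_def)
    qed
    have ch': "AE z in distr (L y) borel (F y). chain \<tau> r z" if "y \<in> Y" for y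
      using ch[OF that] by (intro AEF that) (auto simp: chain_def F_def intro!: closed_Collect_conj closed_Collect_eq continuous_intros)
    have bd': "AE z in distr (L y) borel (F y). q0 z \<in> cball ctr \<rho> \<and> q3 z \<in> cball ctr \<rho>" if "y \<in> Y" for y
      using bx[OF that] Y(2) that
      by (intro AEF that) (auto simp: F_def mem_cball intro!: closed_Collect_conj closed_Collect_le continuous_intros elim: eventually_mono)
    have sep': "AE z in distr (L y) borel (F y). q2 z \<in> cball y ((1 - r) * \<bar>D\<bar>)" if "y \<in> Y" for y
    proof (rule AEF[OF that])
      show "closed {z::'a quad. q2 z \<in> cball y ((1 - r) * \<bar>D\<bar>)}"
        unfolding mem_cball by (intro closed_Collect_le continuous_intros)
      show "AE u in L y. q2 (F y u) \<in> cball y ((1 - r) * \<bar>D\<bar>)"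
        using ch[OF that] dq[OF that]
      proof eventually_elim
        case (elim u)
        then have "dist (q3 u) y = (1 - r) * dist (q0 u) y" by (simp add: chain_def)
        also have "\<dots> \<le> (1 - r) * \<bar>D\<bar>" using elim r by (intro mult_left_mono) auto
        finally show ?case by (simp add: F_def dist_commute)
      qed
    qed
    show ?thesis
    proof (rule crossing[OF proper geod enb, of "distr (L y) borel (F y)" "distr (L y') borel (F y')" \<tau> r ctr \<rho>
          "cball y ((1 - r) * \<bar>D\<bar>)" "cball y' ((1 - r) * \<bar>D\<bar>)" \<sigma>])
      have q0e: "distr (distr (L y) borel (F y)) borel q0 = \<mu>y y" if "y \<in> Y" for y
        using dF[OF that qc(1)] L(3)[OF that] by (simp add: F_def)
      show "absolutely_continuous m (distr (distr (L y) borel (F y)) borel q0)"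
        unfolding q0e[OF y(1)] by (rule msub_scale_ac[OF \<mu>s])
      have q2e: "absolutely_continuous m (distr (distr (L y) borel (F y)) borel q2)" if "y \<in> Y" for y
        using dF[OF that qc(3)] L(6)[OF that] by (simp add: F_def)
      show "absolutely_continuous m (distr (distr (L y) borel (F y)) borel q2)"
        "absolutely_continuous m (distr (distr (L y') borel (F y')) borel q2)" using q2e y by auto
      have c03: "continuous_on UNIV (\<lambda>z::'a quad. (q0 z, q3 z))" by (intro continuous_intros)
      have pl: "distr (distr (L y) borel (F y)) borel (\<lambda>z. (q0 z, q3 z)) = \<pi>y y" if "y \<in> Y" for y
        using distr_compose[OF Fm[OF that] cont_measurable[OF c03 refl]] plan[OF that] by (simp add: F_def)
      have "distr (msum (distr (L y) borel (F y)) (distr (L y') borel (F y'))) borel (\<lambda>z. (q0 z, q3 z)) = msum (\<pi>y y) (\<pi>y y')"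
        using pl y c03 by (subst distr_msum) (auto intro: cont_measurable)
      then show "opt (distr (msum (distr (L y) borel (F y)) (distr (L y') borel (F y'))) borel (\<lambda>z. (q0 z, q3 z)))"
        using opt_msub[OF op psum[OF y(3)]] by simp
      show "cball y ((1 - r) * \<bar>D\<bar>) \<inter> cball y' ((1 - r) * \<bar>D\<bar>) = {}"
      proof (rule ccontr)
        assume "\<not> ?thesis"
        then obtain x where "dist y x \<le> (1 - r) * \<bar>D\<bar>" "dist y' x \<le> (1 - r) * \<bar>D\<bar>" by auto
        then show False using \<delta>(2)[OF y] rD dist_triangle2[of y y' x] by linarith
      qed
      show "msub \<sigma> (distr (distr (L y) borel (F y)) borel q1)" "msub \<sigma> (distr (distr (L y') borel (F y')) borel q1)"
        using \<sigma> dF[OF y(1) qc(2)] dF[OF y(2) qc(2)] by (simp_all add: F_def)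
      show "finite_measure (distr (L y) borel (F y))" "finite_measure (distr (L y') borel (F y'))"
        using L(1) Fm y by (auto intro: finite_measure.finite_measure_distr)
    qed (use \<tau> r y ch' bd' sep' in auto)
  qed
  \<comment> \<open>The auxiliary time \<open>r\<close> has done its work, and its point is replaced
    by the target.\<close>
  define \<Lambda> where "\<Lambda> = mix borel Y (\<lambda>y. distr (L y) borel (\<lambda>u. (q0 u, q1 u, q2 u, y)))"
  have Hm: "(\<lambda>u. (q0 u, q1 u, q2 u, y)) \<in> L y \<rightarrow>\<^sub>M borel" if "y \<in> Y" for y
    using L(2)[OF that] by (intro cont_measurable continuous_intros) auto
  have S\<Lambda>: "sets \<Lambda> = sets borel" by (simp add: \<Lambda>_def)
  have f\<Lambda>: "finite_measure \<Lambda>"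
    unfolding \<Lambda>_def using Y(1) L(1) Hm by (intro finite_measure_mix) (auto intro: finite_measure.finite_measure_distr)
  have dq: "distr \<Lambda> borel q = mix borel Y (\<lambda>y. distr (L y) borel (\<lambda>u. q (q0 u, q1 u, q2 u, y)))"
    if "continuous_on UNIV q" for q :: "'a quad \<Rightarrow> 'b::{metric_space,second_countable_topology}"
  proof -
    have qm: "q \<in> borel \<rightarrow>\<^sub>M borel" using that by (rule borel_measurable_continuous_onI)
    have "distr \<Lambda> borel q = mix borel Y (\<lambda>y. distr (distr (L y) borel (\<lambda>u. (q0 u, q1 u, q2 u, y))) borel q)"
      unfolding \<Lambda>_def using qm by (intro distr_mix) auto
    also have "\<dots> = mix borel Y (\<lambda>y. distr (L y) borel (\<lambda>u. q (q0 u, q1 u, q2 u, y)))"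
      unfolding mix_def using Hm qm by (intro arg_cong[where f="measure_of _ _"] ext sum.cong refl) (simp add: distr_compose)
    finally show ?thesis .
  qed
  have "distr \<Lambda> borel (\<lambda>z. (q0 z, q3 z)) = \<pi>"
  proof (rule measure_eqI)
    fix A assume "A \<in> sets (distr \<Lambda> borel (\<lambda>z. (q0 z, q3 z)))"
    then have A: "A \<in> sets borel" "A \<in> sets \<pi>" using O(2) by auto
    have "distr \<Lambda> borel (\<lambda>z. (q0 z, q3 z)) = mix borel Y (\<lambda>y. distr (L y) borel (\<lambda>u. (q0 u, y)))"
      using dq[of "\<lambda>z. (q0 z, q3 z)"] by (simp add: continuous_intros)
    also have "emeasure \<dots> A = (\<Sum>y\<in>Y. emeasure \<pi> (snd -` {y} \<inter> A))"
      using A plan by (subst emeasure_mix) (auto simp: pe pS)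
    also have "\<dots> = emeasure \<pi> (\<Union>y\<in>Y. snd -` {y} \<inter> A)"
      using Y(1) sfm A by (intro sum_emeasure) (auto simp: disjoint_family_on_def)
    also have "\<dots> = emeasure \<pi> A"
    proof (rule emeasure_eq_AE)
      show "AE z in \<pi>. z \<in> (\<Union>y\<in>Y. snd -` {y} \<inter> A) \<longleftrightarrow> z \<in> A" using Y(3) by eventually_elim auto
      show "(\<Union>y\<in>Y. snd -` {y} \<inter> A) \<in> sets \<pi>" using Y(1) sfm A by (intro sets.finite_UN) auto
    qed (use A in simp)
    finally show "emeasure (distr \<Lambda> borel (\<lambda>z. (q0 z, q3 z))) A = emeasure \<pi> A" .
  qed (simp add: O(2))
  moreover have "AE z in \<Lambda>. chain t s z"
  proof -
    have cl: "closed {z::'a quad. chain t s z}"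
      unfolding chain_def by (intro closed_Collect_conj closed_Collect_eq continuous_intros)
    have "AE z in distr (L y) borel (\<lambda>u. (q0 u, q1 u, q2 u, y)). chain t s z" if "y \<in> Y" for y
      using L(7)[OF that] Hm[OF that] cl by (subst AE_distr_iff) (auto simp: borel_closed elim: eventually_mono)
    then show ?thesis unfolding \<Lambda>_def using Y(1) cl by (intro AE_mix) (auto simp: borel_closed)
  qed
  moreover have "msub (distr \<Lambda> borel q1) (scale_measure (ennreal (dens1 C D t)) m)"
    unfolding dq[OF qc(2)] prod.sel
  proof (rule disjoint_sum_bound[OF Y(1)])
    show "emeasure \<sigma> (space \<sigma>) = 0" if "y \<in> Y" "y' \<in> Y" "y \<noteq> y'" "msub \<sigma> (distr (L y) borel q1)" "msub \<sigma> (distr (L y') borel q1)" for y y' \<sigma>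
      using ts r L(7) that(4,5) by (intro cross[OF that(1-3), of t q1]) (auto intro: qc elim: eventually_mono)
  qed (use L(1,4) cont_measurable[OF qc(2) L(2)] in \<open>auto intro: finite_measure.finite_measure_distr\<close>)
  moreover have "msub (distr \<Lambda> borel q2) (scale_measure (ennreal (dens2 C D t s)) m)"
    unfolding dq[OF qc(3)] prod.sel
  proof (rule disjoint_sum_bound[OF Y(1)])
    show "emeasure \<sigma> (space \<sigma>) = 0" if "y \<in> Y" "y' \<in> Y" "y \<noteq> y'" "msub \<sigma> (distr (L y) borel q2)" "msub \<sigma> (distr (L y') borel q2)" for y y' \<sigma>
      using ts r L(7) that(4,5) by (intro cross[OF that(1-3), of s q2]) (auto intro: qc elim: eventually_mono)
  qed (use L(1,5) cont_measurable[OF qc(3) L(2)] in \<open>auto intro: finite_measure.finite_measure_distr\<close>)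
  ultimately show ?thesis using f\<Lambda> S\<Lambda> unfolding D_def by blast
qed

text \<open>The targets are moved to finitely many points by \<open>q n\<close>, the new marginals
  are coupled optimally, and the resulting flows converge weakly along a subsequence. The limit
  couples the marginals of \<pi> optimally but need not induce \<pi> itself, so only the marginals
  and the cost of \<pi> reappear.\<close>

lemma general_target_chain:
  fixes \<pi> :: "('a \<times> 'a) measure"
  assumes op: "opt \<pi>" and bd: "AE z in \<pi>. fst z \<in> cball ctr \<rho> \<and> snd z \<in> cball ctr \<rho>" and \<rho>: "0 \<le> \<rho>"
    and le: "msub (distr \<pi> borel fst) (scale_measure (ennreal C) m)" and C: "0 < C" and ts: "0 < t" "t < s" "s < 1"
  obtains \<Lambda> where "finite_measure \<Lambda>" "sets \<Lambda> = sets borel" "opt (distr \<Lambda> borel (\<lambda>z. (q0 z, q3 z)))"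
    "transport_cost (distr \<Lambda> borel (\<lambda>z. (q0 z, q3 z))) = transport_cost \<pi>"
    "distr \<Lambda> borel q0 = distr \<pi> borel fst" "distr \<Lambda> borel q3 = distr \<pi> borel snd"
    "AE z in \<Lambda>. chain t s z"
    "msub (distr \<Lambda> borel q1) (scale_measure (ennreal (dens1 C (2 * \<rho>) t)) m)"
    "msub (distr \<Lambda> borel q2) (scale_measure (ennreal (dens2 C (2 * \<rho>) t s)) m)"
proof -
  note O = optD[OF op]
  interpret \<pi>: finite_measure \<pi> by (rule O)
  define W where "W = cball ctr \<rho>"
  have W: "compact W" unfolding W_def by (rule compact_cball')
  have cW: "ctr \<in> W" using \<rho> by (simp add: W_def)
  have "\<exists>q. q \<in> borel \<rightarrow>\<^sub>M borel \<and> finite (q ` W) \<and> range q \<subseteq> W \<and> (\<forall>y\<in>W. dist (q y) y < 1 / real (Suc n))" for n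
  proof -
    obtain ix :: "'a \<Rightarrow> nat" where ix: "ix \<in> borel \<rightarrow>\<^sub>M count_space UNIV" and ixd: "\<And>x y. ix x = ix y \<Longrightarrow> dist x y < 1 / real (Suc n)"
      and ixf: "\<And>K. compact K \<Longrightarrow> finite (ix ` K)"
      using cell_index[of "1 / real (Suc n)"] by (auto simp del: of_nat_Suc)
    define c where "c k = (if \<exists>u\<in>W. ix u = k then SOME u. u \<in> W \<and> ix u = k else ctr)" for k
    have c: "c k \<in> W" "(\<exists>u\<in>W. ix u = k) \<Longrightarrow> ix (c k) = k" for k
      using someI_ex[of "\<lambda>u. u \<in> W \<and> ix u = k"] cW by (auto simp: c_def Bex_def)
    have "(\<lambda>y. c (ix y)) \<in> borel \<rightarrow>\<^sub>M borel" by (rule measurable_compose[OF ix]) simp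
    moreover have "finite ((\<lambda>y. c (ix y)) ` W)" using finite_imageI[OF ixf[OF W], of c] by (simp add: image_image)
    moreover have "dist (c (ix y)) y < 1 / real (Suc n)" if "y \<in> W" for y using that by (intro ixd c(2)) auto
    ultimately show ?thesis using c(1) by (intro exI[of _ "\<lambda>y. c (ix y)"]) blast
  qed
  then have "\<exists>q. \<forall>n. q n \<in> borel \<rightarrow>\<^sub>M borel \<and> finite (q n ` W) \<and> range (q n) \<subseteq> W \<and> (\<forall>y\<in>W. dist (q n y) y < 1 / real (Suc n))"
    by (intro choice allI)
  then obtain q where qm: "\<And>n. q n \<in> borel \<rightarrow>\<^sub>M borel" and qf: "\<And>n. finite (q n ` W)" and qW: "\<And>n y. q n y \<in> W"
    and qd: "\<And>n y. y \<in> W \<Longrightarrow> dist (q n y) y < 1 / real (Suc n)" by blast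
  have ql: "(\<lambda>n. q n y) \<longlonglongrightarrow> y" if "y \<in> W" for y
  proof -
    have "dist (q n y) y \<le> inverse (real (Suc n))" for n using less_imp_le[OF qd[OF that]] unfolding inverse_eq_divide .
    then have "(\<lambda>n. dist (q n y) y) \<longlonglongrightarrow> 0"
      by (intro tendsto_sandwich[OF _ _ tendsto_const LIMSEQ_inverse_real_of_nat]) (rule always_eventually; simp)+
    then show ?thesis by (subst tendsto_dist_iff)
  qed
  note fs = fst_snd_meas[OF O(2)]
  have qs: "(\<lambda>z. q n (snd z)) \<in> \<pi> \<rightarrow>\<^sub>M borel" for n by (rule measurable_compose[OF fs(2) qm])
  define \<theta> where "\<theta> n = distr \<pi> borel (\<lambda>z. (fst z, q n (snd z)))" for n
  have \<theta>f: "finite_measure (\<theta> n)" and \<theta>S: "sets (\<theta> n) = sets borel" for n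
    unfolding \<theta>_def using pair_borel_measurable[OF fs(1) qs] by (auto intro: \<pi>.finite_measure_distr)
  have \<theta>m: "distr (\<theta> n) borel fst = distr \<pi> borel fst" "distr (\<theta> n) borel snd = distr \<pi> borel (\<lambda>z. q n (snd z))" for n
    unfolding \<theta>_def by (rule distr_pair_marginals[OF fs(1) qs])+
  have \<theta>c: "transport_cost (\<theta> n) = (\<integral>\<^sup>+z. ennreal ((dist (fst z) (q n (snd z)))\<^sup>2) \<partial>\<pi>)" for n
    unfolding \<theta>_def by (rule transport_cost_distr[OF pair_borel_measurable[OF fs(1) qs]])
  have bound: "AE z in \<pi>. ennreal ((dist (fst z) (q n (snd z)))\<^sup>2) \<le> ennreal ((2 * \<rho>)\<^sup>2)" for n
    using bd
  proof eventually_elim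
    case (elim z)
    then have "dist (fst z) (q n (snd z)) \<le> 2 * \<rho>"
      using qW[of n "snd z"] dist_triangle3[of "fst z" "q n (snd z)" ctr] by (simp add: W_def)
    then show ?case by (intro ennreal_leI power_mono) auto
  qed
  \<comment> \<open>An optimal plan for the moved targets costs at most
    \<open>transport_cost (\<theta> n)\<close>. This limit therefore bounds the cost of the weak
    limit by that of \<pi>.\<close>
  have climit: "(\<lambda>n. transport_cost (\<theta> n)) \<longlonglongrightarrow> transport_cost \<pi>"
    unfolding \<theta>c transport_cost_def[of \<pi>]
  proof (rule nn_integral_dominated_convergence[where w="\<lambda>_. ennreal ((2 * \<rho>)\<^sup>2)", OF _ _ _ bound])
    show "(\<lambda>z. ennreal ((dist (fst z) (q n (snd z)))\<^sup>2)) \<in> borel_measurable \<pi>" for n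
      using measurable_compose[OF pair_borel_measurable[OF fs(1) qs] dist_sq_meas] by simp
    show "(\<lambda>z. ennreal ((dist (fst z) (snd z))\<^sup>2)) \<in> borel_measurable \<pi>" by (rule measurable_sets_transfer[OF dist_sq_meas O(2)])
    show "AE z in \<pi>. (\<lambda>n. ennreal ((dist (fst z) (q n (snd z)))\<^sup>2)) \<longlonglongrightarrow> ennreal ((dist (fst z) (snd z))\<^sup>2)"
      using bd by eventually_elim (intro tendsto_ennrealI tendsto_intros ql, simp add: W_def)
  qed (simp_all add: ennreal_mult_eq_top_iff less_top[symmetric])
  have "\<exists>\<Lambda>. finite_measure \<Lambda> \<and> sets \<Lambda> = sets borel \<and> transport_cost (distr \<Lambda> borel (\<lambda>z. (q0 z, q3 z))) \<le> transport_cost (\<theta> n) \<and>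
    distr \<Lambda> borel q0 = distr \<pi> borel fst \<and> distr \<Lambda> borel q3 = distr \<pi> borel (\<lambda>z. q n (snd z)) \<and>
    (AE z in \<Lambda>. chain t s z) \<and>
    msub (distr \<Lambda> borel q1) (scale_measure (ennreal (dens1 C (2 * \<rho>) t)) m) \<and>
    msub (distr \<Lambda> borel q2) (scale_measure (ennreal (dens2 C (2 * \<rho>) t s)) m)" for n
  proof -
    have "transport_cost (\<theta> n) \<le> (\<integral>\<^sup>+z. ennreal ((2 * \<rho>)\<^sup>2) \<partial>\<pi>)" unfolding \<theta>c using bound by (rule nn_integral_mono_AE)
    also have "\<dots> < \<infinity>" by (simp add: ennreal_mult_eq_top_iff less_top[symmetric])
    finally obtain \<eta> where \<eta>: "opt \<eta>" "distr \<eta> borel fst = distr (\<theta> n) borel fst" "distr \<eta> borel snd = distr (\<theta> n) borel snd"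
      by (rule opt_exists[OF \<theta>f \<theta>S])
    note OE = optD[OF \<eta>(1)]
    have "AE z in \<pi>. q n (snd z) \<in> q n ` W" using bd by eventually_elim (simp add: W_def)
    then have "AE y in distr \<eta> borel snd. y \<in> q n ` W"
      unfolding \<eta>(3) \<theta>m using qs finite_imp_closed[OF qf[of n]] by (subst AE_distr_iff) simp_all
    then have Yn: "AE z in \<eta>. snd z \<in> q n ` W" by (rule AE_distr_vimage[OF fst_snd_meas(2)[OF OE(2)]])
    have "AE x in distr \<eta> borel fst. x \<in> cball ctr \<rho>"
      unfolding \<eta>(2) \<theta>m using bd fs by (subst AE_distr_iff) (auto elim!: eventually_mono)
    then have Xn: "AE z in \<eta>. fst z \<in> cball ctr \<rho>" by (rule AE_distr_vimage[OF fst_snd_meas(1)[OF OE(2)]])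
    have "q n ` W \<subseteq> cball ctr \<rho>" using qW by (auto simp: W_def)
    moreover have "msub (distr \<eta> borel fst) (scale_measure (ennreal C) m)" unfolding \<eta>(2) \<theta>m by (rule le)
    ultimately obtain \<Lambda> where L: "finite_measure \<Lambda>" "sets \<Lambda> = sets borel" "distr \<Lambda> borel (\<lambda>z. (q0 z, q3 z)) = \<eta>"
      "AE z in \<Lambda>. chain t s z" "msub (distr \<Lambda> borel q1) (scale_measure (ennreal (dens1 C (2 * \<rho>) t)) m)"
      "msub (distr \<Lambda> borel q2) (scale_measure (ennreal (dens2 C (2 * \<rho>) t s)) m)"
      using finite_target_chain[OF \<eta>(1) qf _ Yn Xn _ C ts] by blast
    have q03: "q0 \<in> \<Lambda> \<rightarrow>\<^sub>M (borel :: 'a measure)" "q3 \<in> \<Lambda> \<rightarrow>\<^sub>M (borel :: 'a measure)"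
      by (intro cont_measurable[OF _ L(2)] continuous_intros)+
    have "distr \<Lambda> borel q0 = distr \<pi> borel fst" "distr \<Lambda> borel q3 = distr \<pi> borel (\<lambda>z. q n (snd z))"
      using distr_pair_marginals[OF q03] \<eta>(2,3) \<theta>m[of n] by (simp_all add: L(3))
    moreover have "transport_cost \<eta> \<le> transport_cost (\<theta> n)" by (rule OE(4)[OF \<theta>S]) (simp_all add: \<eta>)
    ultimately show ?thesis using L by (intro exI[of _ \<Lambda>]) simp
  qed
  then have "\<exists>\<Lambda>. \<forall>n. finite_measure (\<Lambda> n) \<and> sets (\<Lambda> n) = sets borel \<and> transport_cost (distr (\<Lambda> n) borel (\<lambda>z. (q0 z, q3 z))) \<le> transport_cost (\<theta> n) \<and>
    distr (\<Lambda> n) borel q0 = distr \<pi> borel fst \<and> distr (\<Lambda> n) borel q3 = distr \<pi> borel (\<lambda>z. q n (snd z)) \<and>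
    (AE z in \<Lambda> n. chain t s z) \<and>
    msub (distr (\<Lambda> n) borel q1) (scale_measure (ennreal (dens1 C (2 * \<rho>) t)) m) \<and>
    msub (distr (\<Lambda> n) borel q2) (scale_measure (ennreal (dens2 C (2 * \<rho>) t s)) m)" by (intro choice allI)
  then obtain \<Lambda> where S: "\<And>n. sets (\<Lambda> n) = sets borel"
    and Lc: "\<And>n. transport_cost (distr (\<Lambda> n) borel (\<lambda>z. (q0 z, q3 z))) \<le> transport_cost (\<theta> n)"
    and L0: "\<And>n. distr (\<Lambda> n) borel q0 = distr \<pi> borel fst" and L3: "\<And>n. distr (\<Lambda> n) borel q3 = distr \<pi> borel (\<lambda>z. q n (snd z))"
    and Lch: "\<And>n. AE z in \<Lambda> n. chain t s z"
    and Ld: "\<And>n. msub (distr (\<Lambda> n) borel q1) (scale_measure (ennreal (dens1 C (2 * \<rho>) t)) m)"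
      "\<And>n. msub (distr (\<Lambda> n) borel q2) (scale_measure (ennreal (dens2 C (2 * \<rho>) t s)) m)"
    by blast
  have qc: "continuous_on UNIV (\<lambda>u::'a quad. q0 u)" "continuous_on UNIV (\<lambda>u::'a quad. q1 u)"
    "continuous_on UNIV (\<lambda>u::'a quad. q2 u)" "continuous_on UNIV (\<lambda>u::'a quad. q3 u)"
    by (intro continuous_intros)+
  note qLm = qc[THEN cont_measurable]
  have tot: "emeasure (\<Lambda> n) UNIV = ennreal (measure \<pi> UNIV)" for n
    using emeasure_distr[OF qLm(1)[OF S], of UNIV n] emeasure_distr[OF fs(1), of UNIV]
    by (simp add: L0 space_UNIV_borel[OF S] space_UNIV_borel[OF O(2)] \<pi>.emeasure_eq_measure)
  define V where "V = cball ctr (3 * \<rho>)"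
  have V: "compact V" unfolding V_def by (rule compact_cball')
  have "tight_seq \<Lambda>"
  proof (rule tight_seq_compact[OF compact_Times[OF V compact_Times[OF V compact_Times[OF V V]]] _ S])
    fix n
    have "AE x in distr (\<Lambda> n) borel q0. x \<in> cball ctr \<rho>"
      unfolding L0 using bd fs by (subst AE_distr_iff) (auto elim!: eventually_mono)
    then have 0: "AE z in \<Lambda> n. q0 z \<in> cball ctr \<rho>" by (rule AE_distr_vimage[OF qLm(1)[OF S]])
    have "AE x in distr (\<Lambda> n) borel q3. x \<in> cball ctr \<rho>"
      unfolding L3 using qW qs by (subst AE_distr_iff) (auto simp: W_def)
    then have 3: "AE z in \<Lambda> n. q3 z \<in> cball ctr \<rho>" by (rule AE_distr_vimage[OF qLm(4)[OF S]])
    show "AE z in \<Lambda> n. z \<in> V \<times> V \<times> V \<times> V"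
      using 0 3 Lch[of n]
    proof eventually_elim
      case (elim z)
      have a: "dist ctr (q0 z) \<le> \<rho>" "dist ctr (q3 z) \<le> \<rho>" using elim by auto
      then have d: "dist (q0 z) (q3 z) \<le> 2 * \<rho>" using dist_triangle3[of "q0 z" "q3 z" ctr] by simp
      have f: "u * dist (q0 z) (q3 z) \<le> 2 * \<rho>" if "u \<le> 1" for u
        using mult_right_mono[OF that, of "dist (q0 z) (q3 z)"] d by simp
      have "dist (q0 z) (q1 z) \<le> 2 * \<rho>" "dist (q3 z) (q2 z) \<le> 2 * \<rho>"
        using f[of t] f[of "1 - s"] elim(3) ts by (auto simp: chain_def dist_commute)
      then have "dist ctr (q1 z) \<le> 3 * \<rho>" "dist ctr (q2 z) \<le> 3 * \<rho>"
        using a dist_triangle[of ctr "q1 z" "q0 z"] dist_triangle[of ctr "q2 z" "q3 z"] by linarith+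
      moreover have "dist ctr (q0 z) \<le> 3 * \<rho>" "dist ctr (q3 z) \<le> 3 * \<rho>" using a \<rho> by linarith+
      ultimately show ?case by (simp add: V_def mem_Times_iff)
    qed
  qed
  then obtain r L where r: "strict_mono r" and L: "finite_measure L" "sets L = sets borel" and w: "wconv (\<Lambda> \<circ> r) L"
    by (rule prokhorov_finite[OF tot S])
  have Sr: "sets ((\<Lambda> \<circ> r) j) = sets borel" for j by (simp add: S)
  have ff: "finite_measure (distr \<pi> borel fst)" "finite_measure (distr \<pi> borel snd)" using fs by (auto intro: \<pi>.finite_measure_distr)
  have M0: "distr L borel q0 = distr \<pi> borel fst"
    by (rule wconv_marginal[OF w qc(1) Sr L(2,1) _ ff(1)]) (simp add: L0)
  have M3: "distr L borel q3 = distr \<pi> borel snd"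
  proof (rule wconv_unique)
    show "wconv (\<lambda>j. distr ((\<Lambda> \<circ> r) j) borel q3) (distr L borel q3)" by (rule wconv_distr[OF w qc(4) Sr L(2)])
    have "wconv (\<lambda>n. distr \<pi> borel (\<lambda>z. q n (snd z))) (distr \<pi> borel snd)"
    proof (rule wconv_distr_tendsto[OF \<pi>.finite_measure_axioms qs fs(2)])
      show "AE z in \<pi>. (\<lambda>n. q n (snd z)) \<longlonglongrightarrow> snd z" using bd by eventually_elim (intro ql, simp add: W_def)
    qed
    from wconv_subseq[OF this r] show "wconv (\<lambda>j. distr ((\<Lambda> \<circ> r) j) borel q3) (distr \<pi> borel snd)"
      by (simp add: o_def L3)
    show "finite_measure (distr L borel q3)" using L(1) qLm(4)[OF L(2)] by (rule finite_measure.finite_measure_distr)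
  qed (simp_all add: ff)
  have c03: "continuous_on UNIV (\<lambda>z::'a quad. (q0 z, q3 z))" by (intro continuous_intros)
  have pm: "(\<lambda>z. (q0 z, q3 z)) \<in> P \<rightarrow>\<^sub>M borel" if "sets P = sets borel" for P :: "'a quad measure" using c03 that by (rule cont_measurable)
  have cost: "transport_cost (distr L borel (\<lambda>z. (q0 z, q3 z))) \<le> transport_cost \<pi>"
    unfolding transport_cost_distr[OF pm[OF L(2)]]
  proof (rule wconv_nn_integral_le[OF w _ _ L(2) Sr])
    show "(\<integral>\<^sup>+z. ennreal ((dist (q0 z) (q3 z))\<^sup>2) \<partial>(\<Lambda> \<circ> r) j) \<le> transport_cost (\<theta> (r j))" for j
      using Lc[of "r j"] unfolding transport_cost_distr[OF pm[OF S]] by simp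
    show "(\<lambda>j. transport_cost (\<theta> (r j))) \<longlonglongrightarrow> transport_cost \<pi>"
      using LIMSEQ_subseq_LIMSEQ[OF climit r] by (simp add: o_def)
  qed (auto intro!: continuous_intros)
  note pmarg = distr_pair_marginals[OF qLm(1)[OF L(2)] qLm(4)[OF L(2)]]
  have oL: "opt (distr L borel (\<lambda>z. (q0 z, q3 z)))"
    using cost L pm M0 M3 pmarg by (intro opt_le_cost[OF op]) (auto intro: finite_measure.finite_measure_distr)
  have "transport_cost \<pi> \<le> transport_cost (distr L borel (\<lambda>z. (q0 z, q3 z)))"
    using M0 M3 pmarg by (intro O(4)) auto
  with cost have ceq: "transport_cost (distr L borel (\<lambda>z. (q0 z, q3 z))) = transport_cost \<pi>" by (rule antisym)
  have chL: "AE z in L. chain t s z"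
  proof -
    let ?F = "{z::'a quad. chain t s z}"
    have "closed ?F" unfolding chain_def by (intro closed_Collect_conj closed_Collect_eq continuous_intros)
    moreover have "(ctr, ctr, ctr, ctr) \<in> ?F" by (simp add: chain_def)
    moreover have "AE z in (\<Lambda> \<circ> r) j. z \<in> ?F" for j using Lch[of "r j"] unfolding o_def mem_Collect_eq .
    moreover have "emeasure ((\<Lambda> \<circ> r) j) (space ((\<Lambda> \<circ> r) j)) \<le> ennreal (measure \<pi> UNIV)" for j
      using tot by (simp add: space_UNIV_borel[OF S])
    ultimately have "AE z in L. z \<in> ?F" using Sr L(2) by (intro wconv_AE_closed[OF w]) auto
    then show ?thesis by simp
  qed
  show ?thesis
    by (rule that[OF L oL ceq M0 M3 chL msub_limit_marginal[OF mms w Sr L(2,1) qc(2)] msub_limit_marginal[OF mms w Sr L(2,1) qc(3)]])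
      (simp_all add: Ld)
qed

end

section \<open>Optimal plans are induced by maps\<close>

text \<open>Restriction written as a density, so that the sigma-algebra remains the Borel
  one.\<close>

definition snd_restr :: "('a \<times> 'a::topological_space) measure \<Rightarrow> 'a set \<Rightarrow> ('a \<times> 'a) measure" where
  "snd_restr \<pi> E = density \<pi> (indicator (snd -` E))"

lemma snd_restr:
  fixes \<pi> :: "('a::topological_space \<times> 'a) measure"
  assumes "sets \<pi> = sets borel" "E \<in> sets borel"
  shows "sets (snd_restr \<pi> E) = sets borel" "snd -` E \<in> sets \<pi>" "msub (snd_restr \<pi> E) \<pi>"
    "A \<in> sets \<pi> \<Longrightarrow> emeasure (snd_restr \<pi> E) A = emeasure \<pi> (snd -` E \<inter> A)"
    "AE z in snd_restr \<pi> E. snd z \<in> E"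
proof -
  show s: "snd -` E \<in> sets \<pi>"
    using measurable_sets[OF fst_snd_meas(2)[OF assms(1)] assms(2)] by (simp add: space_UNIV_borel[OF assms(1)])
  show "sets (snd_restr \<pi> E) = sets borel" by (simp add: snd_restr_def assms)
  show "msub (snd_restr \<pi> E) \<pi>" unfolding snd_restr_def using s by (intro msub_density) (auto split: split_indicator)
  show "A \<in> sets \<pi> \<Longrightarrow> emeasure (snd_restr \<pi> E) A = emeasure \<pi> (snd -` E \<inter> A)"
    using s by (simp add: snd_restr_def emeasure_density indicator_inter_arith[symmetric])
  show "AE z in snd_restr \<pi> E. snd z \<in> E"
    unfolding snd_restr_def using s by (subst AE_density) (auto split: split_indicator_asm)
qed

lemma snd_restr_mono:
  assumes "sets \<pi> = sets borel" "E \<in> sets borel" "msub \<eta> \<pi>"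
  shows "msub (snd_restr \<eta> E) (snd_restr \<pi> E)"
proof -
  have S: "sets \<eta> = sets borel" using msub_sets[OF assms(3)] assms(1) by simp
  show ?thesis
    using S assms snd_restr(1,4)[OF assms(1,2)] snd_restr(1,4)[OF S assms(2)]
    by (intro msubI) (auto intro: msub_emeasure)
qed

lemma msum_snd_restr:
  assumes S: "sets \<pi> = sets borel" and E: "E1 \<in> sets borel" "E2 \<in> sets borel" "E1 \<inter> E2 = {}"
  shows "msub (msum (snd_restr \<pi> E1) (snd_restr \<pi> E2)) \<pi>"
proof (rule msubI)
  fix A assume A: "A \<in> sets \<pi>"
  have "emeasure (msum (snd_restr \<pi> E1) (snd_restr \<pi> E2)) A = emeasure \<pi> (snd -` E1 \<inter> A) + emeasure \<pi> (snd -` E2 \<inter> A)"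
    using A S snd_restr(1,4)[OF S E(1)] snd_restr(1,4)[OF S E(2)] by (simp add: emeasure_msum)
  also have "\<dots> = emeasure \<pi> ((snd -` E1 \<inter> A) \<union> (snd -` E2 \<inter> A))"
    using A snd_restr(2)[OF S E(1)] snd_restr(2)[OF S E(2)] E(3) by (intro plus_emeasure) auto
  also have "\<dots> \<le> emeasure \<pi> A" using A by (intro emeasure_mono) auto
  finally show "emeasure (msum (snd_restr \<pi> E1) (snd_restr \<pi> E2)) A \<le> emeasure \<pi> A" .
qed (simp add: S snd_restr(1)[OF S E(1)])

text \<open>Inner regularity of the second marginal: giving up the targets in \<open>E - C\<close>
  costs mass at most \<open>e\<close> in any plan below \<pi>, in particular in the plan whose first
  marginal is \<sigma>.\<close>

lemma shrink_to_compact: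
  fixes \<pi> :: "('a::polish_space \<times> 'a) measure"
  assumes \<pi>: "finite_measure \<pi>" "sets \<pi> = sets borel" and E: "E \<in> sets borel"
    and \<sigma>: "msub \<sigma> (distr (snd_restr \<pi> E) borel fst)" and e: "0 < e"
  obtains C \<sigma>' where "compact C" "C \<subseteq> E" "msub \<sigma>' \<sigma>" "msub \<sigma>' (distr (snd_restr \<pi> C) borel fst)"
    "emeasure \<sigma> UNIV \<le> emeasure \<sigma>' UNIV + ennreal e"
proof -
  interpret \<pi>: finite_measure \<pi> by fact
  let ?\<mu> = "distr \<pi> borel snd"
  interpret \<mu>: finite_measure ?\<mu> using fst_snd_meas(2)[OF \<pi>(2)] by (rule \<pi>.finite_measure_distr)
  have sup: "emeasure ?\<mu> E = (SUP K\<in>{K. K \<subseteq> E \<and> compact K}. emeasure ?\<mu> K)"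
    using E \<mu>.emeasure_finite[of "space ?\<mu>"] by (intro inner_regular) auto
  have "\<exists>C. compact C \<and> C \<subseteq> E \<and> emeasure ?\<mu> E \<le> emeasure ?\<mu> C + ennreal e"
  proof (cases "emeasure ?\<mu> E \<le> ennreal e")
    case True
    then show ?thesis by (intro exI[of _ "{}"]) simp
  next
    case False
    then have "0 < emeasure ?\<mu> E" by (simp add: not_le le_less_trans[OF zero_le])
    then have "emeasure ?\<mu> E - ennreal e < emeasure ?\<mu> E"
      using e \<mu>.emeasure_finite[of E] by (intro ennreal_between) (simp_all add: less_top[symmetric])
    then have "emeasure ?\<mu> E - ennreal e < (SUP K\<in>{K. K \<subseteq> E \<and> compact K}. emeasure ?\<mu> K)"
      using sup by simp
    then obtain C where C: "C \<subseteq> E" "compact C" "emeasure ?\<mu> E - ennreal e < emeasure ?\<mu> C"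
      unfolding less_SUP_iff by blast
    have "emeasure ?\<mu> E \<le> emeasure ?\<mu> C + ennreal e"
      using C(3) \<mu>.emeasure_finite[of E] \<mu>.emeasure_finite[of C]
      by (metis ennreal_minus_le_iff add.commute less_imp_le)
    then show ?thesis using C by blast
  qed
  then obtain C where C: "compact C" "C \<subseteq> E" "emeasure ?\<mu> E \<le> emeasure ?\<mu> C + ennreal e" by blast
  have Cb: "C \<in> sets borel" "E - C \<in> sets borel" using E compact_imp_closed[OF C(1)] by auto
  note R = snd_restr[OF \<pi>(2) E]
  have "finite_measure (snd_restr \<pi> E)" using R(3) \<pi>(1) by (rule msub_finite)
  then obtain \<eta> where \<eta>: "msub \<eta> (snd_restr \<pi> E)" "distr \<eta> borel fst = \<sigma>"
    using fst_snd_meas(1)[OF R(1)] \<sigma> by (rule msub_lift)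
  have S\<eta>: "sets \<eta> = sets borel" using msub_sets[OF \<eta>(1)] R(1) by simp
  have \<eta>\<pi>: "msub \<eta> \<pi>" using \<eta>(1) R(3) by (rule msub_trans)
  note RC = snd_restr[OF S\<eta> Cb(1)]
  have sp: "space \<eta> = UNIV" by (rule space_UNIV_borel[OF S\<eta>])
  have dC: "emeasure (distr (snd_restr \<eta> C) borel fst) UNIV = emeasure \<eta> (snd -` C)"
    using fst_snd_meas(1)[OF RC(1)] RC(4)[of UNIV] S\<eta> by (simp add: emeasure_distr space_UNIV_borel[OF RC(1)])
  have "emeasure \<sigma> UNIV = emeasure \<eta> UNIV"
    using fst_snd_meas(1)[OF S\<eta>] by (simp add: \<eta>(2)[symmetric] emeasure_distr sp)
  also have "\<dots> \<le> emeasure \<eta> (snd -` C \<union> snd -` (E - C))"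
  proof -
    have "AE z in \<eta>. snd z \<in> E" using \<eta>(1) R(5) by (rule msub_AE)
    then show ?thesis using RC(2) snd_restr(2)[OF S\<eta> Cb(2)] by (intro emeasure_mono_AE) (auto elim!: eventually_mono)
  qed
  also have "\<dots> \<le> emeasure \<eta> (snd -` C) + emeasure \<eta> (snd -` (E - C))"
    using RC(2) snd_restr(2)[OF S\<eta> Cb(2)] by (rule emeasure_subadditive)
  also have "emeasure \<eta> (snd -` (E - C)) \<le> ennreal e"
  proof -
    have "emeasure \<eta> (snd -` (E - C)) \<le> emeasure \<pi> (snd -` (E - C))" by (rule msub_emeasure[OF \<eta>\<pi>])
    also have "\<dots> = emeasure ?\<mu> (E - C)" using Cb fst_snd_meas(2)[OF \<pi>(2)] by (simp add: emeasure_distr space_UNIV_borel[OF \<pi>(2)])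
    also have "\<dots> = emeasure ?\<mu> E - emeasure ?\<mu> C" using C E Cb by (intro emeasure_Diff) auto
    also have "\<dots> \<le> ennreal e" using C(3) by (simp add: ennreal_minus_le_iff)
    finally show ?thesis .
  qed
  finally have "emeasure \<sigma> UNIV \<le> emeasure (distr (snd_restr \<eta> C) borel fst) UNIV + ennreal e" unfolding dC by (simp add: add_left_mono)
  moreover have "msub (distr (snd_restr \<eta> C) borel fst) \<sigma>"
    unfolding \<eta>(2)[symmetric] by (rule msub_distr[OF RC(3) fst_snd_meas(1)[OF S\<eta>]])
  moreover have "msub (distr (snd_restr \<eta> C) borel fst) (distr (snd_restr \<pi> C) borel fst)"
    by (rule msub_distr[OF snd_restr_mono[OF \<pi>(2) Cb(1) \<eta>\<pi>] fst_snd_meas(1)[OF snd_restr(1)[OF \<pi>(2) Cb(1)]]])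
  ultimately show ?thesis using C by (intro that)
qed

lemma separate_compacts:
  fixes C1 C2 :: "'a::metric_space set"
  assumes "compact C1" "compact C2" "C1 \<inter> C2 = {}"
  shows "\<exists>\<delta>>0. \<forall>x\<in>C1. \<forall>y\<in>C2. \<delta> \<le> dist x y"
proof (cases "C1 \<times> C2 = {}")
  case True
  then show ?thesis by (intro exI[of _ 1]) auto
next
  case False
  have "continuous_on (C1 \<times> C2) (\<lambda>z. dist (fst z) (snd z))" by (intro continuous_intros)
  then obtain z where z: "z \<in> C1 \<times> C2" "\<And>w. w \<in> C1 \<times> C2 \<Longrightarrow> dist (fst z) (snd z) \<le> dist (fst w) (snd w)"
    using continuous_attains_inf[OF compact_Times[OF assms(1,2)] False] by blast
  have "fst z \<noteq> snd z" using z(1) assms(3) by auto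
  then show ?thesis using z(2) by (intro exI[of _ "dist (fst z) (snd z)"]) force
qed

context mcp_space begin

text \<open>Some level set where the density is at least \<open>1 / Suc n\<close> is charged, and it
  contains a charged compact set. A constant density is wanted because then one constant
  \<open>c\<close> governs both the mass and the density bound of the flows.\<close>

lemma ac_minorant:
  assumes \<sigma>: "finite_measure \<sigma>" "sets \<sigma> = sets borel" "absolutely_continuous m \<sigma>" "emeasure \<sigma> UNIV \<noteq> 0"
  obtains A c where "compact A" "0 < c" "0 < measure m A" "msub (density m (\<lambda>x. ennreal c * indicator A x)) \<sigma>"
proof -
  interpret \<sigma>: finite_measure \<sigma> by fact
  interpret m: sigma_finite_measure m by (rule mms_sigma_finite[OF mms])
  note Sm = mms_sets[OF mms]
  obtain f where f[measurable]: "f \<in> borel_measurable m" and fd: "density m f = \<sigma>"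
    using m.Radon_Nikodym[OF \<sigma>(3)] \<sigma>(2) Sm by auto
  define E where "E n = {x\<in>space m. ennreal (1 / real (Suc n)) \<le> f x}" for n
  have Em: "E n \<in> sets m" for n unfolding E_def by measurable
  have "\<exists>n. emeasure \<sigma> (E n) \<noteq> 0"
  proof (rule ccontr)
    assume n: "\<not> ?thesis"
    then have "AE x in \<sigma>. x \<notin> (\<Union>n. E n)"
      using Em Sm \<sigma>(2) by (intro AE_not_in null_sets_UN) (auto intro: null_setsI)
    moreover have "AE x in \<sigma>. 0 < f x"
      unfolding fd[symmetric] by (subst AE_density) auto
    ultimately have "AE x in \<sigma>. False"
    proof eventually_elim
      case (elim x)
      have "\<exists>n. ennreal (1 / real (Suc n)) \<le> f x"
      proof (cases "f x" rule: ennreal_cases)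
        case (real r)
        then obtain n where "1 / real (Suc n) < r" using elim nat_approx_posE[of r] by auto
        then show ?thesis using real by (intro exI[of _ n]) (simp del: of_nat_Suc)
      qed simp
      then show ?case using elim by (auto simp: E_def mms_space[OF mms])
    qed
    then show False using \<sigma>(4) AE_iff_measurable[of UNIV \<sigma> "\<lambda>_. False"] by (simp add: space_UNIV_borel[OF \<sigma>(2)] \<sigma>(2))
  qed
  then obtain n where n: "emeasure \<sigma> (E n) \<noteq> 0" by auto
  define c where "c = 1 / real (Suc n)"
  have "emeasure \<sigma> (E n) = (SUP K\<in>{K. K \<subseteq> E n \<and> compact K}. emeasure \<sigma> K)"
    using Em Sm \<sigma>(2) \<sigma>.emeasure_finite[of "space \<sigma>"] by (intro inner_regular) auto
  then have "0 < (SUP K\<in>{K. K \<subseteq> E n \<and> compact K}. emeasure \<sigma> K)" using n by (simp add: zero_less_iff_neq_zero)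
  then obtain A where A: "A \<subseteq> E n" "compact A" "0 < emeasure \<sigma> A" by (auto simp: less_SUP_iff)
  have Am: "A \<in> sets m" "A \<in> sets borel" using compact_imp_closed[OF A(2)] Sm by auto
  have "emeasure m A \<noteq> 0" using A(3) \<sigma>(3) Am by (auto simp: absolutely_continuous_def null_sets_def)
  moreover have "emeasure m A < \<infinity>" using mms_bounded[OF mms Am(2) compact_imp_bounded[OF A(2)]] .
  ultimately have "0 < measure m A" by (simp add: measure_def enn2real_positive_iff zero_less_iff_neq_zero)
  moreover have "msub (density m (\<lambda>x. ennreal c * indicator A x)) \<sigma>"
  proof (rule msubI)
    fix B assume "B \<in> sets \<sigma>"
    then have B: "B \<in> sets m" using \<sigma>(2) Sm by simp
    have "ennreal c * indicator A x * indicator B x \<le> f x * indicator B x" for x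
      using A(1) by (auto simp: E_def c_def split: split_indicator)
    then show "emeasure (density m (\<lambda>x. ennreal c * indicator A x)) B \<le> emeasure \<sigma> B"
      unfolding fd[symmetric] using B Am by (simp add: emeasure_density nn_integral_mono)
  qed (simp add: Sm \<sigma>(2))
  ultimately show ?thesis using A(2) by (intro that[of A c]) (auto simp: c_def)
qed

text \<open>Compactness keeps the flows in a bounded region and gives the two target sets a positive
  distance; hence their positions are still disjoint at a time \<open>s < 1\<close>, as
  \<open>crossing\<close> demands.\<close>

lemma no_splitting_compact:
  fixes \<pi> :: "('a \<times> 'a) measure"
  assumes op: "opt \<pi>" and ac: "absolutely_continuous m (distr \<pi> borel fst)"
    and C: "compact C1" "compact C2" "C1 \<inter> C2 = {}"
    and \<sigma>: "msub \<sigma> (distr (snd_restr \<pi> C1) borel fst)" "msub \<sigma> (distr (snd_restr \<pi> C2) borel fst)"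
  shows "emeasure \<sigma> UNIV = 0"
proof (rule ccontr)
  assume nz: "emeasure \<sigma> UNIV \<noteq> 0"
  note O = optD[OF op] and Sm = mms_sets[OF mms]
  have Cb: "C1 \<in> sets borel" "C2 \<in> sets borel" using compact_imp_closed[OF C(1)] compact_imp_closed[OF C(2)] by simp_all
  note R1 = snd_restr[OF O(2) Cb(1)] and R2 = snd_restr[OF O(2) Cb(2)]
  have s1: "msub \<sigma> (distr \<pi> borel fst)"
    using \<sigma>(1) msub_distr[OF R1(3) fst_snd_meas(1)[OF O(2)]] by (rule msub_trans)
  have S\<sigma>: "sets \<sigma> = sets borel" using msub_sets[OF s1] by simp
  have f\<sigma>: "finite_measure \<sigma>"
    using s1 finite_measure.finite_measure_distr[OF O(1) fst_snd_meas(1)[OF O(2)]] by (rule msub_finite)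
  have "emeasure \<sigma> E = 0" if "E \<in> null_sets m" for E
  proof -
    have "emeasure (distr \<pi> borel fst) E = 0" using ac that by (auto simp: absolutely_continuous_def)
    then show ?thesis using msub_emeasure[OF s1, of E] by simp
  qed
  then have "absolutely_continuous m \<sigma>" using Sm S\<sigma> by (auto simp: absolutely_continuous_def null_sets_def)
  then obtain A c where A: "compact A" "0 < c" "0 < measure m A" and sA: "msub (density m (\<lambda>x. ennreal c * indicator A x)) \<sigma>"
    by (rule ac_minorant[OF f\<sigma> S\<sigma> _ nz])
  define \<sigma>' where "\<sigma>' = density m (\<lambda>x. ennreal c * indicator A x)"
  have Am: "A \<in> sets borel" "A \<in> sets m" "closed A" using compact_imp_closed[OF A(1)] Sm by auto
  have Ane: "A \<noteq> {}" using A(3) by auto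
  have e\<sigma>': "emeasure \<sigma>' B = ennreal c * emeasure m (A \<inter> B)" if "B \<in> sets borel" for B
  proof -
    have B: "B \<in> sets m" using that Sm by simp
    have "emeasure \<sigma>' B = (\<integral>\<^sup>+x. ennreal c * indicator A x * indicator B x \<partial>m)"
      unfolding \<sigma>'_def using Am B by (intro emeasure_density) auto
    also have "\<dots> = (\<integral>\<^sup>+x. ennreal c * indicator (A \<inter> B) x \<partial>m)"
      by (intro nn_integral_cong) (simp add: indicator_inter_arith mult.assoc)
    also have "\<dots> = ennreal c * emeasure m (A \<inter> B)" using Am B by (intro nn_integral_cmult_indicator) auto
    finally show ?thesis .
  qed
  have \<sigma>'m: "msub \<sigma>' (scale_measure (ennreal c) m)"
  proof (rule msubI)
    fix B assume "B \<in> sets (scale_measure (ennreal c) m)"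
    then have "B \<in> sets borel" "B \<in> sets m" using Sm by auto
    then show "emeasure \<sigma>' B \<le> emeasure (scale_measure (ennreal c) m) B"
      by (simp add: e\<sigma>' mult_left_mono emeasure_mono)
  qed (simp add: \<sigma>'_def)
  have fR: "finite_measure (snd_restr \<pi> C1)" "finite_measure (snd_restr \<pi> C2)"
    using msub_finite[OF R1(3) O(1)] msub_finite[OF R2(3) O(1)] .
  \<comment> \<open>Parts of \<pi> with one common first marginal \<open>\<sigma>'\<close> and with
    targets in \<open>C1\<close> and in \<open>C2\<close>.\<close>
  obtain \<pi>1 where \<pi>1: "msub \<pi>1 (snd_restr \<pi> C1)" "distr \<pi>1 borel fst = \<sigma>'"
    by (rule msub_lift[OF fR(1) fst_snd_meas(1)[OF R1(1)] msub_trans[OF sA \<sigma>(1), folded \<sigma>'_def]])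
  obtain \<pi>2 where \<pi>2: "msub \<pi>2 (snd_restr \<pi> C2)" "distr \<pi>2 borel fst = \<sigma>'"
    by (rule msub_lift[OF fR(2) fst_snd_meas(1)[OF R2(1)] msub_trans[OF sA \<sigma>(2), folded \<sigma>'_def]])
  have S\<pi>: "sets \<pi>1 = sets borel" "sets \<pi>2 = sets borel" using msub_sets[OF \<pi>1(1)] msub_sets[OF \<pi>2(1)] R1(1) R2(1) by auto
  have o12: "opt (msum \<pi>1 \<pi>2)"
    by (rule opt_msub[OF op msub_trans[OF msub_msum_mono[OF \<pi>1(1) \<pi>2(1)] msum_snd_restr[OF O(2) Cb C(3)]]]) (simp add: R1(1) R2(1))
  have o1: "opt \<pi>1" and o2: "opt \<pi>2"
    using opt_msub[OF o12 msub_msum1] opt_msub[OF o12 msub_msum2] S\<pi> by auto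
  obtain ctr :: 'a where "ctr \<in> A" using Ane by auto
  have "bounded (A \<union> C1 \<union> C2)" using A(1) C by (simp add: compact_imp_bounded)
  then obtain \<rho>0 where \<rho>0: "\<And>x. x \<in> A \<union> C1 \<union> C2 \<Longrightarrow> dist ctr x \<le> \<rho>0"
    using bounded_any_center[of "A \<union> C1 \<union> C2" ctr] by auto
  define \<rho> where "\<rho> = max \<rho>0 1"
  have \<rho>: "0 < \<rho>" "A \<union> C1 \<union> C2 \<subseteq> cball ctr \<rho>" using \<rho>0 by (force simp: \<rho>_def)+
  have "AE x in \<sigma>'. x \<in> A" using Am e\<sigma>'[of "- A"] by (intro AE_I[of _ _ "- A"]) (auto simp: \<sigma>'_def Sm)
  then have "AE x in distr \<pi>1 borel fst. x \<in> A" "AE x in distr \<pi>2 borel fst. x \<in> A" by (simp_all only: \<pi>1(2) \<pi>2(2))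
  then have fA: "AE z in \<pi>1. fst z \<in> A" "AE z in \<pi>2. fst z \<in> A"
    using AE_distr_vimage[OF fst_snd_meas(1)[OF S\<pi>(1)]] AE_distr_vimage[OF fst_snd_meas(1)[OF S\<pi>(2)]] by blast+
  have sC: "AE z in \<pi>1. snd z \<in> C1" "AE z in \<pi>2. snd z \<in> C2"
    by (rule msub_AE[OF \<pi>1(1) R1(5)], rule msub_AE[OF \<pi>2(1) R2(5)])
  have bd: "AE z in \<pi>1. fst z \<in> cball ctr \<rho> \<and> snd z \<in> cball ctr \<rho>" "AE z in \<pi>2. fst z \<in> cball ctr \<rho> \<and> snd z \<in> cball ctr \<rho>"
    using fA(1) sC(1) apply eventually_elim using \<rho>(2) apply blast
    using fA(2) sC(2) apply eventually_elim using \<rho>(2) apply blast done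
  obtain \<delta> where \<delta>: "0 < \<delta>" "\<And>x y. x \<in> C1 \<Longrightarrow> y \<in> C2 \<Longrightarrow> \<delta> \<le> dist x y"
    using separate_compacts[OF C] by blast
  \<comment> \<open>\<open>s\<close> exceeds \<open>1/2\<close>, the largest \<open>t\<close>
    considered, and at time \<open>s\<close> the flows are within \<open>\<delta> / 4\<close> of
    \<open>C1\<close> and of \<open>C2\<close>.\<close>
  define s where "s = 1 - min (1/4) (\<delta> / (8 * \<rho>))"
  have s: "1/2 < s" "s < 1" using \<delta>(1) \<rho>(1) by (auto simp: s_def min_def)
  have "(1 - s) * (2 * \<rho>) \<le> (\<delta> / (8 * \<rho>)) * (2 * \<rho>)" using \<rho>(1) by (intro mult_right_mono) (auto simp: s_def)
  also have "\<dots> = \<delta> / 4" using \<rho>(1) by simp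
  finally have sd: "(1 - s) * (2 * \<rho>) \<le> \<delta> / 4" .
  \<comment> \<open>Geodesics have length at most \<open>2 * \<rho>\<close>, so \<open>B t\<close>
    contains both flows at time \<open>t\<close>.\<close>
  define B where "B t = {x. infdist x A \<le> t * (2 * \<rho>)}" for t
  have Bc: "closed (B t)" for t unfolding B_def by (intro closed_Collect_le continuous_intros)
  have key: "ennreal (2 * contraction K N (2 * \<rho>) t powr N * measure m A) \<le> emeasure m (B t)" if t: "0 < t" "t \<le> 1/2" for t
  proof -
    have ts: "0 < t" "t < s" "s < 1" using t s by auto
    have \<rho>': "0 \<le> \<rho>" using \<rho>(1) by simp
    have le: "msub (distr \<pi>1 borel fst) (scale_measure (ennreal c) m)" "msub (distr \<pi>2 borel fst) (scale_measure (ennreal c) m)"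
      using \<sigma>'m by (simp_all add: \<pi>1(2) \<pi>2(2))
    let ?pr = "\<lambda>z::'a quad. (q0 z, q3 z)"
    obtain L1 where L1: "finite_measure L1" "sets L1 = sets borel" "opt (distr L1 borel ?pr)"
      "transport_cost (distr L1 borel ?pr) = transport_cost \<pi>1"
      "distr L1 borel q0 = distr \<pi>1 borel fst" "distr L1 borel q3 = distr \<pi>1 borel snd" "AE z in L1. chain t s z"
      "msub (distr L1 borel q1) (scale_measure (ennreal (dens1 c (2 * \<rho>) t)) m)"
      "msub (distr L1 borel q2) (scale_measure (ennreal (dens2 c (2 * \<rho>) t s)) m)"
      by (rule general_target_chain[OF o1 bd(1) \<rho>' le(1) A(2) ts])
    obtain L2 where L2: "finite_measure L2" "sets L2 = sets borel" "opt (distr L2 borel ?pr)"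
      "transport_cost (distr L2 borel ?pr) = transport_cost \<pi>2"
      "distr L2 borel q0 = distr \<pi>2 borel fst" "distr L2 borel q3 = distr \<pi>2 borel snd" "AE z in L2. chain t s z"
      "msub (distr L2 borel q1) (scale_measure (ennreal (dens1 c (2 * \<rho>) t)) m)"
      "msub (distr L2 borel q2) (scale_measure (ennreal (dens2 c (2 * \<rho>) t s)) m)"
      by (rule general_target_chain[OF o2 bd(2) \<rho>' le(2) A(2) ts])
    have qc: "continuous_on UNIV (\<lambda>u::'a quad. q0 u)" "continuous_on UNIV (\<lambda>u::'a quad. q1 u)"
      "continuous_on UNIV (\<lambda>u::'a quad. q2 u)" "continuous_on UNIV (\<lambda>u::'a quad. q3 u)" "continuous_on UNIV ?pr"
      by (intro continuous_intros)+
    note qm1 = qc[THEN cont_measurable, OF L1(2)] and qm2 = qc[THEN cont_measurable, OF L2(2)]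
    have q0A: "AE z in L1. q0 z \<in> A" "AE z in L2. q0 z \<in> A"
    proof -
      have "AE x in distr L1 borel q0. x \<in> A" "AE x in distr L2 borel q0. x \<in> A"
        using \<open>AE x in \<sigma>'. x \<in> A\<close> by (simp_all only: L1(5) L2(5) \<pi>1(2) \<pi>2(2))
      from AE_distr_vimage[OF qm1(1) this(1)] AE_distr_vimage[OF qm2(1) this(2)]
      show "AE z in L1. q0 z \<in> A" "AE z in L2. q0 z \<in> A" .
    qed
    have "AE x in distr \<pi>1 borel snd. x \<in> C1" "AE x in distr \<pi>2 borel snd. x \<in> C2"
      using sC Cb fst_snd_meas(2)[OF S\<pi>(1)] fst_snd_meas(2)[OF S\<pi>(2)] by (simp_all add: AE_distr_iff)
    then have q3C: "AE z in L1. q3 z \<in> C1" "AE z in L2. q3 z \<in> C2"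
    proof -
      assume "AE x in distr \<pi>1 borel snd. x \<in> C1" "AE x in distr \<pi>2 borel snd. x \<in> C2"
      then have "AE x in distr L1 borel q3. x \<in> C1" "AE x in distr L2 borel q3. x \<in> C2"
        by (simp_all only: L1(6) L2(6))
      from AE_distr_vimage[OF qm1(4) this(1)] AE_distr_vimage[OF qm2(4) this(2)]
      show "AE z in L1. q3 z \<in> C1" "AE z in L2. q3 z \<in> C2" .
    qed
    have dAC: "dist x y \<le> 2 * \<rho>" if "x \<in> A" "y \<in> C1 \<union> C2" for x y
    proof -
      have "x \<in> cball ctr \<rho>" "y \<in> cball ctr \<rho>" using \<rho>(2) that by auto
      then show ?thesis using dist_triangle3[of x y ctr] by simp
    qed
    have no: "emeasure \<tau> (space \<tau>) = 0" if "msub \<tau> (distr L1 borel q1)" "msub \<tau> (distr L2 borel q1)" for \<tau>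
    proof (rule crossing[OF proper geod enb L1(1) L2(1) L1(2) L2(2) ts L1(7) L2(7), where ctr=ctr and D=\<rho>
          and ?S1.0 = "{x. \<exists>y\<in>C1. dist x y \<le> (1 - s) * (2 * \<rho>)}" and ?S2.0 = "{x. \<exists>y\<in>C2. dist x y \<le> (1 - s) * (2 * \<rho>)}"])
      show "AE z in L1. q0 z \<in> cball ctr \<rho> \<and> q3 z \<in> cball ctr \<rho>" using q0A(1) q3C(1) by eventually_elim (use \<rho>(2) in blast)
      show "AE z in L2. q0 z \<in> cball ctr \<rho> \<and> q3 z \<in> cball ctr \<rho>" using q0A(2) q3C(2) by eventually_elim (use \<rho>(2) in blast)
      show "absolutely_continuous m (distr L1 borel q0)" unfolding L1(5) by (rule msub_scale_ac[OF le(1)])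
      show "absolutely_continuous m (distr L1 borel q2)" "absolutely_continuous m (distr L2 borel q2)"
        using msub_scale_ac[OF L1(9)] msub_scale_ac[OF L2(9)] .
      have dm: "distr (msum L1 L2) borel ?pr = msum (distr L1 borel ?pr) (distr L2 borel ?pr)"
        using L1(2) L2(2) qm1(5) by (intro distr_msum) simp_all
      \<comment> \<open>The flows may couple the marginals differently from \<open>\<pi>1\<close>
        and \<open>\<pi>2\<close>, but at the same costs, so their sum is as cheap as the optimal
        \<open>msum \<pi>1 \<pi>2\<close>.\<close>
      show "opt (distr (msum L1 L2) borel ?pr)"
        unfolding dm
      proof (rule opt_le_cost[OF o12])
        show "finite_measure (msum (distr L1 borel ?pr) (distr L2 borel ?pr))"
          using L1(1) L2(1) qm1(5) qm2(5) by (intro finite_measure_msum finite_measure.finite_measure_distr) simp_all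
        show "distr (msum (distr L1 borel ?pr) (distr L2 borel ?pr)) borel fst = distr (msum \<pi>1 \<pi>2) borel fst"
          "distr (msum (distr L1 borel ?pr) (distr L2 borel ?pr)) borel snd = distr (msum \<pi>1 \<pi>2) borel snd"
          using distr_pair_marginals[OF qm1(1,4)] distr_pair_marginals[OF qm2(1,4)] S\<pi> L1(5,6) L2(5,6)
          by (simp_all add: distr_msum fst_snd_meas)
        show "transport_cost (msum (distr L1 borel ?pr) (distr L2 borel ?pr)) \<le> transport_cost (msum \<pi>1 \<pi>2)"
          using S\<pi> by (simp add: transport_cost_msum L1(4) L2(4))
      qed simp
      have q2s: "\<exists>y\<in>E. dist (q2 z) y \<le> (1 - s) * (2 * \<rho>)" if "chain t s z" "q0 z \<in> A" "q3 z \<in> E" "E \<subseteq> C1 \<union> C2" for z E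
      proof (intro bexI[of _ "q3 z"] that)
        have "dist (q2 z) (q3 z) = (1 - s) * dist (q0 z) (q3 z)" using that by (simp add: chain_def)
        also have "\<dots> \<le> (1 - s) * (2 * \<rho>)" using dAC[OF that(2)] that(3,4) ts by (intro mult_left_mono) auto
        finally show "dist (q2 z) (q3 z) \<le> (1 - s) * (2 * \<rho>)" .
      qed
      show "AE z in L1. q2 z \<in> {x. \<exists>y\<in>C1. dist x y \<le> (1 - s) * (2 * \<rho>)}"
        using L1(7) q0A(1) q3C(1) by eventually_elim (use q2s in blast)
      show "AE z in L2. q2 z \<in> {x. \<exists>y\<in>C2. dist x y \<le> (1 - s) * (2 * \<rho>)}"
        using L2(7) q0A(2) q3C(2) by eventually_elim (use q2s in blast)
      show "{x. \<exists>y\<in>C1. dist x y \<le> (1 - s) * (2 * \<rho>)} \<inter> {x. \<exists>y\<in>C2. dist x y \<le> (1 - s) * (2 * \<rho>)} = {}"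
      proof (rule ccontr)
        assume "\<not> ?thesis"
        then obtain x y y' where "y \<in> C1" "y' \<in> C2" "dist x y \<le> (1 - s) * (2 * \<rho>)" "dist x y' \<le> (1 - s) * (2 * \<rho>)" by auto
        then show False using \<delta>(2)[of y y'] \<delta>(1) sd dist_triangle3[of y y' x] by linarith
      qed
    qed fact+
    \<comment> \<open>Without a common part at time \<open>t\<close> the sum of both flows obeys the
      density bound of one, while its mass is twice that of \<open>\<sigma>'\<close>.\<close>
    have "msub (mix borel (UNIV::bool set) (\<lambda>b. if b then distr L1 borel q1 else distr L2 borel q1)) (scale_measure (ennreal (dens1 c (2 * \<rho>) t)) m)"
    proof (rule disjoint_sum_bound)
      show "emeasure \<tau> (space \<tau>) = 0" if "y \<noteq> y'" "msub \<tau> (if y then distr L1 borel q1 else distr L2 borel q1)"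
        "msub \<tau> (if y' then distr L1 borel q1 else distr L2 borel q1)" for y y' :: bool and \<tau>
        using that no[of \<tau>] by (auto split: if_splits)
    qed (use L1 L2 qm1(2) qm2(2) in \<open>auto intro: finite_measure.finite_measure_distr\<close>)
    from msub_emeasure[OF this, of "B t"]
    have "emeasure (distr L1 borel q1) (B t) + emeasure (distr L2 borel q1) (B t) \<le> ennreal (dens1 c (2 * \<rho>) t) * emeasure m (B t)"
      using Bc[of t] by (subst (asm) emeasure_mix) (auto simp: UNIV_bool add.commute)
    moreover have eq: "emeasure (distr L borel q1) (B t) = ennreal c * ennreal (measure m A)"
      if L: "sets L = sets borel" "distr L borel q0 = \<sigma>'" "AE z in L. chain t s z" "AE z in L. q0 z \<in> A" "AE z in L. q3 z \<in> C1 \<union> C2" for L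
    proof -
      note qm = qc[THEN cont_measurable, OF L(1)]
      have "AE z in L. q1 z \<in> B t"
        using L(3-5)
      proof eventually_elim
        case (elim z)
        have "infdist (q1 z) A \<le> dist (q1 z) (q0 z)" using elim by (intro infdist_le)
        also have "\<dots> = t * dist (q0 z) (q3 z)" using elim by (simp add: chain_def dist_commute)
        also have "\<dots> \<le> t * (2 * \<rho>)" using dAC elim t by (intro mult_left_mono) auto
        finally show ?case by (simp add: B_def)
      qed
      then have "emeasure L (q1 -` B t \<inter> space L) = emeasure L (space L)"
        using measurable_sets[OF qm(2), of "B t"] Bc[of t] by (intro emeasure_eq_AE) (auto elim!: eventually_mono)
      then have "emeasure (distr L borel q1) (B t) = emeasure L (space L)"
        using qm(2) Bc[of t] by (subst emeasure_distr) auto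
      also have "\<dots> = emeasure (distr L borel q0) UNIV" using qm(1) by (simp add: emeasure_distr)
      also have "\<dots> = ennreal c * emeasure m A" unfolding L(2) by (simp add: e\<sigma>')
      also have "emeasure m A = ennreal (measure m A)"
        using mms_bounded[OF mms Am(1) compact_imp_bounded[OF A(1)]] by (simp add: emeasure_eq_ennreal_measure less_top)
      finally show ?thesis .
    qed
    ultimately have le2: "ennreal c * ennreal (measure m A) + ennreal c * ennreal (measure m A) \<le> ennreal (dens1 c (2 * \<rho>) t) * emeasure m (B t)"
    proof -
      have "emeasure (distr L1 borel q1) (B t) = ennreal c * ennreal (measure m A)"
        using q3C(1) by (intro eq L1 q0A) (simp_all add: L1(5) \<pi>1(2) eventually_mono)
      moreover have "emeasure (distr L2 borel q1) (B t) = ennreal c * ennreal (measure m A)"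
        using q3C(2) by (intro eq L2 q0A) (simp_all add: L2(5) \<pi>2(2) eventually_mono)
      moreover assume "emeasure (distr L1 borel q1) (B t) + emeasure (distr L2 borel q1) (B t) \<le> ennreal (dens1 c (2 * \<rho>) t) * emeasure m (B t)"
      ultimately show ?thesis by simp
    qed
    define \<kappa> where "\<kappa> = contraction K N (2 * \<rho>) t powr N"
    have \<kappa>: "0 < \<kappa>" unfolding \<kappa>_def using contraction_pos[of t K N "2 * \<rho>"] t by simp
    have "ennreal (\<kappa> / c) * (ennreal c * ennreal (measure m A) + ennreal c * ennreal (measure m A)) \<le> ennreal (\<kappa> / c) * (ennreal (c / \<kappa>) * emeasure m (B t))"
      using le2 unfolding dens1_def \<kappa>_def by (intro mult_left_mono) auto
    also have "ennreal (\<kappa> / c) * (ennreal (c / \<kappa>) * emeasure m (B t)) = emeasure m (B t)"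
      using \<kappa> A(2) by (simp add: mult.assoc[symmetric] ennreal_mult'[symmetric])
    also have "ennreal (\<kappa> / c) * (ennreal c * ennreal (measure m A) + ennreal c * ennreal (measure m A)) = ennreal (2 * \<kappa> * measure m A)"
      using \<kappa> A(2,3) by (simp add: ennreal_mult'[symmetric] ennreal_plus[symmetric] field_simps del: ennreal_plus)
    finally show ?thesis unfolding \<kappa>_def .
  qed
  define t where "t n = 1 / real (Suc (Suc n))" for n
  have t: "0 < t n" "t n \<le> 1/2" for n by (auto simp: t_def field_simps)
  have t0: "t \<longlonglongrightarrow> 0" unfolding t_def using LIMSEQ_ignore_initial_segment[OF LIMSEQ_inverse_real_of_nat, of 1] by (simp add: inverse_eq_divide)
  have "filterlim t (at_right 0) sequentially" using t0 t(1) by (auto simp: filterlim_at less_imp_neq[OF t(1), symmetric])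
  then have "(\<lambda>n. contraction K N (2 * \<rho>) (t n)) \<longlonglongrightarrow> 1" by (rule filterlim_compose[OF contraction_tendsto])
  then have "(\<lambda>n. 2 * contraction K N (2 * \<rho>) (t n) powr N * measure m A) \<longlonglongrightarrow> 2 * 1 powr N * measure m A"
    by (intro tendsto_intros) auto
  then have l1: "(\<lambda>n. ennreal (2 * contraction K N (2 * \<rho>) (t n) powr N * measure m A)) \<longlonglongrightarrow> ennreal (2 * measure m A)"
    by (simp add: tendsto_ennrealI)
  have dec: "decseq (\<lambda>n. B (t n))"
  proof (rule decseq_SucI)
    fix n
    have "t (Suc n) * (2 * \<rho>) \<le> t n * (2 * \<rho>)" using \<rho>(1) by (intro mult_right_mono) (auto simp: t_def field_simps)
    then show "B (t (Suc n)) \<subseteq> B (t n)" by (auto simp: B_def)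
  qed
  have bB: "bounded (B (t n))" for n
  proof -
    have "dist ctr x \<le> \<rho> + (2 * \<rho> + 1)" if "x \<in> B (t n)" for x
    proof -
      have "t n * (2 * \<rho>) \<le> 1 * (2 * \<rho>)" using t[of n] \<rho>(1) by (intro mult_right_mono) auto
      then have "(INF a\<in>A. dist x a) < 2 * \<rho> + 1" using that Ane by (simp add: B_def infdist_notempty)
      then obtain a where "a \<in> A" "dist x a < 2 * \<rho> + 1" using Ane by (subst (asm) cINF_less_iff) auto
      moreover have "dist ctr a \<le> \<rho>" using \<rho>(2) \<open>a \<in> A\<close> by auto
      ultimately show ?thesis using dist_triangle[of ctr x a] by (simp add: dist_commute)
    qed
    then show ?thesis by (auto simp: bounded_def)
  qed
  have "(\<lambda>n. emeasure m (B (t n))) \<longlonglongrightarrow> emeasure m (\<Inter>n. B (t n))"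
  proof (rule Lim_emeasure_decseq[OF _ dec])
    show "range (\<lambda>n. B (t n)) \<subseteq> sets m" using Bc Sm by auto
    show "emeasure m (B (t n)) \<noteq> \<infinity>" for n using mms_bounded[OF mms _ bB[of n]] Bc[of "t n"] by (auto simp: less_top)
  qed
  moreover have "(\<Inter>n. B (t n)) = A"
  proof
    show "(\<Inter>n. B (t n)) \<subseteq> A"
    proof
      fix x assume "x \<in> (\<Inter>n. B (t n))"
      then have "infdist x A \<le> t n * (2 * \<rho>)" for n by (auto simp: B_def)
      then have "infdist x A \<le> 0" using tendsto_mult_left_zero[OF t0, of "2 * \<rho>"] by (intro LIMSEQ_le_const) auto
      then show "x \<in> A" using in_closed_iff_infdist_zero[OF Am(3) Ane] infdist_nonneg[of x A] by simp
    qed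
    show "A \<subseteq> (\<Inter>n. B (t n))" using t(1) \<rho>(1) by (auto simp: B_def less_imp_le)
  qed
  \<comment> \<open>The contraction factor tends to one, and the neighbourhoods, of finite volume,
    decrease to the closed set \<open>A\<close>.\<close>
  ultimately have "ennreal (2 * measure m A) \<le> emeasure m A"
    using l1 key[OF t] by (intro LIMSEQ_le[OF l1]) auto
  also have "emeasure m A = ennreal (measure m A)"
    using mms_bounded[OF mms Am(1) compact_imp_bounded[OF A(1)]] by (simp add: emeasure_eq_ennreal_measure less_top)
  finally show False using A(3) by (simp add: ennreal_le_iff)
qed

section \<open>From disjoint targets to a transport map\<close>

text \<open>The Borel sets are replaced by compact subsets one after the other. Each replacement
  costs at most a quarter of the mass of \<sigma>, so at least half of it would remain, against the
  compact case.\<close>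

lemma no_splitting:
  fixes \<pi> :: "('a \<times> 'a) measure"
  assumes op: "opt \<pi>" and ac: "absolutely_continuous m (distr \<pi> borel fst)"
    and E: "E1 \<in> sets borel" "E2 \<in> sets borel" "E1 \<inter> E2 = {}"
    and \<sigma>: "msub \<sigma> (distr (snd_restr \<pi> E1) borel fst)" "msub \<sigma> (distr (snd_restr \<pi> E2) borel fst)"
  shows "emeasure \<sigma> UNIV = 0"
proof (rule ccontr)
  assume nz: "emeasure \<sigma> UNIV \<noteq> 0"
  note O = optD[OF op]
  have "finite_measure \<sigma>"
    using msub_finite[OF \<sigma>(1)] finite_measure.finite_measure_distr[OF msub_finite[OF snd_restr(3)[OF O(2) E(1)] O(1)] fst_snd_meas(1)[OF snd_restr(1)[OF O(2) E(1)]]] .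
  then have fin: "emeasure \<sigma> UNIV \<noteq> \<infinity>" using finite_measure.emeasure_finite by auto
  define a where "a = enn2real (emeasure \<sigma> UNIV) / 4"
  have a: "0 < a" "emeasure \<sigma> UNIV = ennreal (4 * a)"
    using nz fin by (auto simp: a_def enn2real_positive_iff zero_less_iff_neq_zero less_top[symmetric])
  obtain C1 \<sigma>1 where 1: "compact C1" "C1 \<subseteq> E1" "msub \<sigma>1 \<sigma>" "msub \<sigma>1 (distr (snd_restr \<pi> C1) borel fst)"
      "emeasure \<sigma> UNIV \<le> emeasure \<sigma>1 UNIV + ennreal a"
    by (rule shrink_to_compact[OF O(1,2) E(1) \<sigma>(1) a(1)])
  obtain C2 \<sigma>2 where 2: "compact C2" "C2 \<subseteq> E2" "msub \<sigma>2 \<sigma>1" "msub \<sigma>2 (distr (snd_restr \<pi> C2) borel fst)"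
      "emeasure \<sigma>1 UNIV \<le> emeasure \<sigma>2 UNIV + ennreal a"
    by (rule shrink_to_compact[OF O(1,2) E(2) msub_trans[OF 1(3) \<sigma>(2)] a(1)])
  have "C1 \<inter> C2 = {}" using 1(2) 2(2) E(3) by blast
  then have "emeasure \<sigma>2 UNIV = 0"
    using no_splitting_compact[OF op ac 1(1) 2(1) _ msub_trans[OF 2(3) 1(4)] 2(4)] by simp
  then have "ennreal (4 * a) \<le> ennreal a + ennreal a"
    using 1(5) 2(5) a(2) by (metis add.left_neutral add_right_mono order_trans)
  also have "\<dots> = ennreal (2 * a)" using a(1) by (simp add: ennreal_plus[symmetric] del: ennreal_plus)
  finally show False using a(1) by (simp add: ennreal_le_iff)
qed

text \<open>The part of \<pi> with targets in cell \<open>k\<close> has a first marginal with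
  density \<open>g k\<close>. By \<open>no_splitting\<close> no two of these densities have a common
  part, so almost surely the cell of the target is the only index whose density is nonzero at the
  starting point.\<close>

lemma second_cell_map:
  fixes \<pi> :: "('a \<times> 'a) measure"
  assumes op: "opt \<pi>" and ac: "absolutely_continuous m (distr \<pi> borel fst)"
    and ix: "ix \<in> borel \<rightarrow>\<^sub>M count_space (UNIV::nat set)"
  shows "\<exists>j \<in> borel \<rightarrow>\<^sub>M count_space UNIV. AE z in \<pi>. j (fst z) = ix (snd z)"
proof -
  note O = optD[OF op]
  note fm = fst_snd_meas[OF O(2)]
  let ?\<mu> = "distr \<pi> borel fst"
  interpret \<pi>: finite_measure \<pi> by (rule O(1))
  interpret \<mu>: finite_measure ?\<mu> using fm(1) by (rule \<pi>.finite_measure_distr)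
  define E where "E k = ix -` {k}" for k
  have E: "E k \<in> sets borel" for k using measurable_sets[OF ix, of "{k}"] by (simp add: E_def)
  have Ed: "E k \<inter> E l = {}" if "k \<noteq> l" for k l using that by (auto simp: E_def)
  note R = snd_restr[OF O(2) E]
  have "\<exists>g. g \<in> borel_measurable borel \<and> distr (snd_restr \<pi> (E k)) borel fst = density ?\<mu> g" for k
    using msub_density_exists[OF \<mu>.finite_measure_axioms msub_distr[OF R(3) fm(1), of k]] by (metis measurable_distr_eq1)
  then obtain g where g[measurable]: "\<And>k. g k \<in> borel_measurable borel" and gd: "\<And>k. distr (snd_restr \<pi> (E k)) borel fst = density ?\<mu> (g k)"
    by metis
  have dis: "AE x in ?\<mu>. min (g k x) (g l x) = 0" if "k \<noteq> l" for k l
  proof -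
    have "msub (density ?\<mu> (\<lambda>x. min (g k x) (g l x))) (density ?\<mu> (g i))" if "i = k \<or> i = l" for i
      using that by (intro msubI) (auto simp: emeasure_density intro!: nn_integral_mono split: split_indicator)
    then have "emeasure (density ?\<mu> (\<lambda>x. min (g k x) (g l x))) UNIV = 0"
      by (intro no_splitting[OF op ac E E Ed[OF that]]) (simp_all add: gd)
    then have "(\<integral>\<^sup>+x. min (g k x) (g l x) \<partial>?\<mu>) = 0" by (simp add: emeasure_density)
    then show ?thesis by (subst (asm) nn_integral_0_iff_AE) auto
  qed
  have pos: "AE z in \<pi>. snd z \<in> E k \<longrightarrow> g k (fst z) \<noteq> 0" for k
  proof -
    have "AE x in density ?\<mu> (g k). g k x \<noteq> 0" by (subst AE_density) (auto simp: zero_less_iff_neq_zero)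
    then have "AE z in snd_restr \<pi> (E k). g k (fst z) \<noteq> 0"
      unfolding gd[symmetric] by (rule AE_distr_vimage[OF fst_snd_meas(1)[OF R(1)]])
    then show ?thesis
      unfolding snd_restr_def using R(2)[of k] by (subst (asm) AE_density) (auto elim!: eventually_mono split: split_indicator_asm)
  qed
  have "AE x in ?\<mu>. \<forall>k l. k \<noteq> l \<longrightarrow> min (g k x) (g l x) = 0"
    using dis by (auto simp: AE_all_countable)
  then have "AE z in \<pi>. \<forall>k l. k \<noteq> l \<longrightarrow> min (g k (fst z)) (g l (fst z)) = 0" by (rule AE_distr_vimage[OF fm(1)])
  moreover have "AE z in \<pi>. \<forall>k. snd z \<in> E k \<longrightarrow> g k (fst z) \<noteq> 0" using pos by (simp add: AE_all_countable)
  ultimately have "AE z in \<pi>. (LEAST k. g k (fst z) \<noteq> 0) = ix (snd z)"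
  proof eventually_elim
    case (elim z)
    have "g (ix (snd z)) (fst z) \<noteq> 0" using elim(2) by (simp add: E_def)
    moreover have "k = ix (snd z)" if "g k (fst z) \<noteq> 0" for k
    proof (rule ccontr)
      assume "k \<noteq> ix (snd z)"
      then have "min (g k (fst z)) (g (ix (snd z)) (fst z)) = 0" using elim(1) by blast
      then show False using that calculation unfolding min_def by presburger
    qed
    ultimately show ?case by (metis (mono_tags, lifting) LeastI)
  qed
  moreover have "(\<lambda>x. LEAST k. g k x \<noteq> 0) \<in> borel \<rightarrow>\<^sub>M count_space UNIV"
    by (rule measurable_Least) measurable
  ultimately show ?thesis by (intro bexI[of _ "\<lambda>x. LEAST k. g k x \<noteq> 0"])
qed

text \<open>By \<open>second_cell_map\<close> the starting point determines the cell of the target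
  in every partition, hence the target up to \<open>1 / Suc n\<close>. The map is the limit of
  representatives of these cells.\<close>

theorem opt_induced_by_map:
  fixes \<pi> :: "('a \<times> 'a) measure"
  assumes op: "opt \<pi>" and ac: "absolutely_continuous m (distr \<pi> borel fst)"
  shows "\<exists>T\<in>borel \<rightarrow>\<^sub>M borel. AE z in \<pi>. T (fst z) = snd z"
proof -
  have "\<exists>ix p. ix \<in> borel \<rightarrow>\<^sub>M count_space (UNIV::nat set) \<and> (\<forall>x::'a. dist (p (ix x)) x < 1 / real (Suc n))" for n
  proof -
    obtain ix :: "'a \<Rightarrow> nat" where ix: "ix \<in> borel \<rightarrow>\<^sub>M count_space UNIV" "\<And>x y. ix x = ix y \<Longrightarrow> dist x y < 1 / real (Suc n)"
      using cell_index[of "1 / real (Suc n)"] by auto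
    have "dist (SOME y. ix y = ix x) x < 1 / real (Suc n)" for x
      by (rule ix(2)) (rule someI[of "\<lambda>y. ix y = ix x"], rule refl)
    then show ?thesis using ix(1) by (intro exI[of _ ix] exI[of _ "\<lambda>k. SOME y. ix y = k"]) auto
  qed
  then obtain ix p where ix: "\<And>n. ix n \<in> borel \<rightarrow>\<^sub>M count_space (UNIV::nat set)"
    and p: "\<And>n x. dist (p n (ix n x) :: 'a) x < 1 / real (Suc n)"
    by metis
  have "\<exists>j. j \<in> borel \<rightarrow>\<^sub>M count_space UNIV \<and> (AE z in \<pi>. j (fst z) = ix n (snd z))" for n
    using second_cell_map[OF op ac ix] by blast
  then obtain j where j: "\<And>n. j n \<in> borel \<rightarrow>\<^sub>M count_space (UNIV::nat set)" and jx: "\<And>n. AE z in \<pi>. j n (fst z) = ix n (snd z)"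
    by metis
  obtain x0 :: 'a where True by blast
  define S where "S n x = p n (j n x)" for n x
  have S[measurable]: "S n \<in> borel \<rightarrow>\<^sub>M borel" for n
    unfolding S_def by (rule measurable_compose[OF j]) simp
  \<comment> \<open>Where the sequence is not Cauchy the constant \<open>x0\<close> is taken, so
    that the limit exists everywhere and is a Borel map.\<close>
  define S' where "S' n x = (if Cauchy (\<lambda>n. S n x) then S n x else x0)" for n x
  have S': "S' n \<in> borel \<rightarrow>\<^sub>M borel" for n
    unfolding S'_def by (intro measurable_If_set[of "S n" _ _ _ "{x. Cauchy (\<lambda>n. S n x)}", simplified]) measurable
  have conv: "(\<lambda>n. S' n x) \<longlonglongrightarrow> lim (\<lambda>n. S' n x)" for x
    unfolding convergent_LIMSEQ_iff[symmetric] S'_def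
    by (cases "Cauchy (\<lambda>n. S n x)") (simp_all add: Cauchy_convergent convergent_const)
  have "(\<lambda>x. lim (\<lambda>n. S' n x)) \<in> borel \<rightarrow>\<^sub>M borel"
    using S' conv by (rule borel_measurable_LIMSEQ_metric)
  moreover have "AE z in \<pi>. lim (\<lambda>n. S' n (fst z)) = snd z"
  proof -
    have "AE z in \<pi>. \<forall>n. j n (fst z) = ix n (snd z)" using jx by (simp add: AE_all_countable)
    then show ?thesis
    proof eventually_elim
      case (elim z)
      have "(\<lambda>n. dist (S n (fst z)) (snd z)) \<longlonglongrightarrow> 0"
      proof (rule tendsto_sandwich[OF _ _ tendsto_const LIMSEQ_inverse_real_of_nat])
        show "\<forall>\<^sub>F n in sequentially. dist (S n (fst z)) (snd z) \<le> inverse (real (Suc n))"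
          using p[of _ "snd z"] elim by (intro always_eventually) (simp add: S_def inverse_eq_divide less_imp_le del: of_nat_Suc)
      qed simp
      then have l: "(\<lambda>n. S n (fst z)) \<longlonglongrightarrow> snd z" by (subst tendsto_dist_iff)
      then have "S' n (fst z) = S n (fst z)" for n unfolding S'_def using LIMSEQ_imp_Cauchy by auto
      then show ?case using l by (simp add: limI)
    qed
  qed
  ultimately show ?thesis by (intro bexI[of _ "\<lambda>x. lim (\<lambda>n. S' n x)"])
qed

end

section \<open>Existence and uniqueness\<close>

lemma product_plan:
  fixes \<mu>0 \<mu>1 :: "'a::second_countable_topology measure"
  assumes "\<mu>0 \<in> Prob" "\<mu>1 \<in> Prob"
  shows "\<mu>0 \<Otimes>\<^sub>M \<mu>1 \<in> plans \<mu>0 \<mu>1"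
proof -
  have p: "prob_space \<mu>0" "prob_space \<mu>1" and S: "sets \<mu>0 = sets borel" "sets \<mu>1 = sets borel"
    using assms by (auto simp: Prob_def)
  interpret \<mu>0: prob_space \<mu>0 by (rule p)
  interpret \<mu>1: prob_space \<mu>1 by (rule p)
  interpret P: pair_prob_space \<mu>0 \<mu>1 ..
  have SP: "sets (\<mu>0 \<Otimes>\<^sub>M \<mu>1) = sets borel"
    unfolding borel_prod[symmetric] by (rule sets_pair_measure_cong[OF S])
  have sp: "space \<mu>0 = UNIV" "space \<mu>1 = UNIV" using space_UNIV_borel S by auto
  note fm = fst_snd_meas[OF SP]
  have "distr (\<mu>0 \<Otimes>\<^sub>M \<mu>1) borel fst = \<mu>0"
  proof (rule measure_eqI)
    fix A assume "A \<in> sets (distr (\<mu>0 \<Otimes>\<^sub>M \<mu>1) borel fst)"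
    then have A: "A \<in> sets borel" by simp
    have "fst -` A \<inter> space (\<mu>0 \<Otimes>\<^sub>M \<mu>1) = A \<times> UNIV" by (auto simp: space_pair_measure sp)
    then show "emeasure (distr (\<mu>0 \<Otimes>\<^sub>M \<mu>1) borel fst) A = emeasure \<mu>0 A"
      using A S \<mu>1.emeasure_space_1 \<mu>1.emeasure_pair_measure_Times[of A \<mu>0 UNIV] by (simp add: emeasure_distr[OF fm(1) A] sp)
  qed (simp add: S)
  moreover have "distr (\<mu>0 \<Otimes>\<^sub>M \<mu>1) borel snd = \<mu>1"
  proof (rule measure_eqI)
    fix A assume "A \<in> sets (distr (\<mu>0 \<Otimes>\<^sub>M \<mu>1) borel snd)"
    then have A: "A \<in> sets borel" by simp
    have "snd -` A \<inter> space (\<mu>0 \<Otimes>\<^sub>M \<mu>1) = UNIV \<times> A" by (auto simp: space_pair_measure sp)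
    then show "emeasure (distr (\<mu>0 \<Otimes>\<^sub>M \<mu>1) borel snd) A = emeasure \<mu>1 A"
      using A S \<mu>0.emeasure_space_1 \<mu>1.emeasure_pair_measure_Times[of UNIV \<mu>0 A] by (simp add: emeasure_distr[OF fm(2) A] sp)
  qed (simp add: S)
  ultimately show ?thesis using P.prob_space_axioms SP by (simp add: plans_def Prob_def)
qed

text \<open>The triangle inequality through the two base points, together with \<open>(u + v +
  w)\<^sup>2 \<le> 3 * u\<^sup>2 + 3 * v\<^sup>2 + 3 * w\<^sup>2\<close>.\<close>

lemma transport_cost_finite:
  assumes "\<mu>0 \<in> Prob2" "\<mu>1 \<in> Prob2" "\<pi> \<in> plans \<mu>0 \<mu>1"
  shows "transport_cost \<pi> < \<infinity>"
proof -
  obtain a b where a: "(\<integral>\<^sup>+x. ennreal ((dist x a)\<^sup>2) \<partial>\<mu>0) < \<infinity>" and b: "(\<integral>\<^sup>+x. ennreal ((dist x b)\<^sup>2) \<partial>\<mu>1) < \<infinity>"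
    using assms by (auto simp: Prob2_def)
  have S: "sets \<pi> = sets borel" and p: "prob_space \<pi>" and d: "distr \<pi> borel fst = \<mu>0" "distr \<pi> borel snd = \<mu>1"
    using assms(3) by (auto simp: plans_def Prob_def)
  interpret prob_space \<pi> by (rule p)
  note fm = fst_snd_meas[OF S]
  have dm: "(\<lambda>x. ennreal ((dist x c)\<^sup>2)) \<in> borel_measurable borel" for c :: 'a
    by (intro measurable_compose[OF borel_measurable_continuous_onI measurable_ennreal] continuous_intros)
  have le: "(dist x y)\<^sup>2 \<le> 3 * (dist x a)\<^sup>2 + 3 * (dist a b)\<^sup>2 + 3 * (dist y b)\<^sup>2" for x y
  proof -
    have "dist x y \<le> dist x a + dist a b + dist y b"
      using dist_triangle[of x y a] dist_triangle[of a y b] by (simp add: dist_commute)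
    then have "(dist x y)\<^sup>2 \<le> (dist x a + dist a b + dist y b)\<^sup>2" by (intro power_mono) auto
    also have "\<dots> \<le> 3 * (dist x a)\<^sup>2 + 3 * (dist a b)\<^sup>2 + 3 * (dist y b)\<^sup>2"
      using sum_squares_ge_zero[of "dist x a - dist a b" "dist x a - dist y b"] zero_le_square[of "dist a b - dist y b"]
      by (simp add: power2_eq_square algebra_simps)
    finally show ?thesis .
  qed
  have "transport_cost \<pi> \<le> (\<integral>\<^sup>+z. 3 * ennreal ((dist (fst z) a)\<^sup>2) + ennreal (3 * (dist a b)\<^sup>2) + 3 * ennreal ((dist (snd z) b)\<^sup>2) \<partial>\<pi>)"
    unfolding transport_cost_def
  proof (rule nn_integral_mono)
    fix z
    have "3 * ennreal ((dist (fst z) a)\<^sup>2) + ennreal (3 * (dist a b)\<^sup>2) + 3 * ennreal ((dist (snd z) b)\<^sup>2)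
      = ennreal (3 * (dist (fst z) a)\<^sup>2 + 3 * (dist a b)\<^sup>2 + 3 * (dist (snd z) b)\<^sup>2)"
      by (simp add: ennreal_mult)
    then show "ennreal ((dist (fst z) (snd z))\<^sup>2) \<le> 3 * ennreal ((dist (fst z) a)\<^sup>2) + ennreal (3 * (dist a b)\<^sup>2) + 3 * ennreal ((dist (snd z) b)\<^sup>2)"
      by (simp only:) (rule ennreal_leI[OF le])
  qed
  also have "\<dots> = 3 * (\<integral>\<^sup>+z. ennreal ((dist (fst z) a)\<^sup>2) \<partial>\<pi>) + ennreal (3 * (dist a b)\<^sup>2) + 3 * (\<integral>\<^sup>+z. ennreal ((dist (snd z) b)\<^sup>2) \<partial>\<pi>)"
    using measurable_compose[OF fm(1) dm[of a]] measurable_compose[OF fm(2) dm[of b]]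
    by (simp add: nn_integral_add nn_integral_cmult emeasure_space_1)
  also have "(\<integral>\<^sup>+z. ennreal ((dist (fst z) a)\<^sup>2) \<partial>\<pi>) = (\<integral>\<^sup>+x. ennreal ((dist x a)\<^sup>2) \<partial>\<mu>0)"
    unfolding d(1)[symmetric] using dm by (intro nn_integral_distr[OF fm(1), symmetric]) simp
  also have "(\<integral>\<^sup>+z. ennreal ((dist (snd z) b)\<^sup>2) \<partial>\<pi>) = (\<integral>\<^sup>+x. ennreal ((dist x b)\<^sup>2) \<partial>\<mu>1)"
    unfolding d(2)[symmetric] using dm by (intro nn_integral_distr[OF fm(2), symmetric]) simp
  also have "3 * (\<integral>\<^sup>+x. ennreal ((dist x a)\<^sup>2) \<partial>\<mu>0) + ennreal (3 * (dist a b)\<^sup>2) + 3 * (\<integral>\<^sup>+x. ennreal ((dist x b)\<^sup>2) \<partial>\<mu>1) < \<infinity>"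
    using a b by (simp add: ennreal_mult_less_top)
  finally show ?thesis .
qed

text \<open>The competitors in \<open>opt\<close> are not normalised, but their marginals force
  total mass one.\<close>

lemma optimal_plan_iff_opt:
  assumes "\<mu>0 \<in> Prob2" "\<mu>1 \<in> Prob2" "\<pi> \<in> plans \<mu>0 \<mu>1"
  shows "\<pi> \<in> optimal_plans \<mu>0 \<mu>1 \<longleftrightarrow> opt \<pi>"
proof -
  have \<pi>: "prob_space \<pi>" "sets \<pi> = sets borel" "distr \<pi> borel fst = \<mu>0" "distr \<pi> borel snd = \<mu>1"
    using assms(3) by (auto simp: plans_def Prob_def)
  interpret \<pi>: prob_space \<pi> by (rule \<pi>)
  have "\<pi>' \<in> plans \<mu>0 \<mu>1 \<longleftrightarrow> sets \<pi>' = sets borel \<and> distr \<pi>' borel fst = \<mu>0 \<and> distr \<pi>' borel snd = \<mu>1" for \<pi>'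
  proof -
    have "prob_space \<pi>'" if S: "sets \<pi>' = sets borel" and d: "distr \<pi>' borel fst = \<mu>0"
    proof (rule prob_spaceI)
      have "emeasure \<pi>' (space \<pi>') = emeasure \<mu>0 UNIV"
        unfolding d[symmetric] using fst_snd_meas(1)[OF S] by (simp add: emeasure_distr)
      also have "\<dots> = 1"
        unfolding \<pi>(3)[symmetric] using fst_snd_meas(1)[OF \<pi>(2)] \<pi>.emeasure_space_1 by (simp add: emeasure_distr)
      finally show "emeasure \<pi>' (space \<pi>') = 1" .
    qed
    then show ?thesis by (auto simp: plans_def Prob_def)
  qed
  then show ?thesis
    using transport_cost_finite[OF assms] \<pi> \<pi>.finite_measure_axioms assms(3)
    by (auto simp: optimal_plans_def opt_def)
qed

lemma plan_induced_by_map: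
  fixes \<pi> :: "('a::second_countable_topology \<times> 'a) measure"
  assumes S: "sets \<pi> = sets borel" and T: "T \<in> borel \<rightarrow>\<^sub>M borel" and ae: "AE z in \<pi>. T (fst z) = snd z"
  shows "\<pi> = distr (distr \<pi> borel fst) borel (\<lambda>x. (x, T x))"
proof -
  note fm = fst_snd_meas[OF S]
  have gm: "(\<lambda>x. (x, T x)) \<in> borel \<rightarrow>\<^sub>M borel" using T by (intro pair_borel_measurable) auto
  have "distr (distr \<pi> borel fst) borel (\<lambda>x. (x, T x)) = distr \<pi> borel (\<lambda>z. (fst z, T (fst z)))"
    by (rule distr_compose[OF fm(1) gm])
  also have "\<dots> = distr \<pi> borel (\<lambda>z. z)"
    using ae measurable_compose[OF fm(1) gm] S by (intro distr_AE_eqI) (auto elim!: eventually_mono intro: measurable_sets_transfer)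
  also have "\<dots> = \<pi>" by (rule distr_id2[OF S[symmetric]])
  finally show ?thesis ..
qed

theorem theorem5p1:
  fixes m \<mu>0 \<mu>1 :: "'a::polish_space measure" and K N :: real
  assumes "metric_measure_space m"
    and "msupp m = UNIV"
    and "\<forall>x y::'a. \<exists>\<gamma>\<in>Geo. apply_bcontfun \<gamma> 0 = x \<and> apply_bcontfun \<gamma> 1 = y"
    and "1 < N"
    and "essentially_non_branching m"
    and "MCP K N m"
    and "\<mu>0 \<in> Prob2" and "\<mu>1 \<in> Prob2"
    and "absolutely_continuous m \<mu>0"
  shows "\<exists>T\<in>borel \<rightarrow>\<^sub>M borel.
           optimal_plans \<mu>0 \<mu>1 = {distr \<mu>0 borel (\<lambda>x. (x, T x))} \<and>
           (W2 \<mu>0 \<mu>1)\<^sup>2 = (\<integral>\<^sup>+ x. ennreal ((dist x (T x))\<^sup>2) \<partial>\<mu>0)"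
proof -
  interpret mcp_space m K N using assms by unfold_locales
  note iff = optimal_plan_iff_opt[OF assms(7,8)]
  have P: "\<mu>0 \<in> Prob" "\<mu>1 \<in> Prob" using assms(7,8) by (simp_all add: Prob2_def)
  note pp = product_plan[OF P]
  have pp': "prob_space (\<mu>0 \<Otimes>\<^sub>M \<mu>1)" "sets (\<mu>0 \<Otimes>\<^sub>M \<mu>1) = sets borel"
    "distr (\<mu>0 \<Otimes>\<^sub>M \<mu>1) borel fst = \<mu>0" "distr (\<mu>0 \<Otimes>\<^sub>M \<mu>1) borel snd = \<mu>1"
    using pp by (auto simp: plans_def Prob_def)
  \<comment> \<open>The product plan has finite cost thanks to the second moments and is the
    admissible plan from which \<open>opt_exists\<close> starts.\<close>
  obtain \<pi> where \<pi>: "opt \<pi>" "distr \<pi> borel fst = \<mu>0" "distr \<pi> borel snd = \<mu>1"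
    using opt_exists[OF prob_space.finite_measure[OF pp'(1)] pp'(2) transport_cost_finite[OF assms(7,8) pp]] unfolding pp'(3,4) by blast
  note O = optD[OF \<pi>(1)]
  have S0: "prob_space \<mu>0" "sets \<mu>0 = sets borel" using P by (auto simp: Prob_def)
  have p\<pi>: "prob_space \<pi>"
  proof (rule prob_spaceI)
    have "emeasure \<pi> (space \<pi>) = emeasure \<mu>0 UNIV"
      unfolding \<pi>(2)[symmetric] using fst_snd_meas(1)[OF O(2)] by (simp add: emeasure_distr)
    then show "emeasure \<pi> (space \<pi>) = 1" using prob_space.emeasure_space_1[OF S0(1)] by (simp add: space_UNIV_borel[OF S0(2)])
  qed
  have \<pi>p: "\<pi> \<in> plans \<mu>0 \<mu>1" using p\<pi> O(2) \<pi>(2,3) by (simp add: plans_def Prob_def)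
  obtain T where T: "T \<in> borel \<rightarrow>\<^sub>M borel" "AE z in \<pi>. T (fst z) = snd z"
    using opt_induced_by_map[OF \<pi>(1)] assms(9) unfolding \<pi>(2) by blast
  have \<pi>T: "\<pi> = distr \<mu>0 borel (\<lambda>x. (x, T x))" using plan_induced_by_map[OF O(2) T] unfolding \<pi>(2) .
  have uniq: "\<pi>' = \<pi>" if "\<pi>' \<in> optimal_plans \<mu>0 \<mu>1" for \<pi>'
  proof -
    have \<pi>'p: "\<pi>' \<in> plans \<mu>0 \<mu>1" using that by (simp add: optimal_plans_def)
    then have \<pi>': "opt \<pi>'" "distr \<pi>' borel fst = \<mu>0" "distr \<pi>' borel snd = \<mu>1"
      using iff[of \<pi>'] that by (auto simp: plans_def)
    note O' = optD[OF \<pi>'(1)]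
    have o: "opt (msum \<pi> \<pi>')" by (rule opt_msum_same[OF \<pi>(1) \<pi>'(1)]) (simp_all add: \<pi> \<pi>')
    have "distr (msum \<pi> \<pi>') borel fst = msum \<mu>0 \<mu>0"
      using fst_snd_meas(1)[OF O(2)] O(2) O'(2) by (simp add: distr_msum \<pi>(2) \<pi>'(2))
    moreover have "absolutely_continuous m (msum \<mu>0 \<mu>0)"
      using assms(9) mms_sets[OF mms] S0(2) by (auto simp: absolutely_continuous_def null_sets_def emeasure_msum)
    ultimately obtain U where U: "U \<in> borel \<rightarrow>\<^sub>M borel" "AE z in msum \<pi> \<pi>'. U (fst z) = snd z"
      using opt_induced_by_map[OF o] by auto
    have "AE z in \<pi>. U (fst z) = snd z" "AE z in \<pi>'. U (fst z) = snd z"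
      using msub_AE[OF msub_msum1 U(2)] msub_AE[OF msub_msum2 U(2)] O(2) O'(2) by simp_all
    from plan_induced_by_map[OF O(2) U(1) this(1)] plan_induced_by_map[OF O'(2) U(1) this(2)]
    show ?thesis unfolding \<pi>(2) \<pi>'(2) by simp
  qed
  have gm: "(\<lambda>x. (x, T x)) \<in> \<mu>0 \<rightarrow>\<^sub>M borel"
    using T(1) by (intro pair_borel_measurable measurable_sets_transfer[OF _ S0(2)]) auto
  have "(W2 \<mu>0 \<mu>1)\<^sup>2 = (ennreal (sqrt (enn2real (transport_cost \<pi>))))\<^sup>2"
    using opt_W2[OF \<pi>(1) p\<pi>] unfolding \<pi>(2,3) by simp
  also have "\<dots> = transport_cost \<pi>"
    using O(3) by (simp add: ennreal_power)
  also have "\<dots> = (\<integral>\<^sup>+ x. ennreal ((dist x (T x))\<^sup>2) \<partial>\<mu>0)"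
    unfolding \<pi>T by (rule transport_cost_distr[OF gm])
  finally have W: "(W2 \<mu>0 \<mu>1)\<^sup>2 = (\<integral>\<^sup>+ x. ennreal ((dist x (T x))\<^sup>2) \<partial>\<mu>0)" .
  have "optimal_plans \<mu>0 \<mu>1 = {distr \<mu>0 borel (\<lambda>x. (x, T x))}"
  proof -
    have "\<pi> \<in> optimal_plans \<mu>0 \<mu>1" using iff[OF \<pi>p] \<pi>(1) by blast
    then have "optimal_plans \<mu>0 \<mu>1 = {\<pi>}" using uniq by blast
    then show ?thesis using \<pi>T by (rule trans[OF _ arg_cong[of _ _ "\<lambda>p. {p}"]])
  qed
  then show ?thesis using W by (intro bexI[OF _ T(1)] conjI)
qed

end
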